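(* Let $\Lambda$ be a basic representation-finite algebra and let $\Gamma$ be its Auslander algebra. Then $\Gamma$ has a quasi-hereditary structure such that the objects of $\Gamma\text{-}\mathrm{torsl}$ are precisely the $\Delta$-filtered $\Gamma$-modules if and only if $\Lambda$ is uniserial.
   Context: Fix a field $k$. Algebras are finite-dimensional $k$-algebras, modules are finite-dimensional left modules, and $A\text{-}\mathrm{mod}$ is the category of such modules over $A$. $E$ is the basic $\Lambda$-module with $\mathrm{add}(E)=\Lambda\text{-}\mathrm{mod}$ (the direct sum of one representative of each isomorphism class of indecomposable $\Lambda$-modules), and the Auslander algebra of $\Lambda$ is $\Gamma := \mathrm{End}_\Lambda(E)^{\mathrm{op}}$. $\Gamma\text{-}\mathrm{torsl}$ is the full subcategory of $\Gamma\text{-}\mathrm{mod}$ of modules of projective dimension at most $1$. An algebra is uniserial (a Nakayama algebra) if each of its indecomposable modules has a unique composition series. Quasi-hereditary structures. Let $A$ be a basic finite-dimensional algebra, $\Xi$ a set parametrizing the isomorphism classes of simple $A$-modules $S(\xi)$, and $P(\xi)$ the projective cover of $S(\xi)$. Given a partial order $\le$ on $\Xi$, the standard module $\Delta(\xi)$ is the maximal factor module of $P(\xi)$ all of whose composition factors $S(\rho)$ satisfy $\rho\le\xi$. The partial order is adapted if for every $A$-module $X$ with $\mathrm{top}(X)=S(\xi)$ and $\mathrm{soc}(X)=S(\xi')$ with $\xi,\xi'$ incomparable, there is $\rho\in\Xi$ with $\rho>\xi$ such that $S(\rho)$ is a composition factor of $X$. $\mathcal{F}(\Delta)$ is the full subcategory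 of $A$-modules having a filtration with subquotients isomorphic to standard modules (the $\Delta$-filtered modules). A quasi-hereditary structure on $A$ is an adapted partial order on $\Xi$ such that all standard modules are Schurian (their endomorphism rings are division rings) and $A\in\mathcal{F}(\Delta)$. *)

theory Defs
  imports "Jordan_Normal_Form.Missing_VectorSpace" "HOL-Algebra.AbelCoset" "HOL-Library.Extended_Nat"
begin

text \<open>
  The record type \<open>('k, 'a) module\<close> of \<open>HOL-Algebra\<close> carries a ring structure on \<open>'a\<close>
  together with scalars from \<open>'k\<close>. It serves for non-commutative algebras, and, with the fields
  \<open>mult\<close> and \<open>one\<close> ignored, for left modules over them. (The locale \<open>module\<close> itself cannot be
  used for the latter, because it requires a commutative ring of scalars.)
\<close>

definition fd_algebra :: "'k ring \<Rightarrow> ('k, 'a) module \<Rightarrow> bool" where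
  "fd_algebra K A \<longleftrightarrow> vectorspace K A \<and> vectorspace.fin_dim K A \<and> ring A \<and>
     (\<forall>c \<in> carrier K. \<forall>a \<in> carrier A. \<forall>b \<in> carrier A.
        (c \<odot>\<^bsub>A\<^esub> a) \<otimes>\<^bsub>A\<^esub> b = c \<odot>\<^bsub>A\<^esub> (a \<otimes>\<^bsub>A\<^esub> b) \<and>
        a \<otimes>\<^bsub>A\<^esub> (c \<odot>\<^bsub>A\<^esub> b) = c \<odot>\<^bsub>A\<^esub> (a \<otimes>\<^bsub>A\<^esub> b))"

locale left_module = A?: ring A + M?: abelian_group M
  for A :: "('a, 'b) ring_scheme" (structure) and M :: "('a, 'm, 'c) module_scheme" (structure) +
  assumes smult_closed:
      "\<lbrakk>a \<in> carrier A; x \<in> carrier M\<rbrakk> \<Longrightarrow> a \<odot>\<^bsub>M\<^esub> x \<in> carrier M"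
    and smult_l_distr:
      "\<lbrakk>a \<in> carrier A; b \<in> carrier A; x \<in> carrier M\<rbrakk> \<Longrightarrow>
        (a \<oplus>\<^bsub>A\<^esub> b) \<odot>\<^bsub>M\<^esub> x = a \<odot>\<^bsub>M\<^esub> x \<oplus>\<^bsub>M\<^esub> b \<odot>\<^bsub>M\<^esub> x"
    and smult_r_distr:
      "\<lbrakk>a \<in> carrier A; x \<in> carrier M; y \<in> carrier M\<rbrakk> \<Longrightarrow>
        a \<odot>\<^bsub>M\<^esub> (x \<oplus>\<^bsub>M\<^esub> y) = a \<odot>\<^bsub>M\<^esub> x \<oplus>\<^bsub>M\<^esub> a \<odot>\<^bsub>M\<^esub> y"
    and smult_assoc1:
      "\<lbrakk>a \<in> carrier A; b \<in> carrier A; x \<in> carrier M\<rbrakk> \<Longrightarrow>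
        (a \<otimes>\<^bsub>A\<^esub> b) \<odot>\<^bsub>M\<^esub> x = a \<odot>\<^bsub>M\<^esub> (b \<odot>\<^bsub>M\<^esub> x)"
    and smult_one: "x \<in> carrier M \<Longrightarrow> \<one>\<^bsub>A\<^esub> \<odot>\<^bsub>M\<^esub> x = x"

definition restrict_scalars :: "('k, 'a) module \<Rightarrow> ('a, 'm) module \<Rightarrow> ('k, 'm) module" where
  "restrict_scalars A M =
     \<lparr>carrier = carrier M, mult = mult M, one = one M, zero = zero M, add = add M,
      smult = (\<lambda>c x. (c \<odot>\<^bsub>A\<^esub> \<one>\<^bsub>A\<^esub>) \<odot>\<^bsub>M\<^esub> x)\<rparr>"

definition fd_left_module :: "'k ring \<Rightarrow> ('k, 'a) module \<Rightarrow> ('a, 'm) module \<Rightarrow> bool" where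
  "fd_left_module K A M \<longleftrightarrow> left_module A M \<and> vectorspace.fin_dim K (restrict_scalars A M)"

text \<open>
  The objects of the category of finite-dimensional modules: since every finite-dimensional
  module over a \<open>K\<close>-algebra is isomorphic to one whose elements have type \<open>nat \<Rightarrow> 'k\<close>
  (lemma \<open>fmod_representative\<close> below), all quantification over modules is over this set.
\<close>

definition fmod :: "'k ring \<Rightarrow> ('k, 'a) module \<Rightarrow> ('a, nat \<Rightarrow> 'k) module set" where
  "fmod K A = {M. fd_left_module K A M}"

definition lmod_hom :: "('k, 'a) module \<Rightarrow> ('a, 'm) module \<Rightarrow> ('a, 'n) module \<Rightarrow> ('m \<Rightarrow> 'n) set" where
  "lmod_hom A M N = LinearCombinations.module_hom A M N \<inter> extensional (carrier M)"

definition lmod_iso :: "('k, 'a) module \<Rightarrow> ('a, 'm) module \<Rightarrow> ('a, 'n) module \<Rightarrow> bool" where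
  "lmod_iso A M N \<longleftrightarrow> (\<exists>f \<in> lmod_hom A M N. bij_betw f (carrier M) (carrier N))"

definition regular_module :: "('k, 'a) module \<Rightarrow> ('a, 'a) module" where
  "regular_module A =
     \<lparr>carrier = carrier A, mult = mult A, one = one A, zero = zero A, add = add A,
      smult = mult A\<rparr>"

text \<open>
  The locale \<open>submodule\<close> of \<open>HOL-Algebra\<close> does not require commutative scalars, in contrast
  to the locale of the same name in the \<open>VectorSpace\<close> library.
\<close>

abbreviation lsubmodule :: "'m set \<Rightarrow> ('k, 'a) module \<Rightarrow> ('a, 'm) module \<Rightarrow> bool" where
  "lsubmodule U A M \<equiv> Module.submodule U A M"

text \<open>A submodule \<open>U\<close> of \<open>M\<close>, regarded as a module, is \<open>M\<lparr>carrier := U\<rparr>\<close>.\<close>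

definition quot_lmod :: "('a, 'm) module \<Rightarrow> 'm set \<Rightarrow> ('a, 'm set) module" where
  "quot_lmod M U =
     \<lparr>carrier = a_rcosets\<^bsub>M\<^esub> U, mult = undefined, one = undefined, zero = U, add = set_add M,
      smult = (\<lambda>a X. \<Union>x \<in> X. U +>\<^bsub>M\<^esub> (a \<odot>\<^bsub>M\<^esub> x))\<rparr>"

lemma vectorspace_restrict_scalars:
  assumes A: "fd_algebra K A" and M: "left_module A M"
  shows "vectorspace K (restrict_scalars A M)"
proof -
  interpret V: vectorspace K A using A by (simp add: fd_algebra_def)
  interpret A: ring A using A by (simp add: fd_algebra_def)
  interpret M: left_module A M by (rule M)
  have c: "c \<odot>\<^bsub>A\<^esub> \<one>\<^bsub>A\<^esub> \<in> carrier A" if "c \<in> carrier K" for c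
    using that by simp
  have ab: "abelian_group (restrict_scalars A M)"
    by (rule abelian_groupI)
      (auto simp: restrict_scalars_def M.a_ac intro: M.l_neg)
  have assoc: "(c \<otimes>\<^bsub>K\<^esub> d) \<odot>\<^bsub>A\<^esub> \<one>\<^bsub>A\<^esub> = (c \<odot>\<^bsub>A\<^esub> \<one>\<^bsub>A\<^esub>) \<otimes>\<^bsub>A\<^esub> (d \<odot>\<^bsub>A\<^esub> \<one>\<^bsub>A\<^esub>)"
    if "c \<in> carrier K" "d \<in> carrier K" for c d
  proof -
    have "(c \<odot>\<^bsub>A\<^esub> \<one>\<^bsub>A\<^esub>) \<otimes>\<^bsub>A\<^esub> (d \<odot>\<^bsub>A\<^esub> \<one>\<^bsub>A\<^esub>) = c \<odot>\<^bsub>A\<^esub> (\<one>\<^bsub>A\<^esub> \<otimes>\<^bsub>A\<^esub> (d \<odot>\<^bsub>A\<^esub> \<one>\<^bsub>A\<^esub>))"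
      using A that(1) c[OF that(2)] A.one_closed unfolding fd_algebra_def by blast
    thus ?thesis using that c by (simp add: V.smult_assoc1)
  qed
  have "Module.module K (restrict_scalars A M)"
    by (rule moduleI[OF V.R.is_cring ab])
      (auto simp: restrict_scalars_def c M.smult_closed M.smult_l_distr M.smult_r_distr
        V.smult_l_distr assoc M.smult_assoc1 M.smult_one)
  thus ?thesis by (simp add: vectorspace_def V.field_axioms)
qed

lemma fmod_representative:
  assumes A: "fd_algebra K A" and M: "fd_left_module K A (M :: ('a, 'm) module)"
  shows "\<exists>N \<in> fmod K A. lmod_iso A M N"
proof -
  have lm: "left_module A M" using M by (simp add: fd_left_module_def)
  interpret A: ring A using A by (simp add: fd_algebra_def)
  interpret M: left_module A M by (rule lm)
  let ?V = "restrict_scalars A M"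
  interpret V: vectorspace K ?V by (rule vectorspace_restrict_scalars[OF A lm])
  have VM: "carrier ?V = carrier M" by (simp add: restrict_scalars_def)
  obtain B where B: "finite B" "B \<subseteq> carrier ?V" "V.span B = carrier ?V"
    using M unfolding fd_left_module_def V.fin_dim_def by auto
  define co where "co x = (SOME a. a \<in> B \<rightarrow> carrier K \<and> V.lincomb a B = x)" for x
  have co: "co x \<in> B \<rightarrow> carrier K \<and> V.lincomb (co x) B = x" if "x \<in> carrier M" for x
  proof -
    have "x \<in> V.span B" using that B(3) VM by simp
    from someI_ex[OF V.finite_in_span[OF B(1,2) this]] show ?thesis unfolding co_def .
  qed
  obtain e :: "nat \<Rightarrow> 'm" and n where e: "B = e ` {i. i < n}"
    using finite_imp_nat_seg_image_inj_on[OF B(1)] by blast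
  define f where "f x = (\<lambda>i. if i < n then co x (e i) else undefined)" for x
  have inj: "inj_on f (carrier M)"
  proof (rule inj_onI)
    fix x y assume x: "x \<in> carrier M" and y: "y \<in> carrier M" and eq: "f x = f y"
    have "co x b = co y b" if "b \<in> B" for b
    proof -
      obtain i where "i < n" "b = e i" using \<open>b \<in> B\<close> e by auto
      thus ?thesis using fun_cong[OF eq, of i] by (simp add: f_def)
    qed
    hence "V.lincomb (co x) B = V.lincomb (co y) B"
      by (intro V.lincomb_cong[OF refl B(2)]) (use co[OF y] in auto)
    thus "x = y" using co[OF x] co[OF y] by simp
  qed
  define g where "g = inv_into (carrier M) f"
  have gf: "g (f x) = x" if "x \<in> carrier M" for x
    using that inj by (simp add: g_def)
  define N :: "('a, nat \<Rightarrow> 'b) module" where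
    "N = \<lparr>carrier = f ` carrier M, mult = undefined, one = undefined, zero = f \<zero>\<^bsub>M\<^esub>,
          add = (\<lambda>x y. f (g x \<oplus>\<^bsub>M\<^esub> g y)), smult = (\<lambda>a x. f (a \<odot>\<^bsub>M\<^esub> g x))\<rparr>"
  have abN: "abelian_group N"
  proof (rule abelian_groupI)
    show "\<exists>y \<in> carrier N. y \<oplus>\<^bsub>N\<^esub> x = \<zero>\<^bsub>N\<^esub>" if x: "x \<in> carrier N" for x
    proof -
      obtain u where u: "u \<in> carrier M" "x = f u" using x by (auto simp: N_def)
      thus ?thesis by (intro bexI[of _ "f (\<ominus>\<^bsub>M\<^esub> u)"]) (auto simp: N_def gf M.l_neg)
    qed
  qed (auto simp: N_def gf M.a_ac)
  have lmN: "left_module A N"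
    by (intro left_module.intro left_module_axioms.intro A.ring_axioms abN)
      (auto simp: N_def gf M.smult_closed M.smult_l_distr M.smult_r_distr M.smult_assoc1
        M.smult_one)
  let ?W = "restrict_scalars A N"
  interpret W: vectorspace K ?W by (rule vectorspace_restrict_scalars[OF A lmN])
  have add: "f (x \<oplus>\<^bsub>M\<^esub> y) = f x \<oplus>\<^bsub>N\<^esub> f y" if "x \<in> carrier M" "y \<in> carrier M" for x y
    using that by (simp add: N_def gf)
  have sm: "f (a \<odot>\<^bsub>M\<^esub> x) = a \<odot>\<^bsub>N\<^esub> f x" if "x \<in> carrier M" for a x
    using that by (simp add: N_def gf)
  have hom: "mod_hom K ?V ?W f"
    by (intro mod_hom.intro mod_hom_axioms.intro V.module_axioms W.module_axioms)
      (auto simp: LinearCombinations.module_hom_def restrict_scalars_def add sm, auto simp: N_def)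
  interpret f: mod_hom K ?V ?W f by (rule hom)
  have fB: "f ` B \<subseteq> carrier ?W" and BM: "B \<subseteq> carrier M"
    using B(2) by (auto simp: restrict_scalars_def N_def)
  have "W.span (f ` B) = carrier ?W"
  proof (rule antisym[OF W.span_is_subset2[OF fB] subsetI])
    fix w assume "w \<in> carrier ?W"
    then obtain v where v: "v \<in> carrier M" "w = f v"
      by (auto simp: restrict_scalars_def N_def)
    have gB: "co v (g (f b)) \<in> carrier K" if "b \<in> B" for b
    proof -
      have "g (f b) = b" using that BM gf by blast
      thus ?thesis using co[OF v(1)] that by (simp add: Pi_iff)
    qed
    have "w = f (V.lincomb (co v) B)" using co v by simp
    also have "\<dots> = (\<Oplus>\<^bsub>?W\<^esub>b\<in>B. f (co v b \<odot>\<^bsub>?V\<^esub> b))"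
      unfolding V.lincomb_def using B(2) co[OF v(1)]
      by (intro f.hom_sum) auto
    also have "\<dots> = (\<Oplus>\<^bsub>?W\<^esub>b\<in>B. co v (g (f b)) \<odot>\<^bsub>?W\<^esub> f b)"
    proof (rule W.finsum_cong'[OF refl])
      show "(\<lambda>b. co v (g (f b)) \<odot>\<^bsub>?W\<^esub> f b) \<in> B \<rightarrow> carrier ?W"
        using gB fB by (intro Pi_I W.smult_closed) auto
      show "f (co v b \<odot>\<^bsub>?V\<^esub> b) = co v (g (f b)) \<odot>\<^bsub>?W\<^esub> f b" if "b \<in> B" for b
        using that B(2) BM co[OF v(1)] gf[of b] by (subst f.f_smult) auto
    qed
    also have "\<dots> = W.lincomb (\<lambda>w. co v (g w)) (f ` B)"
      unfolding W.lincomb_def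
      by (rule W.finsum_reindex[symmetric])
        (use gB fB inj_on_subset[OF inj BM] in auto)
    finally show "w \<in> W.span (f ` B)"
      unfolding W.span_def using B(1) gB by auto
  qed
  hence "W.fin_dim"
    unfolding W.fin_dim_def using B(1,2)
    by (intro exI[of _ "f ` B"]) (auto simp: restrict_scalars_def N_def)
  hence "N \<in> fmod K A" using lmN by (simp add: fmod_def fd_left_module_def)
  moreover have "lmod_iso A M N"
    unfolding lmod_iso_def
  proof (rule bexI)
    show "bij_betw (restrict f (carrier M)) (carrier M) (carrier N)"
      using inj by (simp add: bij_betw_def N_def inj_on_restrict_eq)
    show "restrict f (carrier M) \<in> lmod_hom A M N"
      by (auto simp: lmod_hom_def LinearCombinations.module_hom_def add sm M.smult_closed, auto simp: N_def)
  qed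
  ultimately show ?thesis by blast
qed

definition indecomposable :: "('k, 'a) module \<Rightarrow> ('a, 'm) module \<Rightarrow> bool" where
  "indecomposable A M \<longleftrightarrow> carrier M \<noteq> {\<zero>\<^bsub>M\<^esub>} \<and>
     (\<forall>U V. lsubmodule U A M \<and> lsubmodule V A M \<and> U \<inter> V = {\<zero>\<^bsub>M\<^esub>} \<and> U <+>\<^bsub>M\<^esub> V = carrier M \<longrightarrow>
        U = {\<zero>\<^bsub>M\<^esub>} \<or> V = {\<zero>\<^bsub>M\<^esub>})"

definition simple_module :: "('k, 'a) module \<Rightarrow> ('a, 'm) module \<Rightarrow> bool" where
  "simple_module A M \<longleftrightarrow> carrier M \<noteq> {\<zero>\<^bsub>M\<^esub>} \<and>
     (\<forall>U. lsubmodule U A M \<longrightarrow> U = {\<zero>\<^bsub>M\<^esub>} \<or> U = carrier M)"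

definition internal_direct_sum :: "('k, 'a) module \<Rightarrow> ('a, 'm) module \<Rightarrow> 'm set set \<Rightarrow> bool" where
  "internal_direct_sum A M \<N> \<longleftrightarrow> finite \<N> \<and> (\<forall>N \<in> \<N>. lsubmodule N A M) \<and>
     (\<forall>x \<in> carrier M. \<exists>!f. f \<in> (\<Pi>\<^sub>E N \<in> \<N>. N) \<and> x = finsum M f \<N>)"

definition basic_decomposition :: "('k, 'a) module \<Rightarrow> ('a, 'm) module \<Rightarrow> 'm set set \<Rightarrow> bool" where
  "basic_decomposition A M \<N> \<longleftrightarrow> internal_direct_sum A M \<N> \<and>
     (\<forall>N \<in> \<N>. indecomposable A (M\<lparr>carrier := N\<rparr>)) \<and>
     (\<forall>N \<in> \<N>. \<forall>N' \<in> \<N>. lmod_iso A (M\<lparr>carrier := N\<rparr>) (M\<lparr>carrier := N'\<rparr>) \<longrightarrow> N = N')"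

text \<open>An algebra is basic if it is multiplicity-free as a left module over itself.\<close>

definition basic_algebra :: "('k, 'a) module \<Rightarrow> bool" where
  "basic_algebra A \<longleftrightarrow> (\<exists>\<N>. basic_decomposition A (regular_module A) \<N>)"

definition representation_finite :: "'k ring \<Rightarrow> ('k, 'a) module \<Rightarrow> bool" where
  "representation_finite K A \<longleftrightarrow>
     (\<exists>\<M> \<subseteq> fmod K A. finite \<M> \<and>
        (\<forall>M \<in> fmod K A. indecomposable A M \<longrightarrow> (\<exists>N \<in> \<M>. lmod_iso A M N)))"

definition filtration :: "('k, 'a) module \<Rightarrow> ('a, 'm) module \<Rightarrow> 'm set list \<Rightarrow> bool" where
  "filtration A M Us \<longleftrightarrow> Us \<noteq> [] \<and> hd Us = {\<zero>\<^bsub>M\<^esub>} \<and> last Us = carrier M \<and>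
     (\<forall>U \<in> set Us. lsubmodule U A M) \<and> (\<forall>i. Suc i < length Us \<longrightarrow> Us ! i \<subseteq> Us ! Suc i)"

definition subquotient :: "('a, 'm) module \<Rightarrow> 'm set list \<Rightarrow> nat \<Rightarrow> ('a, 'm set) module" where
  "subquotient M Us i = quot_lmod (M\<lparr>carrier := Us ! Suc i\<rparr>) (Us ! i)"

definition composition_series :: "('k, 'a) module \<Rightarrow> ('a, 'm) module \<Rightarrow> 'm set list \<Rightarrow> bool" where
  "composition_series A M Us \<longleftrightarrow> filtration A M Us \<and>
     (\<forall>i. Suc i < length Us \<longrightarrow> simple_module A (subquotient M Us i))"

definition composition_factor :: "('k, 'a) module \<Rightarrow> ('a, 'm) module \<Rightarrow> ('a, 'n) module \<Rightarrow> bool" where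
  "composition_factor A M S \<longleftrightarrow>
     (\<exists>Us i. composition_series A M Us \<and> Suc i < length Us \<and> lmod_iso A (subquotient M Us i) S)"

definition uniserial_algebra :: "'k ring \<Rightarrow> ('k, 'a) module \<Rightarrow> bool" where
  "uniserial_algebra K A \<longleftrightarrow>
     (\<forall>M \<in> fmod K A. indecomposable A M \<longrightarrow> (\<exists>!Us. composition_series A M Us))"

definition radical :: "('k, 'a) module \<Rightarrow> ('a, 'm) module \<Rightarrow> 'm set" where
  "radical A M = carrier M \<inter>
     \<Inter> {U. lsubmodule U A M \<and> U \<noteq> carrier M \<and>
           (\<forall>V. lsubmodule V A M \<and> U \<subseteq> V \<longrightarrow> V = U \<or> V = carrier M)}"

definition top_module :: "('k, 'a) module \<Rightarrow> ('a, 'm) module \<Rightarrow> ('a, 'm set) module" where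
  "top_module A M = quot_lmod M (radical A M)"

text \<open>The sum of all simple submodules, as the least submodule containing them.\<close>

definition socle :: "('k, 'a) module \<Rightarrow> ('a, 'm) module \<Rightarrow> ('a, 'm) module" where
  "socle A M = M\<lparr>carrier :=
     \<Inter> {V. lsubmodule V A M \<and>
           (\<forall>U. lsubmodule U A M \<and> simple_module A (M\<lparr>carrier := U\<rparr>) \<longrightarrow> U \<subseteq> V)}\<rparr>"

definition projective :: "'k ring \<Rightarrow> ('k, 'a) module \<Rightarrow> ('a, 'm) module \<Rightarrow> bool" where
  "projective K A P \<longleftrightarrow>
     (\<forall>M \<in> fmod K A. \<forall>N \<in> fmod K A. \<forall>g \<in> lmod_hom A M N. \<forall>f \<in> lmod_hom A P N.
        g ` carrier M = carrier N \<longrightarrow>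
        (\<exists>h \<in> lmod_hom A P M. \<forall>x \<in> carrier P. g (h x) = f x))"

definition projective_cover ::
    "'k ring \<Rightarrow> ('k, 'a) module \<Rightarrow> ('a, nat \<Rightarrow> 'k) module \<Rightarrow> ('a, 'm) module \<Rightarrow> bool" where
  "projective_cover K A P M \<longleftrightarrow> P \<in> fmod K A \<and> projective K A P \<and>
     (\<exists>f \<in> lmod_hom A P M. f ` carrier P = carrier M \<and>
        (\<forall>U. lsubmodule U A P \<and> U <+>\<^bsub>P\<^esub> a_kernel P M f = carrier P \<longrightarrow> U = carrier P))"

text \<open>
  \<open>0 \<rightarrow> X (n + 1) \<rightarrow> \<dots> \<rightarrow> X 1 \<rightarrow> X 0 = M \<rightarrow> 0\<close> is exact, where \<open>d i : X (i + 1) \<rightarrow> X i\<close>, and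
  \<open>X 1, \<dots>, X (n + 1)\<close> are projective.
\<close>

definition projective_resolution ::
    "'k ring \<Rightarrow> ('k, 'a) module \<Rightarrow> ('a, nat \<Rightarrow> 'k) module \<Rightarrow> nat \<Rightarrow>
     (nat \<Rightarrow> ('a, nat \<Rightarrow> 'k) module) \<Rightarrow> (nat \<Rightarrow> (nat \<Rightarrow> 'k) \<Rightarrow> (nat \<Rightarrow> 'k)) \<Rightarrow> bool" where
  "projective_resolution K A M n X d \<longleftrightarrow> X 0 = M \<and>
     (\<forall>i \<le> n. X (Suc i) \<in> fmod K A \<and> projective K A (X (Suc i)) \<and>
        d i \<in> lmod_hom A (X (Suc i)) (X i)) \<and>
     d 0 ` carrier (X 1) = carrier M \<and>
     (\<forall>i < n. d (Suc i) ` carrier (X (Suc (Suc i))) = a_kernel (X (Suc i)) (X i) (d i)) \<and>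
     inj_on (d n) (carrier (X (Suc n)))"

text \<open>The infimum of the empty set is \<open>\<infinity>\<close>.\<close>

definition proj_dim :: "'k ring \<Rightarrow> ('k, 'a) module \<Rightarrow> ('a, nat \<Rightarrow> 'k) module \<Rightarrow> enat" where
  "proj_dim K A M = Inf (enat ` {n. \<exists>X d. projective_resolution K A M n X d})"

definition torsl :: "'k ring \<Rightarrow> ('k, 'a) module \<Rightarrow> ('a, nat \<Rightarrow> 'k) module set" where
  "torsl K A = {M \<in> fmod K A. proj_dim K A M \<le> 1}"

definition End_algebra :: "('k, 'a) module \<Rightarrow> ('a, 'm) module \<Rightarrow> ('k, 'm \<Rightarrow> 'm) module" where
  "End_algebra A M =
     \<lparr>carrier = lmod_hom A M M,
      mult = compose (carrier M),
      one = (\<lambda>x \<in> carrier M. x),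
      zero = (\<lambda>x \<in> carrier M. \<zero>\<^bsub>M\<^esub>),
      add = (\<lambda>f g. \<lambda>x \<in> carrier M. f x \<oplus>\<^bsub>M\<^esub> g x),
      smult = (\<lambda>c f. \<lambda>x \<in> carrier M. (c \<odot>\<^bsub>A\<^esub> \<one>\<^bsub>A\<^esub>) \<odot>\<^bsub>M\<^esub> f x)\<rparr>"

definition opposite_algebra :: "('k, 'a) module \<Rightarrow> ('k, 'a) module" where
  "opposite_algebra A = A\<lparr>mult := (\<lambda>a b. b \<otimes>\<^bsub>A\<^esub> a)\<rparr>"

text \<open>
  \<open>E\<close> is the direct sum of one representative of each isomorphism class of indecomposable
  modules, that is, the basic module with \<open>add(E) = A-mod\<close>.
\<close>

definition auslander_generator :: "'k ring \<Rightarrow> ('k, 'a) module \<Rightarrow> ('a, 'm) module \<Rightarrow> bool" where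
  "auslander_generator K A E \<longleftrightarrow> fd_left_module K A E \<and>
     (\<exists>\<N>. basic_decomposition A E \<N> \<and>
        (\<forall>M \<in> fmod K A. indecomposable A M \<longrightarrow> (\<exists>N \<in> \<N>. lmod_iso A M (E\<lparr>carrier := N\<rparr>))))"

definition auslander_algebra :: "('k, 'a) module \<Rightarrow> ('a, 'm) module \<Rightarrow> ('k, 'm \<Rightarrow> 'm) module" where
  "auslander_algebra A E = opposite_algebra (End_algebra A E)"

definition parametrizes_simples ::
    "'k ring \<Rightarrow> ('k, 'a) module \<Rightarrow> 'x set \<Rightarrow> ('x \<Rightarrow> ('a, nat \<Rightarrow> 'k) module) \<Rightarrow> bool" where
  "parametrizes_simples K A \<Xi> S \<longleftrightarrow>
     (\<forall>\<xi> \<in> \<Xi>. S \<xi> \<in> fmod K A \<and> simple_module A (S \<xi>)) \<and>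
     (\<forall>\<xi> \<in> \<Xi>. \<forall>\<xi>' \<in> \<Xi>. lmod_iso A (S \<xi>) (S \<xi>') \<longrightarrow> \<xi> = \<xi>') \<and>
     (\<forall>M \<in> fmod K A. simple_module A M \<longrightarrow> (\<exists>\<xi> \<in> \<Xi>. lmod_iso A M (S \<xi>)))"

text \<open>In the following, \<open>(\<rho>, \<xi>) \<in> leq\<close> means \<open>\<rho> \<le> \<xi>\<close>.\<close>

text \<open>
  The maximal factor module of \<open>P \<xi>\<close> with the required property is the one by the least
  submodule whose factor module has it.
\<close>

definition standard_module ::
    "('k, 'a) module \<Rightarrow> 'x set \<Rightarrow> ('x \<Rightarrow> ('a, 'n) module) \<Rightarrow> ('x \<Rightarrow> ('a, 'm) module) \<Rightarrow>
     'x rel \<Rightarrow> 'x \<Rightarrow> ('a, 'm set) module" where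
  "standard_module A \<Xi> S P leq \<xi> = quot_lmod (P \<xi>)
     (LEAST U. lsubmodule U A (P \<xi>) \<and>
        (\<forall>\<rho> \<in> \<Xi>. composition_factor A (quot_lmod (P \<xi>) U) (S \<rho>) \<longrightarrow> (\<rho>, \<xi>) \<in> leq))"

definition filtered_by ::
    "('k, 'a) module \<Rightarrow> 'x set \<Rightarrow> ('x \<Rightarrow> ('a, 'n) module) \<Rightarrow> ('a, 'm) module \<Rightarrow> bool" where
  "filtered_by A \<Xi> \<Delta> M \<longleftrightarrow> (\<exists>Us. filtration A M Us \<and>
     (\<forall>i. Suc i < length Us \<longrightarrow> (\<exists>\<xi> \<in> \<Xi>. lmod_iso A (subquotient M Us i) (\<Delta> \<xi>))))"

definition adapted_order ::
    "'k ring \<Rightarrow> ('k, 'a) module \<Rightarrow> 'x set \<Rightarrow> ('x \<Rightarrow> ('a, 'n) module) \<Rightarrow> 'x rel \<Rightarrow> bool" where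
  "adapted_order K A \<Xi> S leq \<longleftrightarrow>
     (\<forall>X \<in> fmod K A. \<forall>\<xi> \<in> \<Xi>. \<forall>\<xi>' \<in> \<Xi>.
        lmod_iso A (top_module A X) (S \<xi>) \<and> lmod_iso A (socle A X) (S \<xi>') \<and>
        (\<xi>, \<xi>') \<notin> leq \<and> (\<xi>', \<xi>) \<notin> leq \<longrightarrow>
        (\<exists>\<rho> \<in> \<Xi>. (\<xi>, \<rho>) \<in> leq \<and> \<rho> \<noteq> \<xi> \<and> composition_factor A X (S \<rho>)))"

definition division_ring :: "('a, 'b) ring_scheme \<Rightarrow> bool" where
  "division_ring R \<longleftrightarrow> ring R \<and> Units R = carrier R - {\<zero>\<^bsub>R\<^esub>}"

definition schurian :: "('k, 'a) module \<Rightarrow> ('a, 'm) module \<Rightarrow> bool" where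
  "schurian A M \<longleftrightarrow> division_ring (End_algebra A M)"

definition quasi_hereditary_structure ::
    "'k ring \<Rightarrow> ('k, 'a) module \<Rightarrow> 'x set \<Rightarrow> ('x \<Rightarrow> ('a, 'n) module) \<Rightarrow>
     ('x \<Rightarrow> ('a, 'm) module) \<Rightarrow> 'x rel \<Rightarrow> bool" where
  "quasi_hereditary_structure K A \<Xi> S P leq \<longleftrightarrow>
     partial_order_on \<Xi> leq \<and> adapted_order K A \<Xi> S leq \<and>
     (\<forall>\<xi> \<in> \<Xi>. schurian A (standard_module A \<Xi> S P leq \<xi>)) \<and>
     filtered_by A \<Xi> (standard_module A \<Xi> S P leq) (regular_module A)"

definition delta_filtered_modules ::
    "'k ring \<Rightarrow> ('k, 'a) module \<Rightarrow> 'x set \<Rightarrow> ('x \<Rightarrow> ('a, 'n) module) \<Rightarrow>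
     ('x \<Rightarrow> ('a, 'm) module) \<Rightarrow> 'x rel \<Rightarrow> ('a, nat \<Rightarrow> 'k) module set" where
  "delta_filtered_modules K A \<Xi> S P leq =
     {M \<in> fmod K A. filtered_by A \<Xi> (standard_module A \<Xi> S P leq) M}"

end

theory Submission
  imports Defs
begin

text \<open>
  Let \<open>H X = Hom(E, X)\<close>, a module over \<open>\<Gamma> = End(E)\<^sup>o\<^sup>p\<close>. Every finite-dimensional \<open>\<Lambda>\<close>-module lies in
  \<open>add(E)\<close>, so each \<open>H X\<close> is projective, and \<open>\<Lambda>\<close> itself is a summand of a power of \<open>E\<close>.

  The first step describes projective dimension at most one by elements. Call an element of a
  \<open>\<Gamma>\<close>-module torsion if it is killed by all endomorphisms of \<open>E\<close> that factor through \<open>\<Lambda>\<close>. The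
  submodules \<open>U\<close> of \<open>X\<close> correspond, as \<open>Hom(E, U)\<close>, to the submodules of \<open>H X\<close> with torsion-free factor
  module (\<open>tclosed_HS\<close>). Hence a torsion-free module \<open>M\<close>, written as a quotient of some \<open>H X\<close>, has a
  resolution \<open>0 \<rightarrow> H Y \<rightarrow> H X \<rightarrow> M \<rightarrow> 0\<close> with \<open>Y\<close> a submodule of \<open>X\<close>. Conversely, a cokernel of an injection
  between projective modules is torsion-free, because a homomorphism \<open>E \<rightarrow> X\<close> can be
  glued from a compatible family of composites with maps \<open>\<Lambda> \<rightarrow> E\<close> (\<open>torsl_imp_tfree\<close>,
  \<open>tfree_imp_torsl\<close>).

  The simple \<open>\<Gamma>\<close>-modules correspond to the indecomposable summands \<open>N\<close> of \<open>E\<close>, with projective covers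
  \<open>Hom(E, N)\<close>, and the simple module of \<open>N\<close> is a composition factor of \<open>M\<close> if and only if the
  idempotent \<open>ee N\<close>, the projection onto \<open>N\<close>, does not kill \<open>M\<close>. A standard module is therefore
  \<open>Hom(E, N)\<close> modulo the submodule generated by the maps that factor through summands which are not
  below \<open>N\<close>.

  Let \<open>\<Lambda>\<close> be uniserial, and let summands of smaller dimension be the larger ones. A map to \<open>N\<close>
  from a different summand that is not longer than \<open>N\<close> has its image in the radical of \<open>N\<close>, and a map
  into the radical factors through its image, which is isomorphic to a shorter summand. So the
  standard module of \<open>N\<close> is \<open>Hom(E, N) / Hom(E, rad N)\<close> (\<open>ker_standard_uleq\<close>), which is torsion-free and has no
  proper nonzero submodule with torsion-free factor module. The modules filtered by standard
  modules are then torsion-free. If \<open>Y \<subseteq> X\<close> then \<open>H X / H Y\<close> is filtered by standard modules: for a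
  maximal submodule \<open>V\<close> of \<open>X\<close>, a submodule of least dimension among those not contained in \<open>V\<close> is
  isomorphic to some \<open>N\<close>, and every map \<open>E \<rightarrow> X\<close> agrees modulo \<open>V\<close> with a map into it. So \<open>H X / H V\<close> is
  the standard module of \<open>N\<close> (\<open>maximal_step\<close>, \<open>filtered_by_standard\<close>).

  Conversely, let the torsion-free modules be the filtered ones for some order. If \<open>T\<close> is a simple
  \<open>\<Lambda>\<close>-module, then every nonzero map \<open>E \<rightarrow> T\<close> is surjective, so that a nonzero submodule \<open>F\<close> of \<open>H T\<close> has no
  torsion-free factor module except \<open>F\<close> and \<open>0\<close>; being filtered, \<open>F\<close> is a standard module
  (\<open>simple_hom_sub_standard\<close>). This has two consequences for an indecomposable module \<open>M\<close>. First, for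
  a maximal submodule \<open>V\<close> the image of \<open>H M \<rightarrow> H (M / V)\<close> is the standard module of \<open>M\<close>, so \<open>V\<close>, being
  determined by the kernel of this map, is unique (\<open>max_sub_unique\<close>). Second, \<open>V\<close> is zero or
  indecomposable: if \<open>V = C \<oplus> D\<close>, the images of \<open>H (M / C)\<close> and \<open>H (M / D)\<close> in \<open>H (M / V)\<close> are comparable,
  since their sum is a standard module and has a unique maximal submodule. This gives a map
  between \<open>M / C\<close> and \<open>M / D\<close> over \<open>M / V\<close>, and such a map splits \<open>C\<close> or \<open>D\<close> off \<open>M\<close>
  (\<open>max_sub_indecomposable\<close>). By induction the submodules of \<open>M\<close> form a chain.
\<close>


section \<open>Linear maps between finite-dimensional spaces\<close>

lemma (in linear_map) lin_indpt_image:
  assumes inj: "inj_on T (carrier V)" and B: "B \<subseteq> carrier V" "V.module.lin_indpt B"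
  shows "W.module.lin_indpt (T ` B)"
proof
  assume "W.module.lin_dep (T ` B)"
  then obtain C a v where C: "finite C" "C \<subseteq> T ` B" "a \<in> C \<rightarrow> carrier K"
    "W.module.lincomb a C = \<zero>\<^bsub>W\<^esub>" "v \<in> C" "a v \<noteq> \<zero>\<^bsub>K\<^esub>"
    unfolding W.module.lin_dep_def by blast
  obtain D where D: "finite D" "D \<subseteq> B" "C = T ` D"
    using C(1,2) by (meson finite_subset_image)
  have DV: "D \<subseteq> carrier V" using D B by blast
  have a: "a \<circ> T \<in> D \<rightarrow> carrier K" using C(3) D(3) by auto
  have "T (V.module.lincomb (a \<circ> T) D) = T \<zero>\<^bsub>V\<^esub>"
    using lincomb_linear_image[OF inj DV _ D(1), of a] C(3,4) D(3) by simp
  moreover have "V.module.lincomb (a \<circ> T) D \<in> carrier V"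
    by (rule V.module.lincomb_closed[OF DV a])
  ultimately have lc: "V.module.lincomb (a \<circ> T) D = \<zero>\<^bsub>V\<^esub>"
    using inj by (meson V.module.M.zero_closed inj_onD)
  obtain w where w: "w \<in> D" "v = T w" using C(5) D(3) by auto
  have "V.module.lin_dep B"
    by (rule V.module.lin_dep_crit[OF D(1,2) a w(1) _ lc]) (use C(6) w in simp)
  thus False using B(2) by simp
qed

lemma (in linear_map) inj_imp_fin_dim:
  assumes inj: "inj_on T (carrier V)" and W: "W.fin_dim"
  shows "V.fin_dim"
proof -
  let ?P = "\<lambda>A. A \<subseteq> carrier V \<and> V.module.lin_indpt A"
  have "finite A \<and> card A \<le> W.dim" if A: "?P A" for A
  proof -
    have TA: "T ` A \<subseteq> carrier W" using A by auto
    have "W.module.lin_indpt (T ` A)" using lin_indpt_image[OF inj] A by blast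
    moreover have "inj_on T A" using A inj by (meson inj_on_subset)
    ultimately show ?thesis
      using W.li_le_dim[OF W TA] by (metis card_image finite_imageD)
  qed
  moreover have "?P {}" by (auto simp: V.module.lin_dep_def)
  ultimately obtain A where A: "finite A" "maximal A ?P"
    using maximal_exists[of ?P "W.dim" "{}"] by blast
  have "V.basis A" by (rule V.max_li_is_basis[OF A(2)])
  thus ?thesis unfolding V.fin_dim_def V.basis_def using A(1) by blast
qed

lemma (in linear_map) inj_imp_dim_le:
  assumes inj: "inj_on T (carrier V)" and W: "W.fin_dim"
  shows "V.dim \<le> W.dim" and "W.dim \<le> V.dim \<Longrightarrow> T ` carrier V = carrier W"
proof -
  obtain B where B: "finite B" "V.basis B"
    using V.finite_basis_exists[OF inj_imp_fin_dim[OF inj W]] by blast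
  have BV: "B \<subseteq> carrier V" "V.module.lin_indpt B" using B(2) by (auto simp: V.basis_def)
  have TB: "T ` B \<subseteq> carrier W" using BV by auto
  have li: "W.module.lin_indpt (T ` B)" by (rule lin_indpt_image[OF inj BV])
  have c: "card (T ` B) = V.dim"
    using V.dim_basis[OF B] card_image inj_on_subset[OF inj BV(1)] by metis
  show "V.dim \<le> W.dim" using W.li_le_dim(2)[OF W TB li] c by simp
  assume "W.dim \<le> V.dim"
  hence "W.basis (T ` B)" by (intro W.dim_li_is_basis W TB li) (use B c in auto)
  hence span: "W.module.span (T ` B) = carrier W" by (simp add: W.basis_def)
  show "T ` carrier V = carrier W"
  proof
    show "carrier W \<subseteq> T ` carrier V"
    proof
      fix w assume "w \<in> carrier W"
      then obtain a where a: "a \<in> T ` B \<rightarrow> carrier K" "W.module.lincomb a (T ` B) = w"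
        using W.module.finite_in_span[of "T ` B" w] span B(1) TB by auto
      have "w = T (V.module.lincomb (a \<circ> T) B)"
        using lincomb_linear_image[OF inj BV(1) a(1) B(1)] a(2) by simp
      moreover have "V.module.lincomb (a \<circ> T) B \<in> carrier V"
        using a(1) by (intro V.module.lincomb_closed BV(1)) auto
      ultimately show "w \<in> T ` carrier V" by blast
    qed
  qed auto
qed

lemma (in linear_map) surj_imp_dim_le:
  assumes surj: "T ` carrier V = carrier W" and V: "V.fin_dim"
  shows "W.dim \<le> V.dim" and "V.dim \<le> W.dim \<Longrightarrow> inj_on T (carrier V)"
proof -
  have "imT = carrier W" using surj by (simp add: im_def)
  hence rn: "W.dim + vectorspace.dim K (V.vs kerT) = V.dim"
    using rank_nullity[OF V] by simp
  thus "W.dim \<le> V.dim" by simp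
  interpret Ker: vectorspace K "V.vs kerT" by (rule V.subspace_is_vs[OF kerT_is_subspace])
  have sub: "kerT \<subseteq> carrier V" by (auto simp: ker_def)
  have "mod_hom K (V.vs kerT) V id"
    by (intro mod_hom.intro mod_hom_axioms.intro Ker.module.module_axioms V.module.module_axioms)
      (use sub in \<open>auto simp: LinearCombinations.module_hom_def\<close>)
  then interpret inc: linear_map K "V.vs kerT" V id
    by (intro linear_map.intro Ker.vectorspace_axioms V.vectorspace_axioms)
  have fd: "Ker.fin_dim" by (rule inc.inj_imp_fin_dim[OF _ V]) simp
  assume "V.dim \<le> W.dim"
  hence "Ker.dim = 0" using rn by simp
  moreover obtain B where B: "finite B" "Ker.basis B" using Ker.finite_basis_exists[OF fd] by blast
  ultimately have "B = {}" using Ker.dim_basis[OF B] by simp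
  hence "carrier (V.vs kerT) = {\<zero>\<^bsub>V\<^esub>}" using B(2) Ker.span_empty by (simp add: Ker.basis_def)
  thus "inj_on T (carrier V)" by (rule Ke0_imp_inj)
qed

section \<open>Left modules\<close>

abbreviation lhom where "lhom \<equiv> LinearCombinations.module_hom"

lemma lhomI:
  assumes "\<And>x. x \<in> carrier M \<Longrightarrow> f x \<in> carrier N"
    and "\<And>x y. \<lbrakk>x \<in> carrier M; y \<in> carrier M\<rbrakk> \<Longrightarrow> f (x \<oplus>\<^bsub>M\<^esub> y) = f x \<oplus>\<^bsub>N\<^esub> f y"
    and "\<And>a x. \<lbrakk>a \<in> carrier A; x \<in> carrier M\<rbrakk> \<Longrightarrow> f (a \<odot>\<^bsub>M\<^esub> x) = a \<odot>\<^bsub>N\<^esub> f x"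
  shows "f \<in> lhom A M N"
  using assms by (auto simp: LinearCombinations.module_hom_def)

lemma lhom_closed: "f \<in> lhom A M N \<Longrightarrow> x \<in> carrier M \<Longrightarrow> f x \<in> carrier N"
  by (auto simp: LinearCombinations.module_hom_def)

lemmas lhom_add = LinearCombinations.module_hom_add and lhom_smult = LinearCombinations.module_hom_smult

lemma lhom_comp:
  assumes f: "f \<in> lhom A M N" and g: "g \<in> lhom A N Q"
  shows "(\<lambda>x. g (f x)) \<in> lhom A M Q"
  by (rule lhomI) (simp_all add: lhom_closed[OF f] lhom_closed[OF g] lhom_add[OF f] lhom_add[OF g]
    lhom_smult[OF f] lhom_smult[OF g])

lemma lhom_id: "(\<lambda>x. x) \<in> lhom A M M"
  by (rule lhomI) simp_all

lemma lhom_sub_cod: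
  "f \<in> lhom A M (N\<lparr>carrier := U\<rparr>) \<longleftrightarrow> f \<in> carrier M \<rightarrow> U \<and> f \<in> lhom A M N" if "U \<subseteq> carrier N"
  using that by (auto simp: LinearCombinations.module_hom_def)

lemma lhom_sub_dom: "f \<in> lhom A M N \<Longrightarrow> U \<subseteq> carrier M \<Longrightarrow> f \<in> lhom A (M\<lparr>carrier := U\<rparr>) N"
  by (auto simp: LinearCombinations.module_hom_def Pi_iff subset_iff)

locale lmod = left_module A M for A :: "('k, 'a) module" and M :: "('a, 'm) module"

lemma (in lmod) closed_ops [simp, intro]:
  "a \<in> carrier A \<Longrightarrow> x \<in> carrier M \<Longrightarrow> a \<odot>\<^bsub>M\<^esub> x \<in> carrier M"
  by (rule smult_closed)

lemma (in lmod) smult_zero [simp]: "a \<in> carrier A \<Longrightarrow> a \<odot>\<^bsub>M\<^esub> \<zero>\<^bsub>M\<^esub> = \<zero>\<^bsub>M\<^esub>"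
proof -
  assume a: "a \<in> carrier A"
  have "a \<odot>\<^bsub>M\<^esub> \<zero>\<^bsub>M\<^esub> \<oplus>\<^bsub>M\<^esub> a \<odot>\<^bsub>M\<^esub> \<zero>\<^bsub>M\<^esub> = a \<odot>\<^bsub>M\<^esub> \<zero>\<^bsub>M\<^esub>"
    using a smult_r_distr[of a "\<zero>\<^bsub>M\<^esub>" "\<zero>\<^bsub>M\<^esub>"] by simp
  thus ?thesis using a by simp
qed

lemma (in lmod) zero_smult [simp]: "x \<in> carrier M \<Longrightarrow> \<zero>\<^bsub>A\<^esub> \<odot>\<^bsub>M\<^esub> x = \<zero>\<^bsub>M\<^esub>"
proof -
  assume x: "x \<in> carrier M"
  have "\<zero>\<^bsub>A\<^esub> \<odot>\<^bsub>M\<^esub> x \<oplus>\<^bsub>M\<^esub> \<zero>\<^bsub>A\<^esub> \<odot>\<^bsub>M\<^esub> x = \<zero>\<^bsub>A\<^esub> \<odot>\<^bsub>M\<^esub> x"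
    using x smult_l_distr[of "\<zero>\<^bsub>A\<^esub>" "\<zero>\<^bsub>A\<^esub>" x] by simp
  thus ?thesis using x by simp
qed

lemma (in lmod) minus_one_smult: "x \<in> carrier M \<Longrightarrow> (\<ominus>\<^bsub>A\<^esub> \<one>\<^bsub>A\<^esub>) \<odot>\<^bsub>M\<^esub> x = \<ominus>\<^bsub>M\<^esub> x"
proof -
  assume x: "x \<in> carrier M"
  have "(\<ominus>\<^bsub>A\<^esub> \<one>\<^bsub>A\<^esub>) \<odot>\<^bsub>M\<^esub> x \<oplus>\<^bsub>M\<^esub> x = (\<ominus>\<^bsub>A\<^esub> \<one>\<^bsub>A\<^esub> \<oplus>\<^bsub>A\<^esub> \<one>\<^bsub>A\<^esub>) \<odot>\<^bsub>M\<^esub> x"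
    using x by (simp add: smult_l_distr smult_one)
  also have "\<dots> = \<zero>\<^bsub>M\<^esub>" using x by (simp add: A.l_neg)
  finally show ?thesis using x by (simp add: M.minus_equality)
qed

lemma (in lmod) diff_add_cancel:
  "x \<in> carrier M \<Longrightarrow> y \<in> carrier M \<Longrightarrow> (x \<ominus>\<^bsub>M\<^esub> y) \<oplus>\<^bsub>M\<^esub> y = x"
  by (simp add: a_minus_def M.add.m_assoc M.l_neg)

lemma (in lmod) lsubmoduleI:
  assumes U: "U \<subseteq> carrier M" "\<zero>\<^bsub>M\<^esub> \<in> U"
    and add: "\<And>x y. x \<in> U \<Longrightarrow> y \<in> U \<Longrightarrow> x \<oplus>\<^bsub>M\<^esub> y \<in> U"
    and sm: "\<And>a x. a \<in> carrier A \<Longrightarrow> x \<in> U \<Longrightarrow> a \<odot>\<^bsub>M\<^esub> x \<in> U"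
  shows "lsubmodule U A M"
proof (intro Module.submodule.intro M.add.subgroupI Module.submodule_axioms.intro)
  show "\<ominus>\<^bsub>M\<^esub> x \<in> U" if "x \<in> U" for x
    using that sm[of "\<ominus>\<^bsub>A\<^esub> \<one>\<^bsub>A\<^esub>" x] minus_one_smult[of x] U by auto
qed (use assms in auto)

lemma lsub_subset: "lsubmodule U A M \<Longrightarrow> U \<subseteq> carrier M"
  by (metis Module.submodule.axioms(1) subgroup.subset partial_object.select_convs(1))

lemma lsub_mem: "lsubmodule U A M \<Longrightarrow> x \<in> U \<Longrightarrow> x \<in> carrier M"
  using lsub_subset by blast

lemma lsub_zero: "lsubmodule U A M \<Longrightarrow> \<zero>\<^bsub>M\<^esub> \<in> U"
  using Module.submodule.axioms(1) subgroup.one_closed by fastforce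

lemma lsub_add: "lsubmodule U A M \<Longrightarrow> x \<in> U \<Longrightarrow> y \<in> U \<Longrightarrow> x \<oplus>\<^bsub>M\<^esub> y \<in> U"
  using Module.submodule.axioms(1) subgroup.m_closed by fastforce

lemma lsub_smult: "lsubmodule U A M \<Longrightarrow> a \<in> carrier A \<Longrightarrow> x \<in> U \<Longrightarrow> a \<odot>\<^bsub>M\<^esub> x \<in> U"
  by (simp add: Module.submodule.smult_closed)

context lmod
begin

lemma lsub_minus: "lsubmodule U A M \<Longrightarrow> x \<in> U \<Longrightarrow> \<ominus>\<^bsub>M\<^esub> x \<in> U"
  using lsub_smult[of U A M "\<ominus>\<^bsub>A\<^esub> \<one>\<^bsub>A\<^esub>" x] minus_one_smult[of x] lsub_mem[of U A M x] by simp

lemma lsub_diff: "lsubmodule U A M \<Longrightarrow> x \<in> U \<Longrightarrow> y \<in> U \<Longrightarrow> x \<ominus>\<^bsub>M\<^esub> y \<in> U"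
  by (simp add: a_minus_def lsub_add lsub_minus)

lemma lsub_diff_right:
  assumes "lsubmodule U A M" "x \<ominus>\<^bsub>M\<^esub> y \<in> U" "y \<in> U" "x \<in> carrier M"
  shows "x \<in> U"
  using lsub_add[OF assms(1,2,3)] diff_add_cancel[OF assms(4) lsub_mem[OF assms(1,3)]] by simp

lemma lsub_carrier: "lsubmodule (carrier M) A M"
  by (rule lsubmoduleI) auto

lemma lsub_zero_module: "lsubmodule {\<zero>\<^bsub>M\<^esub>} A M"
  by (rule lsubmoduleI) auto

lemma lsub_Inter:
  assumes "\<U> \<noteq> {}" and U: "\<And>U. U \<in> \<U> \<Longrightarrow> lsubmodule U A M"
  shows "lsubmodule (\<Inter>\<U>) A M"
proof (rule lsubmoduleI)
  show "\<Inter>\<U> \<subseteq> carrier M" using assms(1) lsub_subset[OF U] by blast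
  show "\<zero>\<^bsub>M\<^esub> \<in> \<Inter>\<U>" using lsub_zero[OF U] by (intro InterI)
next
  fix x y assume "x \<in> \<Inter>\<U>" "y \<in> \<Inter>\<U>"
  thus "x \<oplus>\<^bsub>M\<^esub> y \<in> \<Inter>\<U>" using lsub_add[OF U] by (meson InterD InterI)
next
  fix a x assume "a \<in> carrier A" "x \<in> \<Inter>\<U>"
  thus "a \<odot>\<^bsub>M\<^esub> x \<in> \<Inter>\<U>" using lsub_smult[OF U] by (meson InterD InterI)
qed

lemma set_add_iff: "z \<in> U <+>\<^bsub>M\<^esub> V \<longleftrightarrow> (\<exists>x\<in>U. \<exists>y\<in>V. z = x \<oplus>\<^bsub>M\<^esub> y)"
  by (auto simp: set_add_def set_mult_def)

lemma lsub_sum: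
  assumes U: "lsubmodule U A M" and V: "lsubmodule V A M"
  shows "lsubmodule (U <+>\<^bsub>M\<^esub> V) A M"
proof (rule lsubmoduleI)
  show "U <+>\<^bsub>M\<^esub> V \<subseteq> carrier M" using lsub_mem[OF U] lsub_mem[OF V] by (auto simp: set_add_iff)
  show "\<zero>\<^bsub>M\<^esub> \<in> U <+>\<^bsub>M\<^esub> V" unfolding set_add_iff
    by (rule bexI[OF _ lsub_zero[OF U]], rule bexI[OF _ lsub_zero[OF V]]) simp
  fix x y assume "x \<in> U <+>\<^bsub>M\<^esub> V" "y \<in> U <+>\<^bsub>M\<^esub> V"
  then obtain u v u' v' where uv: "u \<in> U" "v \<in> V" "u' \<in> U" "v' \<in> V"
    "x = u \<oplus>\<^bsub>M\<^esub> v" "y = u' \<oplus>\<^bsub>M\<^esub> v'" by (auto simp: set_add_iff)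
  have c: "u \<in> carrier M" "v \<in> carrier M" "u' \<in> carrier M" "v' \<in> carrier M"
    using uv lsub_mem[OF U] lsub_mem[OF V] by auto
  have "x \<oplus>\<^bsub>M\<^esub> y = (u \<oplus>\<^bsub>M\<^esub> u') \<oplus>\<^bsub>M\<^esub> (v \<oplus>\<^bsub>M\<^esub> v')"
    using c uv(5,6) by (simp add: M.a_ac)
  thus "x \<oplus>\<^bsub>M\<^esub> y \<in> U <+>\<^bsub>M\<^esub> V"
    unfolding set_add_iff using lsub_add[OF U uv(1,3)] lsub_add[OF V uv(2,4)] by blast
next
  fix a x assume a: "a \<in> carrier A" and "x \<in> U <+>\<^bsub>M\<^esub> V"
  then obtain u v where uv: "u \<in> U" "v \<in> V" "x = u \<oplus>\<^bsub>M\<^esub> v" by (auto simp: set_add_iff)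
  have "a \<odot>\<^bsub>M\<^esub> x = a \<odot>\<^bsub>M\<^esub> u \<oplus>\<^bsub>M\<^esub> a \<odot>\<^bsub>M\<^esub> v"
    using uv a lsub_mem[OF U] lsub_mem[OF V] by (simp add: smult_r_distr)
  thus "a \<odot>\<^bsub>M\<^esub> x \<in> U <+>\<^bsub>M\<^esub> V"
    unfolding set_add_iff using lsub_smult[OF U a uv(1)] lsub_smult[OF V a uv(2)] by blast
qed

lemma lsub_sum_supset:
  assumes U: "lsubmodule U A M" and V: "lsubmodule V A M"
  shows "U \<subseteq> U <+>\<^bsub>M\<^esub> V" "V \<subseteq> U <+>\<^bsub>M\<^esub> V"
proof -
  show "U \<subseteq> U <+>\<^bsub>M\<^esub> V"
  proof
    fix x assume "x \<in> U"
    thus "x \<in> U <+>\<^bsub>M\<^esub> V" unfolding set_add_iff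
      by (intro bexI[OF _ \<open>x \<in> U\<close>] bexI[OF _ lsub_zero[OF V]]) (simp add: lsub_mem[OF U])
  qed
  show "V \<subseteq> U <+>\<^bsub>M\<^esub> V"
  proof
    fix x assume "x \<in> V"
    thus "x \<in> U <+>\<^bsub>M\<^esub> V" unfolding set_add_iff
      by (intro bexI[OF _ lsub_zero[OF U]] bexI[OF _ \<open>x \<in> V\<close>]) (simp add: lsub_mem[OF V])
  qed
qed

lemma lsub_sum_least:
  "lsubmodule W A M \<Longrightarrow> U \<subseteq> W \<Longrightarrow> V \<subseteq> W \<Longrightarrow> U <+>\<^bsub>M\<^esub> V \<subseteq> W"
  by (auto simp: set_add_iff subset_iff intro: lsub_add)

lemma lmod_sub:
  assumes U: "lsubmodule U A M"
  shows "lmod A (M\<lparr>carrier := U\<rparr>)"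
proof -
  have c: "x \<in> carrier M" if "x \<in> U" for x using that U by (rule lsub_mem[rotated])
  have "abelian_group (M\<lparr>carrier := U\<rparr>)"
  proof (rule abelian_groupI)
    fix x assume "x \<in> carrier (M\<lparr>carrier := U\<rparr>)"
    thus "\<exists>y\<in>carrier (M\<lparr>carrier := U\<rparr>). y \<oplus>\<^bsub>M\<lparr>carrier := U\<rparr>\<^esub> x = \<zero>\<^bsub>M\<lparr>carrier := U\<rparr>\<^esub>"
      by (intro bexI[of _ "\<ominus>\<^bsub>M\<^esub> x"]) (auto simp: c M.l_neg lsub_minus[OF U])
  qed (auto simp: c M.a_ac lsub_add[OF U] lsub_zero[OF U])
  thus ?thesis
    by (intro lmod.intro left_module.intro left_module_axioms.intro A.ring_axioms)
      (auto simp: c lsub_smult[OF U] smult_l_distr smult_r_distr smult_assoc1 smult_one)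
qed

lemma lsub_sub_iff:
  assumes U: "lsubmodule U A M"
  shows "lsubmodule W A (M\<lparr>carrier := U\<rparr>) \<longleftrightarrow> lsubmodule W A M \<and> W \<subseteq> U"
proof
  interpret U: lmod A "M\<lparr>carrier := U\<rparr>" by (rule lmod_sub[OF U])
  { assume W: "lsubmodule W A (M\<lparr>carrier := U\<rparr>)"
    have "W \<subseteq> U" using lsub_subset[OF W] by simp
    thus "lsubmodule W A M \<and> W \<subseteq> U"
      using lsub_zero[OF W] lsub_add[OF W] lsub_smult[OF W] lsub_subset[OF U]
      by (intro conjI lsubmoduleI) auto }
  { assume "lsubmodule W A M \<and> W \<subseteq> U"
    hence W: "lsubmodule W A M" "W \<subseteq> U" by auto
    show "lsubmodule W A (M\<lparr>carrier := U\<rparr>)"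
      using lsub_zero[OF W(1)] lsub_add[OF W(1)] lsub_smult[OF W(1)] W(2)
      by (intro U.lsubmoduleI) auto }
qed

end

lemma lhom_zero:
  assumes "lmod A M" "lmod A N" and f: "f \<in> lhom A M N"
  shows "f \<zero>\<^bsub>M\<^esub> = \<zero>\<^bsub>N\<^esub>"
proof -
  interpret M: lmod A M by fact
  interpret N: lmod A N by fact
  have "f (\<zero>\<^bsub>A\<^esub> \<odot>\<^bsub>M\<^esub> \<zero>\<^bsub>M\<^esub>) = \<zero>\<^bsub>A\<^esub> \<odot>\<^bsub>N\<^esub> f \<zero>\<^bsub>M\<^esub>" by (rule lhom_smult[OF f]) auto
  thus ?thesis using lhom_closed[OF f M.zero_closed] by simp
qed

lemma lhom_minus:
  assumes "lmod A M" "lmod A N" and f: "f \<in> lhom A M N" and x: "x \<in> carrier M"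
  shows "f (\<ominus>\<^bsub>M\<^esub> x) = \<ominus>\<^bsub>N\<^esub> f x"
proof -
  interpret M: lmod A M by fact
  interpret N: lmod A N by fact
  show ?thesis
    using lhom_smult[OF f, of "\<ominus>\<^bsub>A\<^esub> \<one>\<^bsub>A\<^esub>" x] x lhom_closed[OF f x]
    by (simp add: M.minus_one_smult N.minus_one_smult)
qed

lemma lhom_diff:
  assumes "lmod A M" "lmod A N" and f: "f \<in> lhom A M N"
    and x: "x \<in> carrier M" "y \<in> carrier M"
  shows "f (x \<ominus>\<^bsub>M\<^esub> y) = f x \<ominus>\<^bsub>N\<^esub> f y"
proof -
  interpret M: lmod A M by fact
  show ?thesis using lhom_add[OF f x(1), of "\<ominus>\<^bsub>M\<^esub> y"] x lhom_minus[OF assms(1,2) f x(2)]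
    by (simp add: a_minus_def)
qed

lemma lhom_zero_map: "lmod A N \<Longrightarrow> (\<lambda>x. \<zero>\<^bsub>N\<^esub>) \<in> lhom A M N"
proof -
  assume "lmod A N"
  then interpret N: lmod A N .
  show ?thesis by (rule lhomI) auto
qed

lemma lhom_plus:
  assumes "lmod A N" and f: "f \<in> lhom A M N" and g: "g \<in> lhom A M N"
  shows "(\<lambda>x. f x \<oplus>\<^bsub>N\<^esub> g x) \<in> lhom A M N"
proof -
  interpret N: lmod A N by fact
  show ?thesis
    by (rule lhomI)
      (simp_all add: lhom_closed[OF f] lhom_closed[OF g] lhom_add[OF f] lhom_add[OF g]
        lhom_smult[OF f] lhom_smult[OF g] N.a_ac N.smult_r_distr)
qed

lemma lsub_vimage:
  assumes "lmod A M" "lmod A N" and f: "f \<in> lhom A M N" and U: "lsubmodule U A N"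
  shows "lsubmodule {x \<in> carrier M. f x \<in> U} A M"
proof -
  interpret M: lmod A M by fact
  show ?thesis
    by (rule M.lsubmoduleI)
      (auto simp: lhom_add[OF f] lhom_smult[OF f] lhom_zero[OF assms(1,2) f]
        lsub_zero[OF U] lsub_add[OF U] lsub_smult[OF U])
qed

lemma lsub_image:
  assumes "lmod A M" "lmod A N" and f: "f \<in> lhom A M N" and U: "lsubmodule U A M"
  shows "lsubmodule (f ` U) A N"
proof -
  interpret M: lmod A M by fact
  interpret N: lmod A N by fact
  have c: "x \<in> carrier M" if "x \<in> U" for x by (rule lsub_mem[OF U that])
  show ?thesis
  proof (rule N.lsubmoduleI)
    show "\<zero>\<^bsub>N\<^esub> \<in> f ` U" using lhom_zero[OF assms(1,2) f] lsub_zero[OF U] by (metis imageI)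
    fix x y assume "x \<in> f ` U" "y \<in> f ` U"
    then obtain u v where "u \<in> U" "v \<in> U" "x = f u" "y = f v" by auto
    thus "x \<oplus>\<^bsub>N\<^esub> y \<in> f ` U" using lhom_add[OF f, of u v] lsub_add[OF U, of u v] c by (metis imageI)
  next
    fix a x assume a: "a \<in> carrier A" and "x \<in> f ` U"
    then obtain u where "u \<in> U" "x = f u" by auto
    thus "a \<odot>\<^bsub>N\<^esub> x \<in> f ` U" using lhom_smult[OF f a, of u] lsub_smult[OF U a, of u] c by (metis imageI)
  qed (use c lhom_closed[OF f] in auto)
qed

lemma lhom_inj_iff:
  assumes "lmod A M" "lmod A N" and f: "f \<in> lhom A M N"
  shows "inj_on f (carrier M) \<longleftrightarrow> (\<forall>x \<in> carrier M. f x = \<zero>\<^bsub>N\<^esub> \<longrightarrow> x = \<zero>\<^bsub>M\<^esub>)"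
proof
  interpret M: lmod A M by fact
  interpret N: lmod A N by fact
  have 0: "f \<zero>\<^bsub>M\<^esub> = \<zero>\<^bsub>N\<^esub>" by (rule lhom_zero[OF assms])
  { assume "inj_on f (carrier M)"
    thus "\<forall>x \<in> carrier M. f x = \<zero>\<^bsub>N\<^esub> \<longrightarrow> x = \<zero>\<^bsub>M\<^esub>" using 0 by (metis M.zero_closed inj_onD) }
  { assume k: "\<forall>x \<in> carrier M. f x = \<zero>\<^bsub>N\<^esub> \<longrightarrow> x = \<zero>\<^bsub>M\<^esub>"
    show "inj_on f (carrier M)"
    proof (rule inj_onI)
      fix x y assume xy: "x \<in> carrier M" "y \<in> carrier M" "f x = f y"
      have "f (x \<ominus>\<^bsub>M\<^esub> y) = \<zero>\<^bsub>N\<^esub>"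
        using lhom_diff[OF assms xy(1,2)] xy lhom_closed[OF f] by (simp add: N.r_neg a_minus_def)
      hence "x \<ominus>\<^bsub>M\<^esub> y = \<zero>\<^bsub>M\<^esub>" using k xy by simp
      thus "x = y" using xy by simp
    qed }
qed

lemma lhom_inv:
  assumes f: "f \<in> lhom A M N" and b: "bij_betw f (carrier M) (carrier N)"
    and M: "lmod A M"
  shows "inv_into (carrier M) f \<in> lhom A N M"
proof -
  interpret M: lmod A M by fact
  let ?g = "inv_into (carrier M) f"
  have gc: "?g y \<in> carrier M" "f (?g y) = y" if "y \<in> carrier N" for y
    using b that by (metis bij_betw_def inv_into_into, metis bij_betw_inv_into_right)
  have gf: "?g (f x) = x" if "x \<in> carrier M" for x
    using b that by (meson bij_betw_inv_into_left)
  show ?thesis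
  proof (rule lhomI)
    fix x y assume xy: "x \<in> carrier N" "y \<in> carrier N"
    have "x \<oplus>\<^bsub>N\<^esub> y = f (?g x \<oplus>\<^bsub>M\<^esub> ?g y)" using xy gc by (simp add: lhom_add[OF f])
    thus "?g (x \<oplus>\<^bsub>N\<^esub> y) = ?g x \<oplus>\<^bsub>M\<^esub> ?g y" using xy gc gf by simp
  next
    fix a x assume ax: "a \<in> carrier A" "x \<in> carrier N"
    have "a \<odot>\<^bsub>N\<^esub> x = f (a \<odot>\<^bsub>M\<^esub> ?g x)" using ax gc by (simp add: lhom_smult[OF f])
    thus "?g (a \<odot>\<^bsub>N\<^esub> x) = a \<odot>\<^bsub>M\<^esub> ?g x" using ax gc gf by simp
  qed (use gc in auto)
qed

lemma lmod_iso_iff: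
  assumes "lmod A M"
  shows "lmod_iso A M N \<longleftrightarrow> (\<exists>f \<in> lhom A M N. bij_betw f (carrier M) (carrier N))"
proof
  interpret M: lmod A M by fact
  assume "\<exists>f \<in> lhom A M N. bij_betw f (carrier M) (carrier N)"
  then obtain f where f: "f \<in> lhom A M N" "bij_betw f (carrier M) (carrier N)" by blast
  have "restrict f (carrier M) \<in> lmod_hom A M N"
    unfolding lmod_hom_def
    by (auto intro!: lhomI simp: lhom_closed[OF f(1)] lhom_add[OF f(1)] lhom_smult[OF f(1)])
  moreover have "bij_betw (restrict f (carrier M)) (carrier M) (carrier N)"
    using f(2) by (simp add: bij_betw_def inj_on_restrict_eq)
  ultimately show "lmod_iso A M N" unfolding lmod_iso_def by blast
qed (auto simp: lmod_iso_def lmod_hom_def)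

lemma lmod_iso_sym:
  assumes "lmod A M" "lmod A N" "lmod_iso A M N"
  shows "lmod_iso A N M"
  using assms lhom_inv[of _ A M N] bij_betw_inv_into[of _ "carrier M" "carrier N"]
  by (metis lmod_iso_iff)

lemma lmod_iso_trans:
  assumes "lmod A M" "lmod A N" "lmod_iso A M N" "lmod_iso A N Q"
  shows "lmod_iso A M Q"
proof -
  obtain f g where f: "f \<in> lhom A M N" "bij_betw f (carrier M) (carrier N)"
    and g: "g \<in> lhom A N Q" "bij_betw g (carrier N) (carrier Q)"
    using assms lmod_iso_iff by metis
  have "bij_betw (\<lambda>x. g (f x)) (carrier M) (carrier Q)"
    using bij_betw_trans[OF f(2) g(2)] by (simp add: comp_def)
  thus ?thesis using lhom_comp[OF f(1) g(1)] lmod_iso_iff[OF assms(1)] by metis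
qed

subsection \<open>Quotients\<close>

definition lepi :: "('k, 'a) module \<Rightarrow> ('a, 'm) module \<Rightarrow> ('a, 'n) module \<Rightarrow> ('m \<Rightarrow> 'n) \<Rightarrow> bool" where
  "lepi A M N p \<longleftrightarrow> p \<in> lhom A M N \<and> p ` carrier M = carrier N"

lemma lepiD: "lepi A M N p \<Longrightarrow> p \<in> lhom A M N" "lepi A M N p \<Longrightarrow> p ` carrier M = carrier N"
  by (auto simp: lepi_def)

lemma lepi_ex: "lepi A M N p \<Longrightarrow> y \<in> carrier N \<Longrightarrow> \<exists>x \<in> carrier M. y = p x"
  by (auto simp: lepi_def)

lemma lepi_comp: "lepi A M N p \<Longrightarrow> lepi A N Q q \<Longrightarrow> lepi A M Q (\<lambda>x. q (p x))"
  unfolding lepi_def using lhom_comp by (auto simp flip: image_image)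

text \<open>The homomorphism theorem, for an arbitrary epimorphism in place of the canonical one, so that it
  applies without passing to cosets.\<close>
lemma lepi_factor:
  assumes "lmod A M" "lmod A Q" "lmod A N"
    and p: "lepi A M Q p" and f: "f \<in> lhom A M N"
    and k: "\<And>x. x \<in> carrier M \<Longrightarrow> p x = \<zero>\<^bsub>Q\<^esub> \<Longrightarrow> f x = \<zero>\<^bsub>N\<^esub>"
  shows "\<exists>g \<in> lhom A Q N. \<forall>x \<in> carrier M. g (p x) = f x"
proof -
  interpret M: lmod A M by fact
  interpret Q: lmod A Q by fact
  interpret N: lmod A N by fact
  have ph: "p \<in> lhom A M Q" by (rule lepiD[OF p])
  define g where "g y = f (inv_into (carrier M) p y)" for y
  have i: "inv_into (carrier M) p y \<in> carrier M" "p (inv_into (carrier M) p y) = y"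
    if "y \<in> carrier Q" for y
    using that lepiD(2)[OF p] by (metis inv_into_into, metis f_inv_into_f)
  have gp: "g (p x) = f x" if x: "x \<in> carrier M" for x
  proof -
    let ?y = "inv_into (carrier M) p (p x)"
    have y: "?y \<in> carrier M" "p ?y = p x" using i[of "p x"] x lhom_closed[OF ph] by auto
    have "p (?y \<ominus>\<^bsub>M\<^esub> x) = \<zero>\<^bsub>Q\<^esub>"
      using lhom_diff[OF assms(1,2) ph y(1) x] y x lhom_closed[OF ph]
      by (simp add: a_minus_def Q.r_neg)
    hence "f (?y \<ominus>\<^bsub>M\<^esub> x) = \<zero>\<^bsub>N\<^esub>" using k y x by simp
    hence "f ?y \<ominus>\<^bsub>N\<^esub> f x = \<zero>\<^bsub>N\<^esub>" using lhom_diff[OF assms(1,3) f y(1) x] by simp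
    thus ?thesis using y x lhom_closed[OF f] by (simp add: g_def)
  qed
  have "g \<in> lhom A Q N"
  proof (rule lhomI)
    fix x y assume "x \<in> carrier Q" "y \<in> carrier Q"
    then obtain u v where uv: "u \<in> carrier M" "v \<in> carrier M" "x = p u" "y = p v"
      using lepi_ex[OF p] by metis
    have "x \<oplus>\<^bsub>Q\<^esub> y = p (u \<oplus>\<^bsub>M\<^esub> v)" using uv by (simp add: lhom_add[OF ph])
    thus "g (x \<oplus>\<^bsub>Q\<^esub> y) = g x \<oplus>\<^bsub>N\<^esub> g y" using uv by (simp add: gp lhom_add[OF f])
  next
    fix a x assume a: "a \<in> carrier A" and "x \<in> carrier Q"
    then obtain u where u: "u \<in> carrier M" "x = p u" using lepi_ex[OF p] by metis
    have "a \<odot>\<^bsub>Q\<^esub> x = p (a \<odot>\<^bsub>M\<^esub> u)" using u a by (simp add: lhom_smult[OF ph])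
    thus "g (a \<odot>\<^bsub>Q\<^esub> x) = a \<odot>\<^bsub>N\<^esub> g x" using u a by (simp add: gp lhom_smult[OF f])
  qed (use i lhom_closed[OF f] in \<open>auto simp: g_def\<close>)
  thus ?thesis using gp by blast
qed

lemma lmod_iso_of_epis:
  assumes "lmod A M" "lmod A Q" "lmod A Q'"
    and p: "lepi A M Q p" and q: "lepi A M Q' q"
    and k: "\<And>x. x \<in> carrier M \<Longrightarrow> p x = \<zero>\<^bsub>Q\<^esub> \<longleftrightarrow> q x = \<zero>\<^bsub>Q'\<^esub>"
  shows "lmod_iso A Q Q'"
proof -
  obtain g where g: "g \<in> lhom A Q Q'" "\<And>x. x \<in> carrier M \<Longrightarrow> g (p x) = q x"
    using lepi_factor[OF assms(1-4) lepiD(1)[OF q]] k by blast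
  have "inj_on g (carrier Q)"
    unfolding lhom_inj_iff[OF assms(2,3) g(1)] using lepi_ex[OF p] g(2) k by metis
  moreover have "g ` carrier Q = carrier Q'"
  proof
    show "g ` carrier Q \<subseteq> carrier Q'" using lhom_closed[OF g(1)] by blast
    show "carrier Q' \<subseteq> g ` carrier Q"
    proof
      fix y assume "y \<in> carrier Q'"
      then obtain x where x: "x \<in> carrier M" "y = q x" using lepi_ex[OF q] by blast
      thus "y \<in> g ` carrier Q" using g(2)[OF x(1)] lhom_closed[OF lepiD(1)[OF p] x(1)]
        by (metis imageI)
    qed
  qed
  ultimately show ?thesis
    unfolding lmod_iso_iff[OF assms(2)] bij_betw_def using g(1) by blast
qed

lemma lmod_iso_lepi:
  assumes "lmod A Q" "lmod A Q'" "lmod_iso A Q Q'" "lepi A M Q p"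
  shows "\<exists>q. lepi A M Q' q \<and> (\<forall>x \<in> carrier M. q x = \<zero>\<^bsub>Q'\<^esub> \<longleftrightarrow> p x = \<zero>\<^bsub>Q\<^esub>)"
proof -
  obtain f where f: "f \<in> lhom A Q Q'" "bij_betw f (carrier Q) (carrier Q')"
    using assms lmod_iso_iff by metis
  have e: "lepi A Q Q' f" using f by (simp add: lepi_def bij_betw_def)
  have "f y = \<zero>\<^bsub>Q'\<^esub> \<longleftrightarrow> y = \<zero>\<^bsub>Q\<^esub>" if "y \<in> carrier Q" for y
    using lhom_inj_iff[OF assms(1,2) f(1)] lhom_zero[OF assms(1,2) f(1)] f(2) that
    by (auto simp: bij_betw_def)
  thus ?thesis using lepi_comp[OF assms(4) e] lhom_closed[OF lepiD(1)[OF assms(4)]] by blast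
qed

abbreviation quot_map :: "('a, 'm) module \<Rightarrow> 'm set \<Rightarrow> 'm \<Rightarrow> 'm set" where
  "quot_map M U \<equiv> \<lambda>x. U +>\<^bsub>M\<^esub> x"

context lmod
begin

lemma
  assumes U: "lsubmodule U A M"
  shows lmod_quot: "lmod A (quot_lmod M U)"
    and quot_map_epi: "lepi A M (quot_lmod M U) (quot_map M U)"
    and quot_map_zero_iff: "x \<in> carrier M \<Longrightarrow> quot_map M U x = \<zero>\<^bsub>quot_lmod M U\<^esub> \<longleftrightarrow> x \<in> U"
proof -
  interpret S: additive_subgroup U M
    by (rule additive_subgroup.intro[OF Module.submodule.axioms(1)[OF U]])
  interpret S: abelian_subgroup U M
    by (rule abelian_subgroupI3[OF S.additive_subgroup_axioms M.abelian_group_axioms])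
  let ?Q = "quot_lmod M U" and ?q = "quot_map M U"
  have c: "x \<in> carrier M" if "x \<in> U" for x using that U by (rule lsub_mem[rotated])
  have car: "carrier ?Q = ?q ` carrier M"
    by (auto simp: quot_lmod_def A_RCOSETS_def')
  have add: "?q x \<oplus>\<^bsub>?Q\<^esub> ?q y = ?q (x \<oplus>\<^bsub>M\<^esub> y)" if "x \<in> carrier M" "y \<in> carrier M" for x y
    using that by (simp add: quot_lmod_def S.a_rcos_sum)
  have zero_iff: "?q x = \<zero>\<^bsub>?Q\<^esub> \<longleftrightarrow> x \<in> U" if x: "x \<in> carrier M" for x
  proof
    assume "?q x = \<zero>\<^bsub>?Q\<^esub>"
    thus "x \<in> U" using S.a_rcos_self[OF x] by (simp add: quot_lmod_def)
  qed (simp add: quot_lmod_def S.a_rcos_const)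
  have zero: "\<zero>\<^bsub>?Q\<^esub> = ?q \<zero>\<^bsub>M\<^esub>" using zero_iff[of "\<zero>\<^bsub>M\<^esub>"] by simp
  have sm: "a \<odot>\<^bsub>?Q\<^esub> ?q x = ?q (a \<odot>\<^bsub>M\<^esub> x)" if a: "a \<in> carrier A" and x: "x \<in> carrier M" for a x
  proof -
    have "?q (a \<odot>\<^bsub>M\<^esub> y) = ?q (a \<odot>\<^bsub>M\<^esub> x)" if y: "y \<in> ?q x" for y
    proof -
      obtain u where u: "u \<in> U" "y = u \<oplus>\<^bsub>M\<^esub> x"
        using y by (auto simp: a_r_coset_def r_coset_def)
      have "a \<odot>\<^bsub>M\<^esub> y = a \<odot>\<^bsub>M\<^esub> u \<oplus>\<^bsub>M\<^esub> a \<odot>\<^bsub>M\<^esub> x"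
        using u a x c by (simp add: smult_r_distr)
      hence "a \<odot>\<^bsub>M\<^esub> y \<in> ?q (a \<odot>\<^bsub>M\<^esub> x)"
        using lsub_smult[OF U a u(1)] by (auto simp: a_r_coset_def r_coset_def)
      thus ?thesis using S.a_repr_independence' a x by (metis closed_ops)
    qed
    moreover have "x \<in> ?q x" by (rule S.a_rcos_self[OF x])
    ultimately have "(\<Union>y \<in> ?q x. ?q (a \<odot>\<^bsub>M\<^esub> y)) = ?q (a \<odot>\<^bsub>M\<^esub> x)" by blast
    thus ?thesis by (simp add: quot_lmod_def)
  qed
  have ab: "abelian_group ?Q"
  proof (rule abelian_groupI)
    fix X assume "X \<in> carrier ?Q"
    then obtain x where x: "x \<in> carrier M" "X = ?q x" by (auto simp: car)
    thus "\<exists>Y\<in>carrier ?Q. Y \<oplus>\<^bsub>?Q\<^esub> X = \<zero>\<^bsub>?Q\<^esub>"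
      by (intro bexI[of _ "?q (\<ominus>\<^bsub>M\<^esub> x)"]) (auto simp: add zero car M.l_neg)
  qed (auto simp: car add zero M.a_ac)
  show "lmod A ?Q"
    by (intro lmod.intro left_module.intro left_module_axioms.intro A.ring_axioms ab)
      (auto simp: car add sm smult_l_distr smult_r_distr smult_assoc1 smult_one)
  show "lepi A M ?Q ?q"
    unfolding lepi_def using car by (auto intro!: lhomI simp: add sm)
  show "?q x = \<zero>\<^bsub>?Q\<^esub> \<longleftrightarrow> x \<in> U" if "x \<in> carrier M" by (rule zero_iff[OF that])
qed

end

text \<open>With this isomorphism, properties of \<open>quot_lmod M U\<close> are read off \<open>N\<close>, a module without cosets.\<close>
lemma quot_iso:
  assumes M: "lmod A M" and N: "lmod A N" and p: "lepi A M N p"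
    and U: "U = {x \<in> carrier M. p x = \<zero>\<^bsub>N\<^esub>}"
  shows "lsubmodule U A M" "lmod_iso A (quot_lmod M U) N"
proof -
  interpret M: lmod A M by fact
  interpret N: lmod A N by fact
  show sub: "lsubmodule U A M"
    using lsub_vimage[OF M N lepiD(1)[OF p] N.lsub_zero_module] U by simp
  show "lmod_iso A (quot_lmod M U) N"
    by (rule lmod_iso_of_epis[OF M M.lmod_quot[OF sub] N M.quot_map_epi[OF sub] p])
      (simp add: M.quot_map_zero_iff[OF sub], simp add: U)
qed

section \<open>Finite-dimensional modules\<close>

definition kdim :: "'k ring \<Rightarrow> ('k, 'a) module \<Rightarrow> ('a, 'm) module \<Rightarrow> nat" where
  "kdim K A M = vectorspace.dim K (restrict_scalars A M)"

locale fda =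
  fixes K :: "'k ring" and A :: "('k, 'a) module"
  assumes fd_alg: "fd_algebra K A"

sublocale fda \<subseteq> alg: vectorspace K A
  using fd_alg by (simp add: fd_algebra_def)

sublocale fda \<subseteq> algr: ring A
  using fd_alg by (simp add: fd_algebra_def)

context fda
begin

lemma scalar_closed: "c \<in> carrier K \<Longrightarrow> c \<odot>\<^bsub>A\<^esub> \<one>\<^bsub>A\<^esub> \<in> carrier A"
  by simp

lemma scalar_central:
  assumes "c \<in> carrier K" "a \<in> carrier A"
  shows "(c \<odot>\<^bsub>A\<^esub> \<one>\<^bsub>A\<^esub>) \<otimes>\<^bsub>A\<^esub> a = a \<otimes>\<^bsub>A\<^esub> (c \<odot>\<^bsub>A\<^esub> \<one>\<^bsub>A\<^esub>)"
proof -
  have "(c \<odot>\<^bsub>A\<^esub> \<one>\<^bsub>A\<^esub>) \<otimes>\<^bsub>A\<^esub> a = c \<odot>\<^bsub>A\<^esub> (\<one>\<^bsub>A\<^esub> \<otimes>\<^bsub>A\<^esub> a)"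
    "a \<otimes>\<^bsub>A\<^esub> (c \<odot>\<^bsub>A\<^esub> \<one>\<^bsub>A\<^esub>) = c \<odot>\<^bsub>A\<^esub> (a \<otimes>\<^bsub>A\<^esub> \<one>\<^bsub>A\<^esub>)"
    using fd_alg assms algr.one_closed unfolding fd_algebra_def by blast+
  thus ?thesis using assms by simp
qed

lemma fdm_lmod: "fd_left_module K A M \<Longrightarrow> lmod A M"
  by (simp add: fd_left_module_def lmod_def)

lemma linear_of_lhom:
  assumes M: "lmod A M" and N: "lmod A N" and f: "f \<in> lhom A M N"
  shows "linear_map K (restrict_scalars A M) (restrict_scalars A N) f"
proof -
  interpret V: vectorspace K "restrict_scalars A M"
    by (rule vectorspace_restrict_scalars[OF fd_alg]) (use M in \<open>simp add: lmod_def\<close>)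
  interpret W: vectorspace K "restrict_scalars A N"
    by (rule vectorspace_restrict_scalars[OF fd_alg]) (use N in \<open>simp add: lmod_def\<close>)
  have "f \<in> lhom K (restrict_scalars A M) (restrict_scalars A N)"
    by (rule lhomI)
      (simp_all add: restrict_scalars_def lhom_closed[OF f] lhom_add[OF f]
        lhom_smult[OF f scalar_closed])
  hence "mod_hom K (restrict_scalars A M) (restrict_scalars A N) f"
    by (intro mod_hom.intro mod_hom_axioms.intro V.module.module_axioms W.module.module_axioms)
  thus ?thesis
    by (intro linear_map.intro V.vectorspace_axioms W.vectorspace_axioms)
qed

lemma
  assumes M: "fd_left_module K A M" and N: "lmod A N" and p: "lepi A M N p"
  shows fdm_lepi: "fd_left_module K A N"
    and kdim_lepi_le: "kdim K A N \<le> kdim K A M"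
    and kdim_lepi_inj: "kdim K A M \<le> kdim K A N \<Longrightarrow> inj_on p (carrier M)"
proof -
  interpret linear_map K "restrict_scalars A M" "restrict_scalars A N" p
    by (rule linear_of_lhom[OF fdm_lmod[OF M] N lepiD(1)[OF p]])
  have V: "V.fin_dim" using M by (simp add: fd_left_module_def)
  have s: "p ` carrier (restrict_scalars A M) = carrier (restrict_scalars A N)"
    using lepiD(2)[OF p] by (simp add: restrict_scalars_def)
  show "fd_left_module K A N"
    using N surj_fin_dim[OF V s] by (simp add: fd_left_module_def lmod_def)
  show "kdim K A N \<le> kdim K A M" using surj_imp_dim_le(1)[OF s V] by (simp add: kdim_def)
  show "kdim K A M \<le> kdim K A N \<Longrightarrow> inj_on p (carrier M)"
    using surj_imp_dim_le(2)[OF s V] by (simp add: kdim_def) (simp add: restrict_scalars_def)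
qed

lemma
  assumes M: "lmod A M" and N: "fd_left_module K A N" and f: "f \<in> lhom A M N"
    and i: "inj_on f (carrier M)"
  shows fdm_inj: "fd_left_module K A M"
    and kdim_inj_le: "kdim K A M \<le> kdim K A N"
    and kdim_inj_surj: "kdim K A N \<le> kdim K A M \<Longrightarrow> f ` carrier M = carrier N"
proof -
  interpret linear_map K "restrict_scalars A M" "restrict_scalars A N" f
    by (rule linear_of_lhom[OF M fdm_lmod[OF N] f])
  have W: "W.fin_dim" using N by (simp add: fd_left_module_def)
  have s: "inj_on f (carrier (restrict_scalars A M))"
    using i by (simp add: restrict_scalars_def)
  show "fd_left_module K A M"
    using M inj_imp_fin_dim[OF s W] by (simp add: fd_left_module_def lmod_def)
  show "kdim K A M \<le> kdim K A N" using inj_imp_dim_le(1)[OF s W] by (simp add: kdim_def)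
  show "kdim K A N \<le> kdim K A M \<Longrightarrow> f ` carrier M = carrier N"
    using inj_imp_dim_le(2)[OF s W] by (simp add: kdim_def) (simp add: restrict_scalars_def)
qed

lemma lhom_incl: "U \<subseteq> carrier M \<Longrightarrow> (\<lambda>x. x) \<in> lhom A (M\<lparr>carrier := U\<rparr>) M"
  by (rule lhomI) auto

lemma
  assumes M: "fd_left_module K A M" and U: "lsubmodule U A M"
  shows fdm_sub: "fd_left_module K A (M\<lparr>carrier := U\<rparr>)"
    and kdim_sub_le: "kdim K A (M\<lparr>carrier := U\<rparr>) \<le> kdim K A M"
    and kdim_sub_eq: "kdim K A M \<le> kdim K A (M\<lparr>carrier := U\<rparr>) \<Longrightarrow> U = carrier M"
proof -
  interpret M: lmod A M by (rule fdm_lmod[OF M])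
  have 1: "(\<lambda>x. x) \<in> lhom A (M\<lparr>carrier := U\<rparr>) M" by (rule lhom_incl[OF lsub_subset[OF U]])
  have 2: "inj_on (\<lambda>x. x) (carrier (M\<lparr>carrier := U\<rparr>))" by (simp add: inj_on_def)
  note * = M.lmod_sub[OF U] M 1 2
  show "fd_left_module K A (M\<lparr>carrier := U\<rparr>)" by (rule fdm_inj[OF *])
  show "kdim K A (M\<lparr>carrier := U\<rparr>) \<le> kdim K A M" by (rule kdim_inj_le[OF *])
  show "U = carrier M" if "kdim K A M \<le> kdim K A (M\<lparr>carrier := U\<rparr>)"
    using kdim_inj_surj[OF * that] by simp
qed

lemma kdim_psub:
  assumes M: "fd_left_module K A M" and U: "lsubmodule U A M" and V: "lsubmodule V A M"
    and "U \<subset> V"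
  shows "kdim K A (M\<lparr>carrier := U\<rparr>) < kdim K A (M\<lparr>carrier := V\<rparr>)"
proof -
  interpret M: lmod A M by (rule fdm_lmod[OF M])
  have "lsubmodule U A (M\<lparr>carrier := V\<rparr>)" using M.lsub_sub_iff[OF V] U \<open>U \<subset> V\<close> by blast
  from kdim_sub_eq[OF fdm_sub[OF M V] this] show ?thesis using \<open>U \<subset> V\<close> by fastforce
qed

lemma kdim_iso:
  assumes M: "fd_left_module K A M" and N: "lmod A N" and i: "lmod_iso A M N"
  shows "kdim K A M = kdim K A N" "fd_left_module K A N"
proof -
  obtain f where f: "f \<in> lhom A M N" "bij_betw f (carrier M) (carrier N)"
    using i lmod_iso_iff[OF fdm_lmod[OF M]] by metis
  hence e: "lepi A M N f" by (simp add: lepi_def bij_betw_def)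
  show fd: "fd_left_module K A N" by (rule fdm_lepi[OF M N e])
  show "kdim K A M = kdim K A N"
    using kdim_lepi_le[OF M N e] kdim_inj_le[OF fdm_lmod[OF M] fd f(1)] f(2)
    by (simp add: bij_betw_def)
qed

lemma fdm_quot:
  assumes M: "fd_left_module K A M" and U: "lsubmodule U A M"
  shows "fd_left_module K A (quot_lmod M U)"
proof -
  interpret M: lmod A M by (rule fdm_lmod[OF M])
  show ?thesis by (rule fdm_lepi[OF M M.lmod_quot[OF U] M.quot_map_epi[OF U]])
qed

end

section \<open>Maximal submodules, simple and indecomposable modules\<close>

definition max_sub :: "('k, 'a) module \<Rightarrow> ('a, 'm) module \<Rightarrow> 'm set \<Rightarrow> bool" where
  "max_sub A M V \<longleftrightarrow> lsubmodule V A M \<and> V \<noteq> carrier M \<and>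
     (\<forall>W. lsubmodule W A M \<and> V \<subseteq> W \<longrightarrow> W = V \<or> W = carrier M)"

lemma max_subD:
  assumes "max_sub A M V"
  shows "lsubmodule V A M" "V \<noteq> carrier M" "V \<subset> carrier M"
    "lsubmodule W A M \<Longrightarrow> V \<subseteq> W \<Longrightarrow> W = V \<or> W = carrier M"
  using assms lsub_subset[of V A M] by (auto simp: max_sub_def)

lemma (in fda) max_sub_exists:
  assumes M: "fd_left_module K A M" and U: "lsubmodule U A M" "U \<noteq> carrier M"
  shows "\<exists>V. max_sub A M V \<and> U \<subseteq> V"
proof -
  let ?P = "\<lambda>V. lsubmodule V A M \<and> V \<noteq> carrier M \<and> U \<subseteq> V"
  let ?d = "\<lambda>V. kdim K A (M\<lparr>carrier := V\<rparr>)"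
  have "\<forall>V. ?P V \<longrightarrow> ?d V < Suc (kdim K A M)"
    using kdim_sub_le[OF M] by (auto simp: less_Suc_eq_le)
  then obtain V where V: "?P V" "\<And>W. ?P W \<Longrightarrow> ?d W \<le> ?d V"
    using ex_has_greatest_nat[of ?P U ?d "Suc (kdim K A M)"] U by auto
  have "max_sub A M V"
    unfolding max_sub_def
  proof (intro conjI allI impI)
    fix W assume W: "lsubmodule W A M \<and> V \<subseteq> W"
    show "W = V \<or> W = carrier M"
    proof (rule ccontr)
      assume n: "\<not> (W = V \<or> W = carrier M)"
      hence "?d V < ?d W" using kdim_psub[OF M _ _ , of V W] V(1) W by blast
      moreover have "?P W" using W n V(1) by blast
      ultimately show False using V(2) by (meson not_le)
    qed
  qed (use V in auto)
  thus ?thesis using V by blast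
qed

text \<open>The submodules of \<open>Q\<close> correspond to the submodules of \<open>M\<close> that contain the kernel.\<close>
lemma simple_max_sub:
  assumes M: "lmod A M" and Q: "lmod A Q" and p: "lepi A M Q p"
  shows "simple_module A Q \<longleftrightarrow> max_sub A M {x \<in> carrier M. p x = \<zero>\<^bsub>Q\<^esub>}" (is "_ \<longleftrightarrow> max_sub A M ?V")
proof -
  interpret M: lmod A M by (rule M)
  interpret Q: lmod A Q by (rule Q)
  note ph = lepiD(1)[OF p]
  have V: "lsubmodule ?V A M" by (rule quot_iso[OF M Q p refl])
  show ?thesis
  proof
    assume s: "simple_module A Q"
    show "max_sub A M ?V"
      unfolding max_sub_def
    proof (intro conjI allI impI)
      show "?V \<noteq> carrier M"
      proof
        assume eq: "?V = carrier M"
        have "carrier Q = {\<zero>\<^bsub>Q\<^esub>}"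
        proof
          show "carrier Q \<subseteq> {\<zero>\<^bsub>Q\<^esub>}" using lepi_ex[OF p] eq by blast
        qed simp
        thus False using s by (simp add: simple_module_def)
      qed
      fix W assume W: "lsubmodule W A M \<and> ?V \<subseteq> W"
      have "lsubmodule (p ` W) A Q" by (rule lsub_image[OF M Q ph]) (use W in blast)
      then consider "p ` W = {\<zero>\<^bsub>Q\<^esub>}" | "p ` W = carrier Q"
        using s by (auto simp: simple_module_def)
      thus "W = ?V \<or> W = carrier M"
      proof cases
        case 1
        hence "W \<subseteq> ?V" using W lsub_mem[of W A M] by auto
        thus ?thesis using W by blast
      next
        case 2
        have "x \<in> W" if x: "x \<in> carrier M" for x
        proof -
          have "p x \<in> p ` W" using 2 lhom_closed[OF ph x] by simp
          then obtain w where w: "w \<in> W" "p x = p w" by blast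
          have wc: "w \<in> carrier M" by (rule lsub_mem[OF conjunct1[OF W] w(1)])
          have "p (x \<ominus>\<^bsub>M\<^esub> w) = \<zero>\<^bsub>Q\<^esub>"
            using lhom_diff[OF M Q ph x wc] w lhom_closed[OF ph wc] by simp
          hence "x \<ominus>\<^bsub>M\<^esub> w \<in> W" using W x wc by blast
          thus ?thesis using M.lsub_diff_right[of W x w] W w x by blast
        qed
        thus ?thesis using W lsub_subset[of W A M] by blast
      qed
    qed (rule V)
  next
    assume m: "max_sub A M ?V"
    show "simple_module A Q"
      unfolding simple_module_def
    proof (intro conjI allI impI)
      show "carrier Q \<noteq> {\<zero>\<^bsub>Q\<^esub>}" using max_subD(2)[OF m] lhom_closed[OF ph] by auto
      fix U assume U: "lsubmodule U A Q"
      let ?W = "{x \<in> carrier M. p x \<in> U}"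
      have "lsubmodule ?W A M" by (rule lsub_vimage[OF M Q ph U])
      moreover have "?V \<subseteq> ?W" using lsub_zero[OF U] by auto
      ultimately consider "?W = ?V" | "?W = carrier M" using max_subD(4)[OF m] by blast
      thus "U = {\<zero>\<^bsub>Q\<^esub>} \<or> U = carrier Q"
      proof cases
        case 1
        have "y = \<zero>\<^bsub>Q\<^esub>" if y: "y \<in> U" for y
        proof -
          obtain x where "x \<in> carrier M" "y = p x" using lepi_ex[OF p lsub_mem[OF U y]] by blast
          thus ?thesis using 1 y by blast
        qed
        thus ?thesis using lsub_zero[OF U] by blast
      next
        case 2
        have "y \<in> U" if y: "y \<in> carrier Q" for y
        proof -
          obtain x where "x \<in> carrier M" "y = p x" using lepi_ex[OF p y] by blast
          thus ?thesis using 2 by blast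
        qed
        thus ?thesis using lsub_subset[OF U] by blast
      qed
    qed
  qed
qed

lemma (in lmod) simple_quot_iff:
  assumes V: "lsubmodule V A M"
  shows "simple_module A (quot_lmod M V) \<longleftrightarrow> max_sub A M V"
proof -
  have "{x \<in> carrier M. quot_map M V x = \<zero>\<^bsub>quot_lmod M V\<^esub>} = V"
    using quot_map_zero_iff[OF V] lsub_subset[OF V] by blast
  thus ?thesis using simple_max_sub[OF lmod_axioms lmod_quot[OF V] quot_map_epi[OF V]] by simp
qed

lemma lepi_id: "lepi A M M (\<lambda>x. x)"
  by (auto simp: lepi_def lhom_id)

lemma simple_iso:
  assumes "lmod A M" "lmod A N" "lmod_iso A M N" "simple_module A M"
  shows "simple_module A N"
proof -
  obtain q where q: "lepi A M N q" "\<forall>x \<in> carrier M. q x = \<zero>\<^bsub>N\<^esub> \<longleftrightarrow> x = \<zero>\<^bsub>M\<^esub>"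
    using lmod_iso_lepi[OF assms(1-3) lepi_id] by blast
  have "{x \<in> carrier M. q x = \<zero>\<^bsub>N\<^esub>} = {x \<in> carrier M. x = \<zero>\<^bsub>M\<^esub>}" using q(2) by blast
  thus ?thesis
    using simple_max_sub[OF assms(1,2) q(1)] simple_max_sub[OF assms(1,1) lepi_id] assms(4) by simp
qed

lemma indecomposableD:
  assumes "indecomposable A M" "lsubmodule U A M" "lsubmodule V A M" "U \<inter> V = {\<zero>\<^bsub>M\<^esub>}"
    "U <+>\<^bsub>M\<^esub> V = carrier M"
  shows "U = {\<zero>\<^bsub>M\<^esub>} \<or> V = {\<zero>\<^bsub>M\<^esub>}"
  using assms by (auto simp: indecomposable_def)

lemma indecomposable_iso:
  assumes M: "lmod A M" and N: "lmod A N" and i: "lmod_iso A M N" and "indecomposable A M"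
  shows "indecomposable A N"
proof -
  interpret M: lmod A M by (rule M)
  interpret N: lmod A N by (rule N)
  obtain f where f: "f \<in> lhom A M N" "bij_betw f (carrier M) (carrier N)"
    using i lmod_iso_iff[OF M] by metis
  have inj: "inj_on f (carrier M)" and im: "f ` carrier M = carrier N"
    using f(2) by (auto simp: bij_betw_def)
  have 0: "f \<zero>\<^bsub>M\<^esub> = \<zero>\<^bsub>N\<^esub>" by (rule lhom_zero[OF M N f(1)])
  have pre: "f ` {x \<in> carrier M. f x \<in> U} = U" if "lsubmodule U A N" for U
    using lsub_subset[OF that] unfolding im[symmetric] by (auto simp: subset_iff)
  have pre0: "U = {\<zero>\<^bsub>N\<^esub>}" if "lsubmodule U A N" "{x \<in> carrier M. f x \<in> U} = {\<zero>\<^bsub>M\<^esub>}" for U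
    using pre[OF that(1)] that(2) 0 by auto
  show ?thesis
    unfolding indecomposable_def
  proof (intro conjI allI impI)
    show "carrier N \<noteq> {\<zero>\<^bsub>N\<^esub>}"
    proof
      assume "carrier N = {\<zero>\<^bsub>N\<^esub>}"
      hence "x = \<zero>\<^bsub>M\<^esub>" if "x \<in> carrier M" for x
        using lhom_closed[OF f(1) that] lhom_inj_iff[OF M N f(1)] inj that by simp
      hence "carrier M = {\<zero>\<^bsub>M\<^esub>}" using M.M.zero_closed by blast
      thus False using assms(4) by (simp add: indecomposable_def)
    qed
    fix U V assume *: "lsubmodule U A N \<and> lsubmodule V A N \<and> U \<inter> V = {\<zero>\<^bsub>N\<^esub>} \<and> U <+>\<^bsub>N\<^esub> V = carrier N"
    let ?U = "{x \<in> carrier M. f x \<in> U}" and ?V = "{x \<in> carrier M. f x \<in> V}"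
    have U: "lsubmodule U A N" and V: "lsubmodule V A N" using * by auto
    have sub: "lsubmodule ?U A M" "lsubmodule ?V A M"
      using lsub_vimage[OF M N f(1)] U V by blast+
    have "?U \<inter> ?V = {\<zero>\<^bsub>M\<^esub>}"
    proof
      show "?U \<inter> ?V \<subseteq> {\<zero>\<^bsub>M\<^esub>}"
      proof
        fix x assume "x \<in> ?U \<inter> ?V"
        hence "x \<in> carrier M" "f x = f \<zero>\<^bsub>M\<^esub>" using * 0 by auto
        thus "x \<in> {\<zero>\<^bsub>M\<^esub>}" using inj by (auto dest: inj_onD)
      qed
    qed (use lsub_zero[OF sub(1)] lsub_zero[OF sub(2)] in auto)
    moreover have "?U <+>\<^bsub>M\<^esub> ?V = carrier M"
    proof
      show "?U <+>\<^bsub>M\<^esub> ?V \<subseteq> carrier M" by (rule lsub_subset[OF M.lsub_sum[OF sub]])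
      show "carrier M \<subseteq> ?U <+>\<^bsub>M\<^esub> ?V"
      proof
        fix x assume x: "x \<in> carrier M"
        have "f x \<in> U <+>\<^bsub>N\<^esub> V" using * lhom_closed[OF f(1) x] by simp
        then obtain u v where uv: "u \<in> U" "v \<in> V" "f x = u \<oplus>\<^bsub>N\<^esub> v" by (auto simp: N.set_add_iff)
        obtain u' where u': "u' \<in> ?U" "u = f u'" using pre[OF U] uv(1) by blast
        obtain v' where v': "v' \<in> ?V" "v = f v'" using pre[OF V] uv(2) by blast
        have "f x = f (u' \<oplus>\<^bsub>M\<^esub> v')" using uv u' v' lhom_add[OF f(1)] by simp
        hence "x = u' \<oplus>\<^bsub>M\<^esub> v'" using inj x u' v' by (auto dest: inj_onD)
        thus "x \<in> ?U <+>\<^bsub>M\<^esub> ?V" using u' v' M.set_add_iff by blast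
      qed
    qed
    ultimately have "?U = {\<zero>\<^bsub>M\<^esub>} \<or> ?V = {\<zero>\<^bsub>M\<^esub>}"
      using indecomposableD[OF assms(4) sub] by blast
    thus "U = {\<zero>\<^bsub>N\<^esub>} \<or> V = {\<zero>\<^bsub>N\<^esub>}" using pre0 U V by blast
  qed
qed

lemma (in lmod) direct_sum_projections:
  assumes U: "lsubmodule U A M" and V: "lsubmodule V A M"
    and UV: "U \<inter> V = {\<zero>\<^bsub>M\<^esub>}" "U <+>\<^bsub>M\<^esub> V = carrier M"
  shows "\<exists>p q. p \<in> lhom A M M \<and> q \<in> lhom A M M \<and>
    (\<forall>x \<in> carrier M. p x \<in> U \<and> q x \<in> V \<and> x = p x \<oplus>\<^bsub>M\<^esub> q x)"
proof -
  have uniq: "u = u' \<and> v = v'"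
    if "u \<in> U" "v \<in> V" "u' \<in> U" "v' \<in> V" "u \<oplus>\<^bsub>M\<^esub> v = u' \<oplus>\<^bsub>M\<^esub> v'" for u v u' v'
  proof -
    have c: "u \<in> carrier M" "v \<in> carrier M" "u' \<in> carrier M" "v' \<in> carrier M"
      using that lsub_mem[OF U] lsub_mem[OF V] by auto
    have "u \<ominus>\<^bsub>M\<^esub> u' = ((u \<oplus>\<^bsub>M\<^esub> v) \<oplus>\<^bsub>M\<^esub> \<ominus>\<^bsub>M\<^esub> v) \<oplus>\<^bsub>M\<^esub> \<ominus>\<^bsub>M\<^esub> u'"
      using c by (simp add: a_minus_def M.a_assoc M.r_neg)
    also have "\<dots> = \<ominus>\<^bsub>M\<^esub> u' \<oplus>\<^bsub>M\<^esub> (u' \<oplus>\<^bsub>M\<^esub> (v' \<oplus>\<^bsub>M\<^esub> \<ominus>\<^bsub>M\<^esub> v))"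
      using c that(5) M.a_comm[of "(u' \<oplus>\<^bsub>M\<^esub> v') \<oplus>\<^bsub>M\<^esub> \<ominus>\<^bsub>M\<^esub> v" "\<ominus>\<^bsub>M\<^esub> u'"] by (simp add: M.a_assoc)
    also have "\<dots> = v' \<ominus>\<^bsub>M\<^esub> v"
      using c by (simp add: a_minus_def M.r_neg1)
    finally have "u \<ominus>\<^bsub>M\<^esub> u' \<in> U \<inter> V"
      using lsub_diff[OF U that(1,3)] lsub_diff[OF V that(4,2)] by simp
    hence eq: "u = u'" using UV c by simp
    thus ?thesis using that(5) c by simp
  qed
  define p where "p x = (SOME u. u \<in> U \<and> (\<exists>v \<in> V. x = u \<oplus>\<^bsub>M\<^esub> v))" for x
  define q where "q x = (SOME v. v \<in> V \<and> x = p x \<oplus>\<^bsub>M\<^esub> v)" for x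
  have p: "p x \<in> U \<and> (\<exists>v \<in> V. x = p x \<oplus>\<^bsub>M\<^esub> v)" if "x \<in> carrier M" for x
    unfolding p_def by (rule someI_ex) (use that UV(2) set_add_iff in blast)
  have q: "q x \<in> V \<and> x = p x \<oplus>\<^bsub>M\<^esub> q x" if "x \<in> carrier M" for x
    unfolding q_def by (rule someI_ex) (use p[OF that] in blast)
  have pq: "p (u \<oplus>\<^bsub>M\<^esub> v) = u \<and> q (u \<oplus>\<^bsub>M\<^esub> v) = v" if "u \<in> U" "v \<in> V" for u v
  proof -
    have c: "u \<oplus>\<^bsub>M\<^esub> v \<in> carrier M" using that lsub_mem[OF U] lsub_mem[OF V] by simp
    show ?thesis using uniq[of "p (u \<oplus>\<^bsub>M\<^esub> v)" "q (u \<oplus>\<^bsub>M\<^esub> v)" u v] p[OF c] q[OF c] that by simp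
  qed
  have c: "p x \<in> carrier M" "q x \<in> carrier M" if "x \<in> carrier M" for x
    using p[OF that] q[OF that] lsub_mem[OF U] lsub_mem[OF V] by blast+
  have add: "p (x \<oplus>\<^bsub>M\<^esub> y) = p x \<oplus>\<^bsub>M\<^esub> p y \<and> q (x \<oplus>\<^bsub>M\<^esub> y) = q x \<oplus>\<^bsub>M\<^esub> q y"
    if x: "x \<in> carrier M" and y: "y \<in> carrier M" for x y
  proof -
    have "x \<oplus>\<^bsub>M\<^esub> y = (p x \<oplus>\<^bsub>M\<^esub> q x) \<oplus>\<^bsub>M\<^esub> (p y \<oplus>\<^bsub>M\<^esub> q y)" using q[OF x] q[OF y] by simp
    also have "\<dots> = (p x \<oplus>\<^bsub>M\<^esub> p y) \<oplus>\<^bsub>M\<^esub> (q x \<oplus>\<^bsub>M\<^esub> q y)" using c[OF x] c[OF y] by (simp add: M.a_ac)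
    finally show ?thesis
      using pq[of "p x \<oplus>\<^bsub>M\<^esub> p y" "q x \<oplus>\<^bsub>M\<^esub> q y"] p[OF x] p[OF y] q[OF x] q[OF y]
        lsub_add[OF U] lsub_add[OF V] by simp
  qed
  have sm: "p (a \<odot>\<^bsub>M\<^esub> x) = a \<odot>\<^bsub>M\<^esub> p x \<and> q (a \<odot>\<^bsub>M\<^esub> x) = a \<odot>\<^bsub>M\<^esub> q x"
    if a: "a \<in> carrier A" and x: "x \<in> carrier M" for a x
  proof -
    have "a \<odot>\<^bsub>M\<^esub> x = a \<odot>\<^bsub>M\<^esub> (p x \<oplus>\<^bsub>M\<^esub> q x)" using q[OF x] by simp
    also have "\<dots> = a \<odot>\<^bsub>M\<^esub> p x \<oplus>\<^bsub>M\<^esub> a \<odot>\<^bsub>M\<^esub> q x" using c[OF x] a by (simp add: smult_r_distr)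
    finally show ?thesis
      using pq[of "a \<odot>\<^bsub>M\<^esub> p x" "a \<odot>\<^bsub>M\<^esub> q x"] p[OF x] q[OF x]
        lsub_smult[OF U a] lsub_smult[OF V a] by simp
  qed
  have "p \<in> lhom A M M" "q \<in> lhom A M M" by (rule lhomI; use c add sm in simp)+
  thus ?thesis using p q by blast
qed

subsection \<open>Fitting's lemma\<close>

lemma lhom_funpow: "f \<in> lhom A M M \<Longrightarrow> f ^^ n \<in> lhom A M M"
proof (induction n)
  case 0 show ?case using lhom_id by (simp add: id_def)
next
  case (Suc n)
  show ?case using lhom_comp[OF Suc.IH[OF Suc.prems] Suc.prems] by (simp add: comp_def)
qed

context fda
begin

lemma fitting:
  assumes M: "fd_left_module K A M" and ind: "indecomposable A M" and f: "f \<in> lhom A M M"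
    and nb: "\<not> bij_betw f (carrier M) (carrier M)"
  shows "\<exists>n. \<forall>x \<in> carrier M. (f ^^ n) x = \<zero>\<^bsub>M\<^esub>"
proof -
  note lM = fdm_lmod[OF M]
  interpret M: lmod A M by (rule lM)
  let ?I = "\<lambda>n. (f ^^ n) ` carrier M"
  have fn: "f ^^ n \<in> lhom A M M" for n by (rule lhom_funpow[OF f])
  have I: "lsubmodule (?I n) A M" for n by (rule lsub_image[OF lM lM fn M.lsub_carrier])
  define n where "n = arg_min (\<lambda>n. kdim K A (M\<lparr>carrier := ?I n\<rparr>)) (\<lambda>n. 0 < n)"
  have npos: "0 < n" unfolding n_def by (rule arg_min_natI[of _ 1]) simp
  have n: "kdim K A (M\<lparr>carrier := ?I n\<rparr>) \<le> kdim K A (M\<lparr>carrier := ?I m\<rparr>)" if "0 < m" for m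
    unfolding n_def by (rule arg_min_nat_le) (rule that)
  let ?g = "f ^^ n"
  have im2: "?g ` ?I n = ?I (n + n)" by (simp add: funpow_add image_comp)
  have sub: "?I (n + n) \<subseteq> ?I n"
    using lhom_closed[OF fn[of n]] unfolding im2[symmetric] by blast
  have fdI: "fd_left_module K A (M\<lparr>carrier := ?I n\<rparr>)" by (rule fdm_sub[OF M I])
  have "lsubmodule (?I (n + n)) A (M\<lparr>carrier := ?I n\<rparr>)" using M.lsub_sub_iff[OF I] I sub by blast
  from kdim_sub_eq[OF fdI this] have eq: "?I (n + n) = ?I n" using n npos by simp
  have gI: "lepi A (M\<lparr>carrier := ?I n\<rparr>) (M\<lparr>carrier := ?I n\<rparr>) ?g"
    unfolding lepi_def using lhom_sub_dom[OF fn lsub_subset[OF I]] eq im2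
    by (auto simp: lhom_sub_cod[OF lsub_subset[OF I]])
  have injI: "inj_on ?g (?I n)"
    using kdim_lepi_inj[OF fdI fdm_lmod[OF fdI] gI] by simp
  let ?K = "{x \<in> carrier M. ?g x \<in> {\<zero>\<^bsub>M\<^esub>}}"
  have Ks: "lsubmodule ?K A M" by (rule lsub_vimage[OF lM lM fn M.lsub_zero_module])
  have g0: "?g \<zero>\<^bsub>M\<^esub> = \<zero>\<^bsub>M\<^esub>" by (rule lhom_zero[OF lM lM fn])
  have "?K \<inter> ?I n = {\<zero>\<^bsub>M\<^esub>}"
  proof
    show "?K \<inter> ?I n \<subseteq> {\<zero>\<^bsub>M\<^esub>}"
    proof
      fix x assume x: "x \<in> ?K \<inter> ?I n"
      hence "?g x = ?g \<zero>\<^bsub>M\<^esub>" using g0 by simp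
      thus "x \<in> {\<zero>\<^bsub>M\<^esub>}" using inj_onD[OF injI _ _ lsub_zero[OF I[of n]]] x by blast
    qed
  qed (use lsub_zero[OF I[of n]] lsub_zero[OF Ks] in auto)
  moreover have "?K <+>\<^bsub>M\<^esub> ?I n = carrier M"
  proof
    show "?K <+>\<^bsub>M\<^esub> ?I n \<subseteq> carrier M" by (rule lsub_subset[OF M.lsub_sum[OF Ks I]])
    show "carrier M \<subseteq> ?K <+>\<^bsub>M\<^esub> ?I n"
    proof
      fix x assume x: "x \<in> carrier M"
      have "?g x \<in> ?g ` ?I n" using x eq im2 by blast
      then obtain y where y: "y \<in> ?I n" "?g x = ?g y" by blast
      have yc: "y \<in> carrier M" by (rule lsub_mem[OF I y(1)])
      have "?g (x \<ominus>\<^bsub>M\<^esub> y) = \<zero>\<^bsub>M\<^esub>"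
        using lhom_diff[OF lM lM fn x yc] y lhom_closed[OF fn yc] by simp
      hence "x \<ominus>\<^bsub>M\<^esub> y \<in> ?K" using x yc by simp
      thus "x \<in> ?K <+>\<^bsub>M\<^esub> ?I n"
        unfolding M.set_add_iff using M.diff_add_cancel[OF x yc, symmetric] y(1) by blast
    qed
  qed
  ultimately consider "?K = {\<zero>\<^bsub>M\<^esub>}" | "?I n = {\<zero>\<^bsub>M\<^esub>}"
    using indecomposableD[OF ind Ks I] by blast
  thus ?thesis
  proof cases
    case 1
    obtain m where m: "n = Suc m" using npos by (cases n) auto
    have "x = \<zero>\<^bsub>M\<^esub>" if x: "x \<in> carrier M" "f x = \<zero>\<^bsub>M\<^esub>" for x
    proof -
      have "?g x = \<zero>\<^bsub>M\<^esub>"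
        using x(2) lhom_zero[OF lM lM fn[of m]] m by (simp add: funpow_swap1)
      hence "x \<in> ?K" using x by simp
      thus ?thesis unfolding 1 by simp
    qed
    hence "inj_on f (carrier M)" using lhom_inj_iff[OF lM lM f] by blast
    hence "bij_betw f (carrier M) (carrier M)"
      using kdim_inj_surj[OF lM M f] by (simp add: bij_betw_def)
    thus ?thesis using nb by blast
  next
    case 2
    thus ?thesis by blast
  qed
qed

text \<open>The endomorphism ring of an indecomposable module is local: were \<open>f\<close> not bijective, it would
  be nilpotent, and then \<open>g = 1 - f\<close> is injective.\<close>
lemma indecomposable_local:
  assumes M: "fd_left_module K A M" and ind: "indecomposable A M"
    and f: "f \<in> lhom A M M" and g: "g \<in> lhom A M M"
    and sum: "\<And>x. x \<in> carrier M \<Longrightarrow> f x \<oplus>\<^bsub>M\<^esub> g x = x"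
  shows "bij_betw f (carrier M) (carrier M) \<or> bij_betw g (carrier M) (carrier M)"
proof (rule ccontr)
  note lM = fdm_lmod[OF M]
  interpret M: lmod A M by (rule lM)
  assume "\<not> ?thesis"
  hence nf: "\<not> bij_betw f (carrier M) (carrier M)" and ng: "\<not> bij_betw g (carrier M) (carrier M)"
    by auto
  obtain n where n: "\<And>x. x \<in> carrier M \<Longrightarrow> (f ^^ n) x = \<zero>\<^bsub>M\<^esub>" using fitting[OF M ind f nf] by blast
  have "x = \<zero>\<^bsub>M\<^esub>" if x: "x \<in> carrier M" "g x = \<zero>\<^bsub>M\<^esub>" for x
  proof -
    have fx: "f x = x" using sum[OF x(1)] x lhom_closed[OF f x(1)] by simp
    have "(f ^^ m) x = x" for m by (induction m) (simp_all add: fx)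
    thus ?thesis using n[OF x(1)] by simp
  qed
  hence "inj_on g (carrier M)" using lhom_inj_iff[OF lM lM g] by blast
  hence "bij_betw g (carrier M) (carrier M)"
    using kdim_inj_surj[OF lM M g] by (simp add: bij_betw_def)
  thus False using ng by blast
qed

end

section \<open>Composition series\<close>

definition simple_step :: "('k, 'a) module \<Rightarrow> ('a, 'm) module \<Rightarrow> 'm set \<Rightarrow> 'm set \<Rightarrow> bool" where
  "simple_step A M U V \<longleftrightarrow> lsubmodule U A M \<and> lsubmodule V A M \<and> max_sub A (M\<lparr>carrier := V\<rparr>) U"

lemma (in lmod) simple_step_iff:
  "lsubmodule U A M \<Longrightarrow> lsubmodule V A M \<Longrightarrow>
   simple_step A M U V \<longleftrightarrow> U \<subseteq> V \<and> simple_module A (quot_lmod (M\<lparr>carrier := V\<rparr>) U)"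
  unfolding simple_step_def
  using lmod.simple_quot_iff[OF lmod_sub, of V U] lsub_sub_iff[of V U]
    max_subD(3)[of A "M\<lparr>carrier := V\<rparr>" U] by auto

lemma successively_nth:
  "successively P xs \<longleftrightarrow> (\<forall>i. Suc i < length xs \<longrightarrow> P (xs ! i) (xs ! Suc i))"
proof (induction P xs rule: successively.induct)
  case (3 P x y xs)
  show ?case
    unfolding successively.simps 3
  proof (intro iffI conjI allI impI)
    fix i
    assume *: "P x y \<and> (\<forall>i. Suc i < length (y # xs) \<longrightarrow> P ((y # xs) ! i) ((y # xs) ! Suc i))"
      and i: "Suc i < length (x # y # xs)"
    show "P ((x # y # xs) ! i) ((x # y # xs) ! Suc i)"
      using * i by (cases i) auto
  qed fastforce+
qed auto

lemma (in lmod) composition_series_iff: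
  "composition_series A M Us \<longleftrightarrow> Us \<noteq> [] \<and> hd Us = {\<zero>\<^bsub>M\<^esub>} \<and> last Us = carrier M \<and>
     (\<forall>U \<in> set Us. lsubmodule U A M) \<and> successively (simple_step A M) Us"
proof -
  have "simple_step A M (Us ! i) (Us ! Suc i) \<longleftrightarrow>
      Us ! i \<subseteq> Us ! Suc i \<and> simple_module A (subquotient M Us i)"
    if "Suc i < length Us" "\<forall>U \<in> set Us. lsubmodule U A M" for i
    using simple_step_iff[of "Us ! i" "Us ! Suc i"] that by (simp add: subquotient_def)
  thus ?thesis unfolding composition_series_def filtration_def successively_nth by blast
qed

lemma (in fda) simple_steps_between:
  assumes M: "fd_left_module K A M" and U: "lsubmodule U A M" and V: "lsubmodule V A M" and "U \<subseteq> V"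
  shows "\<exists>Us. Us \<noteq> [] \<and> hd Us = U \<and> last Us = V \<and> (\<forall>W \<in> set Us. lsubmodule W A M) \<and>
    successively (simple_step A M) Us"
  using V \<open>U \<subseteq> V\<close>
proof (induction "kdim K A (M\<lparr>carrier := V\<rparr>)" arbitrary: V rule: less_induct)
  case less
  note lM = fdm_lmod[OF M]
  interpret M: lmod A M by (rule lM)
  show ?case
  proof (cases "U = V")
    case True
    thus ?thesis using U by (intro exI[of _ "[U]"]) auto
  next
    case False
    have U': "lsubmodule U A (M\<lparr>carrier := V\<rparr>)" using M.lsub_sub_iff[OF less.prems(1)] U less.prems by blast
    obtain W where W: "max_sub A (M\<lparr>carrier := V\<rparr>) W" "U \<subseteq> W"
      using max_sub_exists[OF fdm_sub[OF M less.prems(1)] U'] False by auto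
    have Ws: "lsubmodule W A M" "W \<subset> V"
      using max_subD(1,3)[OF W(1)] M.lsub_sub_iff[OF less.prems(1)] by auto
    obtain Us where Us: "Us \<noteq> []" "hd Us = U" "last Us = W" "\<forall>W \<in> set Us. lsubmodule W A M"
      "successively (simple_step A M) Us"
      using less.hyps[OF kdim_psub[OF M Ws(1) less.prems(1) Ws(2)] Ws(1) W(2)] by blast
    have "simple_step A M W V" using Ws W less.prems by (simp add: simple_step_def)
    thus ?thesis using Us less.prems(1)
      by (intro exI[of _ "Us @ [V]"]) (auto simp: successively_append_iff)
  qed
qed

lemma (in fda) composition_series_through:
  assumes M: "fd_left_module K A M" and U: "lsubmodule U A M"
  shows "\<exists>Us. composition_series A M Us \<and> U \<in> set Us"
proof -
  interpret M: lmod A M by (rule fdm_lmod[OF M])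
  obtain Us where Us: "Us \<noteq> []" "hd Us = {\<zero>\<^bsub>M\<^esub>}" "last Us = U" "\<forall>W \<in> set Us. lsubmodule W A M"
    "successively (simple_step A M) Us"
    using simple_steps_between[OF M M.lsub_zero_module U] lsub_zero[OF U] by auto
  obtain Vs where Vs: "Vs \<noteq> []" "hd Vs = U" "last Vs = carrier M" "\<forall>W \<in> set Vs. lsubmodule W A M"
    "successively (simple_step A M) Vs"
    using simple_steps_between[OF M U M.lsub_carrier lsub_subset[OF U]] by auto
  obtain Ws where Ws: "Vs = U # Ws" using Vs(1,2) by (cases Vs) auto
  have "composition_series A M (Us @ Ws)"
    unfolding M.composition_series_iff
    using Us Vs Ws by (auto simp: successively_append_iff successively_Cons last_append hd_append
        split: if_splits)
  moreover have "U \<in> set (Us @ Ws)" using Us(1,3) by auto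
  ultimately show ?thesis by blast
qed

definition chain_module :: "('k, 'a) module \<Rightarrow> ('a, 'm) module \<Rightarrow> bool" where
  "chain_module A M \<longleftrightarrow> (\<forall>U V. lsubmodule U A M \<and> lsubmodule V A M \<longrightarrow> U \<subseteq> V \<or> V \<subseteq> U)"

lemma sorted_wrt_psubset_unique:
  "sorted_wrt (\<subset>) xs \<Longrightarrow> sorted_wrt (\<subset>) ys \<Longrightarrow> set xs = set ys \<Longrightarrow> xs = ys"
proof (induction xs arbitrary: ys)
  case (Cons x xs)
  then obtain y ys' where ys: "ys = y # ys'" by (cases ys) auto
  have "x = y"
  proof (rule ccontr)
    assume "x \<noteq> y"
    hence "x \<in> set ys'" "y \<in> set xs" using Cons.prems(3) ys by auto
    thus False using Cons.prems(1,2) ys by auto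
  qed
  moreover have "x \<notin> set xs" "y \<notin> set ys'" using Cons.prems(1,2) ys by auto
  ultimately have "set xs = set ys'" using Cons.prems(3) ys by auto
  thus ?case using Cons ys \<open>x = y\<close> by auto
qed auto

text \<open>A composition series of a chain module consists of all submodules, so it is unique. Conversely, a
  composition series can be chosen through any given submodule; if there is only one, it contains
  all submodules, and its members form a chain.\<close>
lemma (in fda) unique_composition_series_iff:
  assumes M: "fd_left_module K A M"
  shows "(\<exists>!Us. composition_series A M Us) \<longleftrightarrow> chain_module A M"
proof
  interpret M: lmod A M by (rule fdm_lmod[OF M])
  have strict: "sorted_wrt (\<subset>) Us" if "composition_series A M Us" for Us
  proof -
    have "successively (\<subset>) Us"
      using that unfolding M.composition_series_iff
      by (elim conjE) (erule successively_mono, use max_subD(3) in \<open>fastforce simp: simple_step_def\<close>)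
    thus ?thesis by (simp add: successively_conv_sorted_wrt transp_def)
  qed
  { assume u: "\<exists>!Us. composition_series A M Us"
    then obtain Us where Us: "composition_series A M Us"
      "\<And>Vs. composition_series A M Vs \<Longrightarrow> Vs = Us" by blast
    show "chain_module A M"
      unfolding chain_module_def
    proof (intro allI impI)
      fix U V assume "lsubmodule U A M \<and> lsubmodule V A M"
      hence "U \<in> set Us" "V \<in> set Us"
        using composition_series_through[OF M] Us(2) by blast+
      then obtain i j where "i < length Us" "j < length Us" "U = Us ! i" "V = Us ! j"
        by (auto simp: in_set_conv_nth)
      thus "U \<subseteq> V \<or> V \<subseteq> U"
        using sorted_wrt_nth_less[OF strict[OF Us(1)], of i j]
          sorted_wrt_nth_less[OF strict[OF Us(1)], of j i] by (metis linorder_neqE_nat order_refl psubsetE)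
    qed }
  { assume ch: "chain_module A M"
    have all: "set Us = {W. lsubmodule W A M}" if Us: "composition_series A M Us" for Us
    proof
      show "set Us \<subseteq> {W. lsubmodule W A M}" using Us by (auto simp: M.composition_series_iff)
      show "{W. lsubmodule W A M} \<subseteq> set Us"
      proof
        fix W assume "W \<in> {W. lsubmodule W A M}"
        hence W: "lsubmodule W A M" by simp
        have ne: "Us \<noteq> []" and lst: "last Us = carrier M" and hdz: "hd Us = {\<zero>\<^bsub>M\<^esub>}"
          and st: "successively (simple_step A M) Us"
          using Us by (auto simp: M.composition_series_iff)
        define i where "i = (LEAST i. i < length Us \<and> W \<subseteq> Us ! i)"
        have ex: "length Us - 1 < length Us \<and> W \<subseteq> Us ! (length Us - 1)"
          using ne lst lsub_subset[OF W] by (simp add: last_conv_nth)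
        have i: "i < length Us" "W \<subseteq> Us ! i"
          using LeastI[of "\<lambda>i. i < length Us \<and> W \<subseteq> Us ! i", OF ex] by (auto simp: i_def)
        show "W \<in> set Us"
        proof (cases i)
          case 0
          hence "W \<subseteq> {\<zero>\<^bsub>M\<^esub>}" using i hdz ne by (simp add: hd_conv_nth)
          hence "W = Us ! 0" using lsub_zero[OF W] hdz ne by (auto simp: hd_conv_nth)
          thus ?thesis using ne by simp
        next
          case (Suc j)
          have "\<not> W \<subseteq> Us ! j"
            using not_less_Least[of j "\<lambda>i. i < length Us \<and> W \<subseteq> Us ! i"] i(1) Suc by (auto simp: i_def)
          have step: "simple_step A M (Us ! j) (Us ! i)" using st i(1) Suc by (auto simp: successively_nth)
          hence "Us ! j \<subseteq> W" using ch W \<open>\<not> W \<subseteq> Us ! j\<close> by (auto simp: chain_module_def simple_step_def)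
          moreover have "lsubmodule W A (M\<lparr>carrier := Us ! i\<rparr>)"
            using M.lsub_sub_iff[of "Us ! i" W] step W i(2) by (auto simp: simple_step_def)
          ultimately have "W = Us ! j \<or> W = Us ! i"
            using max_subD(4)[of A "M\<lparr>carrier := Us ! i\<rparr>" "Us ! j" W] step by (auto simp: simple_step_def)
          thus ?thesis using i(1) Suc by auto
        qed
      qed
    qed
    obtain Us where Us: "composition_series A M Us"
      using composition_series_through[OF M M.lsub_carrier] by blast
    show "\<exists>!Us. composition_series A M Us"
    proof (rule ex1I[of "composition_series A M", OF Us])
      fix Vs assume Vs: "composition_series A M Vs"
      show "Vs = Us"
        by (rule sorted_wrt_psubset_unique[OF strict[OF Vs] strict[OF Us]]) (simp add: all Us Vs)
    qed }
qed

lemma chain_module_iso: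
  assumes M: "lmod A M" and N: "lmod A N" and p: "lepi A M N p" and "chain_module A M"
  shows "chain_module A N"
  unfolding chain_module_def
proof (intro allI impI)
  fix U V assume UV: "lsubmodule U A N \<and> lsubmodule V A N"
  let ?f = "\<lambda>U. {x \<in> carrier M. p x \<in> U}"
  have "lsubmodule (?f U) A M" "lsubmodule (?f V) A M"
    using UV lsub_vimage[OF M N lepiD(1)[OF p]] by blast+
  hence "?f U \<subseteq> ?f V \<or> ?f V \<subseteq> ?f U" using assms(4) by (simp add: chain_module_def)
  moreover have "p ` ?f W = W" if W: "lsubmodule W A N" for W
  proof
    show "W \<subseteq> p ` ?f W"
    proof
      fix y assume y: "y \<in> W"
      then obtain x where "x \<in> carrier M" "y = p x" using lepi_ex[OF p lsub_mem[OF W y]] by blast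
      thus "y \<in> p ` ?f W" using y by blast
    qed
  qed blast
  ultimately show "U \<subseteq> V \<or> V \<subseteq> U"
    using UV image_mono[of "?f U" "?f V" p] image_mono[of "?f V" "?f U" p] by auto
qed

lemma chain_module_indecomposable:
  assumes "lmod A M" "chain_module A M" "carrier M \<noteq> {\<zero>\<^bsub>M\<^esub>}"
  shows "indecomposable A M"
  unfolding indecomposable_def
proof (intro conjI allI impI assms(3))
  fix U V assume *: "lsubmodule U A M \<and> lsubmodule V A M \<and> U \<inter> V = {\<zero>\<^bsub>M\<^esub>} \<and> U <+>\<^bsub>M\<^esub> V = carrier M"
  hence "U \<subseteq> V \<or> V \<subseteq> U" using assms(2) by (simp add: chain_module_def)
  thus "U = {\<zero>\<^bsub>M\<^esub>} \<or> V = {\<zero>\<^bsub>M\<^esub>}" using * by auto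
qed

lemma chain_module_sub:
  assumes "lmod A M" "chain_module A M" "lsubmodule U A M"
  shows "chain_module A (M\<lparr>carrier := U\<rparr>)"
  using assms lmod.lsub_sub_iff[OF assms(1,3)] by (auto simp: chain_module_def)

section \<open>Direct powers and finite-dimensionality\<close>

definition pow_mod :: "'i set \<Rightarrow> ('a, 'm) module \<Rightarrow> ('a, 'i \<Rightarrow> 'm) module" where
  "pow_mod I M = \<lparr>carrier = I \<rightarrow>\<^sub>E carrier M, mult = undefined, one = undefined,
     zero = (\<lambda>i\<in>I. \<zero>\<^bsub>M\<^esub>), add = (\<lambda>f g. \<lambda>i\<in>I. f i \<oplus>\<^bsub>M\<^esub> g i),
     smult = (\<lambda>a f. \<lambda>i\<in>I. a \<odot>\<^bsub>M\<^esub> f i)\<rparr>"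

lemma (in lmod) lmod_pow: "lmod A (pow_mod I M)"
proof -
  have ab: "abelian_group (pow_mod I M)"
  proof (rule abelian_groupI)
    fix f assume f: "f \<in> carrier (pow_mod I M)"
    hence "(\<lambda>i\<in>I. \<ominus>\<^bsub>M\<^esub> f i) \<in> carrier (pow_mod I M)"
      "(\<lambda>i\<in>I. \<ominus>\<^bsub>M\<^esub> f i) \<oplus>\<^bsub>pow_mod I M\<^esub> f = \<zero>\<^bsub>pow_mod I M\<^esub>"
      by (auto simp: pow_mod_def PiE_iff M.l_neg intro!: restrict_ext)
    thus "\<exists>g\<in>carrier (pow_mod I M). g \<oplus>\<^bsub>pow_mod I M\<^esub> f = \<zero>\<^bsub>pow_mod I M\<^esub>" by blast
  next
    fix f assume "f \<in> carrier (pow_mod I M)"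
    thus "\<zero>\<^bsub>pow_mod I M\<^esub> \<oplus>\<^bsub>pow_mod I M\<^esub> f = f"
      by (auto simp: pow_mod_def PiE_iff extensional_def fun_eq_iff)
  qed (auto simp: pow_mod_def PiE_iff M.a_ac intro!: restrict_ext)
  have one: "\<one>\<^bsub>A\<^esub> \<odot>\<^bsub>pow_mod I M\<^esub> f = f" if "f \<in> carrier (pow_mod I M)" for f
    using that by (auto simp: pow_mod_def PiE_iff extensional_def fun_eq_iff smult_one)
  show ?thesis
    by (intro lmod.intro left_module.intro left_module_axioms.intro A.ring_axioms ab one)
      (auto simp: pow_mod_def PiE_iff smult_l_distr smult_r_distr smult_assoc1 intro!: restrict_ext)
qed

lemma lmod_regular_module:
  assumes "ring A"
  shows "lmod A (regular_module A)"
proof -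
  interpret ring A by fact
  have "abelian_group (regular_module A)"
    by (rule abelian_groupI)
      (auto simp: regular_module_def a_ac intro!: bexI[of _ "\<ominus>\<^bsub>A\<^esub> _"] l_neg)
  thus ?thesis
    by (intro lmod.intro left_module.intro left_module_axioms.intro ring_axioms)
      (auto simp: regular_module_def l_distr r_distr m_assoc)
qed

lemma regular_simps [simp]:
  "carrier (regular_module A) = carrier A" "zero (regular_module A) = \<zero>\<^bsub>A\<^esub>"
  "add (regular_module A) = add A" "smult (regular_module A) = mult A"
  by (simp_all add: regular_module_def)

context fda
begin

text \<open>The \<open>K\<close>-subspaces of \<open>M\<close>.\<close>
definition scal_closed :: "('a, 'm) module \<Rightarrow> 'm set \<Rightarrow> bool" where
  "scal_closed M W \<longleftrightarrow> \<zero>\<^bsub>M\<^esub> \<in> W \<and> (\<forall>x\<in>W. \<forall>y\<in>W. x \<oplus>\<^bsub>M\<^esub> y \<in> W) \<and>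
     (\<forall>c\<in>carrier K. \<forall>x\<in>W. (c \<odot>\<^bsub>A\<^esub> \<one>\<^bsub>A\<^esub>) \<odot>\<^bsub>M\<^esub> x \<in> W)"

text \<open>This form of finite generation avoids linear combinations, and it is preserved by powers.\<close>
lemma fdm_iff:
  assumes M: "lmod A M"
  shows "fd_left_module K A M \<longleftrightarrow> (\<exists>G. finite G \<and> G \<subseteq> carrier M \<and>
    (\<forall>W. W \<subseteq> carrier M \<longrightarrow> scal_closed M W \<longrightarrow> G \<subseteq> W \<longrightarrow> W = carrier M))"
proof -
  let ?V = "restrict_scalars A M"
  interpret V: vectorspace K ?V
    by (rule vectorspace_restrict_scalars[OF fd_alg]) (use M in \<open>simp add: lmod_def\<close>)
  have sc: "scal_closed M W \<and> W \<subseteq> carrier M \<longleftrightarrow> VectorSpace.subspace K W ?V" for W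
    using V.vectorspace_axioms V.module.module_axioms
    unfolding VectorSpace.subspace_def LinearCombinations.submodule_def scal_closed_def
    by (auto simp: restrict_scalars_def)
  have car: "carrier ?V = carrier M" by (simp add: restrict_scalars_def)
  show ?thesis
  proof
    assume "fd_left_module K A M"
    then obtain G where G: "finite G" "G \<subseteq> carrier M" "V.module.span G = carrier M"
      unfolding fd_left_module_def V.fin_dim_def car by blast
    have "W = carrier M" if W: "W \<subseteq> carrier M" "scal_closed M W" "G \<subseteq> W" for W
    proof -
      have "LinearCombinations.submodule K W ?V"
        using sc[of W] W by (simp add: VectorSpace.subspace_def)
      hence "V.module.span G \<subseteq> W" using V.module.span_is_subset[OF W(3)] by blast
      thus ?thesis using G W by blast
    qed
    thus "\<exists>G. finite G \<and> G \<subseteq> carrier M \<and>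
      (\<forall>W. W \<subseteq> carrier M \<longrightarrow> scal_closed M W \<longrightarrow> G \<subseteq> W \<longrightarrow> W = carrier M)" using G by blast
  next
    assume "\<exists>G. finite G \<and> G \<subseteq> carrier M \<and>
      (\<forall>W. W \<subseteq> carrier M \<longrightarrow> scal_closed M W \<longrightarrow> G \<subseteq> W \<longrightarrow> W = carrier M)"
    then obtain G where G: "finite G" "G \<subseteq> carrier M"
      "\<And>W. W \<subseteq> carrier M \<Longrightarrow> scal_closed M W \<Longrightarrow> G \<subseteq> W \<Longrightarrow> W = carrier M" by blast
    have GV: "G \<subseteq> carrier ?V" using G car by simp
    have "VectorSpace.subspace K (V.module.span G) ?V" by (rule V.span_is_subspace[OF GV])
    hence "V.module.span G = carrier M"
      using G(3) sc V.module.in_own_span[OF GV] by blast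
    hence "V.fin_dim" unfolding V.fin_dim_def using G(1) GV car by blast
    thus "fd_left_module K A M" using M by (simp add: fd_left_module_def lmod_def)
  qed
qed

lemma fdm_pow:
  assumes I: "finite I" and M: "fd_left_module K A M"
  shows "fd_left_module K A (pow_mod I M)"
proof -
  interpret M: lmod A M by (rule fdm_lmod[OF M])
  let ?P = "pow_mod I M"
  interpret P: lmod A ?P by (rule M.lmod_pow)
  obtain G where G: "finite G" "G \<subseteq> carrier M"
    "\<And>W. W \<subseteq> carrier M \<Longrightarrow> scal_closed M W \<Longrightarrow> G \<subseteq> W \<Longrightarrow> W = carrier M"
    using M fdm_iff[OF M.lmod_axioms] by blast
  define \<delta> where "\<delta> i x = (\<lambda>j\<in>I. if j = i then x else \<zero>\<^bsub>M\<^esub>)" for i x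
  let ?G = "(\<lambda>(i, x). \<delta> i x) ` (I \<times> G)"
  have "W = carrier ?P" if W: "W \<subseteq> carrier ?P" "scal_closed ?P W" "?G \<subseteq> W" for W
  proof -
    have W0: "(\<lambda>i\<in>I. \<zero>\<^bsub>M\<^esub>) \<in> W" and Wadd: "\<And>f g. f \<in> W \<Longrightarrow> g \<in> W \<Longrightarrow> (\<lambda>i\<in>I. f i \<oplus>\<^bsub>M\<^esub> g i) \<in> W"
      and Wsm: "\<And>c f. c \<in> carrier K \<Longrightarrow> f \<in> W \<Longrightarrow> (\<lambda>i\<in>I. (c \<odot>\<^bsub>A\<^esub> \<one>\<^bsub>A\<^esub>) \<odot>\<^bsub>M\<^esub> f i) \<in> W"
      using W(2) by (simp_all add: scal_closed_def pow_mod_def)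
    have \<delta>: "\<delta> i x \<in> W" if i: "i \<in> I" and x: "x \<in> carrier M" for i x
    proof -
      have "scal_closed M {x \<in> carrier M. \<delta> i x \<in> W}"
        unfolding scal_closed_def
      proof (intro conjI ballI)
        have "\<delta> i \<zero>\<^bsub>M\<^esub> = (\<lambda>i\<in>I. \<zero>\<^bsub>M\<^esub>)" by (auto simp: \<delta>_def)
        thus "\<zero>\<^bsub>M\<^esub> \<in> {x \<in> carrier M. \<delta> i x \<in> W}" using W0 by simp
      next
        fix x y assume "x \<in> {x \<in> carrier M. \<delta> i x \<in> W}" "y \<in> {x \<in> carrier M. \<delta> i x \<in> W}"
        hence xy: "x \<in> carrier M" "y \<in> carrier M" "\<delta> i x \<in> W" "\<delta> i y \<in> W" by auto
        have "\<delta> i (x \<oplus>\<^bsub>M\<^esub> y) = (\<lambda>j\<in>I. \<delta> i x j \<oplus>\<^bsub>M\<^esub> \<delta> i y j)"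
          using xy by (auto simp: \<delta>_def intro!: restrict_ext)
        thus "x \<oplus>\<^bsub>M\<^esub> y \<in> {x \<in> carrier M. \<delta> i x \<in> W}" using Wadd[OF xy(3,4)] xy by simp
      next
        fix c x assume c: "c \<in> carrier K" and "x \<in> {x \<in> carrier M. \<delta> i x \<in> W}"
        hence x: "x \<in> carrier M" "\<delta> i x \<in> W" by auto
        have "\<delta> i ((c \<odot>\<^bsub>A\<^esub> \<one>\<^bsub>A\<^esub>) \<odot>\<^bsub>M\<^esub> x) = (\<lambda>j\<in>I. (c \<odot>\<^bsub>A\<^esub> \<one>\<^bsub>A\<^esub>) \<odot>\<^bsub>M\<^esub> \<delta> i x j)"
          using x c by (auto simp: \<delta>_def intro!: restrict_ext)
        thus "(c \<odot>\<^bsub>A\<^esub> \<one>\<^bsub>A\<^esub>) \<odot>\<^bsub>M\<^esub> x \<in> {x \<in> carrier M. \<delta> i x \<in> W}" using Wsm[OF c x(2)] x c by simp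
      qed
      moreover have "G \<subseteq> {x \<in> carrier M. \<delta> i x \<in> W}"
      proof
        fix g assume "g \<in> G"
        hence "\<delta> i g \<in> ?G" using i by auto
        thus "g \<in> {x \<in> carrier M. \<delta> i x \<in> W}" using W(3) G(2) \<open>g \<in> G\<close> by auto
      qed
      ultimately have "{x \<in> carrier M. \<delta> i x \<in> W} = carrier M" by (intro G(3)) auto
      thus ?thesis using x by auto
    qed
    have "f \<in> W" if f: "f \<in> carrier ?P" for f
    proof -
      have fc: "f i \<in> carrier M" if "i \<in> I" for i using f that by (auto simp: pow_mod_def)
      have "(\<lambda>i\<in>I. if i \<in> J then f i else \<zero>\<^bsub>M\<^esub>) \<in> W" if "finite J" "J \<subseteq> I" for J
        using that
      proof (induction J rule: finite_induct)
        case empty thus ?case using W0 by (simp add: restrict_def)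
      next
        case (insert j J)
        have J: "(\<lambda>i\<in>I. if i \<in> J then f i else \<zero>\<^bsub>M\<^esub>) \<in> W" and j: "j \<in> I"
          using insert.IH insert.prems by blast+
        have "(\<lambda>i\<in>I. if i \<in> insert j J then f i else \<zero>\<^bsub>M\<^esub>) =
          (\<lambda>i\<in>I. (\<lambda>i\<in>I. if i \<in> J then f i else \<zero>\<^bsub>M\<^esub>) i \<oplus>\<^bsub>M\<^esub> \<delta> j (f j) i)"
          using insert.hyps(2) fc by (auto simp: \<delta>_def intro!: restrict_ext)
        thus ?case using Wadd[OF J \<delta>[OF j fc[OF j]]] by (simp only:)
      qed
      from this[OF I order_refl] have "(\<lambda>i\<in>I. if i \<in> I then f i else \<zero>\<^bsub>M\<^esub>) \<in> W" .
      moreover have "(\<lambda>i\<in>I. if i \<in> I then f i else \<zero>\<^bsub>M\<^esub>) = f"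
        using f by (auto simp: pow_mod_def PiE_iff extensional_def fun_eq_iff)
      ultimately show ?thesis by simp
    qed
    thus ?thesis using W(1) by blast
  qed
  moreover have "finite ?G" using G(1) I by simp
  moreover have "?G \<subseteq> carrier ?P" using G(2) by (auto simp: \<delta>_def pow_mod_def)
  ultimately show ?thesis using fdm_iff[OF P.lmod_axioms] by blast
qed

lemma lmod_regular: "lmod A (regular_module A)"
  by (rule lmod_regular_module[OF algr.ring_axioms])

lemma fdm_regular: "fd_left_module K A (regular_module A)"
proof -
  let ?R = "restrict_scalars A (regular_module A)"
  interpret V: vectorspace K ?R
    by (rule vectorspace_restrict_scalars[OF fd_alg]) (use lmod_regular in \<open>simp add: lmod_def\<close>)
  have sm: "(c \<odot>\<^bsub>A\<^esub> \<one>\<^bsub>A\<^esub>) \<otimes>\<^bsub>A\<^esub> x = c \<odot>\<^bsub>A\<^esub> x" if "c \<in> carrier K" "x \<in> carrier A" for c x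
  proof -
    have "(c \<odot>\<^bsub>A\<^esub> \<one>\<^bsub>A\<^esub>) \<otimes>\<^bsub>A\<^esub> x = c \<odot>\<^bsub>A\<^esub> (\<one>\<^bsub>A\<^esub> \<otimes>\<^bsub>A\<^esub> x)"
      using fd_alg that algr.one_closed unfolding fd_algebra_def by blast
    thus ?thesis using that by simp
  qed
  have "mod_hom K A ?R (\<lambda>x. x)"
    by (intro mod_hom.intro mod_hom_axioms.intro alg.module.module_axioms V.module.module_axioms)
      (auto simp: LinearCombinations.module_hom_def restrict_scalars_def sm)
  then interpret lin: linear_map K A ?R "\<lambda>x. x"
    by (intro linear_map.intro alg.vectorspace_axioms V.vectorspace_axioms)
  have "V.fin_dim"
  proof (rule lin.surj_fin_dim)
    show "vectorspace.fin_dim K A" using fd_alg unfolding fd_algebra_def by blast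
    show "(\<lambda>x. x) ` carrier A = carrier ?R"
      unfolding restrict_scalars_def regular_module_def by simp
  qed
  thus ?thesis using lmod_regular unfolding fd_left_module_def lmod_def by blast
qed

end

section \<open>Endomorphism algebras and modules of homomorphisms\<close>

lemma lmod_homD:
  assumes "f \<in> lmod_hom A M N"
  shows "f \<in> lhom A M N" "f \<in> extensional (carrier M)"
  using assms by (auto simp: lmod_hom_def)

lemma lmod_hom_restrict:
  assumes M: "lmod A M" and f: "f \<in> lhom A M N"
  shows "(\<lambda>x\<in>carrier M. f x) \<in> lmod_hom A M N"
proof -
  interpret M: lmod A M by (rule M)
  show ?thesis
    unfolding lmod_hom_def
    by (auto intro!: lhomI simp: lhom_closed[OF f] lhom_add[OF f] lhom_smult[OF f])
qed

lemma lmod_hom_eqI: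
  assumes "f \<in> lmod_hom A M N" "g \<in> lmod_hom A M N'" "\<And>x. x \<in> carrier M \<Longrightarrow> f x = g x"
  shows "f = g"
  using assms by (auto simp: lmod_hom_def intro: extensionalityI)

lemma lmod_hom_compose:
  assumes "lmod A L" "g \<in> lmod_hom A L M" "f \<in> lmod_hom A M N"
  shows "compose (carrier L) f g \<in> lmod_hom A L N"
  unfolding compose_def
  by (rule lmod_hom_restrict[OF assms(1)], rule lhom_comp)
    (use assms(2,3) in \<open>auto simp: lmod_hom_def\<close>)

lemma lmod_hom_zero:
  assumes "lmod A M" "lmod A N"
  shows "(\<lambda>x\<in>carrier M. \<zero>\<^bsub>N\<^esub>) \<in> lmod_hom A M N"
  by (rule lmod_hom_restrict[OF assms(1) lhom_zero_map[OF assms(2)]])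

lemma lmod_hom_plus:
  assumes "lmod A M" "lmod A N" "f \<in> lmod_hom A M N" "g \<in> lmod_hom A M N"
  shows "(\<lambda>x\<in>carrier M. f x \<oplus>\<^bsub>N\<^esub> g x) \<in> lmod_hom A M N"
  by (rule lmod_hom_restrict[OF assms(1)], rule lhom_plus[OF assms(2)])
    (use assms(3,4) in \<open>auto simp: lmod_hom_def\<close>)

lemma lmod_hom_uminus:
  assumes M: "lmod A M" and N: "lmod A N" and f: "f \<in> lmod_hom A M N"
  shows "(\<lambda>x\<in>carrier M. \<ominus>\<^bsub>N\<^esub> f x) \<in> lmod_hom A M N"
proof -
  interpret M: lmod A M by (rule M)
  interpret N: lmod A N by (rule N)
  note fh = lmod_homD(1)[OF f]
  have "(\<lambda>x. f (\<ominus>\<^bsub>M\<^esub> x)) \<in> lhom A M N"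
  proof (rule lhomI)
    fix a x assume "a \<in> carrier A" "x \<in> carrier M"
    thus "f (\<ominus>\<^bsub>M\<^esub> (a \<odot>\<^bsub>M\<^esub> x)) = a \<odot>\<^bsub>N\<^esub> f (\<ominus>\<^bsub>M\<^esub> x)"
      using lhom_smult[OF fh, of a "\<ominus>\<^bsub>M\<^esub> x"] M.smult_r_distr[of a "\<ominus>\<^bsub>M\<^esub> x" x]
      by (simp add: M.l_neg M.minus_equality)
  qed (auto simp: lhom_closed[OF fh] lhom_add[OF fh] M.minus_add)
  hence "(\<lambda>x\<in>carrier M. f (\<ominus>\<^bsub>M\<^esub> x)) \<in> lmod_hom A M N" by (rule lmod_hom_restrict[OF M])
  moreover have "(\<lambda>x\<in>carrier M. f (\<ominus>\<^bsub>M\<^esub> x)) = (\<lambda>x\<in>carrier M. \<ominus>\<^bsub>N\<^esub> f x)"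
    using lhom_minus[OF M N fh] by (intro restrict_ext) auto
  ultimately show ?thesis by simp
qed

lemma lmod_hom_app:
  "f \<in> lmod_hom A M N \<Longrightarrow> x \<in> carrier M \<Longrightarrow> f x \<in> carrier N"
  "f \<in> lmod_hom A M N \<Longrightarrow> x \<in> carrier M \<Longrightarrow> y \<in> carrier M \<Longrightarrow> f (x \<oplus>\<^bsub>M\<^esub> y) = f x \<oplus>\<^bsub>N\<^esub> f y"
  "f \<in> lmod_hom A M N \<Longrightarrow> a \<in> carrier A \<Longrightarrow> x \<in> carrier M \<Longrightarrow> f (a \<odot>\<^bsub>M\<^esub> x) = a \<odot>\<^bsub>N\<^esub> f x"
  by (meson lmod_homD lhom_closed lhom_add lhom_smult)+

lemma lmod_hom_abelian_group:
  assumes M: "lmod A M" and N: "lmod A N"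
  shows "abelian_group \<lparr>carrier = lmod_hom A M N, mult = m, one = u,
    zero = (\<lambda>x\<in>carrier M. \<zero>\<^bsub>N\<^esub>), add = (\<lambda>f g. \<lambda>x\<in>carrier M. f x \<oplus>\<^bsub>N\<^esub> g x), \<dots> = s\<rparr>"
    (is "abelian_group ?H")
proof -
  interpret N: lmod A N by (rule N)
  show ?thesis
  proof (rule abelian_groupI)
    fix f assume "f \<in> carrier ?H"
    hence f: "f \<in> lmod_hom A M N" by simp
    show "\<exists>g\<in>carrier ?H. g \<oplus>\<^bsub>?H\<^esub> f = \<zero>\<^bsub>?H\<^esub>"
      by (rule bexI[of _ "\<lambda>x\<in>carrier M. \<ominus>\<^bsub>N\<^esub> f x"])
        (auto simp: lmod_hom_uminus[OF M N f] N.l_neg lmod_hom_app(1)[OF f] intro!: restrict_ext)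
    show "\<zero>\<^bsub>?H\<^esub> \<oplus>\<^bsub>?H\<^esub> f = f"
      using lmod_homD(2)[OF f] lmod_hom_app(1)[OF f] by (auto simp: extensional_def fun_eq_iff)
  qed (auto simp: lmod_hom_plus[OF M N] lmod_hom_zero[OF M N] lmod_hom_app(1) N.a_ac
      intro!: restrict_ext)
qed

lemma (in lmod) ring_End: "ring (End_algebra A M)"
proof (rule ringI)
  show "abelian_group (End_algebra A M)"
    unfolding End_algebra_def by (rule lmod_hom_abelian_group[OF lmod_axioms lmod_axioms])
  note [simp] = lmod_hom_app(1) lmod_hom_app(2)
  have id: "(\<lambda>x\<in>carrier M. x) \<in> lmod_hom A M M"
    by (rule lmod_hom_restrict[OF lmod_axioms lhom_id])
  show "monoid (End_algebra A M)"
  proof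
    fix f g h
    assume f: "f \<in> carrier (End_algebra A M)" and g: "g \<in> carrier (End_algebra A M)"
      and h: "h \<in> carrier (End_algebra A M)"
    hence fgh: "f \<in> lmod_hom A M M" "g \<in> lmod_hom A M M" "h \<in> lmod_hom A M M"
      by (simp_all add: End_algebra_def)
    show "f \<otimes>\<^bsub>End_algebra A M\<^esub> g \<in> carrier (End_algebra A M)"
      using fgh lmod_hom_compose[OF lmod_axioms] by (simp add: End_algebra_def)
    show "f \<otimes>\<^bsub>End_algebra A M\<^esub> g \<otimes>\<^bsub>End_algebra A M\<^esub> h =
      f \<otimes>\<^bsub>End_algebra A M\<^esub> (g \<otimes>\<^bsub>End_algebra A M\<^esub> h)"
      using fgh by (auto simp: End_algebra_def compose_def intro!: restrict_ext)
    show "\<one>\<^bsub>End_algebra A M\<^esub> \<otimes>\<^bsub>End_algebra A M\<^esub> f = f" "f \<otimes>\<^bsub>End_algebra A M\<^esub> \<one>\<^bsub>End_algebra A M\<^esub> = f"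
      using lmod_homD(2)[OF fgh(1)] fgh(1)
      by (auto simp: End_algebra_def compose_def extensional_def fun_eq_iff)
  qed (simp add: End_algebra_def id)
qed (auto simp: End_algebra_def compose_def lmod_hom_app intro!: restrict_ext)

lemma ring_opposite:
  assumes "ring A"
  shows "ring (opposite_algebra A)"
proof -
  interpret ring A by fact
  have "abelian_group (opposite_algebra A)"
    by (rule abelian_groupI)
      (auto simp: opposite_algebra_def a_ac intro!: bexI[of _ "\<ominus>\<^bsub>A\<^esub> _"] l_neg)
  moreover have "monoid (opposite_algebra A)"
    by standard (auto simp: opposite_algebra_def m_assoc)
  ultimately show ?thesis
    by (rule ringI) (auto simp: opposite_algebra_def l_distr r_distr)
qed

text \<open>
  For a fixed module \<open>E\<close>, the group of homomorphisms \<open>E \<rightarrow> X\<close> is a left module over the opposite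
  of the endomorphism ring of \<open>E\<close>, acting by precomposition.
\<close>
definition hom_mod :: "('k, 'a) module \<Rightarrow> ('a, 'e) module \<Rightarrow> ('a, 'm) module \<Rightarrow> ('e \<Rightarrow> 'e, 'e \<Rightarrow> 'm) module" where
  "hom_mod A E X = \<lparr>carrier = lmod_hom A E X, mult = undefined, one = undefined,
     zero = (\<lambda>x\<in>carrier E. \<zero>\<^bsub>X\<^esub>), add = (\<lambda>f g. \<lambda>x\<in>carrier E. f x \<oplus>\<^bsub>X\<^esub> g x),
     smult = (\<lambda>\<gamma> f. compose (carrier E) f \<gamma>)\<rparr>"

lemma hom_mod_simps [simp]:
  "carrier (hom_mod A E X) = lmod_hom A E X"
  "\<zero>\<^bsub>hom_mod A E X\<^esub> = (\<lambda>x\<in>carrier E. \<zero>\<^bsub>X\<^esub>)"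
  "f \<oplus>\<^bsub>hom_mod A E X\<^esub> g = (\<lambda>x\<in>carrier E. f x \<oplus>\<^bsub>X\<^esub> g x)"
  "\<gamma> \<odot>\<^bsub>hom_mod A E X\<^esub> f = compose (carrier E) f \<gamma>"
  by (simp_all add: hom_mod_def)

lemma auslander_algebra_simps [simp]:
  "carrier (auslander_algebra A E) = lmod_hom A E E"
  "\<gamma> \<otimes>\<^bsub>auslander_algebra A E\<^esub> \<delta> = compose (carrier E) \<delta> \<gamma>"
  "\<one>\<^bsub>auslander_algebra A E\<^esub> = (\<lambda>x\<in>carrier E. x)"
  "\<zero>\<^bsub>auslander_algebra A E\<^esub> = (\<lambda>x\<in>carrier E. \<zero>\<^bsub>E\<^esub>)"
  "\<gamma> \<oplus>\<^bsub>auslander_algebra A E\<^esub> \<delta> = (\<lambda>x\<in>carrier E. \<gamma> x \<oplus>\<^bsub>E\<^esub> \<delta> x)"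
  "c \<odot>\<^bsub>auslander_algebra A E\<^esub> \<gamma> = (\<lambda>x\<in>carrier E. (c \<odot>\<^bsub>A\<^esub> \<one>\<^bsub>A\<^esub>) \<odot>\<^bsub>E\<^esub> \<gamma> x)"
  by (simp_all add: auslander_algebra_def opposite_algebra_def End_algebra_def)

lemma lmod_hom_mod:
  assumes E: "lmod A E" and X: "lmod A X"
  shows "lmod (auslander_algebra A E) (hom_mod A E X)"
proof -
  interpret E: lmod A E by (rule E)
  interpret X: lmod A X by (rule X)
  have r: "ring (auslander_algebra A E)"
    unfolding auslander_algebra_def by (rule ring_opposite[OF E.ring_End])
  have ab: "abelian_group (hom_mod A E X)"
    unfolding hom_mod_def by (rule lmod_hom_abelian_group[OF E X])
  show ?thesis
  proof (intro lmod.intro left_module.intro left_module_axioms.intro r ab)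
    fix f assume "f \<in> carrier (hom_mod A E X)"
    thus "\<one>\<^bsub>auslander_algebra A E\<^esub> \<odot>\<^bsub>hom_mod A E X\<^esub> f = f"
      by (auto simp: compose_def lmod_hom_def extensional_def fun_eq_iff)
  next
    fix \<gamma> f assume "\<gamma> \<in> carrier (auslander_algebra A E)" "f \<in> carrier (hom_mod A E X)"
    thus "\<gamma> \<odot>\<^bsub>hom_mod A E X\<^esub> f \<in> carrier (hom_mod A E X)"
      by (simp add: lmod_hom_compose[OF E])
  qed (auto simp: compose_def lmod_hom_app intro!: restrict_ext)
qed

context fda
begin

lemma vectorspace_auslander_algebra:
  assumes E: "lmod A E"
  shows "vectorspace K (auslander_algebra A E)"
proof -
  let ?G = "auslander_algebra A E"
  interpret E: lmod A E by (rule E)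
  interpret G: ring ?G
    unfolding auslander_algebra_def by (rule ring_opposite[OF E.ring_End])
  have assoc: "(c \<otimes>\<^bsub>K\<^esub> d) \<odot>\<^bsub>A\<^esub> \<one>\<^bsub>A\<^esub> = (c \<odot>\<^bsub>A\<^esub> \<one>\<^bsub>A\<^esub>) \<otimes>\<^bsub>A\<^esub> (d \<odot>\<^bsub>A\<^esub> \<one>\<^bsub>A\<^esub>)"
    if "c \<in> carrier K" "d \<in> carrier K" for c d
  proof -
    have "(c \<odot>\<^bsub>A\<^esub> \<one>\<^bsub>A\<^esub>) \<otimes>\<^bsub>A\<^esub> (d \<odot>\<^bsub>A\<^esub> \<one>\<^bsub>A\<^esub>) = c \<odot>\<^bsub>A\<^esub> (\<one>\<^bsub>A\<^esub> \<otimes>\<^bsub>A\<^esub> (d \<odot>\<^bsub>A\<^esub> \<one>\<^bsub>A\<^esub>))"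
      using fd_alg that(1) scalar_closed[OF that(2)] algr.one_closed unfolding fd_algebra_def by blast
    thus ?thesis using that scalar_closed by (simp add: alg.module.smult_assoc1)
  qed
  have cl: "(\<lambda>x\<in>carrier E. (c \<odot>\<^bsub>A\<^esub> \<one>\<^bsub>A\<^esub>) \<odot>\<^bsub>E\<^esub> f x) \<in> lmod_hom A E E"
    if c: "c \<in> carrier K" and f: "f \<in> lmod_hom A E E" for c f
  proof (rule lmod_hom_restrict[OF E], rule lhomI)
    fix a x assume ax: "a \<in> carrier A" "x \<in> carrier E"
    have "(c \<odot>\<^bsub>A\<^esub> \<one>\<^bsub>A\<^esub>) \<odot>\<^bsub>E\<^esub> (a \<odot>\<^bsub>E\<^esub> f x) = ((c \<odot>\<^bsub>A\<^esub> \<one>\<^bsub>A\<^esub>) \<otimes>\<^bsub>A\<^esub> a) \<odot>\<^bsub>E\<^esub> f x"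
      using ax c scalar_closed lmod_hom_app(1)[OF f] by (simp add: E.smult_assoc1)
    also have "\<dots> = a \<odot>\<^bsub>E\<^esub> ((c \<odot>\<^bsub>A\<^esub> \<one>\<^bsub>A\<^esub>) \<odot>\<^bsub>E\<^esub> f x)"
      using ax c scalar_closed lmod_hom_app(1)[OF f] by (simp add: scalar_central E.smult_assoc1)
    finally show "(c \<odot>\<^bsub>A\<^esub> \<one>\<^bsub>A\<^esub>) \<odot>\<^bsub>E\<^esub> f (a \<odot>\<^bsub>E\<^esub> x) = a \<odot>\<^bsub>E\<^esub> ((c \<odot>\<^bsub>A\<^esub> \<one>\<^bsub>A\<^esub>) \<odot>\<^bsub>E\<^esub> f x)"
      using ax by (simp add: lmod_hom_app[OF f])
  qed (use c scalar_closed in \<open>auto simp: lmod_hom_app[OF f] E.smult_r_distr\<close>)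
  have one: "\<one>\<^bsub>K\<^esub> \<odot>\<^bsub>A\<^esub> \<one>\<^bsub>A\<^esub> = \<one>\<^bsub>A\<^esub>" by (simp add: alg.module.smult_one)
  have "Module.module K ?G"
  proof (rule moduleI[OF alg.R.is_cring G.abelian_group_axioms])
    fix f assume "f \<in> carrier ?G"
    thus "\<one>\<^bsub>K\<^esub> \<odot>\<^bsub>?G\<^esub> f = f"
      by (auto simp: one E.smult_one lmod_hom_app lmod_hom_def extensional_def fun_eq_iff lhom_closed)
  qed (auto simp: cl scalar_closed lmod_hom_app E.smult_l_distr E.smult_r_distr
      alg.module.smult_l_distr assoc E.smult_assoc1 intro!: restrict_ext)
  thus ?thesis by (simp add: vectorspace_def alg.field_axioms)
qed

text \<open>
  A homomorphism out of \<open>E\<close> is determined by its values on a finite spanning set of \<open>E\<close>, so that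
  homomorphisms \<open>E \<rightarrow> X\<close> embed into a direct power of \<open>X\<close>.
\<close>
lemma lmod_hom_embeds:
  assumes E: "fd_left_module K A E" and X: "lmod A X"
  shows "\<exists>G. finite G \<and> G \<subseteq> carrier E \<and> inj_on (\<lambda>f. restrict f G) (lmod_hom A E X)"
proof -
  interpret E: lmod A E by (rule fdm_lmod[OF E])
  interpret X: lmod A X by (rule X)
  obtain G where G: "finite G" "G \<subseteq> carrier E"
    "\<And>W. W \<subseteq> carrier E \<Longrightarrow> scal_closed E W \<Longrightarrow> G \<subseteq> W \<Longrightarrow> W = carrier E"
    using E fdm_iff[OF E.lmod_axioms] by blast
  have "f = g" if f: "f \<in> lmod_hom A E X" and g: "g \<in> lmod_hom A E X" and eq: "restrict f G = restrict g G"
    for f g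
  proof -
    have "{x \<in> carrier E. f x = g x} = carrier E"
    proof (rule G(3))
      show "scal_closed E {x \<in> carrier E. f x = g x}"
        using lhom_zero[OF E.lmod_axioms X lmod_homD(1)[OF f]] lhom_zero[OF E.lmod_axioms X lmod_homD(1)[OF g]]
        by (auto simp: scal_closed_def lmod_hom_app[OF f] lmod_hom_app[OF g])
      show "G \<subseteq> {x \<in> carrier E. f x = g x}"
      proof
        fix x assume "x \<in> G"
        thus "x \<in> {x \<in> carrier E. f x = g x}" using fun_cong[OF eq, of x] G(2) by auto
      qed
    qed blast
    thus ?thesis by (intro lmod_hom_eqI[OF f g]) blast
  qed
  thus ?thesis using G(1,2) by (blast intro: inj_onI)
qed

lemma fd_auslander_algebra:
  assumes E: "fd_left_module K A E"
  shows "fd_algebra K (auslander_algebra A E)"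
proof -
  let ?G = "auslander_algebra A E"
  interpret E: lmod A E by (rule fdm_lmod[OF E])
  interpret V: vectorspace K ?G by (rule vectorspace_auslander_algebra[OF E.lmod_axioms])
  have r: "ring ?G" unfolding auslander_algebra_def by (rule ring_opposite[OF E.ring_End])
  obtain B where B: "finite B" "B \<subseteq> carrier E" "inj_on (\<lambda>f. restrict f B) (lmod_hom A E E)"
    using lmod_hom_embeds[OF E E.lmod_axioms] by blast
  let ?W = "restrict_scalars A (pow_mod B E)"
  have fdP: "fd_left_module K A (pow_mod B E)" by (rule fdm_pow[OF B(1) E])
  interpret W: vectorspace K ?W
    by (rule vectorspace_restrict_scalars[OF fd_alg]) (use fdm_lmod[OF fdP] in \<open>simp add: lmod_def\<close>)
  have "mod_hom K ?G ?W (\<lambda>f. restrict f B)"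
    by (intro mod_hom.intro mod_hom_axioms.intro V.module.module_axioms W.module.module_axioms)
      (use B(2) in \<open>auto simp: LinearCombinations.module_hom_def restrict_scalars_def pow_mod_def
        lmod_hom_app subset_iff intro!: restrict_ext\<close>)
  then interpret lin: linear_map K ?G ?W "\<lambda>f. restrict f B"
    by (intro linear_map.intro V.vectorspace_axioms W.vectorspace_axioms)
  have "V.fin_dim"
    by (rule lin.inj_imp_fin_dim) (use B fdP in \<open>auto simp: fd_left_module_def\<close>)
  moreover have "(c \<odot>\<^bsub>?G\<^esub> f) \<otimes>\<^bsub>?G\<^esub> g = c \<odot>\<^bsub>?G\<^esub> (f \<otimes>\<^bsub>?G\<^esub> g)"
    "f \<otimes>\<^bsub>?G\<^esub> (c \<odot>\<^bsub>?G\<^esub> g) = c \<odot>\<^bsub>?G\<^esub> (f \<otimes>\<^bsub>?G\<^esub> g)"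
    if "c \<in> carrier K" "f \<in> carrier ?G" "g \<in> carrier ?G" for c f g
    using that by (auto simp: compose_def scalar_closed lmod_hom_app intro!: restrict_ext)
  ultimately show ?thesis
    unfolding fd_algebra_def using V.vectorspace_axioms r by blast
qed

lemma fdm_hom_mod:
  assumes E: "fd_left_module K A E" and X: "fd_left_module K A X"
  shows "fd_left_module K (auslander_algebra A E) (hom_mod A E X)"
proof -
  let ?G = "auslander_algebra A E"
  let ?V = "restrict_scalars ?G (hom_mod A E X)"
  interpret E: lmod A E by (rule fdm_lmod[OF E])
  interpret X: lmod A X by (rule fdm_lmod[OF X])
  have H: "lmod ?G (hom_mod A E X)" by (rule lmod_hom_mod[OF E.lmod_axioms X.lmod_axioms])
  interpret V: vectorspace K ?V
    by (rule vectorspace_restrict_scalars[OF fd_auslander_algebra[OF E]])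
      (use H in \<open>simp add: lmod_def\<close>)
  obtain B where B: "finite B" "B \<subseteq> carrier E" "inj_on (\<lambda>f. restrict f B) (lmod_hom A E X)"
    using lmod_hom_embeds[OF E X.lmod_axioms] by blast
  let ?W = "restrict_scalars A (pow_mod B X)"
  have fdP: "fd_left_module K A (pow_mod B X)" by (rule fdm_pow[OF B(1) X])
  interpret W: vectorspace K ?W
    by (rule vectorspace_restrict_scalars[OF fd_alg]) (use fdm_lmod[OF fdP] in \<open>simp add: lmod_def\<close>)
  have "mod_hom K ?V ?W (\<lambda>f. restrict f B)"
    by (intro mod_hom.intro mod_hom_axioms.intro V.module.module_axioms W.module.module_axioms)
      (use B(2) in \<open>auto simp: LinearCombinations.module_hom_def restrict_scalars_def pow_mod_def
        compose_def scalar_closed lmod_hom_app subset_iff intro!: restrict_ext\<close>)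
  then interpret lin: linear_map K ?V ?W "\<lambda>f. restrict f B"
    by (intro linear_map.intro V.vectorspace_axioms W.vectorspace_axioms)
  have "V.fin_dim"
    by (rule lin.inj_imp_fin_dim)
      (use B fdP in \<open>auto simp: fd_left_module_def restrict_scalars_def[of ?G]\<close>)
  thus ?thesis using H by (simp add: fd_left_module_def lmod_def)
qed

end

section \<open>The Auslander algebra\<close>

lemma (in lmod) finsum_smult:
  assumes "finite I" "f \<in> I \<rightarrow> carrier M" "a \<in> carrier A"
  shows "a \<odot>\<^bsub>M\<^esub> finsum M f I = finsum M (\<lambda>i. a \<odot>\<^bsub>M\<^esub> f i) I"
  using assms(1,2)
proof (induction I rule: finite_induct)
  case (insert i I)
  hence "f \<in> I \<rightarrow> carrier M" "f i \<in> carrier M" by auto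
  moreover have "(\<lambda>i. a \<odot>\<^bsub>M\<^esub> f i) \<in> I \<rightarrow> carrier M" using insert.prems assms(3) by auto
  ultimately show ?case using insert assms(3) by (simp add: smult_r_distr)
qed (simp add: assms(3))

lemma internal_direct_sum_projections:
  assumes M: "lmod A M" and d: "internal_direct_sum A M \<N>"
  shows "\<exists>e. (\<forall>N \<in> \<N>. e N \<in> lhom A M M \<and> (\<forall>x \<in> carrier M. e N x \<in> N) \<and> (\<forall>x \<in> N. e N x = x) \<and>
      (\<forall>N' \<in> \<N>. N' \<noteq> N \<longrightarrow> (\<forall>x \<in> N'. e N x = \<zero>\<^bsub>M\<^esub>))) \<and>
    (\<forall>x \<in> carrier M. finsum M (\<lambda>N. e N x) \<N> = x)"
proof -
  interpret M: lmod A M by (rule M)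
  have fin: "finite \<N>" and sub: "\<And>N. N \<in> \<N> \<Longrightarrow> lsubmodule N A M"
    and ex1: "\<And>x. x \<in> carrier M \<Longrightarrow> \<exists>!f. f \<in> (\<Pi>\<^sub>E N \<in> \<N>. N) \<and> x = finsum M f \<N>"
    using d by (auto simp: internal_direct_sum_def)
  define F where "F x = (THE f. f \<in> (\<Pi>\<^sub>E N \<in> \<N>. N) \<and> x = finsum M f \<N>)" for x
  have F: "F x \<in> (\<Pi>\<^sub>E N \<in> \<N>. N)" "finsum M (F x) \<N> = x" if "x \<in> carrier M" for x
    using theI'[OF ex1[OF that]] by (auto simp: F_def)
  have uniq: "F x = f" if "f \<in> (\<Pi>\<^sub>E N \<in> \<N>. N)" "x = finsum M f \<N>" "x \<in> carrier M" for x f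
    unfolding F_def using that by (intro the1_equality ex1) auto
  have FN: "F x N \<in> N" if "x \<in> carrier M" "N \<in> \<N>" for x N using F(1)[OF that(1)] that(2) by auto
  have Fc: "F x N \<in> carrier M" if "x \<in> carrier M" "N \<in> \<N>" for x N
    by (rule lsub_mem[OF sub[OF that(2)] FN[OF that]])
  have add: "F (x \<oplus>\<^bsub>M\<^esub> y) = (\<lambda>N\<in>\<N>. F x N \<oplus>\<^bsub>M\<^esub> F y N)" if x: "x \<in> carrier M" and y: "y \<in> carrier M" for x y
  proof (rule uniq)
    show "(\<lambda>N\<in>\<N>. F x N \<oplus>\<^bsub>M\<^esub> F y N) \<in> (\<Pi>\<^sub>E N \<in> \<N>. N)"
      using lsub_add[OF sub] FN x y by auto
    have "finsum M (\<lambda>N\<in>\<N>. F x N \<oplus>\<^bsub>M\<^esub> F y N) \<N> = finsum M (\<lambda>N. F x N \<oplus>\<^bsub>M\<^esub> F y N) \<N>"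
      using Fc x y by (intro M.finsum_cong') auto
    also have "\<dots> = finsum M (F x) \<N> \<oplus>\<^bsub>M\<^esub> finsum M (F y) \<N>"
      using Fc x y by (intro M.finsum_addf) auto
    finally show "x \<oplus>\<^bsub>M\<^esub> y = finsum M (\<lambda>N\<in>\<N>. F x N \<oplus>\<^bsub>M\<^esub> F y N) \<N>" using F(2) x y by simp
  qed (use x y in simp)
  have sm: "F (a \<odot>\<^bsub>M\<^esub> x) = (\<lambda>N\<in>\<N>. a \<odot>\<^bsub>M\<^esub> F x N)" if a: "a \<in> carrier A" and x: "x \<in> carrier M" for a x
  proof (rule uniq)
    show "(\<lambda>N\<in>\<N>. a \<odot>\<^bsub>M\<^esub> F x N) \<in> (\<Pi>\<^sub>E N \<in> \<N>. N)"
      using lsub_smult[OF sub a] FN x by auto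
    have "finsum M (\<lambda>N\<in>\<N>. a \<odot>\<^bsub>M\<^esub> F x N) \<N> = finsum M (\<lambda>N. a \<odot>\<^bsub>M\<^esub> F x N) \<N>"
      using Fc x a by (intro M.finsum_cong') auto
    also have "\<dots> = a \<odot>\<^bsub>M\<^esub> finsum M (F x) \<N>"
      using Fc x a fin by (intro M.finsum_smult[symmetric]) auto
    finally show "a \<odot>\<^bsub>M\<^esub> x = finsum M (\<lambda>N\<in>\<N>. a \<odot>\<^bsub>M\<^esub> F x N) \<N>" using F(2) x by simp
  qed (use a x in simp)
  have on: "F x = (\<lambda>N'\<in>\<N>. if N = N' then x else \<zero>\<^bsub>M\<^esub>)" if N: "N \<in> \<N>" and x: "x \<in> N" for N x
  proof -
    have xc: "x \<in> carrier M" by (rule lsub_mem[OF sub[OF N] x])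
    have "finsum M (\<lambda>N'\<in>\<N>. if N = N' then x else \<zero>\<^bsub>M\<^esub>) \<N> =
        finsum M (\<lambda>N'. if N = N' then x else \<zero>\<^bsub>M\<^esub>) \<N>"
      using xc by (intro M.finsum_cong') auto
    also have "\<dots> = x" using M.finsum_singleton[OF N fin, of "\<lambda>_. x"] xc by simp
    finally show ?thesis
      using x lsub_zero[OF sub] xc by (intro uniq) auto
  qed
  have hom: "(\<lambda>x. F x N) \<in> lhom A M M" if N: "N \<in> \<N>" for N
    by (rule lhomI) (use Fc N in \<open>simp_all add: add sm\<close>)
  have off: "F x N = \<zero>\<^bsub>M\<^esub>" if "N \<in> \<N>" "N' \<in> \<N>" "N' \<noteq> N" "x \<in> N'" for x N N'
    using on[OF that(2,4)] that by simp
  have self: "F x N = x" if "N \<in> \<N>" "x \<in> N" for x N using on[OF that] that by simp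
  show ?thesis
    by (rule exI[of _ "\<lambda>N x. F x N"]) (use hom FN self off F(2) in auto)
qed

locale auslander = fda K \<Lambda> for K :: "'k ring" and \<Lambda> :: "('k, 'a) module" +
  fixes E :: "('a, 'e) module" and \<N> :: "'e set set"
  assumes fdE: "fd_left_module K \<Lambda> E"
    and decE: "basic_decomposition \<Lambda> E \<N>"
    and coverE: "\<And>M. M \<in> fmod K \<Lambda> \<Longrightarrow> indecomposable \<Lambda> M \<Longrightarrow>
      \<exists>N \<in> \<N>. lmod_iso \<Lambda> M (E\<lparr>carrier := N\<rparr>)"
begin

abbreviation \<Gamma> :: "('k, 'e \<Rightarrow> 'e) module" where "\<Gamma> \<equiv> auslander_algebra \<Lambda> E"

abbreviation H :: "('a, 'm) module \<Rightarrow> ('e \<Rightarrow> 'e, 'e \<Rightarrow> 'm) module" where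
  "H \<equiv> hom_mod \<Lambda> E"

abbreviation fdL :: "('a, 'm) module \<Rightarrow> bool" where "fdL \<equiv> fd_left_module K \<Lambda>"

abbreviation fdG :: "('e \<Rightarrow> 'e, 'm) module \<Rightarrow> bool" where "fdG \<equiv> fd_left_module K \<Gamma>"

lemma fda_G: "fda K \<Gamma>"
  by (rule fda.intro[OF fd_auslander_algebra[OF fdE]])

lemmas fdG_lmod = fda.fdm_lmod[OF fda_G]

lemma lmod_E: "lmod \<Lambda> E" by (rule fdm_lmod[OF fdE])

lemma lmod_H: "lmod \<Lambda> X \<Longrightarrow> lmod \<Gamma> (H X)"
  by (rule lmod_hom_mod[OF lmod_E])

lemma fdm_H: "fdL X \<Longrightarrow> fdG (H X)"
  by (rule fdm_hom_mod[OF fdE])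

lemma summand_props:
  "finite \<N>" "N \<in> \<N> \<Longrightarrow> lsubmodule N \<Lambda> E"
  "N \<in> \<N> \<Longrightarrow> indecomposable \<Lambda> (E\<lparr>carrier := N\<rparr>)"
  "N \<in> \<N> \<Longrightarrow> N' \<in> \<N> \<Longrightarrow> lmod_iso \<Lambda> (E\<lparr>carrier := N\<rparr>) (E\<lparr>carrier := N'\<rparr>) \<Longrightarrow> N = N'"
  using decE by (auto simp: basic_decomposition_def internal_direct_sum_def)

lemma fdm_summand: "N \<in> \<N> \<Longrightarrow> fdL (E\<lparr>carrier := N\<rparr>)"
  by (rule fdm_sub[OF fdE summand_props(2)])

definition pr :: "'e set \<Rightarrow> 'e \<Rightarrow> 'e" where
  "pr = (SOME e. (\<forall>N \<in> \<N>. e N \<in> lhom \<Lambda> E E \<and> (\<forall>x \<in> carrier E. e N x \<in> N) \<and>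
      (\<forall>x \<in> N. e N x = x) \<and> (\<forall>N' \<in> \<N>. N' \<noteq> N \<longrightarrow> (\<forall>x \<in> N'. e N x = \<zero>\<^bsub>E\<^esub>))) \<and>
    (\<forall>x \<in> carrier E. finsum E (\<lambda>N. e N x) \<N> = x))"

lemma
  shows pr_hom: "N \<in> \<N> \<Longrightarrow> pr N \<in> lhom \<Lambda> E E"
    and pr_in: "N \<in> \<N> \<Longrightarrow> x \<in> carrier E \<Longrightarrow> pr N x \<in> N"
    and pr_on: "N \<in> \<N> \<Longrightarrow> x \<in> N \<Longrightarrow> pr N x = x"
    and pr_sum: "x \<in> carrier E \<Longrightarrow> finsum E (\<lambda>N. pr N x) \<N> = x"
proof -
  have "internal_direct_sum \<Lambda> E \<N>" using decE by (simp add: basic_decomposition_def)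
  from someI_ex[OF internal_direct_sum_projections[OF lmod_E this], folded pr_def]
  show "N \<in> \<N> \<Longrightarrow> pr N \<in> lhom \<Lambda> E E"
    "N \<in> \<N> \<Longrightarrow> x \<in> carrier E \<Longrightarrow> pr N x \<in> N" "N \<in> \<N> \<Longrightarrow> x \<in> N \<Longrightarrow> pr N x = x"
    "x \<in> carrier E \<Longrightarrow> finsum E (\<lambda>N. pr N x) \<N> = x" by auto
qed

subsection \<open>Every module lies in add(E)\<close>

text \<open>Membership of \<open>X\<close> in \<open>add(E)\<close> means that the identity of \<open>X\<close> is such a sum of composites
  \<open>X \<rightarrow> E \<rightarrow> X\<close>. The rule \<open>congr\<close> is needed as functions may differ outside the carrier.\<close>
inductive through_E :: "('a, 'm) module \<Rightarrow> ('m \<Rightarrow> 'm) \<Rightarrow> bool" for X where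
  zero: "through_E X (\<lambda>x. \<zero>\<^bsub>X\<^esub>)"
| comp: "a \<in> lhom \<Lambda> X E \<Longrightarrow> b \<in> lhom \<Lambda> E X \<Longrightarrow> through_E X (\<lambda>x. b (a x))"
| plus: "through_E X f \<Longrightarrow> through_E X g \<Longrightarrow> through_E X (\<lambda>x. f x \<oplus>\<^bsub>X\<^esub> g x)"
| congr: "through_E X f \<Longrightarrow> (\<And>x. x \<in> carrier X \<Longrightarrow> f x = g x) \<Longrightarrow> through_E X g"

lemma summand_iso:
  assumes X: "fdL X" and ind: "indecomposable \<Lambda> X"
  shows "\<exists>N \<in> \<N>. lmod_iso \<Lambda> X (E\<lparr>carrier := N\<rparr>)"
proof -
  obtain Y where Y: "Y \<in> fmod K \<Lambda>" "lmod_iso \<Lambda> X Y"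
    using fmod_representative[OF fd_alg X] by blast
  hence lY: "lmod \<Lambda> Y" by (simp add: fmod_def fdm_lmod)
  have "indecomposable \<Lambda> Y" by (rule indecomposable_iso[OF fdm_lmod[OF X] lY Y(2) ind])
  then obtain N where "N \<in> \<N>" "lmod_iso \<Lambda> Y (E\<lparr>carrier := N\<rparr>)" using coverE[OF Y(1)] by blast
  thus ?thesis using lmod_iso_trans[OF fdm_lmod[OF X] lY Y(2)] by blast
qed

text \<open>Induction on the dimension: an indecomposable \<open>X\<close> is a summand of \<open>E\<close>, and otherwise the projections
  to the two parts of a decomposition reduce the claim to smaller modules.\<close>
lemma through_E_id: "fdL X \<Longrightarrow> through_E X (\<lambda>x. x)"
proof (induction "kdim K \<Lambda> X" arbitrary: X rule: less_induct)
  case less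
  note lX = fdm_lmod[OF less.prems]
  interpret X: lmod \<Lambda> X by (rule lX)
  consider "carrier X = {\<zero>\<^bsub>X\<^esub>}" | "indecomposable \<Lambda> X"
    | U V where "lsubmodule U \<Lambda> X" "lsubmodule V \<Lambda> X" "U \<inter> V = {\<zero>\<^bsub>X\<^esub>}"
      "U <+>\<^bsub>X\<^esub> V = carrier X" "U \<noteq> {\<zero>\<^bsub>X\<^esub>}" "V \<noteq> {\<zero>\<^bsub>X\<^esub>}"
    unfolding indecomposable_def by blast
  thus ?case
  proof cases
    case 1
    thus ?thesis by (intro through_E.congr[OF through_E.zero]) auto
  next
    case 2
    obtain N where N: "N \<in> \<N>" "lmod_iso \<Lambda> X (E\<lparr>carrier := N\<rparr>)" using summand_iso[OF less.prems 2] by blast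
    obtain f where f: "f \<in> lhom \<Lambda> X (E\<lparr>carrier := N\<rparr>)" "bij_betw f (carrier X) N"
      using N(2) unfolding lmod_iso_iff[OF lX] by auto
    note Nsub = lsub_subset[OF summand_props(2)[OF N(1)]]
    let ?g = "inv_into (carrier X) f"
    have g: "?g \<in> lhom \<Lambda> (E\<lparr>carrier := N\<rparr>) X" by (rule lhom_inv[OF f(1) _ lX]) (use f(2) in simp)
    have fE: "f \<in> lhom \<Lambda> X E" and fN: "\<And>x. x \<in> carrier X \<Longrightarrow> f x \<in> N"
      using f(1) unfolding lhom_sub_cod[OF Nsub] by auto
    have "pr N \<in> lhom \<Lambda> E (E\<lparr>carrier := N\<rparr>)"
      unfolding lhom_sub_cod[OF Nsub] using pr_hom[OF N(1)] pr_in[OF N(1)] by auto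
    hence "(\<lambda>x. ?g (pr N x)) \<in> lhom \<Lambda> E X" using g by (rule lhom_comp)
    from through_E.comp[OF fE this] show ?thesis
      by (rule through_E.congr) (use fN pr_on[OF N(1)] f(2) in \<open>simp add: bij_betw_inv_into_left\<close>)
  next
    case 3
    obtain p q where pq: "p \<in> lhom \<Lambda> X X" "q \<in> lhom \<Lambda> X X"
      "\<And>x. x \<in> carrier X \<Longrightarrow> p x \<in> U" "\<And>x. x \<in> carrier X \<Longrightarrow> q x \<in> V"
      "\<And>x. x \<in> carrier X \<Longrightarrow> x = p x \<oplus>\<^bsub>X\<^esub> q x"
      using X.direct_sum_projections[OF 3(1-4)] by blast
    have pull: "through_E X (\<lambda>x. f (r x))"
      if f: "through_E (X\<lparr>carrier := W\<rparr>) f" and r: "r \<in> lhom \<Lambda> X X" "\<And>x. x \<in> carrier X \<Longrightarrow> r x \<in> W"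
        and W: "lsubmodule W \<Lambda> X" for f r W
      using f
    proof induction
      case zero
      show ?case using through_E.zero[of X] by simp
    next
      case (comp a b)
      have "r \<in> lhom \<Lambda> X (X\<lparr>carrier := W\<rparr>)" unfolding lhom_sub_cod[OF lsub_subset[OF W]] using r by auto
      from lhom_comp[OF this comp(1)] have 1: "(\<lambda>x. a (r x)) \<in> lhom \<Lambda> X E" .
      have "b \<in> lhom \<Lambda> E X" using comp(2) unfolding lhom_sub_cod[OF lsub_subset[OF W]] by blast
      from through_E.comp[OF 1 this] show ?case .
    next
      case (plus f g)
      from through_E.plus[OF plus.IH] show ?case by simp
    next
      case (congr f g)
      show ?case by (rule through_E.congr[OF congr.IH]) (use congr(2) r in simp)
    qed
    have psub: "W \<subset> carrier X"
      if W: "lsubmodule W \<Lambda> X" and W': "lsubmodule W' \<Lambda> X" "W \<inter> W' = {\<zero>\<^bsub>X\<^esub>}" "W' \<noteq> {\<zero>\<^bsub>X\<^esub>}" for W W'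
    proof -
      have "W \<noteq> carrier X" using W' lsub_subset[OF W'(1)] by auto
      thus ?thesis using lsub_subset[OF W] by blast
    qed
    have dim: "kdim K \<Lambda> (X\<lparr>carrier := W\<rparr>) < kdim K \<Lambda> X" if "lsubmodule W \<Lambda> X" "W \<subset> carrier X" for W
      using kdim_psub[OF less.prems that(1) X.lsub_carrier that(2)] by simp
    have U: "U \<subset> carrier X" by (rule psub[OF 3(1,2,3,6)])
    have V: "V \<subset> carrier X" by (rule psub[OF 3(2,1) _ 3(5)]) (use 3(3) in blast)
    have "through_E (X\<lparr>carrier := U\<rparr>) (\<lambda>x. x)" "through_E (X\<lparr>carrier := V\<rparr>) (\<lambda>x. x)"
      using less.hyps[OF dim[OF 3(1) U] fdm_sub[OF less.prems 3(1)]]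
        less.hyps[OF dim[OF 3(2) V] fdm_sub[OF less.prems 3(2)]] .
    hence "through_E X (\<lambda>x. p x \<oplus>\<^bsub>X\<^esub> q x)"
      using pull[OF _ pq(1,3) 3(1)] pull[OF _ pq(2,4) 3(2)] by (intro through_E.plus) auto
    thus ?thesis by (rule through_E.congr) (simp add: pq(5)[symmetric])
  qed
qed

abbreviation dual :: "('e \<Rightarrow> 'a) set" where "dual \<equiv> lhom \<Lambda> E (regular_module \<Lambda>)"

text \<open>The identity of \<open>\<Lambda>\<close> is a sum of composites \<open>\<Lambda> \<rightarrow> E \<rightarrow> \<Lambda>\<close>, hence \<open>1\<close> is a sum of values of maps
  \<open>E \<rightarrow> \<Lambda>\<close>.\<close>
lemma trace_ideal:
  assumes I: "lsubmodule I \<Lambda> (regular_module \<Lambda>)"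
    and gen: "\<And>s x. s \<in> dual \<Longrightarrow> x \<in> carrier E \<Longrightarrow> s x \<in> I"
  shows "\<one>\<^bsub>\<Lambda>\<^esub> \<in> I"
proof -
  have "f \<one>\<^bsub>\<Lambda>\<^esub> \<in> I" if "through_E (regular_module \<Lambda>) f" for f
    using that
  proof induction
    case zero show ?case using lsub_zero[OF I] by simp
  next
    case (comp a b)
    show ?case by (rule gen[OF comp(2)]) (rule lhom_closed[OF comp(1)], simp)
  next
    case (plus f g) show ?case using lsub_add[OF I plus.IH] by simp
  next
    case (congr f g) thus ?case by simp
  qed
  from this[OF through_E_id[OF fdm_regular]] show ?thesis .
qed

lemma trace_mem:
  assumes X: "lmod \<Lambda> X" and Y: "lsubmodule Y \<Lambda> X" and y: "y \<in> carrier X"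
    and gen: "\<And>s x. s \<in> dual \<Longrightarrow> x \<in> carrier E \<Longrightarrow> s x \<odot>\<^bsub>X\<^esub> y \<in> Y"
  shows "y \<in> Y"
proof -
  interpret X: lmod \<Lambda> X by (rule X)
  have h: "(\<lambda>a. a \<odot>\<^bsub>X\<^esub> y) \<in> lhom \<Lambda> (regular_module \<Lambda>) X"
    by (rule lhomI) (simp_all add: y X.smult_l_distr X.smult_assoc1)
  have "\<one>\<^bsub>\<Lambda>\<^esub> \<in> {a \<in> carrier (regular_module \<Lambda>). a \<odot>\<^bsub>X\<^esub> y \<in> Y}"
    by (rule trace_ideal[OF lsub_vimage[OF lmod_regular X h Y]])
      (use gen lhom_closed[of _ \<Lambda> E "regular_module \<Lambda>"] in auto)
  thus ?thesis using y by (simp add: X.smult_one)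
qed

lemma trace_eq:
  assumes X: "lmod \<Lambda> X" and y: "y \<in> carrier X" "y' \<in> carrier X"
    and gen: "\<And>s x. s \<in> dual \<Longrightarrow> x \<in> carrier E \<Longrightarrow> s x \<odot>\<^bsub>X\<^esub> y = s x \<odot>\<^bsub>X\<^esub> y'"
  shows "y = y'"
proof -
  interpret X: lmod \<Lambda> X by (rule X)
  have "y \<ominus>\<^bsub>X\<^esub> y' \<in> {\<zero>\<^bsub>X\<^esub>}"
  proof (rule trace_mem[OF X X.lsub_zero_module])
    fix s x assume s: "s \<in> dual" and x: "x \<in> carrier E"
    have a: "s x \<in> carrier \<Lambda>" using lhom_closed[OF s x] by simp
    have h: "(\<lambda>y. s x \<odot>\<^bsub>X\<^esub> y) y = (\<lambda>y. s x \<odot>\<^bsub>X\<^esub> y) y'" using gen[OF s x] by simp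
    have "s x \<odot>\<^bsub>X\<^esub> (y \<ominus>\<^bsub>X\<^esub> y') \<oplus>\<^bsub>X\<^esub> s x \<odot>\<^bsub>X\<^esub> y' = s x \<odot>\<^bsub>X\<^esub> y"
      using X.smult_r_distr[OF a, of "y \<ominus>\<^bsub>X\<^esub> y'" y'] y X.diff_add_cancel[OF y] by simp
    thus "s x \<odot>\<^bsub>X\<^esub> (y \<ominus>\<^bsub>X\<^esub> y') \<in> {\<zero>\<^bsub>X\<^esub>}" using gen[OF s x] a y by simp
  qed (use y in simp)
  thus ?thesis using y by simp
qed

subsection \<open>Torsion-free modules\<close>

text \<open>The composite of \<open>s : E \<rightarrow> \<Lambda>\<close> with the map \<open>\<Lambda> \<rightarrow> X\<close> that sends \<open>1\<close> to \<open>y\<close>. For \<open>X = E\<close> these are the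
  generators of the ideal of \<open>\<Gamma>\<close> formed by the endomorphisms that factor through a free module.\<close>
definition elem :: "('a, 'm) module \<Rightarrow> ('e \<Rightarrow> 'a) \<Rightarrow> 'm \<Rightarrow> ('e \<Rightarrow> 'm)" where
  "elem X s y = (\<lambda>x\<in>carrier E. s x \<odot>\<^bsub>X\<^esub> y)"

lemma elem_hom:
  assumes X: "lmod \<Lambda> X" and s: "s \<in> dual" and y: "y \<in> carrier X"
  shows "elem X s y \<in> lmod_hom \<Lambda> E X"
proof -
  interpret X: lmod \<Lambda> X by (rule X)
  have a: "s x \<in> carrier \<Lambda>" if "x \<in> carrier E" for x using lhom_closed[OF s that] by simp
  show ?thesis
    unfolding elem_def
    by (rule lmod_hom_restrict[OF lmod_E], rule lhomI)
      (use a y lhom_add[OF s] lhom_smult[OF s] in \<open>simp_all add: X.smult_l_distr X.smult_assoc1\<close>)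
qed

lemma elem_smult:
  assumes f: "f \<in> lmod_hom \<Lambda> E X" and s: "s \<in> dual" and e: "e \<in> carrier E"
  shows "elem E s e \<odot>\<^bsub>H X\<^esub> f = elem X s (f e)"
  using lhom_closed[OF s] e
  by (auto simp: elem_def compose_def lmod_hom_app[OF f] intro!: restrict_ext)

lemma dual_comp: "s \<in> dual \<Longrightarrow> \<gamma> \<in> lmod_hom \<Lambda> E E \<Longrightarrow> (\<lambda>x. s (\<gamma> x)) \<in> dual"
  using lhom_comp[OF lmod_homD(1)] by blast

lemma dual_mult: 
  assumes s: "s \<in> dual" and a: "a \<in> carrier \<Lambda>" shows "(\<lambda>x. s x \<otimes>\<^bsub>\<Lambda>\<^esub> a) \<in> dual"
  by (rule lhomI) (use lhom_closed[OF s] lhom_add[OF s] lhom_smult[OF s] a in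
    \<open>simp_all add: algr.l_distr algr.m_assoc\<close>)

lemma elem_add:
  assumes X: "lmod \<Lambda> X" and s: "s \<in> dual" and y: "y \<in> carrier X" "z \<in> carrier X"
  shows "elem X s (y \<oplus>\<^bsub>X\<^esub> z) = elem X s y \<oplus>\<^bsub>H X\<^esub> elem X s z"
proof -
  interpret X: lmod \<Lambda> X by (rule X)
  show ?thesis using lhom_closed[OF s] y by (auto simp: elem_def X.smult_r_distr intro!: restrict_ext)
qed

lemma elem_scal:
  assumes X: "lmod \<Lambda> X" and s: "s \<in> dual" and a: "a \<in> carrier \<Lambda>" and y: "y \<in> carrier X"
  shows "elem X s (a \<odot>\<^bsub>X\<^esub> y) = elem X (\<lambda>x. s x \<otimes>\<^bsub>\<Lambda>\<^esub> a) y"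
proof -
  interpret X: lmod \<Lambda> X by (rule X)
  show ?thesis
    using lhom_closed[OF s] y a by (auto simp: elem_def X.smult_assoc1 intro!: restrict_ext)
qed

text \<open>The factor module of \<open>M\<close> by \<open>G\<close> has no nonzero element that is killed by all \<open>elem E s e\<close>. In terms of
  torsion theory: the factor module is torsion-free.\<close>
definition tclosed :: "('e \<Rightarrow> 'e, 'm) module \<Rightarrow> 'm set \<Rightarrow> bool" where
  "tclosed M G \<longleftrightarrow> (\<forall>m \<in> carrier M.
     (\<forall>s \<in> dual. \<forall>e \<in> carrier E. elem E s e \<odot>\<^bsub>M\<^esub> m \<in> G) \<longrightarrow> m \<in> G)"

abbreviation tfree :: "('e \<Rightarrow> 'e, 'm) module \<Rightarrow> bool" where
  "tfree M \<equiv> tclosed M {\<zero>\<^bsub>M\<^esub>}"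

lemma tclosedD:
  assumes "tclosed M G" "m \<in> carrier M"
    "\<And>s e. s \<in> dual \<Longrightarrow> e \<in> carrier E \<Longrightarrow> elem E s e \<odot>\<^bsub>M\<^esub> m \<in> G"
  shows "m \<in> G"
  using assms by (simp add: tclosed_def)

lemma elem_G: "s \<in> dual \<Longrightarrow> e \<in> carrier E \<Longrightarrow> elem E s e \<in> carrier \<Gamma>"
  using elem_hom[OF lmod_E] by simp

lemma tclosed_vimage:
  assumes M: "lmod \<Gamma> M" and f: "f \<in> lhom \<Gamma> M N" and G: "tclosed N G"
  shows "tclosed M {x \<in> carrier M. f x \<in> G}"
  unfolding tclosed_def
proof (intro ballI impI)
  fix m assume m: "m \<in> carrier M"
    and *: "\<forall>s\<in>dual. \<forall>e\<in>carrier E. elem E s e \<odot>\<^bsub>M\<^esub> m \<in> {x \<in> carrier M. f x \<in> G}"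
  have "f m \<in> G"
    by (rule tclosedD[OF G lhom_closed[OF f m]])
      (use * lhom_smult[OF f elem_G m] in fastforce)
  thus "m \<in> {x \<in> carrier M. f x \<in> G}" using m by simp
qed

lemma tfree_inj:
  assumes M: "lmod \<Gamma> M" and N: "lmod \<Gamma> N" and f: "f \<in> lhom \<Gamma> M N"
    and i: "inj_on f (carrier M)" and t: "tfree N"
  shows "tfree M"
proof -
  interpret M: lmod \<Gamma> M by (rule M)
  have "{x \<in> carrier M. f x \<in> {\<zero>\<^bsub>N\<^esub>}} = {\<zero>\<^bsub>M\<^esub>}"
    using i lhom_inj_iff[OF M N f] lhom_zero[OF M N f] by auto
  thus ?thesis using tclosed_vimage[OF M f t] by simp
qed

lemma tfree_iso:
  assumes "lmod \<Gamma> M" "lmod \<Gamma> N" "lmod_iso \<Gamma> M N" "tfree N"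
  shows "tfree M"
proof -
  obtain f where "f \<in> lhom \<Gamma> M N" "bij_betw f (carrier M) (carrier N)"
    using assms(3) unfolding lmod_iso_iff[OF assms(1)] by blast
  thus ?thesis using tfree_inj[OF assms(1,2) _ _ assms(4)] by (simp add: bij_betw_def)
qed

lemma tfree_epi_iff:
  assumes M: "lmod \<Gamma> M" and N: "lmod \<Gamma> N" and p: "lepi \<Gamma> M N p"
    and G: "G = {x \<in> carrier M. p x = \<zero>\<^bsub>N\<^esub>}"
  shows "tfree N \<longleftrightarrow> tclosed M G"
proof
  assume "tfree N"
  from tclosed_vimage[OF M lepiD(1)[OF p] this] show "tclosed M G" using G by simp
next
  interpret M: lmod \<Gamma> M by (rule M)
  assume c: "tclosed M G"
  show "tfree N"
    unfolding tclosed_def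
  proof (intro ballI impI)
    fix n assume n: "n \<in> carrier N" and *: "\<forall>s\<in>dual. \<forall>e\<in>carrier E. elem E s e \<odot>\<^bsub>N\<^esub> n \<in> {\<zero>\<^bsub>N\<^esub>}"
    obtain m where m: "m \<in> carrier M" "n = p m" using lepi_ex[OF p n] by blast
    have "m \<in> G"
    proof (rule tclosedD[OF c m(1)])
      fix s e assume se: "s \<in> dual" "e \<in> carrier E"
      have "p (elem E s e \<odot>\<^bsub>M\<^esub> m) = \<zero>\<^bsub>N\<^esub>"
        using lhom_smult[OF lepiD(1)[OF p] elem_G[OF se] m(1)] * se m(2) by auto
      thus "elem E s e \<odot>\<^bsub>M\<^esub> m \<in> G" using M.closed_ops[OF elem_G[OF se] m(1)] G by blast
    qed
    thus "n \<in> {\<zero>\<^bsub>N\<^esub>}" using m(2) G by simp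
  qed
qed

subsection \<open>Submodules of modules of homomorphisms\<close>

definition HS :: "('a, 'm) module \<Rightarrow> 'm set \<Rightarrow> ('e \<Rightarrow> 'm) set" where
  "HS X U = {f \<in> lmod_hom \<Lambda> E X. \<forall>x \<in> carrier E. f x \<in> U}"

lemma hom_mod_sub:
  assumes "lsubmodule U \<Lambda> X"
  shows "H (X\<lparr>carrier := U\<rparr>) = (H X)\<lparr>carrier := HS X U\<rparr>"
proof -
  have "lmod_hom \<Lambda> E (X\<lparr>carrier := U\<rparr>) = HS X U"
    unfolding lmod_hom_def HS_def lhom_sub_cod[OF lsub_subset[OF assms]] set_eq_iff Int_iff
    using lhom_sub_cod[OF lsub_subset[OF assms]] by blast
  thus ?thesis by (simp add: hom_mod_def)
qed

lemma HS_sub: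
  assumes X: "lmod \<Lambda> X" and U: "lsubmodule U \<Lambda> X"
  shows "lsubmodule (HS X U) \<Gamma> (H X)"
proof -
  interpret X: lmod \<Lambda> X by (rule X)
  interpret H: lmod \<Gamma> "H X" by (rule lmod_H[OF X])
  show ?thesis
  proof (rule H.lsubmoduleI)
    fix \<gamma> f assume "\<gamma> \<in> carrier \<Gamma>" "f \<in> HS X U"
    thus "\<gamma> \<odot>\<^bsub>H X\<^esub> f \<in> HS X U"
      using lmod_hom_compose[OF lmod_E, of \<gamma> E f X] lmod_hom_app(1)[of \<gamma> \<Lambda> E E]
      by (simp add: HS_def compose_eq)
  qed (use lsub_zero[OF U] lsub_add[OF U] lmod_hom_zero[OF lmod_E X] lmod_hom_plus[OF lmod_E X]
      in \<open>auto simp: HS_def\<close>)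
qed

lemma HS_tclosed:
  assumes X: "lmod \<Lambda> X" and U: "lsubmodule U \<Lambda> X"
  shows "tclosed (H X) (HS X U)"
  unfolding tclosed_def
proof (intro ballI impI)
  fix h assume "h \<in> carrier (H X)" and *: "\<forall>s\<in>dual. \<forall>e\<in>carrier E. elem E s e \<odot>\<^bsub>H X\<^esub> h \<in> HS X U"
  hence h: "h \<in> lmod_hom \<Lambda> E X" by simp
  have "h e \<in> U" if e: "e \<in> carrier E" for e
  proof (rule trace_mem[OF X U lmod_hom_app(1)[OF h e]])
    fix s x assume s: "s \<in> dual" and x: "x \<in> carrier E"
    have "elem X s (h e) \<in> HS X U" using * s e elem_smult[OF h s e] by metis
    thus "s x \<odot>\<^bsub>X\<^esub> h e \<in> U" using x by (auto simp: HS_def elem_def)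
  qed
  thus "h \<in> HS X U" using h by (simp add: HS_def)
qed

lemma HS_zero:
  assumes X: "lmod \<Lambda> X"
  shows "HS X {\<zero>\<^bsub>X\<^esub>} = {\<zero>\<^bsub>H X\<^esub>}"
proof
  show "HS X {\<zero>\<^bsub>X\<^esub>} \<subseteq> {\<zero>\<^bsub>H X\<^esub>}"
  proof
    fix f assume f: "f \<in> HS X {\<zero>\<^bsub>X\<^esub>}"
    hence "f = (\<lambda>x\<in>carrier E. \<zero>\<^bsub>X\<^esub>)"
      by (intro lmod_hom_eqI[OF _ lmod_hom_zero[OF lmod_E X]]) (auto simp: HS_def)
    thus "f \<in> {\<zero>\<^bsub>H X\<^esub>}" by simp
  qed
qed (simp add: HS_def lmod_hom_zero[OF lmod_E X])

lemma tfree_H: "lmod \<Lambda> X \<Longrightarrow> tfree (H X)"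
  using HS_tclosed[of X "{\<zero>\<^bsub>X\<^esub>}"] HS_zero[of X] lmod.lsub_zero_module[of \<Lambda> X] by simp

text \<open>The submodule \<open>Y\<close> is the set of all \<open>y\<close> for which \<open>G\<close> contains the maps \<open>E \<rightarrow> \<Lambda> \<rightarrow> X\<close> with \<open>1 \<mapsto> y\<close>.
  A map \<open>f\<close> belongs to \<open>G\<close> if and only if its composites with the maps \<open>E \<rightarrow> \<Lambda> \<rightarrow> E\<close> do, and these only
  depend on the values of \<open>f\<close>.\<close>
lemma tclosed_HS:
  assumes X: "lmod \<Lambda> X" and G: "lsubmodule G \<Gamma> (H X)" and c: "tclosed (H X) G"
  shows "\<exists>Y. lsubmodule Y \<Lambda> X \<and> G = HS X Y"
proof -
  interpret X: lmod \<Lambda> X by (rule X)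
  let ?Y = "{y \<in> carrier X. \<forall>s \<in> dual. elem X s y \<in> G}"
  have Y: "lsubmodule ?Y \<Lambda> X"
  proof (rule X.lsubmoduleI)
    have "elem X s \<zero>\<^bsub>X\<^esub> = \<zero>\<^bsub>H X\<^esub>" if "s \<in> dual" for s
      using lhom_closed[OF that] by (auto simp: elem_def intro!: restrict_ext)
    thus "\<zero>\<^bsub>X\<^esub> \<in> ?Y" using lsub_zero[OF G] by simp
  next
    fix y z assume "y \<in> ?Y" "z \<in> ?Y"
    thus "y \<oplus>\<^bsub>X\<^esub> z \<in> ?Y" using elem_add[OF X] lsub_add[OF G] by simp
  next
    fix a y assume a: "a \<in> carrier \<Lambda>" and y: "y \<in> ?Y"
    thus "a \<odot>\<^bsub>X\<^esub> y \<in> ?Y" using elem_scal[OF X _ a] dual_mult[OF _ a] by simp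
  qed blast
  have "g \<in> HS X ?Y" if g: "g \<in> G" for g
  proof -
    have gh: "g \<in> lmod_hom \<Lambda> E X" using lsub_mem[OF G g] by simp
    have "elem X s (g e) \<in> G" if "s \<in> dual" "e \<in> carrier E" for s e
      using lsub_smult[OF G elem_G[OF that] g] elem_smult[OF gh that] by simp
    thus ?thesis using gh lmod_hom_app(1)[OF gh] by (simp add: HS_def)
  qed
  moreover have "h \<in> G" if h: "h \<in> HS X ?Y" for h
  proof (rule tclosedD[OF c])
    show "h \<in> carrier (H X)" using h by (simp add: HS_def)
    fix s e assume se: "s \<in> dual" "e \<in> carrier E"
    have "elem E s e \<odot>\<^bsub>H X\<^esub> h = elem X s (h e)"
      by (rule elem_smult[OF _ se]) (use h in \<open>simp add: HS_def\<close>)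
    thus "elem E s e \<odot>\<^bsub>H X\<^esub> h \<in> G" using h se by (simp add: HS_def)
  qed
  ultimately show ?thesis using Y by blast
qed

lemma HS_subset_iff:
  assumes X: "lmod \<Lambda> X" and U: "lsubmodule U \<Lambda> X" and V: "lsubmodule V \<Lambda> X"
  shows "HS X U \<subseteq> HS X V \<longleftrightarrow> U \<subseteq> V"
proof
  assume sub: "HS X U \<subseteq> HS X V"
  show "U \<subseteq> V"
  proof
    fix u assume u: "u \<in> U"
    have uc: "u \<in> carrier X" by (rule lsub_mem[OF U u])
    show "u \<in> V"
    proof (rule trace_mem[OF X V uc])
      fix s x assume s: "s \<in> dual" and x: "x \<in> carrier E"
      have "elem X s u \<in> HS X U"
        unfolding HS_def using elem_hom[OF X s uc] lhom_closed[OF s] lsub_smult[OF U _ u]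
        by (simp add: elem_def)
      hence "elem X s u \<in> HS X V" using sub by blast
      thus "s x \<odot>\<^bsub>X\<^esub> u \<in> V" using x by (auto simp: HS_def elem_def)
    qed
  qed
qed (auto simp: HS_def)

lemma H_map:
  assumes X: "lmod \<Lambda> X" and \<theta>: "\<theta> \<in> lhom \<Lambda> X Y"
  shows "(\<lambda>f. \<lambda>x\<in>carrier E. \<theta> (f x)) \<in> lhom \<Gamma> (H X) (H Y)"
proof (rule lhomI)
  fix f assume "f \<in> carrier (H X)"
  hence "f \<in> lhom \<Lambda> E X" by (simp add: lmod_hom_def)
  from lmod_hom_restrict[OF lmod_E lhom_comp[OF this \<theta>]]
  show "(\<lambda>x\<in>carrier E. \<theta> (f x)) \<in> carrier (H Y)" by simp
next
  fix f g assume "f \<in> carrier (H X)" "g \<in> carrier (H X)"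
  thus "(\<lambda>x\<in>carrier E. \<theta> ((f \<oplus>\<^bsub>H X\<^esub> g) x)) = (\<lambda>x\<in>carrier E. \<theta> (f x)) \<oplus>\<^bsub>H Y\<^esub> (\<lambda>x\<in>carrier E. \<theta> (g x))"
    by (auto simp: lhom_add[OF \<theta>] lmod_hom_app intro!: restrict_ext)
next
  fix \<gamma> f assume "\<gamma> \<in> carrier \<Gamma>" "f \<in> carrier (H X)"
  thus "(\<lambda>x\<in>carrier E. \<theta> ((\<gamma> \<odot>\<^bsub>H X\<^esub> f) x)) = \<gamma> \<odot>\<^bsub>H Y\<^esub> (\<lambda>x\<in>carrier E. \<theta> (f x))"
    by (auto simp: compose_def lmod_hom_app intro!: restrict_ext)
qed

end

section \<open>Projective modules and modules of projective dimension at most one\<close>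

lemma lhom_cong:
  assumes M: "lmod A M" and f: "f \<in> lhom A M N" and eq: "\<And>x. x \<in> carrier M \<Longrightarrow> f x = g x"
  shows "g \<in> lhom A M N"
proof -
  interpret M: lmod A M by (rule M)
  show ?thesis
    by (rule lhomI) (simp_all add: eq[symmetric] lhom_closed[OF f] lhom_add[OF f] lhom_smult[OF f])
qed

lemma projectiveD:
  assumes "projective K A P" "M \<in> fmod K A" "N \<in> fmod K A" "g \<in> lmod_hom A M N"
    "f \<in> lmod_hom A P N" "g ` carrier M = carrier N"
  shows "\<exists>h \<in> lmod_hom A P M. \<forall>x \<in> carrier P. g (h x) = f x"
  using assms unfolding projective_def by blast

lemma projective_iso:
  fixes K :: "'k ring" and A :: "('k, 'a) module"
  assumes P: "lmod A P" and Q: "lmod A Q" and i: "lmod_iso A P Q" and pr: "projective K A P"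
  shows "projective K A Q"
proof -
  obtain \<phi> where \<phi>: "\<phi> \<in> lhom A P Q" "bij_betw \<phi> (carrier P) (carrier Q)"
    using i unfolding lmod_iso_iff[OF P] by blast
  let ?\<psi> = "inv_into (carrier P) \<phi>"
  have \<psi>: "?\<psi> \<in> lhom A Q P" by (rule lhom_inv[OF \<phi> P])
  show ?thesis
    unfolding projective_def
  proof (intro ballI impI)
    fix M N :: "('a, nat \<Rightarrow> 'k) module" and g f
    assume M: "M \<in> fmod K A" and N: "N \<in> fmod K A" and g: "g \<in> lmod_hom A M N" and f: "f \<in> lmod_hom A Q N"
      and s: "g ` carrier M = carrier N"
    have "(\<lambda>x\<in>carrier P. f (\<phi> x)) \<in> lmod_hom A P N"
      by (rule lmod_hom_restrict[OF P lhom_comp[OF \<phi>(1) lmod_homD(1)[OF f]]])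
    from projectiveD[OF pr M N g this s]
    obtain h where h: "h \<in> lmod_hom A P M" "\<And>x. x \<in> carrier P \<Longrightarrow> g (h x) = f (\<phi> x)" by auto
    have "(\<lambda>x\<in>carrier Q. h (?\<psi> x)) \<in> lmod_hom A Q M"
      by (rule lmod_hom_restrict[OF Q lhom_comp[OF \<psi> lmod_homD(1)[OF h(1)]]])
    moreover have "g ((\<lambda>x\<in>carrier Q. h (?\<psi> x)) x) = f x" if x: "x \<in> carrier Q" for x
      using h(2)[OF lhom_closed[OF \<psi> x]] x bij_betw_inv_into_right[OF \<phi>(2) x] by simp
    ultimately show "\<exists>h\<in>lmod_hom A Q M. \<forall>x\<in>carrier Q. g (h x) = f x" by blast
  qed
qed

context auslander
begin

lemma through_E_hom:
  assumes X: "lmod \<Lambda> X" and f: "through_E X f"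
  shows "f \<in> lhom \<Lambda> X X"
  using f
proof induction
  case zero show ?case by (rule lhom_zero_map[OF X])
next
  case (comp a b) thus ?case by (rule lhom_comp)
next
  case (plus f g) show ?case by (rule lhom_plus[OF X plus.IH])
next
  case (congr f g) show ?case by (rule lhom_cong[OF X congr.IH congr(2)])
qed

lemma lmod_hom_post:
  "f \<in> lmod_hom \<Lambda> E X \<Longrightarrow> \<theta> \<in> lhom \<Lambda> X Y \<Longrightarrow> (\<lambda>x\<in>carrier E. \<theta> (f x)) \<in> lmod_hom \<Lambda> E Y"
  by (rule lmod_hom_restrict[OF lmod_E lhom_comp[OF lmod_homD(1)]])

text \<open>Write the identity of \<open>X\<close> as a sum of maps \<open>b \<circ> a\<close> through \<open>E\<close>. As \<open>f (b \<circ> a \<circ> h) = (a \<circ> h) \<cdot> f b\<close> for a map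
  \<open>f\<close> out of \<open>H X\<close>, with \<open>a \<circ> h\<close> in \<open>\<Gamma>\<close>, a lift of \<open>f\<close> is determined by lifts of the elements \<open>f b\<close>.\<close>
lemma projective_H:
  assumes X: "fdL X"
  shows "projective K \<Gamma> (H X)"
  unfolding projective_def
proof (intro ballI impI)
  fix M N :: "('e \<Rightarrow> 'e, nat \<Rightarrow> 'k) module" and g f
  assume M: "M \<in> fmod K \<Gamma>" and N: "N \<in> fmod K \<Gamma>" and g': "g \<in> lmod_hom \<Gamma> M N"
    and f': "f \<in> lmod_hom \<Gamma> (H X) N" and s: "g ` carrier M = carrier N"
  note lX = fdm_lmod[OF X] note lH = lmod_H[OF lX]
  have lM: "lmod \<Gamma> M" and lN: "lmod \<Gamma> N" using M N by (simp_all add: fmod_def fdG_lmod)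
  interpret M: lmod \<Gamma> M by (rule lM)
  interpret X: lmod \<Lambda> X by (rule lX)
  note g = lmod_homD(1)[OF g'] and f = lmod_homD(1)[OF f']
  have "\<exists>h \<in> lhom \<Gamma> (H X) M. \<forall>y \<in> carrier (H X). g (h y) = f (\<lambda>x\<in>carrier E. \<phi> (y x))"
    if "through_E X \<phi>" for \<phi>
    using that
  proof induction
    case zero
    show ?case
      by (rule bexI[OF _ lhom_zero_map[OF lM]])
        (use lhom_zero[OF lM lN g] lhom_zero[OF lH lN f] in \<open>simp only: hom_mod_simps simp_thms ball_simps, blast\<close>)
  next
    case (comp a b)
    let ?b = "\<lambda>x\<in>carrier E. b x"
    have b: "?b \<in> carrier (H X)" using lmod_hom_restrict[OF lmod_E comp(2)] by simp
    obtain m where m: "m \<in> carrier M" "g m = f ?b"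
      using s lhom_closed[OF f b] by (metis imageE)
    let ?h = "\<lambda>y. (\<lambda>x\<in>carrier E. a (y x)) \<odot>\<^bsub>M\<^esub> m"
    have aG: "(\<lambda>x\<in>carrier E. a (y x)) \<in> carrier \<Gamma>" if "y \<in> carrier (H X)" for y
      using lmod_hom_post[OF _ comp(1)] that by simp
    have hh: "?h \<in> lhom \<Gamma> (H X) M"
    proof (rule lhomI)
      fix y assume "y \<in> carrier (H X)"
      thus "?h y \<in> carrier M" using M.closed_ops[OF aG m(1)] by blast
    next
      fix y z assume yz: "y \<in> carrier (H X)" "z \<in> carrier (H X)"
      have "(\<lambda>x\<in>carrier E. a ((y \<oplus>\<^bsub>H X\<^esub> z) x)) =
          (\<lambda>x\<in>carrier E. a (y x)) \<oplus>\<^bsub>\<Gamma>\<^esub> (\<lambda>x\<in>carrier E. a (z x))"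
        using yz by (auto simp: lhom_add[OF comp(1)] lmod_hom_app intro!: restrict_ext)
      thus "?h (y \<oplus>\<^bsub>H X\<^esub> z) = ?h y \<oplus>\<^bsub>M\<^esub> ?h z"
        using M.smult_l_distr[OF aG[OF yz(1)] aG[OF yz(2)] m(1)] by (simp only:)
    next
      fix \<gamma> y assume \<gamma>: "\<gamma> \<in> carrier \<Gamma>" and y: "y \<in> carrier (H X)"
      have "(\<lambda>x\<in>carrier E. a ((\<gamma> \<odot>\<^bsub>H X\<^esub> y) x)) = \<gamma> \<otimes>\<^bsub>\<Gamma>\<^esub> (\<lambda>x\<in>carrier E. a (y x))"
        using y \<gamma> by (auto simp: compose_def lmod_hom_app intro!: restrict_ext)
      thus "?h (\<gamma> \<odot>\<^bsub>H X\<^esub> y) = \<gamma> \<odot>\<^bsub>M\<^esub> ?h y"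
        using M.smult_assoc1[OF \<gamma> aG[OF y] m(1)] by (simp only:)
    qed
    have "g (?h y) = f (\<lambda>x\<in>carrier E. b (a (y x)))" if y: "y \<in> carrier (H X)" for y
    proof -
      have "g (?h y) = f ((\<lambda>x\<in>carrier E. a (y x)) \<odot>\<^bsub>H X\<^esub> ?b)"
        using lhom_smult[OF g aG[OF y] m(1)] lhom_smult[OF f aG[OF y] b] m(2) by simp
      also have "(\<lambda>x\<in>carrier E. a (y x)) \<odot>\<^bsub>H X\<^esub> ?b = (\<lambda>x\<in>carrier E. b (a (y x)))"
        using y lhom_closed[OF comp(1)] by (auto simp: compose_def lmod_hom_app intro!: restrict_ext)
      finally show ?thesis .
    qed
    thus ?case by (intro bexI[of _ ?h, OF _ hh] ballI)
  next
    case (plus \<phi> \<psi>)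
    obtain h h' where h: "h \<in> lhom \<Gamma> (H X) M" "h' \<in> lhom \<Gamma> (H X) M"
      "\<And>y. y \<in> carrier (H X) \<Longrightarrow> g (h y) = f (\<lambda>x\<in>carrier E. \<phi> (y x))"
      "\<And>y. y \<in> carrier (H X) \<Longrightarrow> g (h' y) = f (\<lambda>x\<in>carrier E. \<psi> (y x))"
      using plus.IH by blast
    note hom = through_E_hom[OF lX plus(1)] through_E_hom[OF lX plus(2)]
    have "g (h y \<oplus>\<^bsub>M\<^esub> h' y) = f (\<lambda>x\<in>carrier E. \<phi> (y x) \<oplus>\<^bsub>X\<^esub> \<psi> (y x))" if y: "y \<in> carrier (H X)" for y
    proof -
      have c: "(\<lambda>x\<in>carrier E. \<phi> (y x)) \<in> carrier (H X)" "(\<lambda>x\<in>carrier E. \<psi> (y x)) \<in> carrier (H X)"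
        using lmod_hom_post[OF _ hom(1)] lmod_hom_post[OF _ hom(2)] y by auto
      have "(\<lambda>x\<in>carrier E. \<phi> (y x) \<oplus>\<^bsub>X\<^esub> \<psi> (y x)) =
          (\<lambda>x\<in>carrier E. \<phi> (y x)) \<oplus>\<^bsub>H X\<^esub> (\<lambda>x\<in>carrier E. \<psi> (y x))"
        by (auto intro!: restrict_ext)
      thus ?thesis
        using lhom_add[OF f c] lhom_add[OF g lhom_closed[OF h(1) y] lhom_closed[OF h(2) y]] h(3,4)[OF y]
        by (simp only:)
    qed
    thus ?case by (intro bexI[OF _ lhom_plus[OF lM h(1,2)]] ballI)
  next
    case (congr \<phi> \<psi>)
    have "(\<lambda>x\<in>carrier E. \<psi> (y x)) = (\<lambda>x\<in>carrier E. \<phi> (y x))" if "y \<in> carrier (H X)" for y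
      using that congr(2) by (auto simp: lmod_hom_app intro!: restrict_ext)
    thus ?case using congr.IH by auto
  qed
  from this[OF through_E_id[OF X]] obtain h where h: "h \<in> lhom \<Gamma> (H X) M"
    "\<And>y. y \<in> carrier (H X) \<Longrightarrow> g (h y) = f (\<lambda>x\<in>carrier E. y x)" by blast
  have "(\<lambda>x\<in>carrier E. y x) = y" if "y \<in> carrier (H X)" for y
    using that by (auto simp: lmod_hom_def extensional_def fun_eq_iff)
  hence "\<forall>y \<in> carrier (H X). g ((\<lambda>y\<in>carrier (H X). h y) y) = f y" using h(2) by simp
  thus "\<exists>h\<in>lmod_hom \<Gamma> (H X) M. \<forall>x\<in>carrier (H X). g (h x) = f x"
    using lmod_hom_restrict[OF lH h(1)] by blast
qed

text \<open>Every finite-dimensional module is generated by finitely many elements, hence a quotient of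
  \<open>H\<close> of a power of \<open>E\<close>, which is a free module.\<close>
lemma H_cover:
  assumes M: "fdG (M :: ('e \<Rightarrow> 'e, 'm) module)"
  shows "\<exists>(X :: ('a, 'm \<Rightarrow> 'e) module) \<pi>. fdL X \<and> lepi \<Gamma> (H X) M \<pi>"
proof -
  interpret G: fda K \<Gamma> by (rule fda_G)
  interpret M: lmod \<Gamma> M by (rule fdG_lmod[OF M])
  interpret E: lmod \<Lambda> E by (rule lmod_E)
  obtain B where B: "finite B" "B \<subseteq> carrier M"
    "\<And>W. W \<subseteq> carrier M \<Longrightarrow> G.scal_closed M W \<Longrightarrow> B \<subseteq> W \<Longrightarrow> W = carrier M"
    using M G.fdm_iff[OF M.lmod_axioms] by blast
  \<comment> \<open>The generators \<open>b\<close> of \<open>M\<close> correspond to the copies of \<open>E\<close>: the component \<open>c f b\<close> of \<open>f\<close> acts on \<open>b\<close>.\<close>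
  define X where "X = pow_mod B E"
  have fX: "fdL X" unfolding X_def by (rule fdm_pow[OF B(1) fdE])
  note lX = fdm_lmod[OF fX] note lH = lmod_H[OF lX]
  interpret H: lmod \<Gamma> "H X" by (rule lH)
  define c where "c f b = (\<lambda>x\<in>carrier E. f x b)" for f :: "'e \<Rightarrow> 'm \<Rightarrow> 'e" and b
  have cG: "c f b \<in> carrier \<Gamma>" if f: "f \<in> lmod_hom \<Lambda> E X" and b: "b \<in> B" for f b
  proof -
    have "(\<lambda>x. f x b) \<in> lhom \<Lambda> E E"
      using lmod_hom_app[OF f] b by (intro lhomI) (auto simp: X_def pow_mod_def)
    from lmod_hom_restrict[OF lmod_E this] show ?thesis by (simp add: c_def)
  qed
  have cadd: "c (f \<oplus>\<^bsub>H X\<^esub> g) b = c f b \<oplus>\<^bsub>\<Gamma>\<^esub> c g b" if "b \<in> B" for f g b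
    using that by (auto simp: c_def X_def pow_mod_def intro!: restrict_ext)
  have csm: "c (\<gamma> \<odot>\<^bsub>H X\<^esub> f) b = \<gamma> \<otimes>\<^bsub>\<Gamma>\<^esub> c f b" if "\<gamma> \<in> carrier \<Gamma>" for \<gamma> f b
    using that by (auto simp: c_def compose_def lmod_hom_app intro!: restrict_ext)
  have cl: "c f b \<odot>\<^bsub>M\<^esub> b \<in> carrier M" if "f \<in> lmod_hom \<Lambda> E X" "b \<in> B" for f b
    using cG[OF that] B(2) that(2) by blast
  define \<pi> where "\<pi> f = finsum M (\<lambda>b. c f b \<odot>\<^bsub>M\<^esub> b) B" for f
  have \<pi>: "\<pi> \<in> lhom \<Gamma> (H X) M"
  proof (rule lhomI)
    fix f assume "f \<in> carrier (H X)"
    thus "\<pi> f \<in> carrier M" unfolding \<pi>_def using cl by (intro M.finsum_closed) auto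
  next
    fix f g assume fg: "f \<in> carrier (H X)" "g \<in> carrier (H X)"
    have "\<pi> (f \<oplus>\<^bsub>H X\<^esub> g) = finsum M (\<lambda>b. c f b \<odot>\<^bsub>M\<^esub> b \<oplus>\<^bsub>M\<^esub> c g b \<odot>\<^bsub>M\<^esub> b) B"
      unfolding \<pi>_def
    proof (rule M.finsum_cong'[OF refl])
      show "(\<lambda>b. c f b \<odot>\<^bsub>M\<^esub> b \<oplus>\<^bsub>M\<^esub> c g b \<odot>\<^bsub>M\<^esub> b) \<in> B \<rightarrow> carrier M" using cl fg by auto
      fix b assume b: "b \<in> B"
      show "c (f \<oplus>\<^bsub>H X\<^esub> g) b \<odot>\<^bsub>M\<^esub> b = c f b \<odot>\<^bsub>M\<^esub> b \<oplus>\<^bsub>M\<^esub> c g b \<odot>\<^bsub>M\<^esub> b"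
        unfolding cadd[OF b] by (rule M.smult_l_distr) (use cG b fg B(2) in auto)
    qed
    also have "\<dots> = \<pi> f \<oplus>\<^bsub>M\<^esub> \<pi> g"
      unfolding \<pi>_def using cl fg by (intro M.finsum_addf) auto
    finally show "\<pi> (f \<oplus>\<^bsub>H X\<^esub> g) = \<pi> f \<oplus>\<^bsub>M\<^esub> \<pi> g" .
  next
    fix \<gamma> f assume \<gamma>: "\<gamma> \<in> carrier \<Gamma>" and f: "f \<in> carrier (H X)"
    have "\<pi> (\<gamma> \<odot>\<^bsub>H X\<^esub> f) = finsum M (\<lambda>b. \<gamma> \<odot>\<^bsub>M\<^esub> (c f b \<odot>\<^bsub>M\<^esub> b)) B"
      unfolding \<pi>_def
    proof (rule M.finsum_cong'[OF refl])
      show "(\<lambda>b. \<gamma> \<odot>\<^bsub>M\<^esub> (c f b \<odot>\<^bsub>M\<^esub> b)) \<in> B \<rightarrow> carrier M"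
        using cl f M.closed_ops[OF \<gamma>] by auto
      fix b assume b: "b \<in> B"
      show "c (\<gamma> \<odot>\<^bsub>H X\<^esub> f) b \<odot>\<^bsub>M\<^esub> b = \<gamma> \<odot>\<^bsub>M\<^esub> (c f b \<odot>\<^bsub>M\<^esub> b)"
        unfolding csm[OF \<gamma>] by (rule M.smult_assoc1[OF \<gamma>]) (use cG b f B(2) in auto)
    qed
    also have "\<dots> = \<gamma> \<odot>\<^bsub>M\<^esub> \<pi> f"
      unfolding \<pi>_def using cl f by (intro M.finsum_smult[OF B(1) _ \<gamma>, symmetric]) auto
    finally show "\<pi> (\<gamma> \<odot>\<^bsub>H X\<^esub> f) = \<gamma> \<odot>\<^bsub>M\<^esub> \<pi> f" .
  qed
  have "\<pi> ` carrier (H X) = carrier M"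
  proof (rule B(3))
    have im: "lsubmodule (\<pi> ` carrier (H X)) \<Gamma> M"
      by (rule lsub_image[OF lH M.lmod_axioms \<pi> H.lsub_carrier])
    show "\<pi> ` carrier (H X) \<subseteq> carrier M" by (rule lsub_subset[OF im])
    show "G.scal_closed M (\<pi> ` carrier (H X))"
      unfolding G.scal_closed_def
      using lsub_zero[OF im] lsub_add[OF im] lsub_smult[OF im G.scalar_closed] by blast
    show "B \<subseteq> \<pi> ` carrier (H X)"
    proof
      fix b assume b: "b \<in> B"
      define f where "f = (\<lambda>x\<in>carrier E. \<lambda>j\<in>B. if b = j then x else \<zero>\<^bsub>E\<^esub>)"
      have f: "f \<in> carrier (H X)"
      proof -
        have "(\<lambda>x. \<lambda>j\<in>B. if b = j then x else \<zero>\<^bsub>E\<^esub>) \<in> lhom \<Lambda> E X"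
          by (rule lhomI) (auto simp: X_def pow_mod_def intro!: restrict_ext)
        from lmod_hom_restrict[OF lmod_E this] show ?thesis by (simp add: f_def)
      qed
      have "\<pi> f = finsum M (\<lambda>j. if b = j then (\<lambda>x. x) j else \<zero>\<^bsub>M\<^esub>) B"
        unfolding \<pi>_def
      proof (rule M.finsum_cong'[OF refl])
        show "(\<lambda>j. if b = j then (\<lambda>x. x) j else \<zero>\<^bsub>M\<^esub>) \<in> B \<rightarrow> carrier M" using B(2) by auto
        fix j assume j: "j \<in> B"
        have "c f j = (if b = j then \<one>\<^bsub>\<Gamma>\<^esub> else \<zero>\<^bsub>\<Gamma>\<^esub>)"
          using j by (auto simp: c_def f_def intro!: restrict_ext)
        thus "c f j \<odot>\<^bsub>M\<^esub> j = (if b = j then (\<lambda>x. x) j else \<zero>\<^bsub>M\<^esub>)"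
          using M.smult_one[of j] M.zero_smult[of j] j B(2) by auto
      qed
      also have "\<dots> = b" by (rule M.finsum_singleton[OF b B(1)]) (use B(2) in auto)
      finally show "b \<in> \<pi> ` carrier (H X)" using f by (metis imageI)
    qed
  qed
  thus ?thesis using fX \<pi> by (auto simp: lepi_def)
qed

text \<open>An epimorphism from some \<open>H X\<close> onto a projective module splits.\<close>
lemma projective_section:
  assumes Q: "fdG (Q :: ('e \<Rightarrow> 'e, nat \<Rightarrow> 'k) module)" and pr: "projective K \<Gamma> Q"
  shows "\<exists>(X :: ('a, (nat \<Rightarrow> 'k) \<Rightarrow> 'e) module) \<pi> \<sigma>. fdL X \<and> \<pi> \<in> lhom \<Gamma> (H X) Q \<and> \<sigma> \<in> lhom \<Gamma> Q (H X) \<and>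
    (\<forall>q \<in> carrier Q. \<pi> (\<sigma> q) = q)"
proof -
  obtain X :: "('a, (nat \<Rightarrow> 'k) \<Rightarrow> 'e) module" and \<pi> where X: "fdL X" "lepi \<Gamma> (H X) Q \<pi>"
    using H_cover[OF Q] by blast
  note lH = lmod_H[OF fdm_lmod[OF X(1)]] note lQ = fdG_lmod[OF Q]
  obtain N where N: "N \<in> fmod K \<Gamma>" "lmod_iso \<Gamma> (H X) N"
    using fmod_representative[OF fd_auslander_algebra[OF fdE] fdm_H[OF X(1)]] by blast
  have lN: "lmod \<Gamma> N" using N(1) by (simp add: fmod_def fdG_lmod)
  obtain g where g: "g \<in> lhom \<Gamma> N (H X)" "bij_betw g (carrier N) (carrier (H X))"
    using lmod_iso_sym[OF lH lN N(2)] unfolding lmod_iso_iff[OF lN] by blast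
  let ?p = "\<lambda>x\<in>carrier N. \<pi> (g x)"
  have p: "?p \<in> lmod_hom \<Gamma> N Q"
    by (rule lmod_hom_restrict[OF lN lhom_comp[OF g(1) lepiD(1)[OF X(2)]]])
  have s: "?p ` carrier N = carrier Q"
  proof -
    have "?p ` carrier N = \<pi> ` g ` carrier N" by auto
    thus ?thesis using g(2) lepiD(2)[OF X(2)] by (simp add: bij_betw_def)
  qed
  have "(\<lambda>x\<in>carrier Q. x) \<in> lmod_hom \<Gamma> Q Q" by (rule lmod_hom_restrict[OF lQ lhom_id])
  from projectiveD[OF pr N(1) _ p this s] Q
  obtain h where h: "h \<in> lmod_hom \<Gamma> Q N" "\<And>x. x \<in> carrier Q \<Longrightarrow> ?p (h x) = x"
    unfolding fmod_def by auto
  have "\<pi> (g (h q)) = q" if "q \<in> carrier Q" for q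
    using h(2)[OF that] lmod_hom_app(1)[OF h(1) that] by simp
  thus ?thesis
    using X(1) lepiD(1)[OF X(2)] lhom_comp[OF lmod_homD(1)[OF h(1)] g(1)] by blast
qed

lemma tfree_projective:
  assumes Q: "fdG (Q :: ('e \<Rightarrow> 'e, nat \<Rightarrow> 'k) module)" and pr: "projective K \<Gamma> Q"
  shows "tfree Q"
proof -
  obtain X :: "('a, (nat \<Rightarrow> 'k) \<Rightarrow> 'e) module" and \<pi> \<sigma> where X: "fdL X"
    and \<sigma>: "\<sigma> \<in> lhom \<Gamma> Q (H X)" "\<And>q. q \<in> carrier Q \<Longrightarrow> \<pi> (\<sigma> q) = q"
    using projective_section[OF Q pr] by blast
  have "inj_on \<sigma> (carrier Q)" by (rule inj_on_inverseI[of _ \<pi>]) (rule \<sigma>(2))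
  thus ?thesis
    using tfree_inj[OF fdG_lmod[OF Q] lmod_H[OF fdm_lmod[OF X]] \<sigma>(1)] tfree_H[OF fdm_lmod[OF X]] by blast
qed

text \<open>
  A projective submodule \<open>Q1\<close> of a torsion-free module \<open>Q0\<close> is closed: if all \<open>elem E s e\<close> map \<open>q\<close>
  into \<open>Q1\<close>, then these values determine a homomorphism \<open>c : E \<rightarrow> X\<close>, where \<open>Q1\<close> is a retract of
  \<open>H X\<close>, and the image of \<open>c\<close> in \<open>Q1\<close> agrees with \<open>q\<close>.
\<close>
lemma tclosed_projective:
  assumes Q0: "lmod \<Gamma> Q0" and tf: "tfree Q0"
    and Q1: "fdG (Q1 :: ('e \<Rightarrow> 'e, nat \<Rightarrow> 'k) module)" and pr: "projective K \<Gamma> Q1"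
    and d: "d \<in> lhom \<Gamma> Q1 Q0" and inj: "inj_on d (carrier Q1)"
  shows "tclosed Q0 (d ` carrier Q1)"
  unfolding tclosed_def
proof (intro ballI impI)
  fix q assume q: "q \<in> carrier Q0"
    and *: "\<forall>s\<in>dual. \<forall>e\<in>carrier E. elem E s e \<odot>\<^bsub>Q0\<^esub> q \<in> d ` carrier Q1"
  obtain X :: "('a, (nat \<Rightarrow> 'k) \<Rightarrow> 'e) module" and \<pi> \<sigma> where fX: "fdL X"
    and \<pi>: "\<pi> \<in> lhom \<Gamma> (H X) Q1" and \<sigma>: "\<sigma> \<in> lhom \<Gamma> Q1 (H X)"
    and \<pi>\<sigma>: "\<And>q. q \<in> carrier Q1 \<Longrightarrow> \<pi> (\<sigma> q) = q"
    using projective_section[OF Q1 pr] by blast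
  note lX = fdm_lmod[OF fX] note lQ1 = fdG_lmod[OF Q1]
  interpret X: lmod \<Lambda> X by (rule lX)
  interpret E: lmod \<Lambda> E by (rule lmod_E)
  interpret Q0: lmod \<Gamma> Q0 by (rule Q0)
  interpret Q1: lmod \<Gamma> Q1 by (rule lQ1)
  have "\<exists>p. \<forall>s\<in>dual. \<forall>e\<in>carrier E. p s e \<in> carrier Q1 \<and> d (p s e) = elem E s e \<odot>\<^bsub>Q0\<^esub> q"
    by (rule exI[of _ "\<lambda>s e. inv_into (carrier Q1) d (elem E s e \<odot>\<^bsub>Q0\<^esub> q)"])
      (use * in \<open>auto simp: inv_into_into f_inv_into_f\<close>)
  then obtain p where p: "\<And>s e. s \<in> dual \<Longrightarrow> e \<in> carrier E \<Longrightarrow> p s e \<in> carrier Q1"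
    "\<And>s e. s \<in> dual \<Longrightarrow> e \<in> carrier E \<Longrightarrow> d (p s e) = elem E s e \<odot>\<^bsub>Q0\<^esub> q" by blast
  have p_eq: "p s e = y" if "s \<in> dual" "e \<in> carrier E" "y \<in> carrier Q1" "d y = elem E s e \<odot>\<^bsub>Q0\<^esub> q" for s e y
    using inj_onD[OF inj, of "p s e" y] p[OF that(1,2)] that(3,4) by simp
  \<comment> \<open>The map \<open>w s e : E \<rightarrow> X\<close> is the candidate for \<open>elem X s (c e)\<close>, where \<open>c\<close> is the homomorphism to be
    found.\<close>
  define w where "w s e = \<sigma> (p s e)" for s e
  have wH: "w s e \<in> lmod_hom \<Lambda> E X" if "s \<in> dual" "e \<in> carrier E" for s e
    using lhom_closed[OF \<sigma> p(1)[OF that]] by (simp add: w_def)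
  have w_add: "w s (e \<oplus>\<^bsub>E\<^esub> e') x = w s e x \<oplus>\<^bsub>X\<^esub> w s e' x"
    if s: "s \<in> dual" and e: "e \<in> carrier E" "e' \<in> carrier E" and x: "x \<in> carrier E" for s e e' x
  proof -
    have eq: "elem E s (e \<oplus>\<^bsub>E\<^esub> e') = elem E s e \<oplus>\<^bsub>\<Gamma>\<^esub> elem E s e'"
      using elem_add[OF lmod_E s e] by simp
    have "p s (e \<oplus>\<^bsub>E\<^esub> e') = p s e \<oplus>\<^bsub>Q1\<^esub> p s e'"
    proof (rule p_eq[OF s])
      show "d (p s e \<oplus>\<^bsub>Q1\<^esub> p s e') = elem E s (e \<oplus>\<^bsub>E\<^esub> e') \<odot>\<^bsub>Q0\<^esub> q"
        unfolding eq using lhom_add[OF d p(1)[OF s e(1)] p(1)[OF s e(2)]] p(2)[OF s] e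
          Q0.smult_l_distr[OF elem_G[OF s e(1)] elem_G[OF s e(2)] q] by (simp only:)
    qed (use e p(1)[OF s] in auto)
    hence "w s (e \<oplus>\<^bsub>E\<^esub> e') = w s e \<oplus>\<^bsub>H X\<^esub> w s e'"
      unfolding w_def using lhom_add[OF \<sigma> p(1)[OF s e(1)] p(1)[OF s e(2)]] by (simp only:)
    thus ?thesis using x by simp
  qed
  have w_cong: "w s e = w s' e'" if "elem E s e = elem E s' e'" "s \<in> dual" "e \<in> carrier E" "s' \<in> dual" "e' \<in> carrier E"
    for s e s' e'
    using p_eq[OF that(2,3) p(1)[OF that(4,5)]] p(2)[OF that(4,5)] that(1) by (simp add: w_def)
  have w_comp: "w (\<lambda>x. s (\<gamma> x)) e x = w s e (\<gamma> x)"
    if s: "s \<in> dual" and \<gamma>: "\<gamma> \<in> lmod_hom \<Lambda> E E" and e: "e \<in> carrier E" and x: "x \<in> carrier E" for s \<gamma> e x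
  proof -
    have \<gamma>G: "\<gamma> \<in> carrier \<Gamma>" using \<gamma> by simp
    have eq: "elem E (\<lambda>x. s (\<gamma> x)) e = \<gamma> \<otimes>\<^bsub>\<Gamma>\<^esub> elem E s e"
      unfolding auslander_algebra_simps elem_def compose_def
      by (rule restrict_ext) (simp add: lmod_hom_app(1)[OF \<gamma>])
    have "p (\<lambda>x. s (\<gamma> x)) e = \<gamma> \<odot>\<^bsub>Q1\<^esub> p s e"
    proof (rule p_eq[OF dual_comp[OF s \<gamma>] e Q1.closed_ops[OF \<gamma>G p(1)[OF s e]]])
      show "d (\<gamma> \<odot>\<^bsub>Q1\<^esub> p s e) = elem E (\<lambda>x. s (\<gamma> x)) e \<odot>\<^bsub>Q0\<^esub> q"
        unfolding eq using lhom_smult[OF d \<gamma>G p(1)[OF s e]] p(2)[OF s e]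
          Q0.smult_assoc1[OF \<gamma>G elem_G[OF s e] q] by (simp only:)
    qed
    hence "w (\<lambda>x. s (\<gamma> x)) e = \<gamma> \<odot>\<^bsub>H X\<^esub> w s e"
      unfolding w_def using lhom_smult[OF \<sigma> \<gamma>G p(1)[OF s e]] by (simp only:)
    thus ?thesis using x by (simp add: compose_eq)
  qed
  have w_scal: "w (\<lambda>x. s x \<otimes>\<^bsub>\<Lambda>\<^esub> a) e = w s (a \<odot>\<^bsub>E\<^esub> e)"
    if "s \<in> dual" "a \<in> carrier \<Lambda>" "e \<in> carrier E" for s a e
    by (rule w_cong) (use elem_scal[OF lmod_E] dual_mult that in auto)
  \<comment> \<open>The compatibility that allows to define \<open>c\<close> on \<open>\<Lambda> e\<close>: on the elements \<open>s' x'\<close> of \<open>\<Lambda>\<close>, which generate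
    it as a left ideal, \<open>c (s' x' e)\<close> is \<open>w s' e x'\<close>.\<close>
  have key: "s x \<odot>\<^bsub>X\<^esub> w s' e x' = w s (s' x' \<odot>\<^bsub>E\<^esub> e) x"
    if s: "s \<in> dual" and s': "s' \<in> dual" and e: "e \<in> carrier E" and x: "x \<in> carrier E" "x' \<in> carrier E"
    for s s' e x x'
  proof -
    have a: "s x \<in> carrier \<Lambda>" "s' x' \<in> carrier \<Lambda>"
      using lhom_closed[OF s x(1)] lhom_closed[OF s' x(2)] by simp_all
    let ?\<gamma> = "elem E s x'"
    have \<gamma>: "?\<gamma> \<in> lmod_hom \<Lambda> E E" by (rule elem_hom[OF lmod_E s x(2)])
    have "s x \<odot>\<^bsub>X\<^esub> w s' e x' = w s' e (?\<gamma> x)"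
      using lmod_hom_app(3)[OF wH[OF s' e] a(1) x(2)] x by (simp add: elem_def)
    also have "\<dots> = w (\<lambda>x. s' (?\<gamma> x)) e x" by (rule w_comp[OF s' \<gamma> e x(1), symmetric])
    also have "w (\<lambda>x. s' (?\<gamma> x)) e = w s (s' x' \<odot>\<^bsub>E\<^esub> e)"
    proof (rule w_cong[OF _ dual_comp[OF s' \<gamma>] e s])
      have "elem E (\<lambda>x. s' (?\<gamma> x)) e = elem E (\<lambda>x. s x \<otimes>\<^bsub>\<Lambda>\<^esub> s' x') e"
        using lhom_smult[OF s' _ x(2)] lhom_closed[OF s] by (auto simp: elem_def intro!: restrict_ext)
      thus "elem E (\<lambda>x. s' (?\<gamma> x)) e = elem E s (s' x' \<odot>\<^bsub>E\<^esub> e)"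
        using elem_scal[OF lmod_E s a(2) e] by simp
    qed (use a e in simp)
    finally show ?thesis .
  qed
  \<comment> \<open>The \<open>a\<close> for which \<open>c (a e)\<close> exists form a left ideal, and by \<open>key\<close> it contains the trace of \<open>E\<close>.\<close>
  have "\<exists>y \<in> carrier X. \<forall>s\<in>dual. \<forall>x\<in>carrier E. s x \<odot>\<^bsub>X\<^esub> y = w s e x" if e: "e \<in> carrier E" for e
  proof -
    let ?R = "regular_module \<Lambda>"
    interpret R: lmod \<Lambda> ?R by (rule lmod_regular)
    let ?I = "{a \<in> carrier \<Lambda>. \<exists>y \<in> carrier X. \<forall>s\<in>dual. \<forall>x\<in>carrier E. s x \<odot>\<^bsub>X\<^esub> y = w s (a \<odot>\<^bsub>E\<^esub> e) x}"
    have sc: "s x \<in> carrier \<Lambda>" if "s \<in> dual" "x \<in> carrier E" for s x using lhom_closed[OF that] by simp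
    have "lsubmodule ?I \<Lambda> ?R"
    proof (rule R.lsubmoduleI)
      have "s x \<odot>\<^bsub>X\<^esub> \<zero>\<^bsub>X\<^esub> = w s (\<zero>\<^bsub>\<Lambda>\<^esub> \<odot>\<^bsub>E\<^esub> e) x" if s: "s \<in> dual" and x: "x \<in> carrier E" for s x
        using w_add[OF s _ _ x, of "\<zero>\<^bsub>E\<^esub>" "\<zero>\<^bsub>E\<^esub>"] lmod_hom_app(1)[OF wH[OF s], of "\<zero>\<^bsub>E\<^esub>" x] x sc[OF s x] e
        by simp
      thus "\<zero>\<^bsub>?R\<^esub> \<in> ?I" using X.M.zero_closed by auto
    next
      fix a b assume "a \<in> ?I" "b \<in> ?I"
      then obtain y z where ab: "a \<in> carrier \<Lambda>" "b \<in> carrier \<Lambda>" and yz: "y \<in> carrier X" "z \<in> carrier X"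
        "\<And>s x. s \<in> dual \<Longrightarrow> x \<in> carrier E \<Longrightarrow> s x \<odot>\<^bsub>X\<^esub> y = w s (a \<odot>\<^bsub>E\<^esub> e) x"
        "\<And>s x. s \<in> dual \<Longrightarrow> x \<in> carrier E \<Longrightarrow> s x \<odot>\<^bsub>X\<^esub> z = w s (b \<odot>\<^bsub>E\<^esub> e) x" by blast
      have "s x \<odot>\<^bsub>X\<^esub> (y \<oplus>\<^bsub>X\<^esub> z) = w s ((a \<oplus>\<^bsub>\<Lambda>\<^esub> b) \<odot>\<^bsub>E\<^esub> e) x" if "s \<in> dual" "x \<in> carrier E" for s x
        using w_add[OF that(1) _ _ that(2), of "a \<odot>\<^bsub>E\<^esub> e" "b \<odot>\<^bsub>E\<^esub> e"] ab e sc[OF that] yz that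
        by (simp add: X.smult_r_distr E.smult_l_distr)
      moreover have "a \<oplus>\<^bsub>\<Lambda>\<^esub> b \<in> carrier \<Lambda>" using ab by simp
      moreover have "y \<oplus>\<^bsub>X\<^esub> z \<in> carrier X" using yz by simp
      ultimately show "a \<oplus>\<^bsub>?R\<^esub> b \<in> ?I" by auto
    next
      fix b a assume b: "b \<in> carrier \<Lambda>" and "a \<in> ?I"
      then obtain y where a: "a \<in> carrier \<Lambda>" and y: "y \<in> carrier X"
        "\<And>s x. s \<in> dual \<Longrightarrow> x \<in> carrier E \<Longrightarrow> s x \<odot>\<^bsub>X\<^esub> y = w s (a \<odot>\<^bsub>E\<^esub> e) x" by blast
      have "s x \<odot>\<^bsub>X\<^esub> (b \<odot>\<^bsub>X\<^esub> y) = w s ((b \<otimes>\<^bsub>\<Lambda>\<^esub> a) \<odot>\<^bsub>E\<^esub> e) x" if s: "s \<in> dual" and x: "x \<in> carrier E" for s x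
        using y(2)[OF dual_mult[OF s b] x] w_scal[OF s b, of "a \<odot>\<^bsub>E\<^esub> e"] a b e y(1) sc[OF s x]
        by (simp add: X.smult_assoc1 E.smult_assoc1)
      moreover have "b \<otimes>\<^bsub>\<Lambda>\<^esub> a \<in> carrier \<Lambda>" using a b by simp
      moreover have "b \<odot>\<^bsub>X\<^esub> y \<in> carrier X" using b y by simp
      ultimately show "b \<odot>\<^bsub>?R\<^esub> a \<in> ?I" by auto
    qed auto
    moreover have "s' x' \<in> ?I" if "s' \<in> dual" "x' \<in> carrier E" for s' x'
      using key[OF _ that(1) e _ that(2)] lmod_hom_app(1)[OF wH[OF that(1) e] that(2)] sc[OF that] by blast
    ultimately have "\<one>\<^bsub>\<Lambda>\<^esub> \<in> ?I" by (rule trace_ideal)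
    thus ?thesis using e by (auto simp: E.smult_one)
  qed
  then obtain c where c: "\<And>e. e \<in> carrier E \<Longrightarrow> c e \<in> carrier X"
    "\<And>e s x. e \<in> carrier E \<Longrightarrow> s \<in> dual \<Longrightarrow> x \<in> carrier E \<Longrightarrow> s x \<odot>\<^bsub>X\<^esub> c e = w s e x" by metis
  have sc: "s x \<in> carrier \<Lambda>" if "s \<in> dual" "x \<in> carrier E" for s x using lhom_closed[OF that] by simp
  have ch: "c \<in> lhom \<Lambda> E X"
  proof (rule lhomI)
    fix e e' assume e: "e \<in> carrier E" "e' \<in> carrier E"
    show "c (e \<oplus>\<^bsub>E\<^esub> e') = c e \<oplus>\<^bsub>X\<^esub> c e'"
      by (rule trace_eq[OF lX]) (use e c sc w_add in \<open>simp_all add: X.smult_r_distr\<close>)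
  next
    fix a e assume a: "a \<in> carrier \<Lambda>" and e: "e \<in> carrier E"
    show "c (a \<odot>\<^bsub>E\<^esub> e) = a \<odot>\<^bsub>X\<^esub> c e"
    proof (rule trace_eq[OF lX])
      fix s x assume s: "s \<in> dual" and x: "x \<in> carrier E"
      have "s x \<odot>\<^bsub>X\<^esub> (a \<odot>\<^bsub>X\<^esub> c e) = (s x \<otimes>\<^bsub>\<Lambda>\<^esub> a) \<odot>\<^bsub>X\<^esub> c e"
        using c(1)[OF e] a sc[OF s x] by (simp add: X.smult_assoc1)
      also have "\<dots> = w s (a \<odot>\<^bsub>E\<^esub> e) x" using c(2)[OF e dual_mult[OF s a] x] w_scal[OF s a e] by simp
      finally show "s x \<odot>\<^bsub>X\<^esub> c (a \<odot>\<^bsub>E\<^esub> e) = s x \<odot>\<^bsub>X\<^esub> (a \<odot>\<^bsub>X\<^esub> c e)" using c(2) a e s x by simp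
    qed (use c a e in auto)
  qed (rule c)
  let ?c = "\<lambda>x\<in>carrier E. c x"
  have cH: "?c \<in> lmod_hom \<Lambda> E X" by (rule lmod_hom_restrict[OF lmod_E ch])
  have \<pi>c: "\<pi> ?c \<in> carrier Q1" using lhom_closed[OF \<pi>] cH by simp
  have dc: "d (\<pi> ?c) \<in> carrier Q0" by (rule lhom_closed[OF d \<pi>c])
  have "elem E s e \<odot>\<^bsub>Q0\<^esub> d (\<pi> ?c) = elem E s e \<odot>\<^bsub>Q0\<^esub> q" if s: "s \<in> dual" and e: "e \<in> carrier E" for s e
  proof -
    have "elem E s e \<odot>\<^bsub>H X\<^esub> ?c = w s e"
      unfolding elem_smult[OF cH s e]
      by (rule lmod_hom_eqI[OF elem_hom[OF lX s] wH[OF s e]]) (use c e s in \<open>auto simp: elem_def\<close>)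
    hence "elem E s e \<odot>\<^bsub>Q1\<^esub> \<pi> ?c = p s e"
      using lhom_smult[OF \<pi> elem_G[OF s e], of ?c] cH \<pi>\<sigma>[OF p(1)[OF s e]] unfolding w_def by simp
    thus ?thesis using lhom_smult[OF d elem_G[OF s e] \<pi>c] p(2)[OF s e] by simp
  qed
  hence "elem E s e \<odot>\<^bsub>Q0\<^esub> (q \<ominus>\<^bsub>Q0\<^esub> d (\<pi> ?c)) = \<zero>\<^bsub>Q0\<^esub>" if "s \<in> dual" "e \<in> carrier E" for s e
    using Q0.smult_r_distr[OF elem_G[OF that], of "q \<ominus>\<^bsub>Q0\<^esub> d (\<pi> ?c)" "d (\<pi> ?c)"]
      Q0.diff_add_cancel[OF q dc] Q0.closed_ops[OF elem_G[OF that]] q dc that by simp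
  hence "q \<ominus>\<^bsub>Q0\<^esub> d (\<pi> ?c) \<in> {\<zero>\<^bsub>Q0\<^esub>}"
    using tclosedD[OF tf Q0.minus_closed[OF q dc]] by blast
  hence "q = d (\<pi> ?c)" using q dc by simp
  thus "q \<in> d ` carrier Q1" using \<pi>c by blast
qed

lemma proj_dim_le_1_iff:
  "proj_dim K \<Gamma> M \<le> 1 \<longleftrightarrow> (\<exists>n X d. n \<le> 1 \<and> projective_resolution K \<Gamma> M n X d)"
proof
  let ?S = "{n. \<exists>X d. projective_resolution K \<Gamma> M n X d}"
  { assume le: "proj_dim K \<Gamma> M \<le> 1"
    have "?S \<noteq> {}"
    proof
      assume "?S = {}"
      hence "proj_dim K \<Gamma> M = \<infinity>" by (simp add: proj_dim_def Inf_enat_def)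
      thus False using le by simp
    qed
    hence "Inf (enat ` ?S) \<in> enat ` ?S"
      unfolding Inf_enat_def using LeastI_ex[of "\<lambda>x. x \<in> enat ` ?S"] by auto
    then obtain n where n: "n \<in> ?S" "proj_dim K \<Gamma> M = enat n" unfolding proj_dim_def by blast
    hence "n \<le> 1" using le by (simp add: one_enat_def)
    thus "\<exists>n X d. n \<le> 1 \<and> projective_resolution K \<Gamma> M n X d" using n(1) by blast }
  { assume "\<exists>n X d. n \<le> 1 \<and> projective_resolution K \<Gamma> M n X d"
    then obtain n where n: "n \<le> 1" "n \<in> ?S" by blast
    have "proj_dim K \<Gamma> M \<le> enat n" unfolding proj_dim_def by (rule Inf_lower) (use n in blast)
    also have "\<dots> \<le> 1" using n(1) by (simp add: one_enat_def)
    finally show "proj_dim K \<Gamma> M \<le> 1" . }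
qed

text \<open>The kernel of the first map of a projective resolution of length one is projective, hence closed.\<close>
lemma torsl_imp_tfree:
  assumes "M \<in> torsl K \<Gamma>"
  shows "tfree M"
proof -
  have "fdG M" using assms by (simp add: torsl_def fmod_def)
  note lM = fdG_lmod[OF this]
  obtain n X d where n: "n \<le> 1" and res: "projective_resolution K \<Gamma> M n X d"
    using assms proj_dim_le_1_iff[of M] unfolding torsl_def by blast
  have X0: "X 0 = M" and surj: "d 0 ` carrier (X 1) = carrier M"
    and inj: "inj_on (d n) (carrier (X (Suc n)))"
    and ker: "\<And>i. i < n \<Longrightarrow> d (Suc i) ` carrier (X (Suc (Suc i))) = a_kernel (X (Suc i)) (X i) (d i)"
    and fX: "\<And>i. i \<le> n \<Longrightarrow> fdG (X (Suc i))" and pX: "\<And>i. i \<le> n \<Longrightarrow> projective K \<Gamma> (X (Suc i))"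
    and dX: "\<And>i. i \<le> n \<Longrightarrow> d i \<in> lhom \<Gamma> (X (Suc i)) (X i)"
    using res unfolding projective_resolution_def fmod_def by (auto simp: lmod_hom_def)
  have f1: "fdG (X 1)" and p1: "projective K \<Gamma> (X 1)" and d0: "d 0 \<in> lhom \<Gamma> (X 1) M"
    using fX[of 0] pX[of 0] dX[of 0] X0 by auto
  note l1 = fdG_lmod[OF f1]
  have e: "lepi \<Gamma> (X 1) M (d 0)" using d0 surj by (simp add: lepi_def)
  have t1: "tfree (X 1)" by (rule tfree_projective[OF f1 p1])
  let ?K = "{x \<in> carrier (X 1). d 0 x = \<zero>\<^bsub>M\<^esub>}"
  have "tclosed (X 1) ?K"
  proof (cases "n = 0")
    case True
    interpret X1: lmod \<Gamma> "X 1" by (rule l1)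
    have "inj_on (d 0) (carrier (X 1))" using inj True by simp
    hence "x = \<zero>\<^bsub>X 1\<^esub>" if "x \<in> ?K" for x
      using that unfolding lhom_inj_iff[OF l1 lM d0] by blast
    moreover have "\<zero>\<^bsub>X 1\<^esub> \<in> ?K" using lhom_zero[OF l1 lM d0] X1.M.zero_closed by blast
    ultimately have "?K = {\<zero>\<^bsub>X 1\<^esub>}" by blast
    thus ?thesis using t1 by simp
  next
    case False
    hence n1: "n = 1" using n by simp
    have f2: "fdG (X (Suc 1))" and p2: "projective K \<Gamma> (X (Suc 1))"
      and d1: "d 1 \<in> lhom \<Gamma> (X (Suc 1)) (X 1)" using fX[of 1] pX[of 1] dX[of 1] n1 by auto
    have "?K = d 1 ` carrier (X (Suc 1))" using ker[of 0] n1 X0 by (simp add: a_kernel_def')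
    thus ?thesis using tclosed_projective[OF l1 t1 f2 p2 d1] inj n1 by simp
  qed
  thus ?thesis using tfree_epi_iff[OF l1 lM e refl] by blast
qed

text \<open>The kernel of an epimorphism \<open>H X \<rightarrow> M\<close> is closed, so it is \<open>Hom(E, Y)\<close> for a submodule \<open>Y\<close> of \<open>X\<close>, which
  is projective.\<close>
lemma tfree_imp_torsl:
  assumes M: "M \<in> fmod K \<Gamma>" and t: "tfree M"
  shows "M \<in> torsl K \<Gamma>"
proof -
  have fM: "fdG M" using M by (simp add: fmod_def)
  note lM = fdG_lmod[OF fM]
  obtain X :: "('a, (nat \<Rightarrow> 'k) \<Rightarrow> 'e) module" and \<pi> where fX: "fdL X" and \<pi>: "lepi \<Gamma> (H X) M \<pi>"
    using H_cover[OF fM] by blast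
  note lX = fdm_lmod[OF fX] note lH = lmod_H[OF lX]
  interpret X: lmod \<Lambda> X by (rule lX)
  let ?K = "{x \<in> carrier (H X). \<pi> x = \<zero>\<^bsub>M\<^esub>}"
  have "lsubmodule ?K \<Gamma> (H X)" by (rule quot_iso[OF lH lM \<pi> refl])
  moreover have "tclosed (H X) ?K" using tfree_epi_iff[OF lH lM \<pi> refl] t by blast
  ultimately obtain Y where Y: "lsubmodule Y \<Lambda> X" "?K = HS X Y" using tclosed_HS[OF lX] by blast
  let ?Y = "X\<lparr>carrier := Y\<rparr>"
  have fY: "fdL ?Y" by (rule fdm_sub[OF fX Y(1)])
  note lHY = lmod_H[OF fdm_lmod[OF fY]]
  obtain N0 where N0: "N0 \<in> fmod K \<Gamma>" "lmod_iso \<Gamma> (H X) N0"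
    using fmod_representative[OF fd_auslander_algebra[OF fdE] fdm_H[OF fX]] by blast
  obtain N1 where N1: "N1 \<in> fmod K \<Gamma>" "lmod_iso \<Gamma> (H ?Y) N1"
    using fmod_representative[OF fd_auslander_algebra[OF fdE] fdm_H[OF fY]] by blast
  have l0: "lmod \<Gamma> N0" and l1: "lmod \<Gamma> N1" using N0 N1 by (simp_all add: fmod_def fdG_lmod)
  obtain f where f: "f \<in> lhom \<Gamma> (H X) N0" "bij_betw f (carrier (H X)) (carrier N0)"
    using N0(2) unfolding lmod_iso_iff[OF lH] by blast
  let ?f' = "inv_into (carrier (H X)) f"
  have f': "?f' \<in> lhom \<Gamma> N0 (H X)" by (rule lhom_inv[OF f lH])
  have bf': "bij_betw ?f' (carrier N0) (carrier (H X))" by (rule bij_betw_inv_into[OF f(2)])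
  obtain g where g: "g \<in> lhom \<Gamma> N1 (H ?Y)" "bij_betw g (carrier N1) (carrier (H ?Y))"
    using lmod_iso_sym[OF lHY l1 N1(2)] unfolding lmod_iso_iff[OF l1] by blast
  have HY: "carrier (H ?Y) = HS X Y" unfolding hom_mod_sub[OF Y(1)] by simp
  have HYs: "HS X Y \<subseteq> carrier (H X)" by (auto simp: HS_def)
  have g': "g \<in> lhom \<Gamma> N1 (H X)" using g(1) unfolding hom_mod_sub[OF Y(1)] lhom_sub_cod[OF HYs] by blast
  define d0 where "d0 = (\<lambda>x\<in>carrier N0. \<pi> (?f' x))"
  define d1 where "d1 = (\<lambda>x\<in>carrier N1. f (g x))"
  have d0: "d0 \<in> lmod_hom \<Gamma> N0 M"
    unfolding d0_def by (rule lmod_hom_restrict[OF l0 lhom_comp[OF f' lepiD(1)[OF \<pi>]]])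
  have d1: "d1 \<in> lmod_hom \<Gamma> N1 N0"
    unfolding d1_def by (rule lmod_hom_restrict[OF l1 lhom_comp[OF g' f(1)]])
  have s0: "d0 ` carrier N0 = carrier M"
  proof -
    have "d0 ` carrier N0 = \<pi> ` ?f' ` carrier N0" by (auto simp: d0_def)
    thus ?thesis using bf' lepiD(2)[OF \<pi>] by (simp add: bij_betw_def)
  qed
  have im1: "d1 ` carrier N1 = f ` HS X Y"
  proof -
    have "d1 ` carrier N1 = f ` g ` carrier N1" by (auto simp: d1_def)
    thus ?thesis using g(2) HY by (simp add: bij_betw_def)
  qed
  have ker: "d1 ` carrier N1 = a_kernel N0 M d0"
  proof
    show "d1 ` carrier N1 \<subseteq> a_kernel N0 M d0"
      unfolding im1 Y(2)[symmetric] a_kernel_def'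
      using lhom_closed[OF f(1)] bij_betw_inv_into_left[OF f(2)] by (auto simp: d0_def)
    show "a_kernel N0 M d0 \<subseteq> d1 ` carrier N1"
    proof
      fix x assume x: "x \<in> a_kernel N0 M d0"
      hence "x \<in> carrier N0" "\<pi> (?f' x) = \<zero>\<^bsub>M\<^esub>" by (auto simp: a_kernel_def' d0_def)
      hence "?f' x \<in> HS X Y" "x = f (?f' x)"
        unfolding Y(2)[symmetric] using lhom_closed[OF f'] bij_betw_inv_into_right[OF f(2)] by auto
      thus "x \<in> d1 ` carrier N1" unfolding im1 by blast
    qed
  qed
  have inj1: "inj_on d1 (carrier N1)"
  proof (rule inj_onI)
    fix x y assume xy: "x \<in> carrier N1" "y \<in> carrier N1" "d1 x = d1 y"
    hence "f (g x) = f (g y)" by (simp add: d1_def)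
    hence "g x = g y" using inj_onD[of f "carrier (H X)"] f(2) lhom_closed[OF g'] xy
      by (auto simp: bij_betw_def)
    thus "x = y" using g(2) xy by (auto simp: bij_betw_def dest: inj_onD)
  qed
  let ?X = "\<lambda>i::nat. if i = 0 then M else if i = 1 then N0 else N1"
  let ?d = "\<lambda>i::nat. if i = 0 then d0 else d1"
  have "projective_resolution K \<Gamma> M 1 ?X ?d"
    unfolding projective_resolution_def
  proof (intro conjI allI impI)
    fix i :: nat assume "i \<le> 1"
    hence "i = 0 \<or> i = 1" by auto
    thus "?X (Suc i) \<in> fmod K \<Gamma>" "projective K \<Gamma> (?X (Suc i))" "?d i \<in> lmod_hom \<Gamma> (?X (Suc i)) (?X i)"
      using N0(1) N1(1) projective_iso[OF lH l0 N0(2) projective_H[OF fX]]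
        projective_iso[OF lHY l1 N1(2) projective_H[OF fY]] d0 d1 by auto
  next
    fix i :: nat assume "i < 1"
    thus "?d (Suc i) ` carrier (?X (Suc (Suc i))) = a_kernel (?X (Suc i)) (?X i) (?d i)"
      using ker by simp
  qed (use s0 inj1 in auto)
  thus ?thesis using M proj_dim_le_1_iff[of M] unfolding torsl_def by blast
qed

end

section \<open>Simple modules and composition factors over the Auslander algebra\<close>

lemma (in fda) projective_lift:
  assumes P: "lmod A P" and pr: "projective K A P" and M: "fd_left_module K A M"
    and N: "fd_left_module K A N" and g: "lepi A M N g" and f: "f \<in> lhom A P N"
  shows "\<exists>h \<in> lhom A P M. \<forall>x \<in> carrier P. g (h x) = f x"
proof -
  obtain M' where M': "M' \<in> fmod K A" "lmod_iso A M M'" using fmod_representative[OF fd_alg M] by blast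
  obtain N' where N': "N' \<in> fmod K A" "lmod_iso A N N'" using fmod_representative[OF fd_alg N] by blast
  have lM': "lmod A M'" and lN': "lmod A N'" using M' N' by (simp_all add: fmod_def fdm_lmod)
  note lM = fdm_lmod[OF M] note lN = fdm_lmod[OF N]
  obtain m where m: "m \<in> lhom A M' M" "bij_betw m (carrier M') (carrier M)"
    using lmod_iso_sym[OF lM lM' M'(2)] unfolding lmod_iso_iff[OF lM'] by blast
  obtain n where n: "n \<in> lhom A N N'" "bij_betw n (carrier N) (carrier N')"
    using N'(2) unfolding lmod_iso_iff[OF lN] by blast
  let ?g = "\<lambda>x\<in>carrier M'. n (g (m x))" and ?f = "\<lambda>x\<in>carrier P. n (f x)"
  have g': "?g \<in> lmod_hom A M' N'"
    by (rule lmod_hom_restrict[OF lM' lhom_comp[OF lhom_comp[OF m(1) lepiD(1)[OF g]] n(1)]])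
  have f': "?f \<in> lmod_hom A P N'" by (rule lmod_hom_restrict[OF P lhom_comp[OF f n(1)]])
  have s: "?g ` carrier M' = carrier N'"
  proof -
    have "?g ` carrier M' = n ` g ` m ` carrier M'" by (auto simp: image_image)
    thus ?thesis using m(2) n(2) lepiD(2)[OF g] by (simp add: bij_betw_def)
  qed
  obtain h where h: "h \<in> lmod_hom A P M'" "\<And>x. x \<in> carrier P \<Longrightarrow> ?g (h x) = ?f x"
    using projectiveD[OF pr M'(1) N'(1) g' f' s] by blast
  have "g (m (h x)) = f x" if x: "x \<in> carrier P" for x
  proof -
    have "n (g (m (h x))) = n (f x)" using h(2)[OF x] lmod_hom_app(1)[OF h(1) x] x by simp
    moreover have "g (m (h x)) \<in> carrier N"
      using lhom_closed[OF lepiD(1)[OF g]] lhom_closed[OF m(1)] lmod_hom_app(1)[OF h(1) x] by blast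
    ultimately show ?thesis using inj_onD[of n "carrier N"] n(2) lhom_closed[OF f x]
      by (simp add: bij_betw_def)
  qed
  thus ?thesis by (intro bexI[OF _ lhom_comp[OF lmod_homD(1)[OF h(1)] m(1)]] ballI)
qed

text \<open>If the composite \<open>M \<rightarrow> N \<rightarrow> M\<close> is bijective, then \<open>M\<close> is a direct summand of \<open>N\<close>.\<close>
lemma retract_of_indecomposable:
  assumes M: "lmod A M" and N: "lmod A N" and ind: "indecomposable A N" and M0: "carrier M \<noteq> {\<zero>\<^bsub>M\<^esub>}"
    and a: "a \<in> lhom A M N" and b: "b \<in> lhom A N M"
    and ba: "bij_betw (\<lambda>x. b (a x)) (carrier M) (carrier M)"
  shows "lmod_iso A M N"
proof -
  interpret M: lmod A M by (rule M)
  interpret N: lmod A N by (rule N)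
  let ?I = "a ` carrier M" and ?K = "{x \<in> carrier N. b x \<in> {\<zero>\<^bsub>M\<^esub>}}"
  have I: "lsubmodule ?I A N" by (rule lsub_image[OF M N a M.lsub_carrier])
  have Ks: "lsubmodule ?K A N" by (rule lsub_vimage[OF N M b M.lsub_zero_module])
  have inj: "x = y" if "x \<in> carrier M" "y \<in> carrier M" "b (a x) = b (a y)" for x y
    using ba that by (auto simp: bij_betw_def dest: inj_onD)
  have "?I \<inter> ?K \<subseteq> {\<zero>\<^bsub>N\<^esub>}"
  proof
    fix y assume y: "y \<in> ?I \<inter> ?K"
    then obtain x where x: "x \<in> carrier M" "y = a x" by blast
    have "b (a x) = b (a \<zero>\<^bsub>M\<^esub>)" using y x lhom_zero[OF M N a] lhom_zero[OF N M b] by simp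
    hence "x = \<zero>\<^bsub>M\<^esub>" using inj x by simp
    thus "y \<in> {\<zero>\<^bsub>N\<^esub>}" using x lhom_zero[OF M N a] by simp
  qed
  hence 1: "?I \<inter> ?K = {\<zero>\<^bsub>N\<^esub>}" using lsub_zero[OF I] lsub_zero[OF Ks] by blast
  have 2: "?I <+>\<^bsub>N\<^esub> ?K = carrier N"
  proof
    show "?I <+>\<^bsub>N\<^esub> ?K \<subseteq> carrier N" by (rule lsub_subset[OF N.lsub_sum[OF I Ks]])
    show "carrier N \<subseteq> ?I <+>\<^bsub>N\<^esub> ?K"
    proof
      fix y assume y: "y \<in> carrier N"
      have "b y \<in> (\<lambda>x. b (a x)) ` carrier M" using ba lhom_closed[OF b y] by (simp add: bij_betw_def)
      then obtain x where x: "x \<in> carrier M" "b y = b (a x)" by blast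
      have ax: "a x \<in> carrier N" by (rule lhom_closed[OF a x(1)])
      have "b (y \<ominus>\<^bsub>N\<^esub> a x) = \<zero>\<^bsub>M\<^esub>"
        using lhom_diff[OF N M b y ax] x lhom_closed[OF b ax] by simp
      hence "y \<ominus>\<^bsub>N\<^esub> a x \<in> ?K" using y ax by simp
      moreover have "y = a x \<oplus>\<^bsub>N\<^esub> (y \<ominus>\<^bsub>N\<^esub> a x)"
        using N.diff_add_cancel[OF y ax] N.a_comm[OF ax N.minus_closed[OF y ax]] by simp
      ultimately show "y \<in> ?I <+>\<^bsub>N\<^esub> ?K" unfolding N.set_add_iff using x(1) by blast
    qed
  qed
  have "?I \<noteq> {\<zero>\<^bsub>N\<^esub>}"
  proof
    assume eq: "?I = {\<zero>\<^bsub>N\<^esub>}"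
    have "x = \<zero>\<^bsub>M\<^esub>" if x: "x \<in> carrier M" for x
    proof (rule inj[OF x M.M.zero_closed])
      have "a x = \<zero>\<^bsub>N\<^esub>" using eq x by blast
      thus "b (a x) = b (a \<zero>\<^bsub>M\<^esub>)" using lhom_zero[OF M N a] by simp
    qed
    thus False using M0 M.M.zero_closed by blast
  qed
  hence K0: "?K = {\<zero>\<^bsub>N\<^esub>}" using indecomposableD[OF ind I Ks 1 2] by blast
  have "carrier N \<subseteq> ?I"
  proof
    fix y assume "y \<in> carrier N"
    hence "y \<in> ?I <+>\<^bsub>N\<^esub> ?K" by (simp only: 2)
    then obtain u k where uk: "u \<in> ?I" "k \<in> ?K" "y = u \<oplus>\<^bsub>N\<^esub> k" unfolding N.set_add_iff by blast
    have "k = \<zero>\<^bsub>N\<^esub>" using uk(2) K0 by blast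
    thus "y \<in> ?I" using uk lsub_mem[OF I uk(1)] by simp
  qed
  hence "bij_betw a (carrier M) (carrier N)"
    unfolding bij_betw_def using lsub_subset[OF I] inj by (auto intro: inj_onI)
  thus ?thesis unfolding lmod_iso_iff[OF M] using a by blast
qed

context auslander
begin

text \<open>The projection \<open>pr N\<close> as an element of \<open>\<Gamma>\<close>, whose elements are undefined outside \<open>E\<close>.\<close>
definition ee :: "'e set \<Rightarrow> 'e \<Rightarrow> 'e" where
  "ee N = (\<lambda>x\<in>carrier E. pr N x)"

lemma ee_G: "N \<in> \<N> \<Longrightarrow> ee N \<in> carrier \<Gamma>"
  unfolding ee_def using lmod_hom_restrict[OF lmod_E pr_hom] by simp

text \<open>The idempotents \<open>ee N\<close> add up to \<open>1\<close>.\<close>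
lemma ee_generate:
  assumes M: "lmod \<Gamma> M" and G: "lsubmodule G \<Gamma> M" and m: "m \<in> carrier M"
    and ee: "\<And>N. N \<in> \<N> \<Longrightarrow> ee N \<odot>\<^bsub>M\<^esub> m \<in> G"
  shows "m \<in> G"
proof -
  interpret M: lmod \<Gamma> M by (rule M)
  interpret E: lmod \<Lambda> E by (rule lmod_E)
  let ?t = "\<lambda>F. \<lambda>x\<in>carrier E. finsum E (\<lambda>N. pr N x) F"
  have prc: "pr N x \<in> carrier E" if "N \<in> \<N>" "x \<in> carrier E" for N x
    by (rule lhom_closed[OF pr_hom[OF that(1)] that(2)])
  have "?t F \<in> carrier \<Gamma> \<and> ?t F \<odot>\<^bsub>M\<^esub> m \<in> G" if "finite F" "F \<subseteq> \<N>" for F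
    using that
  proof (induction F rule: finite_induct)
    case empty
    have "?t {} = \<zero>\<^bsub>\<Gamma>\<^esub>" by simp
    moreover have "\<zero>\<^bsub>\<Gamma>\<^esub> \<in> carrier \<Gamma>" by (rule M.A.zero_closed)
    moreover have "\<zero>\<^bsub>\<Gamma>\<^esub> \<odot>\<^bsub>M\<^esub> m \<in> G" using M.zero_smult[OF m] lsub_zero[OF G] by simp
    ultimately show ?case by (simp only:)
  next
    case (insert N F)
    have N: "N \<in> \<N>" and F: "F \<subseteq> \<N>" and IH: "?t F \<in> carrier \<Gamma>" "?t F \<odot>\<^bsub>M\<^esub> m \<in> G"
      using insert.IH insert.prems by blast+
    have "?t (insert N F) = ee N \<oplus>\<^bsub>\<Gamma>\<^esub> ?t F"
      unfolding auslander_algebra_simps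
    proof (rule restrict_ext)
      fix x assume x: "x \<in> carrier E"
      have "finsum E (\<lambda>N. pr N x) (insert N F) = pr N x \<oplus>\<^bsub>E\<^esub> finsum E (\<lambda>N. pr N x) F"
        using insert.hyps prc x N F by (intro E.finsum_insert) auto
      thus "finsum E (\<lambda>N. pr N x) (insert N F) = ee N x \<oplus>\<^bsub>E\<^esub> ?t F x"
        using x by (simp add: ee_def)
    qed
    moreover have "ee N \<oplus>\<^bsub>\<Gamma>\<^esub> ?t F \<in> carrier \<Gamma>" by (rule M.A.add.m_closed[OF ee_G[OF N] IH(1)])
    moreover have "(ee N \<oplus>\<^bsub>\<Gamma>\<^esub> ?t F) \<odot>\<^bsub>M\<^esub> m \<in> G"
      unfolding M.smult_l_distr[OF ee_G[OF N] IH(1) m] by (rule lsub_add[OF G ee[OF N] IH(2)])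
    ultimately show ?case by (simp only:)
  qed
  from this[OF summand_props(1) order_refl] have "?t \<N> \<odot>\<^bsub>M\<^esub> m \<in> G" by blast
  moreover have "?t \<N> = \<one>\<^bsub>\<Gamma>\<^esub>"
    unfolding auslander_algebra_simps by (rule restrict_ext) (rule pr_sum)
  ultimately show ?thesis using M.smult_one[OF m] by (simp only:)
qed

lemma ee_idem: "N \<in> \<N> \<Longrightarrow> ee N \<otimes>\<^bsub>\<Gamma>\<^esub> ee N = ee N"
  using pr_in pr_on lhom_closed[OF pr_hom]
  by (auto simp: ee_def compose_def intro!: restrict_ext)

lemma ee_ee:
  "lmod \<Gamma> M \<Longrightarrow> N \<in> \<N> \<Longrightarrow> m \<in> carrier M \<Longrightarrow> ee N \<odot>\<^bsub>M\<^esub> (ee N \<odot>\<^bsub>M\<^esub> m) = ee N \<odot>\<^bsub>M\<^esub> m"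
  using lmod.axioms[of \<Gamma> M] left_module.smult_assoc1[of \<Gamma> M "ee N" "ee N" m] ee_G[of N] ee_idem[of N]
  by simp

subsection \<open>The indecomposable projective modules\<close>

text \<open>This is the indecomposable projective module \<open>\<Gamma> \<cdot> ee N\<close>, because \<open>ee N\<close> generates it freely subject to
  being fixed by the idempotent (\<open>PP_ee\<close>, \<open>act_hom\<close>).\<close>
abbreviation PP :: "'e set \<Rightarrow> ('e \<Rightarrow> 'e, 'e \<Rightarrow> 'e) module" where
  "PP N \<equiv> H (E\<lparr>carrier := N\<rparr>)"

lemma PP_carrier: "N \<in> \<N> \<Longrightarrow> f \<in> carrier (PP N) \<longleftrightarrow> f \<in> lmod_hom \<Lambda> E E \<and> (\<forall>x \<in> carrier E. f x \<in> N)"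
  using hom_mod_sub[OF summand_props(2)] by (simp add: HS_def)

lemma fdm_PP: "N \<in> \<N> \<Longrightarrow> fdG (PP N)"
  by (rule fdm_H[OF fdm_summand])

lemma lmod_PP: "N \<in> \<N> \<Longrightarrow> lmod \<Gamma> (PP N)"
  by (rule fdG_lmod[OF fdm_PP])

lemma projective_PP: "N \<in> \<N> \<Longrightarrow> projective K \<Gamma> (PP N)"
  by (rule projective_H[OF fdm_summand])

lemma ee_PP: "N \<in> \<N> \<Longrightarrow> ee N \<in> carrier (PP N)"
  unfolding PP_carrier using ee_G[of N] pr_in by (simp add: ee_def)

lemma PP_ee: "N \<in> \<N> \<Longrightarrow> f \<in> carrier (PP N) \<Longrightarrow> f \<odot>\<^bsub>PP N\<^esub> ee N = f"
  unfolding PP_carrier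
  by (auto simp: compose_def ee_def pr_on lmod_hom_app lmod_hom_def lhom_closed extensional_def fun_eq_iff)

lemma act_hom:
  assumes M: "lmod \<Gamma> M" and N: "N \<in> \<N>" and m: "m \<in> carrier M"
  shows "(\<lambda>f. f \<odot>\<^bsub>M\<^esub> m) \<in> lhom \<Gamma> (PP N) M"
proof -
  interpret M: lmod \<Gamma> M by (rule M)
  have c: "f \<in> carrier \<Gamma>" if "f \<in> carrier (PP N)" for f using that PP_carrier[OF N] by simp
  show ?thesis
  proof (rule lhomI)
    fix f g assume "f \<in> carrier (PP N)" "g \<in> carrier (PP N)"
    thus "(f \<oplus>\<^bsub>PP N\<^esub> g) \<odot>\<^bsub>M\<^esub> m = f \<odot>\<^bsub>M\<^esub> m \<oplus>\<^bsub>M\<^esub> g \<odot>\<^bsub>M\<^esub> m"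
      using M.smult_l_distr[OF c c m, of f g] by simp
  next
    fix \<gamma> f assume "\<gamma> \<in> carrier \<Gamma>" "f \<in> carrier (PP N)"
    thus "(\<gamma> \<odot>\<^bsub>PP N\<^esub> f) \<odot>\<^bsub>M\<^esub> m = \<gamma> \<odot>\<^bsub>M\<^esub> (f \<odot>\<^bsub>M\<^esub> m)"
      using M.smult_assoc1[OF _ c m, of \<gamma> f] by simp
  qed (rule M.closed_ops[OF c m])
qed

text \<open>A map \<open>E \<rightarrow> N\<close> that is not a split epimorphism generates a proper submodule of \<open>PP N\<close>. As \<open>End(N)\<close> is
  local, these maps are closed under addition and form the radical of \<open>PP N\<close>.\<close>
definition rad_PP :: "'e set \<Rightarrow> ('e \<Rightarrow> 'e) set" where
  "rad_PP N = {f \<in> carrier (PP N). \<forall>g \<in> lhom \<Lambda> (E\<lparr>carrier := N\<rparr>) E. \<not> bij_betw (\<lambda>x. f (g x)) N N}"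

lemma
  assumes N: "N \<in> \<N>"
  shows rad_PP_sub: "lsubmodule (rad_PP N) \<Gamma> (PP N)" and ee_rad_PP: "ee N \<notin> rad_PP N"
    and rad_PP_largest: "lsubmodule U \<Gamma> (PP N) \<Longrightarrow> U \<noteq> carrier (PP N) \<Longrightarrow> U \<subseteq> rad_PP N"
proof -
  let ?N = "E\<lparr>carrier := N\<rparr>"
  interpret E: lmod \<Lambda> E by (rule lmod_E)
  interpret P: lmod \<Gamma> "PP N" by (rule lmod_PP[OF N])
  note fN = fdm_summand[OF N] note lN = fdm_lmod[OF fN] note sN = summand_props(2)[OF N]
  interpret N: lmod \<Lambda> ?N by (rule lN)
  note ind = summand_props(3)[OF N]
  have N0: "N \<noteq> {\<zero>\<^bsub>E\<^esub>}" using ind by (simp add: indecomposable_def)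
  have fhN: "f \<in> lhom \<Lambda> E ?N" if "f \<in> carrier (PP N)" for f
    using that by (simp add: lmod_hom_def)
  have split: "\<exists>g \<in> lhom \<Lambda> ?N E. \<forall>x \<in> N. f (g x) = x" if f: "f \<in> carrier (PP N)" "f \<notin> rad_PP N" for f
  proof -
    obtain g where g: "g \<in> lhom \<Lambda> ?N E" "bij_betw (\<lambda>x. f (g x)) N N"
      using f by (auto simp: rad_PP_def)
    let ?\<phi> = "\<lambda>x. f (g x)"
    have \<phi>: "?\<phi> \<in> lhom \<Lambda> ?N ?N" by (rule lhom_comp[OF g(1) fhN[OF f(1)]])
    have i: "inv_into N ?\<phi> \<in> lhom \<Lambda> ?N ?N" using lhom_inv[OF \<phi> _ lN] g(2) by simp
    have "f (g (inv_into N ?\<phi> x)) = x" if "x \<in> N" for x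
      using bij_betw_inv_into_right[OF g(2) that] .
    thus ?thesis by (intro bexI[OF _ lhom_comp[OF i g(1)]] ballI)
  qed
  show sub: "lsubmodule (rad_PP N) \<Gamma> (PP N)"
  proof (rule P.lsubmoduleI)
    show "rad_PP N \<subseteq> carrier (PP N)" by (auto simp: rad_PP_def)
    have "\<not> bij_betw (\<lambda>x. \<zero>\<^bsub>PP N\<^esub> (g x)) N N" if g: "g \<in> lhom \<Lambda> ?N E" for g
    proof
      assume b: "bij_betw (\<lambda>x. \<zero>\<^bsub>PP N\<^esub> (g x)) N N"
      have "N = (\<lambda>x. \<zero>\<^bsub>PP N\<^esub> (g x)) ` N" using b by (simp add: bij_betw_def)
      also have "\<dots> \<subseteq> {\<zero>\<^bsub>E\<^esub>}" using lhom_closed[OF g] by auto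
      finally show False using N0 lsub_zero[OF sN] by blast
    qed
    thus "\<zero>\<^bsub>PP N\<^esub> \<in> rad_PP N" unfolding rad_PP_def using P.M.zero_closed by blast
  next
    fix f f' assume f: "f \<in> rad_PP N" and f': "f' \<in> rad_PP N"
    have fP: "f \<in> carrier (PP N)" "f' \<in> carrier (PP N)" using f f' by (auto simp: rad_PP_def)
    show "f \<oplus>\<^bsub>PP N\<^esub> f' \<in> rad_PP N"
    proof (rule ccontr)
      assume "f \<oplus>\<^bsub>PP N\<^esub> f' \<notin> rad_PP N"
      then obtain g where g: "g \<in> lhom \<Lambda> ?N E" "\<And>x. x \<in> N \<Longrightarrow> (f \<oplus>\<^bsub>PP N\<^esub> f') (g x) = x"
        using split[OF P.M.add.m_closed[OF fP]] by blast
      have "f (g x) \<oplus>\<^bsub>?N\<^esub> f' (g x) = x" if "x \<in> carrier ?N" for x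
        using g(2)[of x] lhom_closed[OF g(1), of x] that by simp
      from indecomposable_local[OF fN ind lhom_comp[OF g(1) fhN[OF fP(1)]] lhom_comp[OF g(1) fhN[OF fP(2)]] this]
      show False using f f' g(1) by (auto simp: rad_PP_def)
    qed
  next
    fix \<gamma> f assume \<gamma>: "\<gamma> \<in> carrier \<Gamma>" and f: "f \<in> rad_PP N"
    have fP: "f \<in> carrier (PP N)" using f by (simp add: rad_PP_def)
    have \<gamma>h: "\<gamma> \<in> lhom \<Lambda> E E" using \<gamma> by (simp add: lmod_hom_def)
    show "\<gamma> \<odot>\<^bsub>PP N\<^esub> f \<in> rad_PP N"
      unfolding rad_PP_def
    proof (intro CollectI conjI ballI P.closed_ops \<gamma> fP)
      fix g assume g: "g \<in> lhom \<Lambda> ?N E"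
      have "bij_betw (\<lambda>x. (\<gamma> \<odot>\<^bsub>PP N\<^esub> f) (g x)) N N \<longleftrightarrow> bij_betw (\<lambda>x. f (\<gamma> (g x))) N N"
        by (rule bij_betw_cong) (use lhom_closed[OF g] in \<open>simp add: compose_eq\<close>)
      thus "\<not> bij_betw (\<lambda>x. (\<gamma> \<odot>\<^bsub>PP N\<^esub> f) (g x)) N N"
        using f lhom_comp[OF g \<gamma>h] by (auto simp: rad_PP_def)
    qed
  qed
  show "ee N \<notin> rad_PP N"
  proof
    assume "ee N \<in> rad_PP N"
    hence nb: "\<forall>g \<in> lhom \<Lambda> ?N E. \<not> bij_betw (\<lambda>x. ee N (g x)) N N" by (simp add: rad_PP_def)
    have "\<not> bij_betw (\<lambda>x. ee N x) N N"
      by (rule bspec[OF nb lhom_incl[OF lsub_subset[OF sN]]])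
    moreover have "bij_betw (\<lambda>x. ee N x) N N \<longleftrightarrow> bij_betw (\<lambda>x. x) N N"
      by (rule bij_betw_cong) (use lsub_mem[OF sN] pr_on[OF N] in \<open>simp add: ee_def\<close>)
    ultimately show False by (simp add: bij_betw_def)
  qed
  show "U \<subseteq> rad_PP N" if U: "lsubmodule U \<Gamma> (PP N)" "U \<noteq> carrier (PP N)"
  proof
    fix f assume f: "f \<in> U"
    have fP: "f \<in> carrier (PP N)" by (rule lsub_mem[OF U(1) f])
    show "f \<in> rad_PP N"
    proof (rule ccontr)
      assume "f \<notin> rad_PP N"
      then obtain g where g: "g \<in> lhom \<Lambda> ?N E" "\<And>x. x \<in> N \<Longrightarrow> f (g x) = x" using split[OF fP] by blast
      have "h \<in> U" if h: "h \<in> carrier (PP N)" for h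
      proof -
        let ?\<gamma> = "\<lambda>x\<in>carrier E. g (h x)"
        have "?\<gamma> \<in> carrier \<Gamma>" using lmod_hom_restrict[OF lmod_E lhom_comp[OF fhN[OF h] g(1)]] by simp
        from lsub_smult[OF U(1) this f] have "?\<gamma> \<odot>\<^bsub>PP N\<^esub> f \<in> U" .
        moreover have "?\<gamma> \<odot>\<^bsub>PP N\<^esub> f = h"
          using h g(2) PP_carrier[OF N]
          by (auto simp: compose_def lmod_hom_def extensional_def fun_eq_iff)
        ultimately show ?thesis by (simp only:)
      qed
      thus False using U lsub_subset[OF U(1)] by blast
    qed
  qed
qed

subsection \<open>Weights\<close>

text \<open>The simple module with projective cover \<open>PP N\<close> is a composition factor of \<open>M\<close> exactly if this holds,
  see \<open>composition_factor_iff_wt\<close>.\<close>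
definition wt :: "'e set \<Rightarrow> ('e \<Rightarrow> 'e, 'm) module \<Rightarrow> bool" where
  "wt N M \<longleftrightarrow> (\<exists>m \<in> carrier M. ee N \<odot>\<^bsub>M\<^esub> m \<noteq> \<zero>\<^bsub>M\<^esub>)"

lemma wt_sub: "lsubmodule U \<Gamma> M \<Longrightarrow> wt N (M\<lparr>carrier := U\<rparr>) \<Longrightarrow> wt N M"
  using lsub_mem[of U \<Gamma> M] by (auto simp: wt_def)

lemma wt_epi:
  assumes M: "lmod \<Gamma> M" and Q: "lmod \<Gamma> Q" and p: "lepi \<Gamma> M Q p" and N: "N \<in> \<N>"
  shows "wt N Q \<longleftrightarrow> (\<exists>m \<in> carrier M. p (ee N \<odot>\<^bsub>M\<^esub> m) \<noteq> \<zero>\<^bsub>Q\<^esub>)"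
proof -
  have "p (ee N \<odot>\<^bsub>M\<^esub> m) = ee N \<odot>\<^bsub>Q\<^esub> p m" if "m \<in> carrier M" for m
    by (rule lhom_smult[OF lepiD(1)[OF p] ee_G[OF N] that])
  thus ?thesis
    unfolding wt_def lepiD(2)[OF p, symmetric] by auto
qed

lemma wt_epi_imp:
  assumes M: "lmod \<Gamma> M" and Q: "lmod \<Gamma> Q" and p: "lepi \<Gamma> M Q p" and N: "N \<in> \<N>" and w: "wt N Q"
  shows "wt N M"
proof -
  obtain m where m: "m \<in> carrier M" "p (ee N \<odot>\<^bsub>M\<^esub> m) \<noteq> \<zero>\<^bsub>Q\<^esub>" using w wt_epi[OF M Q p N] by blast
  hence "ee N \<odot>\<^bsub>M\<^esub> m \<noteq> \<zero>\<^bsub>M\<^esub>" using lhom_zero[OF M Q lepiD(1)[OF p]] by auto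
  thus ?thesis unfolding wt_def using m(1) by blast
qed

lemma wt_iso:
  assumes M: "lmod \<Gamma> M" and Q: "lmod \<Gamma> Q" and i: "lmod_iso \<Gamma> M Q" and N: "N \<in> \<N>" and w: "wt N Q"
  shows "wt N M"
proof -
  obtain p where "lepi \<Gamma> M Q p" using lmod_iso_lepi[OF M Q i lepi_id] by blast
  thus ?thesis by (rule wt_epi_imp[OF M Q _ N w])
qed

lemma simple_wt_epi:
  assumes S: "lmod \<Gamma> S" and simple: "simple_module \<Gamma> S" and N: "N \<in> \<N>" and w: "wt N S"
  shows "\<exists>p. lepi \<Gamma> (PP N) S p \<and> {f \<in> carrier (PP N). p f = \<zero>\<^bsub>S\<^esub>} = rad_PP N"
proof -
  interpret S: lmod \<Gamma> S by (rule S)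
  interpret P: lmod \<Gamma> "PP N" by (rule lmod_PP[OF N])
  obtain m where m: "m \<in> carrier S" "ee N \<odot>\<^bsub>S\<^esub> m \<noteq> \<zero>\<^bsub>S\<^esub>" using w by (auto simp: wt_def)
  let ?p = "\<lambda>f. f \<odot>\<^bsub>S\<^esub> m"
  have h: "?p \<in> lhom \<Gamma> (PP N) S" by (rule act_hom[OF S N m(1)])
  have im: "lsubmodule (?p ` carrier (PP N)) \<Gamma> S" by (rule lsub_image[OF P.lmod_axioms S h P.lsub_carrier])
  have "?p (ee N) \<in> ?p ` carrier (PP N)" using ee_PP[OF N] by blast
  hence "?p ` carrier (PP N) \<noteq> {\<zero>\<^bsub>S\<^esub>}" using m(2) by blast
  hence "?p ` carrier (PP N) = carrier S" using simple im by (auto simp: simple_module_def)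
  hence e: "lepi \<Gamma> (PP N) S ?p" using h by (simp add: lepi_def)
  let ?V = "{f \<in> carrier (PP N). ?p f = \<zero>\<^bsub>S\<^esub>}"
  have mx: "max_sub \<Gamma> (PP N) ?V" using simple_max_sub[OF P.lmod_axioms S e] simple by simp
  have "?V \<subseteq> rad_PP N" by (rule rad_PP_largest[OF N max_subD(1,2)[OF mx]])
  moreover have "rad_PP N \<noteq> carrier (PP N)" using ee_rad_PP[OF N] ee_PP[OF N] by blast
  ultimately have "rad_PP N = ?V" using max_subD(4)[OF mx rad_PP_sub[OF N]] by blast
  thus ?thesis using e by blast
qed

lemma simple_iso_of_wt:
  assumes "lmod \<Gamma> S" "simple_module \<Gamma> S" "lmod \<Gamma> S'" "simple_module \<Gamma> S'" "N \<in> \<N>" "wt N S" "wt N S'"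
  shows "lmod_iso \<Gamma> S S'"
proof -
  obtain p where p: "lepi \<Gamma> (PP N) S p" "{f \<in> carrier (PP N). p f = \<zero>\<^bsub>S\<^esub>} = rad_PP N"
    using simple_wt_epi assms by blast
  obtain q where q: "lepi \<Gamma> (PP N) S' q" "{f \<in> carrier (PP N). q f = \<zero>\<^bsub>S'\<^esub>} = rad_PP N"
    using simple_wt_epi assms by blast
  show ?thesis
    by (rule lmod_iso_of_epis[OF lmod_PP[OF assms(5)] assms(1,3) p(1) q(1)]) (use p(2) q(2) in blast)
qed

lemma wt_exists:
  assumes S: "lmod \<Gamma> S" and nz: "carrier S \<noteq> {\<zero>\<^bsub>S\<^esub>}"
  shows "\<exists>N \<in> \<N>. wt N S"
proof (rule ccontr)
  interpret S: lmod \<Gamma> S by (rule S)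
  assume n: "\<not> (\<exists>N \<in> \<N>. wt N S)"
  have "m \<in> {\<zero>\<^bsub>S\<^esub>}" if m: "m \<in> carrier S" for m
    by (rule ee_generate[OF S S.lsub_zero_module m]) (use n m in \<open>auto simp: wt_def\<close>)
  thus False using nz S.M.zero_closed by blast
qed

text \<open>If both \<open>N\<close> and \<open>N'\<close> are weights of \<open>S\<close> then some composite \<open>N \<rightarrow> N' \<rightarrow> N\<close> avoids the radical of \<open>PP N\<close>, so
  it is bijective and makes \<open>N\<close> a summand of \<open>N'\<close>.\<close>
lemma wt_unique:
  assumes S: "lmod \<Gamma> S" and simple: "simple_module \<Gamma> S" and N: "N \<in> \<N>" and N': "N' \<in> \<N>"
    and w: "wt N S" and w': "wt N' S"
  shows "N = N'"
proof -
  obtain p where p: "lepi \<Gamma> (PP N) S p" "{f \<in> carrier (PP N). p f = \<zero>\<^bsub>S\<^esub>} = rad_PP N"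
    using simple_wt_epi[OF S simple N w] by blast
  interpret P: lmod \<Gamma> "PP N" by (rule lmod_PP[OF N])
  obtain f where f: "f \<in> carrier (PP N)" "p (ee N' \<odot>\<^bsub>PP N\<^esub> f) \<noteq> \<zero>\<^bsub>S\<^esub>"
    using w' wt_epi[OF P.lmod_axioms S p(1) N'] by blast
  hence "ee N' \<odot>\<^bsub>PP N\<^esub> f \<notin> rad_PP N" using p(2) by blast
  moreover have "ee N' \<odot>\<^bsub>PP N\<^esub> f \<in> carrier (PP N)" by (rule P.closed_ops[OF ee_G[OF N'] f(1)])
  ultimately obtain g where g: "g \<in> lhom \<Lambda> (E\<lparr>carrier := N\<rparr>) E"
    "bij_betw (\<lambda>x. (ee N' \<odot>\<^bsub>PP N\<^esub> f) (g x)) N N" unfolding rad_PP_def by blast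
  let ?N = "E\<lparr>carrier := N\<rparr>" and ?N' = "E\<lparr>carrier := N'\<rparr>"
  note sN = summand_props(2)[OF N] note sN' = summand_props(2)[OF N']
  have b: "bij_betw (\<lambda>x. f (pr N' (g x))) N N"
    using g(2) bij_betw_cong[of N "\<lambda>x. (ee N' \<odot>\<^bsub>PP N\<^esub> f) (g x)" "\<lambda>x. f (pr N' (g x))" N]
      lhom_closed[OF g(1)] by (simp add: compose_eq ee_def)
  have "pr N' \<in> lhom \<Lambda> E ?N'"
    unfolding lhom_sub_cod[OF lsub_subset[OF sN']] using pr_hom[OF N'] pr_in[OF N'] by auto
  hence 1: "(\<lambda>x. pr N' (g x)) \<in> lhom \<Lambda> ?N ?N'" by (rule lhom_comp[OF g(1)])
  have 2: "f \<in> lhom \<Lambda> ?N' ?N"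
    by (rule lhom_sub_dom[OF _ lsub_subset[OF sN']]) (use f(1) in \<open>simp add: lmod_hom_def\<close>)
  have "lmod_iso \<Lambda> ?N ?N'"
    by (rule retract_of_indecomposable[OF fdm_lmod[OF fdm_summand[OF N]] fdm_lmod[OF fdm_summand[OF N']]
          summand_props(3)[OF N'] _ 1 2])
      (use b summand_props(3)[OF N] in \<open>auto simp: indecomposable_def\<close>)
  thus ?thesis by (rule summand_props(4)[OF N N'])
qed

lemma simple_of_summand:
  assumes N: "N \<in> \<N>"
  shows "\<exists>S \<in> fmod K \<Gamma>. simple_module \<Gamma> S \<and> wt N S"
proof -
  interpret P: lmod \<Gamma> "PP N" by (rule lmod_PP[OF N])
  let ?Q = "quot_lmod (PP N) (rad_PP N)"
  have "rad_PP N \<noteq> carrier (PP N)" using ee_rad_PP[OF N] ee_PP[OF N] by blast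
  hence "max_sub \<Gamma> (PP N) (rad_PP N)"
    using rad_PP_sub[OF N] rad_PP_largest[OF N] by (auto simp: max_sub_def)
  hence s: "simple_module \<Gamma> ?Q" using P.simple_quot_iff[OF rad_PP_sub[OF N]] by simp
  note lQ = P.lmod_quot[OF rad_PP_sub[OF N]] note e = P.quot_map_epi[OF rad_PP_sub[OF N]]
  have "ee N \<odot>\<^bsub>PP N\<^esub> ee N \<notin> rad_PP N" using PP_ee[OF N ee_PP[OF N]] ee_rad_PP[OF N] by simp
  hence w: "wt N ?Q"
    using wt_epi[OF P.lmod_axioms lQ e N] ee_PP[OF N]
      P.quot_map_zero_iff[OF rad_PP_sub[OF N] P.closed_ops[OF ee_G[OF N] ee_PP[OF N]]] by blast
  have fQ: "fdG ?Q" by (rule fda.fdm_quot[OF fda_G fdm_PP[OF N] rad_PP_sub[OF N]])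
  obtain S where S: "S \<in> fmod K \<Gamma>" "lmod_iso \<Gamma> ?Q S"
    using fmod_representative[OF fd_auslander_algebra[OF fdE] fQ] by blast
  have lS: "lmod \<Gamma> S" using S(1) by (simp add: fmod_def fdG_lmod)
  have "wt N S" by (rule wt_iso[OF lS lQ lmod_iso_sym[OF lQ lS S(2)] N w])
  moreover have "simple_module \<Gamma> S" by (rule simple_iso[OF lQ lS S(2) s])
  ultimately show ?thesis using S(1) by blast
qed

text \<open>Multiplication by the idempotent \<open>ee N\<close> is exact. If it kills all factors of a composition series,
  it maps each member of the series to the previous one and, being idempotent, it vanishes.\<close>
lemma composition_factor_iff_wt:
  assumes X: "fdG X" and S: "lmod \<Gamma> S" "simple_module \<Gamma> S" and N: "N \<in> \<N>" and w: "wt N S"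
  shows "composition_factor \<Gamma> X S \<longleftrightarrow> wt N X"
proof
  note lX = fdG_lmod[OF X]
  interpret X: lmod \<Gamma> X by (rule lX)
  have subq: "lsubmodule (Us ! i) \<Gamma> X" "lsubmodule (Us ! Suc i) \<Gamma> X"
    "lmod \<Gamma> (X\<lparr>carrier := Us ! Suc i\<rparr>)" "lsubmodule (Us ! i) \<Gamma> (X\<lparr>carrier := Us ! Suc i\<rparr>)"
    "simple_module \<Gamma> (subquotient X Us i)"
    if cs: "composition_series \<Gamma> X Us" and i: "Suc i < length Us" for Us i
  proof -
    show 1: "lsubmodule (Us ! i) \<Gamma> X" and 2: "lsubmodule (Us ! Suc i) \<Gamma> X"
      using cs i by (auto simp: composition_series_def filtration_def)
    show "lmod \<Gamma> (X\<lparr>carrier := Us ! Suc i\<rparr>)" by (rule X.lmod_sub[OF 2])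
    show "lsubmodule (Us ! i) \<Gamma> (X\<lparr>carrier := Us ! Suc i\<rparr>)"
      using X.lsub_sub_iff[OF 2] 1 cs i by (auto simp: composition_series_def filtration_def)
    show "simple_module \<Gamma> (subquotient X Us i)" using cs i by (simp add: composition_series_def)
  qed
  { assume "composition_factor \<Gamma> X S"
    then obtain Us i where cs: "composition_series \<Gamma> X Us" "Suc i < length Us"
      and iso: "lmod_iso \<Gamma> (subquotient X Us i) S" by (auto simp: composition_factor_def)
    note s = subq[OF cs]
    have lq: "lmod \<Gamma> (subquotient X Us i)"
      unfolding subquotient_def by (rule lmod.lmod_quot[OF s(3,4)])
    have "wt N (subquotient X Us i)" by (rule wt_iso[OF lq S(1) iso N w])
    hence "wt N (X\<lparr>carrier := Us ! Suc i\<rparr>)"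
      unfolding subquotient_def
      by (rule wt_epi_imp[OF s(3) lmod.lmod_quot[OF s(3,4)] lmod.quot_map_epi[OF s(3,4)] N])
    thus "wt N X" by (rule wt_sub[OF s(2)]) }
  { assume wX: "wt N X"
    obtain Us where cs: "composition_series \<Gamma> X Us"
      using fda.composition_series_through[OF fda_G X X.lsub_carrier] by blast
    have "\<exists>i. Suc i < length Us \<and> wt N (subquotient X Us i)"
    proof (rule ccontr)
      assume n: "\<not> ?thesis"
      have "\<forall>x \<in> Us ! i. ee N \<odot>\<^bsub>X\<^esub> x = \<zero>\<^bsub>X\<^esub>" if "i < length Us" for i
        using that
      proof (induction i)
        case 0
        thus ?case using cs ee_G[OF N] by (auto simp: composition_series_def filtration_def hd_conv_nth)
      next
        case (Suc i)
        note s = subq[OF cs Suc.prems]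
        interpret V: lmod \<Gamma> "X\<lparr>carrier := Us ! Suc i\<rparr>" by (rule s(3))
        show ?case
        proof
          fix x assume x: "x \<in> Us ! Suc i"
          have xc: "x \<in> carrier X" by (rule lsub_mem[OF s(2) x])
          have ex: "ee N \<odot>\<^bsub>X\<^esub> x \<in> Us ! Suc i" by (rule lsub_smult[OF s(2) ee_G[OF N] x])
          have "\<not> wt N (quot_lmod (X\<lparr>carrier := Us ! Suc i\<rparr>) (Us ! i))"
            using n Suc.prems by (auto simp: subquotient_def)
          hence "ee N \<odot>\<^bsub>X\<^esub> x \<in> Us ! i"
            using wt_epi[OF s(3) V.lmod_quot[OF s(4)] V.quot_map_epi[OF s(4)] N]
              V.quot_map_zero_iff[OF s(4)] x ex by auto
          hence "ee N \<odot>\<^bsub>X\<^esub> (ee N \<odot>\<^bsub>X\<^esub> x) = \<zero>\<^bsub>X\<^esub>" using Suc by simp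
          thus "ee N \<odot>\<^bsub>X\<^esub> x = \<zero>\<^bsub>X\<^esub>" using ee_ee[OF lX N xc] by simp
        qed
      qed
      from this[of "length Us - 1"] have "\<forall>x \<in> carrier X. ee N \<odot>\<^bsub>X\<^esub> x = \<zero>\<^bsub>X\<^esub>"
        using cs by (auto simp: composition_series_def filtration_def last_conv_nth)
      thus False using wX by (auto simp: wt_def)
    qed
    then obtain i where i: "Suc i < length Us" "wt N (subquotient X Us i)" by blast
    note s = subq[OF cs i(1)]
    have lq: "lmod \<Gamma> (subquotient X Us i)"
      unfolding subquotient_def by (rule lmod.lmod_quot[OF s(3,4)])
    have "lmod_iso \<Gamma> (subquotient X Us i) S" by (rule simple_iso_of_wt[OF lq s(5) S N i(2) w])
    thus "composition_factor \<Gamma> X S" using cs i(1) by (auto simp: composition_factor_def) }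
qed

lemma projective_cover_PP:
  assumes PS: "projective_cover K \<Gamma> P S" and S: "S \<in> fmod K \<Gamma>" "simple_module \<Gamma> S"
    and N: "N \<in> \<N>" and w: "wt N S"
  shows "lmod_iso \<Gamma> (PP N) P"
proof -
  interpret G: fda K \<Gamma> by (rule fda_G)
  have fP: "fdG P" and pP: "projective K \<Gamma> P" and fS: "fdG S"
    using PS S(1) by (auto simp: projective_cover_def fmod_def)
  note lP = fdG_lmod[OF fP] note lS = fdG_lmod[OF fS] note lN = lmod_PP[OF N]
  interpret P: lmod \<Gamma> P by (rule lP)
  interpret S: lmod \<Gamma> S by (rule lS)
  interpret N: lmod \<Gamma> "PP N" by (rule lN)
  obtain f where f: "f \<in> lhom \<Gamma> P S" "f ` carrier P = carrier S"
    and sf: "\<And>U. lsubmodule U \<Gamma> P \<Longrightarrow> U <+>\<^bsub>P\<^esub> a_kernel P S f = carrier P \<Longrightarrow> U = carrier P"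
    using PS unfolding projective_cover_def lmod_hom_def by blast
  have ef: "lepi \<Gamma> P S f" using f by (simp add: lepi_def)
  obtain q where q: "lepi \<Gamma> (PP N) S q" "{x \<in> carrier (PP N). q x = \<zero>\<^bsub>S\<^esub>} = rad_PP N"
    using simple_wt_epi[OF lS S(2) N w] by blast
  obtain h where h: "h \<in> lhom \<Gamma> (PP N) P" "\<And>x. x \<in> carrier (PP N) \<Longrightarrow> f (h x) = q x"
    using G.projective_lift[OF lN projective_PP[OF N] fP fS ef lepiD(1)[OF q(1)]] by blast
  have im: "lsubmodule (h ` carrier (PP N)) \<Gamma> P" by (rule lsub_image[OF lN lP h(1) N.lsub_carrier])
  have ker: "lsubmodule (a_kernel P S f) \<Gamma> P"
    unfolding a_kernel_def' by (rule quot_iso(1)[OF lP lS ef refl])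
  have "h ` carrier (PP N) <+>\<^bsub>P\<^esub> a_kernel P S f = carrier P"
  proof
    show "h ` carrier (PP N) <+>\<^bsub>P\<^esub> a_kernel P S f \<subseteq> carrier P" by (rule lsub_subset[OF P.lsub_sum[OF im ker]])
    show "carrier P \<subseteq> h ` carrier (PP N) <+>\<^bsub>P\<^esub> a_kernel P S f"
    proof
      fix y assume y: "y \<in> carrier P"
      obtain x where x: "x \<in> carrier (PP N)" "f y = q x" using lepi_ex[OF q(1) lhom_closed[OF f(1) y]] by blast
      have hx: "h x \<in> carrier P" by (rule lhom_closed[OF h(1) x(1)])
      have "f (y \<ominus>\<^bsub>P\<^esub> h x) = \<zero>\<^bsub>S\<^esub>"
        using lhom_diff[OF lP lS f(1) y hx] x h(2)[OF x(1)] lhom_closed[OF f(1) y] by simp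
      hence "y \<ominus>\<^bsub>P\<^esub> h x \<in> a_kernel P S f" using y hx by (simp add: a_kernel_def')
      moreover have "y = h x \<oplus>\<^bsub>P\<^esub> (y \<ominus>\<^bsub>P\<^esub> h x)"
        using P.diff_add_cancel[OF y hx] P.a_comm[OF hx P.minus_closed[OF y hx]] by simp
      ultimately show "y \<in> h ` carrier (PP N) <+>\<^bsub>P\<^esub> a_kernel P S f"
        unfolding P.set_add_iff using x(1) by blast
    qed
  qed
  hence "h ` carrier (PP N) = carrier P" by (rule sf[OF im])
  hence eh: "lepi \<Gamma> (PP N) P h" using h(1) by (simp add: lepi_def)
  obtain s where s: "s \<in> lhom \<Gamma> P (PP N)" "\<And>y. y \<in> carrier P \<Longrightarrow> h (s y) = y"
    using G.projective_lift[OF lP pP fdm_PP[OF N] fP eh lhom_id] by blast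
  have ims: "lsubmodule (s ` carrier P) \<Gamma> (PP N)" by (rule lsub_image[OF lP lN s(1) P.lsub_carrier])
  have "s ` carrier P = carrier (PP N)"
  proof (rule ccontr)
    assume "s ` carrier P \<noteq> carrier (PP N)"
    from rad_PP_largest[OF N ims this] have "q (s y) = \<zero>\<^bsub>S\<^esub>" if "y \<in> carrier P" for y
      using that q(2) by blast
    hence "f y = \<zero>\<^bsub>S\<^esub>" if "y \<in> carrier P" for y
      using h(2)[OF lhom_closed[OF s(1) that]] s(2)[OF that] that by simp
    hence "f ` carrier P \<subseteq> {\<zero>\<^bsub>S\<^esub>}" by (simp add: image_subset_iff)
    hence "carrier S = {\<zero>\<^bsub>S\<^esub>}" using f(2) S.M.zero_closed by auto
    thus False using S(2) by (simp add: simple_module_def)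
  qed
  moreover have "inj_on s (carrier P)" by (rule inj_on_inverseI[of _ h]) (rule s(2))
  ultimately have "lmod_iso \<Gamma> P (PP N)"
    unfolding lmod_iso_iff[OF lP] bij_betw_def using s(1) by blast
  thus ?thesis by (rule lmod_iso_sym[OF lP lN])
qed

end

section \<open>Standard modules\<close>

lemma carrier_update_self: "M\<lparr>carrier := carrier M\<rparr> = M"
  by simp

locale auslander_simples = auslander K \<Lambda> E \<N>
  for K :: "'k ring" and \<Lambda> :: "('k, 'a) module" and E :: "('a, 'e) module" and \<N> :: "'e set set" +
  fixes \<Xi> :: "'x set" and S P :: "'x \<Rightarrow> ('e \<Rightarrow> 'e, nat \<Rightarrow> 'k) module"
  assumes par: "parametrizes_simples K \<Gamma> \<Xi> S"
    and cov: "\<And>\<xi>. \<xi> \<in> \<Xi> \<Longrightarrow> projective_cover K \<Gamma> (P \<xi>) (S \<xi>)"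
begin

lemma S_props:
  assumes "\<xi> \<in> \<Xi>"
  shows "S \<xi> \<in> fmod K \<Gamma>" "simple_module \<Gamma> (S \<xi>)" "lmod \<Gamma> (S \<xi>)"
  using par assms by (auto simp: parametrizes_simples_def fmod_def fdG_lmod)

text \<open>The index \<open>\<xi>\<close> of a simple module corresponds to the summand \<open>N\<close> of \<open>E\<close> for which \<open>S \<xi>\<close> is
  the top of \<open>PP N\<close>.\<close>
definition sm :: "'x \<Rightarrow> 'e set" where
  "sm \<xi> = (THE N. N \<in> \<N> \<and> wt N (S \<xi>))"

lemma sm:
  assumes \<xi>: "\<xi> \<in> \<Xi>"
  shows "sm \<xi> \<in> \<N>" "wt (sm \<xi>) (S \<xi>)"
proof -
  note S = S_props[OF \<xi>]
  have "carrier (S \<xi>) \<noteq> {\<zero>\<^bsub>S \<xi>\<^esub>}" using S(2) by (simp add: simple_module_def)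
  then obtain N where N: "N \<in> \<N>" "wt N (S \<xi>)" using wt_exists[OF S(3)] by blast
  have "sm \<xi> = N"
    unfolding sm_def by (rule the_equality) (use N wt_unique[OF S(3,2)] in blast)+
  thus "sm \<xi> \<in> \<N>" "wt (sm \<xi>) (S \<xi>)" using N by auto
qed

lemma sm_inj:
  assumes \<xi>: "\<xi> \<in> \<Xi>" and \<rho>: "\<rho> \<in> \<Xi>" and eq: "sm \<xi> = sm \<rho>"
  shows "\<xi> = \<rho>"
proof -
  have "wt (sm \<xi>) (S \<rho>)" unfolding eq by (rule sm(2)[OF \<rho>])
  from simple_iso_of_wt[OF S_props(3,2)[OF \<xi>] S_props(3,2)[OF \<rho>] sm(1)[OF \<xi>] sm(2)[OF \<xi>] this]
  show ?thesis using par \<xi> \<rho> by (auto simp: parametrizes_simples_def)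
qed

lemma sm_surj:
  assumes N: "N \<in> \<N>"
  shows "\<exists>\<xi> \<in> \<Xi>. sm \<xi> = N"
proof -
  obtain T where T: "T \<in> fmod K \<Gamma>" "simple_module \<Gamma> T" "wt N T" using simple_of_summand[OF N] by blast
  then obtain \<xi> where \<xi>: "\<xi> \<in> \<Xi>" "lmod_iso \<Gamma> T (S \<xi>)" using par by (auto simp: parametrizes_simples_def)
  have lT: "lmod \<Gamma> T" using T(1) by (simp add: fmod_def fdG_lmod)
  note S = S_props[OF \<xi>(1)]
  have "wt N (S \<xi>)" by (rule wt_iso[OF S(3) lT lmod_iso_sym[OF lT S(3) \<xi>(2)] N T(3)])
  hence "sm \<xi> = N" using wt_unique[OF S(3,2) sm(1)[OF \<xi>(1)] N sm(2)[OF \<xi>(1)]] by blast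
  thus ?thesis using \<xi>(1) by blast
qed

lemma composition_factor_wt:
  "fdG X \<Longrightarrow> \<xi> \<in> \<Xi> \<Longrightarrow> composition_factor \<Gamma> X (S \<xi>) \<longleftrightarrow> wt (sm \<xi>) X"
  using composition_factor_iff_wt S_props sm by blast

text \<open>The least submodule of \<open>M\<close> whose factor module has no weights in \<open>B\<close>.\<close>
definition wsub :: "('e \<Rightarrow> 'e, 'm) module \<Rightarrow> 'e set set \<Rightarrow> 'm set" where
  "wsub M B = \<Inter> {G. lsubmodule G \<Gamma> M \<and> (\<forall>N \<in> B. \<forall>m \<in> carrier M. ee N \<odot>\<^bsub>M\<^esub> m \<in> G)}"

lemma
  assumes M: "lmod \<Gamma> M" and B: "B \<subseteq> \<N>"
  shows wsub_sub: "lsubmodule (wsub M B) \<Gamma> M"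
    and wsub_ee: "N \<in> B \<Longrightarrow> m \<in> carrier M \<Longrightarrow> ee N \<odot>\<^bsub>M\<^esub> m \<in> wsub M B"
proof -
  interpret M: lmod \<Gamma> M by (rule M)
  have "\<forall>N \<in> B. \<forall>m \<in> carrier M. ee N \<odot>\<^bsub>M\<^esub> m \<in> carrier M"
    using M.closed_ops[OF ee_G] B by blast
  hence "carrier M \<in> {G. lsubmodule G \<Gamma> M \<and> (\<forall>N \<in> B. \<forall>m \<in> carrier M. ee N \<odot>\<^bsub>M\<^esub> m \<in> G)}"
    using M.lsub_carrier by blast
  thus "lsubmodule (wsub M B) \<Gamma> M" unfolding wsub_def by (intro M.lsub_Inter) auto
  show "N \<in> B \<Longrightarrow> m \<in> carrier M \<Longrightarrow> ee N \<odot>\<^bsub>M\<^esub> m \<in> wsub M B" by (auto simp: wsub_def)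
qed

lemma wsub_least:
  "lsubmodule G \<Gamma> M \<Longrightarrow> (\<And>N m. N \<in> B \<Longrightarrow> m \<in> carrier M \<Longrightarrow> ee N \<odot>\<^bsub>M\<^esub> m \<in> G) \<Longrightarrow> wsub M B \<subseteq> G"
  unfolding wsub_def by blast

lemma wsub_iso:
  assumes M: "lmod \<Gamma> M" and M': "lmod \<Gamma> M'" and \<phi>: "\<phi> \<in> lhom \<Gamma> M M'"
    and b: "bij_betw \<phi> (carrier M) (carrier M')" and B: "B \<subseteq> \<N>"
  shows "{x \<in> carrier M. \<phi> x \<in> wsub M' B} = wsub M B"
proof
  interpret M: lmod \<Gamma> M by (rule M)
  note sub = wsub_sub[OF M B] note sub' = wsub_sub[OF M' B]
  show "wsub M B \<subseteq> {x \<in> carrier M. \<phi> x \<in> wsub M' B}"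
  proof (rule wsub_least[OF lsub_vimage[OF M M' \<phi> sub']])
    fix N m assume N: "N \<in> B" and m: "m \<in> carrier M"
    have g: "ee N \<in> carrier \<Gamma>" using ee_G N B by blast
    show "ee N \<odot>\<^bsub>M\<^esub> m \<in> {x \<in> carrier M. \<phi> x \<in> wsub M' B}"
      using wsub_ee[OF M' B N lhom_closed[OF \<phi> m]] lhom_smult[OF \<phi> g m] M.closed_ops[OF g m] by simp
  qed
  have "wsub M' B \<subseteq> \<phi> ` wsub M B"
  proof (rule wsub_least[OF lsub_image[OF M M' \<phi> sub]])
    fix N y assume N: "N \<in> B" and "y \<in> carrier M'"
    then obtain m where m: "m \<in> carrier M" "y = \<phi> m" using b by (auto simp: bij_betw_def)
    have g: "ee N \<in> carrier \<Gamma>" using ee_G N B by blast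
    show "ee N \<odot>\<^bsub>M'\<^esub> y \<in> \<phi> ` wsub M B"
      unfolding m(2) lhom_smult[OF \<phi> g m(1), symmetric] by (rule imageI[OF wsub_ee[OF M B N m(1)]])
  qed
  show "{x \<in> carrier M. \<phi> x \<in> wsub M' B} \<subseteq> wsub M B"
  proof
    fix x assume x: "x \<in> {x \<in> carrier M. \<phi> x \<in> wsub M' B}"
    then obtain y where y: "y \<in> wsub M B" "\<phi> x = \<phi> y" using \<open>wsub M' B \<subseteq> \<phi> ` wsub M B\<close> by blast
    have "x = y" using b x y lsub_mem[OF sub y(1)] by (auto simp: bij_betw_def dest: inj_onD)
    thus "x \<in> wsub M B" using y(1) by simp
  qed
qed

text \<open>The summands of \<open>E\<close> whose simple modules must not occur in the standard module of \<open>\<xi>\<close>.\<close>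
definition not_below :: "'x rel \<Rightarrow> 'x \<Rightarrow> 'e set set" where
  "not_below leq \<xi> = sm ` {\<rho> \<in> \<Xi>. (\<rho>, \<xi>) \<notin> leq}"

lemma not_below_sub: "not_below leq \<xi> \<subseteq> \<N>"
  using sm by (auto simp: not_below_def)

abbreviation \<Delta> :: "'x rel \<Rightarrow> 'x \<Rightarrow> ('e \<Rightarrow> 'e, (nat \<Rightarrow> 'k) set) module" where
  "\<Delta> leq \<equiv> standard_module \<Gamma> \<Xi> S P leq"

lemma standard_module_wsub:
  assumes \<xi>: "\<xi> \<in> \<Xi>"
  shows "\<Delta> leq \<xi> = quot_lmod (P \<xi>) (wsub (P \<xi>) (not_below leq \<xi>))"
proof -
  have fP: "fdG (P \<xi>)" using cov[OF \<xi>] by (simp add: projective_cover_def fmod_def)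
  note lP = fdG_lmod[OF fP]
  interpret P: lmod \<Gamma> "P \<xi>" by (rule lP)
  have *: "(\<forall>\<rho> \<in> \<Xi>. composition_factor \<Gamma> (quot_lmod (P \<xi>) U) (S \<rho>) \<longrightarrow> (\<rho>, \<xi>) \<in> leq) \<longleftrightarrow>
      (\<forall>N \<in> not_below leq \<xi>. \<forall>m \<in> carrier (P \<xi>). ee N \<odot>\<^bsub>P \<xi>\<^esub> m \<in> U)" if U: "lsubmodule U \<Gamma> (P \<xi>)" for U
  proof -
    have fQ: "fdG (quot_lmod (P \<xi>) U)" by (rule fda.fdm_quot[OF fda_G fP U])
    have "composition_factor \<Gamma> (quot_lmod (P \<xi>) U) (S \<rho>) \<longleftrightarrow>
        \<not> (\<forall>m \<in> carrier (P \<xi>). ee (sm \<rho>) \<odot>\<^bsub>P \<xi>\<^esub> m \<in> U)" if \<rho>: "\<rho> \<in> \<Xi>" for \<rho>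
      using composition_factor_wt[OF fQ \<rho>] wt_epi[OF lP P.lmod_quot[OF U] P.quot_map_epi[OF U] sm(1)[OF \<rho>]]
        P.quot_map_zero_iff[OF U] P.closed_ops[OF ee_G[OF sm(1)[OF \<rho>]]] by blast
    thus ?thesis by (auto simp: not_below_def)
  qed
  have "(LEAST U. lsubmodule U \<Gamma> (P \<xi>) \<and>
      (\<forall>\<rho> \<in> \<Xi>. composition_factor \<Gamma> (quot_lmod (P \<xi>) U) (S \<rho>) \<longrightarrow> (\<rho>, \<xi>) \<in> leq)) = wsub (P \<xi>) (not_below leq \<xi>)"
  proof (rule Least_equality)
    show "lsubmodule (wsub (P \<xi>) (not_below leq \<xi>)) \<Gamma> (P \<xi>) \<and> (\<forall>\<rho> \<in> \<Xi>. composition_factor \<Gamma>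
        (quot_lmod (P \<xi>) (wsub (P \<xi>) (not_below leq \<xi>))) (S \<rho>) \<longrightarrow> (\<rho>, \<xi>) \<in> leq)"
      using wsub_sub[OF lP not_below_sub] *[OF wsub_sub[OF lP not_below_sub]] wsub_ee[OF lP not_below_sub] by blast
    fix U assume U: "lsubmodule U \<Gamma> (P \<xi>) \<and>
      (\<forall>\<rho> \<in> \<Xi>. composition_factor \<Gamma> (quot_lmod (P \<xi>) U) (S \<rho>) \<longrightarrow> (\<rho>, \<xi>) \<in> leq)"
    show "wsub (P \<xi>) (not_below leq \<xi>) \<subseteq> U"
      by (rule wsub_least) (use U * in blast)+
  qed
  thus ?thesis by (simp add: standard_module_def)
qed

lemma fdm_standard:
  assumes \<xi>: "\<xi> \<in> \<Xi>"
  shows "fdG (\<Delta> leq \<xi>)"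
proof -
  have fP: "fdG (P \<xi>)" using cov[OF \<xi>] by (simp add: projective_cover_def fmod_def)
  show ?thesis
    unfolding standard_module_wsub[OF \<xi>]
    by (rule fda.fdm_quot[OF fda_G fP wsub_sub[OF fdG_lmod[OF fP] not_below_sub]])
qed

text \<open>The kernel of the epimorphism from \<open>PP (sm \<xi>)\<close> onto the standard module, see \<open>standard_epi\<close>.\<close>
abbreviation ker_standard :: "'x rel \<Rightarrow> 'x \<Rightarrow> ('e \<Rightarrow> 'e) set" where
  "ker_standard leq \<xi> \<equiv> wsub (PP (sm \<xi>)) (not_below leq \<xi>)"

text \<open>As \<open>P \<xi>\<close> is isomorphic to \<open>PP (sm \<xi>)\<close>, the standard modules can be computed there.\<close>
lemma standard_epi:
  assumes \<xi>: "\<xi> \<in> \<Xi>"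
  shows "\<exists>p. lepi \<Gamma> (PP (sm \<xi>)) (\<Delta> leq \<xi>) p \<and> {f \<in> carrier (PP (sm \<xi>)). p f = \<zero>\<^bsub>\<Delta> leq \<xi>\<^esub>} = ker_standard leq \<xi>"
proof -
  have fP: "fdG (P \<xi>)" using cov[OF \<xi>] by (simp add: projective_cover_def fmod_def)
  note lP = fdG_lmod[OF fP] note lPP = lmod_PP[OF sm(1)[OF \<xi>]]
  interpret P: lmod \<Gamma> "P \<xi>" by (rule lP)
  note sub = wsub_sub[OF lP not_below_sub, of leq \<xi>]
  obtain \<phi> where \<phi>: "\<phi> \<in> lhom \<Gamma> (PP (sm \<xi>)) (P \<xi>)" "bij_betw \<phi> (carrier (PP (sm \<xi>))) (carrier (P \<xi>))"
    using projective_cover_PP[OF cov[OF \<xi>] S_props(1,2)[OF \<xi>] sm[OF \<xi>]] unfolding lmod_iso_iff[OF lPP] by blast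
  have e: "lepi \<Gamma> (PP (sm \<xi>)) (P \<xi>) \<phi>" using \<phi> by (simp add: lepi_def bij_betw_def)
  have k: "{f \<in> carrier (PP (sm \<xi>)). quot_map (P \<xi>) (wsub (P \<xi>) (not_below leq \<xi>)) (\<phi> f) =
      \<zero>\<^bsub>quot_lmod (P \<xi>) (wsub (P \<xi>) (not_below leq \<xi>))\<^esub>} = ker_standard leq \<xi>"
    unfolding wsub_iso[OF lPP lP \<phi> not_below_sub, symmetric]
    using P.quot_map_zero_iff[OF sub] lhom_closed[OF \<phi>(1)] by blast
  show ?thesis
    unfolding standard_module_wsub[OF \<xi>]
    using lepi_comp[OF e P.quot_map_epi[OF sub]] k by blast
qed

text \<open>Torsion-free modules are closed under extensions: an element killed by all \<open>elem E s e\<close> lies in each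
  member of the filtration, from the largest down to zero.\<close>
lemma filtered_by_imp_tfree:
  assumes M: "lmod \<Gamma> M" and f: "filtered_by \<Gamma> \<Xi> (\<Delta> leq) M"
    and t: "\<And>\<xi>. \<xi> \<in> \<Xi> \<Longrightarrow> tfree (\<Delta> leq \<xi>)"
  shows "tfree M"
proof -
  interpret M: lmod \<Gamma> M by (rule M)
  obtain Us where Us: "filtration \<Gamma> M Us"
    and iso: "\<And>i. Suc i < length Us \<Longrightarrow> \<exists>\<xi> \<in> \<Xi>. lmod_iso \<Gamma> (subquotient M Us i) (\<Delta> leq \<xi>)"
    using f by (auto simp: filtered_by_def)
  have main: "m = \<zero>\<^bsub>M\<^esub>" if "i < length Us" "m \<in> Us ! i"
    "\<And>s e. s \<in> dual \<Longrightarrow> e \<in> carrier E \<Longrightarrow> elem E s e \<odot>\<^bsub>M\<^esub> m = \<zero>\<^bsub>M\<^esub>" for i m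
    using that
  proof (induction i)
    case 0
    thus ?case using Us by (auto simp: filtration_def hd_conv_nth)
  next
    case (Suc i)
    let ?V = "M\<lparr>carrier := Us ! Suc i\<rparr>"
    have s: "lsubmodule (Us ! Suc i) \<Gamma> M" "lsubmodule (Us ! i) \<Gamma> M" "Us ! i \<subseteq> Us ! Suc i"
      using Us Suc.prems(1) by (auto simp: filtration_def)
    hence s': "lsubmodule (Us ! i) \<Gamma> ?V" using M.lsub_sub_iff[OF s(1)] by blast
    interpret V: lmod \<Gamma> ?V by (rule M.lmod_sub[OF s(1)])
    let ?Q = "quot_lmod ?V (Us ! i)"
    obtain \<xi> where \<xi>: "\<xi> \<in> \<Xi>" "lmod_iso \<Gamma> ?Q (\<Delta> leq \<xi>)"
      using iso[OF Suc.prems(1)] by (auto simp: subquotient_def)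
    have "tfree ?Q"
      by (rule tfree_iso[OF V.lmod_quot[OF s'] fdG_lmod[OF fdm_standard[OF \<xi>(1)]] \<xi>(2) t[OF \<xi>(1)]])
    moreover have "{x \<in> carrier ?V. quot_map ?V (Us ! i) x = \<zero>\<^bsub>?Q\<^esub>} = Us ! i"
      using V.quot_map_zero_iff[OF s'] s(3) by auto
    ultimately have "tclosed ?V (Us ! i)"
      using tfree_epi_iff[OF V.lmod_axioms V.lmod_quot[OF s'] V.quot_map_epi[OF s'] refl] by simp
    hence "m \<in> Us ! i"
      by (rule tclosedD) (use Suc.prems lsub_zero[OF s(2)] in auto)
    thus ?case using Suc by simp
  qed
  have ne: "Us \<noteq> []" and "last Us = carrier M" using Us by (auto simp: filtration_def)
  hence "Us ! (length Us - 1) = carrier M" by (simp add: last_conv_nth)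
  thus ?thesis
    unfolding tclosed_def using main[of "length Us - 1"] ne by auto
qed

end

context auslander
begin

text \<open>A closed submodule that contains a surjection onto \<open>X\<close> contains everything, since the maps
  \<open>E \<rightarrow> \<Lambda> \<rightarrow> X\<close> factor through the surjection.\<close>
lemma tclosed_surj:
  assumes X: "lmod \<Lambda> X" and F: "lsubmodule F \<Gamma> (H X)" and G: "lsubmodule G \<Gamma> (H X)" "G \<subseteq> F"
    and c: "tclosed ((H X)\<lparr>carrier := F\<rparr>) G" and f: "f \<in> G" "f ` carrier E = carrier X"
  shows "G = F"
proof
  show "F \<subseteq> G"
  proof
    fix g assume g: "g \<in> F"
    have gh: "g \<in> lmod_hom \<Lambda> E X" using lsub_mem[OF F g] by simp
    have fh: "f \<in> lmod_hom \<Lambda> E X" using lsub_mem[OF G(1) f(1)] by simp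
    show "g \<in> G"
    proof (rule tclosedD[OF c])
      fix s e assume se: "s \<in> dual" "e \<in> carrier E"
      have "g e \<in> f ` carrier E" using f(2) lmod_hom_app(1)[OF gh se(2)] by simp
      then obtain e' where e': "e' \<in> carrier E" "g e = f e'" by blast
      have "elem E s e \<odot>\<^bsub>H X\<^esub> g = elem E s e' \<odot>\<^bsub>H X\<^esub> f"
        using elem_smult[OF gh se] elem_smult[OF fh se(1) e'(1)] e'(2) by simp
      thus "elem E s e \<odot>\<^bsub>(H X)\<lparr>carrier := F\<rparr>\<^esub> g \<in> G"
        using lsub_smult[OF G(1) elem_G[OF se(1) e'(1)] f(1)] by simp
    qed (use g in simp)
  qed
qed (rule G(2))

end

lemma (in lmod) division_ring_EndI:
  assumes nz: "carrier M \<noteq> {\<zero>\<^bsub>M\<^esub>}"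
    and b: "\<And>\<phi>. \<phi> \<in> lhom A M M \<Longrightarrow> \<exists>x \<in> carrier M. \<phi> x \<noteq> \<zero>\<^bsub>M\<^esub> \<Longrightarrow> bij_betw \<phi> (carrier M) (carrier M)"
  shows "division_ring (End_algebra A M)"
  unfolding division_ring_def
proof (intro conjI ring_End)
  let ?R = "End_algebra A M"
  have sim: "carrier ?R = lmod_hom A M M" "\<one>\<^bsub>?R\<^esub> = (\<lambda>x\<in>carrier M. x)" "\<zero>\<^bsub>?R\<^esub> = (\<lambda>x\<in>carrier M. \<zero>\<^bsub>M\<^esub>)"
    "\<And>f g. f \<otimes>\<^bsub>?R\<^esub> g = compose (carrier M) f g" by (simp_all add: End_algebra_def)
  obtain y where y: "y \<in> carrier M" "y \<noteq> \<zero>\<^bsub>M\<^esub>" using nz M.zero_closed by blast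
  show "Units ?R = carrier ?R - {\<zero>\<^bsub>?R\<^esub>}"
  proof
    show "Units ?R \<subseteq> carrier ?R - {\<zero>\<^bsub>?R\<^esub>}"
    proof
      fix f assume f: "f \<in> Units ?R"
      then obtain g where g: "g \<in> lmod_hom A M M" "g \<otimes>\<^bsub>?R\<^esub> f = \<one>\<^bsub>?R\<^esub>" "f \<in> carrier ?R"
        by (auto simp: Units_def sim(1))
      have "f \<noteq> \<zero>\<^bsub>?R\<^esub>"
      proof
        assume 0: "f = \<zero>\<^bsub>?R\<^esub>"
        have "g (f y) = y" using fun_cong[OF g(2)[unfolded sim], of y] y(1) by (simp add: compose_eq)
        hence "g \<zero>\<^bsub>M\<^esub> = y" using 0 y(1) by (simp add: sim)
        thus False using lhom_zero[OF lmod_axioms lmod_axioms lmod_homD(1)[OF g(1)]] y(2) by simp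
      qed
      thus "f \<in> carrier ?R - {\<zero>\<^bsub>?R\<^esub>}" using g(3) by simp
    qed
    show "carrier ?R - {\<zero>\<^bsub>?R\<^esub>} \<subseteq> Units ?R"
    proof
      fix f assume "f \<in> carrier ?R - {\<zero>\<^bsub>?R\<^esub>}"
      hence f: "f \<in> lmod_hom A M M" and f0: "f \<noteq> (\<lambda>x\<in>carrier M. \<zero>\<^bsub>M\<^esub>)" by (auto simp: sim)
      have "\<exists>x \<in> carrier M. f x \<noteq> \<zero>\<^bsub>M\<^esub>"
      proof (rule ccontr)
        assume "\<not> ?thesis"
        hence "f = (\<lambda>x\<in>carrier M. \<zero>\<^bsub>M\<^esub>)"
          by (intro lmod_hom_eqI[OF f lmod_hom_zero[OF lmod_axioms lmod_axioms]]) auto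
        thus False using f0 by contradiction
      qed
      hence bf: "bij_betw f (carrier M) (carrier M)" by (rule b[OF lmod_homD(1)[OF f]])
      let ?g = "\<lambda>x\<in>carrier M. inv_into (carrier M) f x"
      have g: "?g \<in> lmod_hom A M M"
        by (rule lmod_hom_restrict[OF lmod_axioms lhom_inv[OF lmod_homD(1)[OF f] bf lmod_axioms]])
      have "?g \<otimes>\<^bsub>?R\<^esub> f = \<one>\<^bsub>?R\<^esub>"
        unfolding sim compose_def
        by (rule restrict_ext) (use bij_betw_inv_into_left[OF bf] lmod_hom_app(1)[OF f] in simp)
      moreover have "f \<otimes>\<^bsub>?R\<^esub> ?g = \<one>\<^bsub>?R\<^esub>"
        unfolding sim compose_def
        by (rule restrict_ext) (use bij_betw_inv_into_right[OF bf] in simp)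
      ultimately show "f \<in> Units ?R" using f g unfolding Units_def sim(1) by blast
    qed
  qed
qed

section \<open>Uniserial algebras: the order by dimension\<close>

locale auslander_uniserial = auslander_simples K \<Lambda> E \<N> \<Xi> S P
  for K :: "'k ring" and \<Lambda> :: "('k, 'a) module" and E :: "('a, 'e) module" and \<N> :: "'e set set"
    and \<Xi> :: "'x set" and S P :: "'x \<Rightarrow> ('e \<Rightarrow> 'e, nat \<Rightarrow> 'k) module" +
  assumes uniserial: "uniserial_algebra K \<Lambda>"
begin

lemma chain:
  assumes M: "fdL M" and ind: "indecomposable \<Lambda> M"
  shows "chain_module \<Lambda> M"
proof -
  obtain Y where Y: "Y \<in> fmod K \<Lambda>" "lmod_iso \<Lambda> M Y" using fmod_representative[OF fd_alg M] by blast
  have fY: "fdL Y" using Y(1) by (simp add: fmod_def)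
  note lM = fdm_lmod[OF M] note lY = fdm_lmod[OF fY]
  have "indecomposable \<Lambda> Y" by (rule indecomposable_iso[OF lM lY Y(2) ind])
  hence "\<exists>!Us. composition_series \<Lambda> Y Us" using uniserial Y(1) by (simp add: uniserial_algebra_def)
  hence c: "chain_module \<Lambda> Y" using unique_composition_series_iff[OF fY] by simp
  obtain p where "lepi \<Lambda> Y M p" using lmod_iso_lepi[OF lY lM lmod_iso_sym[OF lM lY Y(2)] lepi_id] by blast
  thus ?thesis by (rule chain_module_iso[OF lY lM _ c])
qed

lemma rd_exists:
  assumes N: "N \<in> \<N>"
  shows "\<exists>R. lsubmodule R \<Lambda> (E\<lparr>carrier := N\<rparr>) \<and> R \<subset> N \<and>
    (\<forall>U. lsubmodule U \<Lambda> (E\<lparr>carrier := N\<rparr>) \<longrightarrow> U \<noteq> N \<longrightarrow> U \<subseteq> R)"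
proof -
  let ?N = "E\<lparr>carrier := N\<rparr>"
  note fN = fdm_summand[OF N]
  interpret N: lmod \<Lambda> ?N by (rule fdm_lmod[OF fN])
  have c: "chain_module \<Lambda> ?N" by (rule chain[OF fN summand_props(3)[OF N]])
  have "{\<zero>\<^bsub>?N\<^esub>} \<noteq> carrier ?N" using summand_props(3)[OF N] by (auto simp: indecomposable_def)
  then obtain R where R: "max_sub \<Lambda> ?N R" using max_sub_exists[OF fN N.lsub_zero_module] by blast
  have "U \<subseteq> R" if U: "lsubmodule U \<Lambda> ?N" "U \<noteq> N" for U
  proof -
    have "U \<subseteq> R \<or> R \<subseteq> U" using c U(1) max_subD(1)[OF R] by (simp add: chain_module_def)
    thus ?thesis using max_subD(4)[OF R U(1)] U(2) by auto
  qed
  thus ?thesis using max_subD(1,3)[OF R] by auto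
qed

text \<open>In a uniserial module the radical is the largest proper submodule.\<close>
definition rd :: "'e set \<Rightarrow> 'e set" where
  "rd N = (SOME R. lsubmodule R \<Lambda> (E\<lparr>carrier := N\<rparr>) \<and> R \<subset> N \<and>
    (\<forall>U. lsubmodule U \<Lambda> (E\<lparr>carrier := N\<rparr>) \<longrightarrow> U \<noteq> N \<longrightarrow> U \<subseteq> R))"

lemma
  assumes N: "N \<in> \<N>"
  shows rd_sub: "lsubmodule (rd N) \<Lambda> (E\<lparr>carrier := N\<rparr>)" and rd_psub: "rd N \<subset> N"
    and rd_largest: "lsubmodule U \<Lambda> (E\<lparr>carrier := N\<rparr>) \<Longrightarrow> U \<noteq> N \<Longrightarrow> U \<subseteq> rd N"
  using someI_ex[OF rd_exists[OF N]] by (auto simp: rd_def)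

abbreviation dimL :: "'e set \<Rightarrow> nat" where
  "dimL N \<equiv> kdim K \<Lambda> (E\<lparr>carrier := N\<rparr>)"

text \<open>A surjection between modules of these dimensions would be an isomorphism.\<close>
lemma non_iso_in_rd:
  assumes N: "N \<in> \<N>" and N': "N' \<in> \<N>" and ne: "N' \<noteq> N" and d: "dimL N' \<le> dimL N"
    and f: "f \<in> lhom \<Lambda> (E\<lparr>carrier := N'\<rparr>) (E\<lparr>carrier := N\<rparr>)" and x: "x \<in> N'"
  shows "f x \<in> rd N"
proof -
  note fN' = fdm_summand[OF N']
  note lN = fdm_lmod[OF fdm_summand[OF N]] note lN' = fdm_lmod[OF fN']
  interpret N': lmod \<Lambda> "E\<lparr>carrier := N'\<rparr>" by (rule lN')
  have "f ` N' \<noteq> N"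
  proof
    assume eq: "f ` N' = N"
    hence e: "lepi \<Lambda> (E\<lparr>carrier := N'\<rparr>) (E\<lparr>carrier := N\<rparr>) f" using f by (simp add: lepi_def)
    have "inj_on f N'" using kdim_lepi_inj[OF fN' lN e d] by simp
    hence "lmod_iso \<Lambda> (E\<lparr>carrier := N'\<rparr>) (E\<lparr>carrier := N\<rparr>)"
      unfolding lmod_iso_iff[OF lN'] using f eq by (auto simp: bij_betw_def)
    thus False using summand_props(4)[OF N' N] ne by blast
  qed
  moreover have "lsubmodule (f ` N') \<Lambda> (E\<lparr>carrier := N\<rparr>)"
    using lsub_image[OF lN' lN f N'.lsub_carrier] by simp
  ultimately have "f ` N' \<subseteq> rd N" using rd_largest[OF N] by blast
  thus ?thesis using x by blast
qed

abbreviation maps_to_rd :: "'e set \<Rightarrow> ('e \<Rightarrow> 'e) set" where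
  "maps_to_rd N \<equiv> HS (E\<lparr>carrier := N\<rparr>) (rd N)"

lemma maps_to_rd_sub: "N \<in> \<N> \<Longrightarrow> lsubmodule (maps_to_rd N) \<Gamma> (PP N)"
  by (rule HS_sub[OF fdm_lmod[OF fdm_summand] rd_sub])

text \<open>If \<open>\<Lambda>\<close> is uniserial, nonzero submodules of an indecomposable module are indecomposable. So the image
  of \<open>f\<close> is isomorphic to a summand of \<open>E\<close>, of smaller dimension than \<open>N\<close>.\<close>
lemma maps_to_rd_factor:
  assumes N: "N \<in> \<N>" and f: "f \<in> maps_to_rd N" "f \<noteq> \<zero>\<^bsub>PP N\<^esub>"
  shows "\<exists>N' \<in> \<N>. dimL N' < dimL N \<and> (\<exists>\<gamma> \<in> carrier \<Gamma>. \<exists>h \<in> carrier (PP N). f = \<gamma> \<odot>\<^bsub>PP N\<^esub> (ee N' \<odot>\<^bsub>PP N\<^esub> h))"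
proof -
  let ?N = "E\<lparr>carrier := N\<rparr>" and ?R = "E\<lparr>carrier := rd N\<rparr>"
  note fN = fdm_summand[OF N] note lN = fdm_lmod[OF fN]
  interpret N: lmod \<Lambda> ?N by (rule lN)
  interpret P: lmod \<Gamma> "PP N" by (rule lmod_PP[OF N])
  have fP: "f \<in> carrier (PP N)" and frd: "\<And>x. x \<in> carrier E \<Longrightarrow> f x \<in> rd N"
    using f(1) by (auto simp: HS_def)
  have fR: "fdL ?R" using fdm_sub[OF fN rd_sub[OF N]] by simp
  note lR = fdm_lmod[OF fR]
  have dR: "kdim K \<Lambda> ?R < dimL N"
    using kdim_psub[OF fN rd_sub[OF N] N.lsub_carrier] rd_psub[OF N] by simp
  have "rd N \<noteq> {\<zero>\<^bsub>E\<^esub>}"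
  proof
    assume "rd N = {\<zero>\<^bsub>E\<^esub>}"
    hence "f \<in> HS ?N {\<zero>\<^bsub>?N\<^esub>}" using f(1) by simp
    thus False using HS_zero[OF lN] f(2) by blast
  qed
  hence "indecomposable \<Lambda> ?R"
    using chain_module_indecomposable[OF lR] chain_module_sub[OF lN chain[OF fN summand_props(3)[OF N]] rd_sub[OF N]]
    by simp
  then obtain N' where N': "N' \<in> \<N>" "lmod_iso \<Lambda> ?R (E\<lparr>carrier := N'\<rparr>)" using summand_iso[OF fR] by blast
  let ?N' = "E\<lparr>carrier := N'\<rparr>"
  note lN' = fdm_lmod[OF fdm_summand[OF N'(1)]] note sN' = summand_props(2)[OF N'(1)]
  obtain \<phi> where \<phi>: "\<phi> \<in> lhom \<Lambda> ?R ?N'" "bij_betw \<phi> (rd N) N'"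
    using N'(2) unfolding lmod_iso_iff[OF lR] by auto
  let ?\<psi> = "inv_into (rd N) \<phi>"
  have \<psi>: "?\<psi> \<in> lhom \<Lambda> ?N' ?R" using lhom_inv[OF \<phi>(1) _ lR] \<phi>(2) by simp
  have rdE: "rd N \<subseteq> carrier E" using rd_psub[OF N] lsub_subset[OF summand_props(2)[OF N]] by blast
  have rdN: "rd N \<subseteq> carrier ?N" using rd_psub[OF N] by auto
  have "f \<in> lhom \<Lambda> E ?R"
    unfolding lhom_sub_cod[OF rdE] using fP frd PP_carrier[OF N] by (auto simp: lmod_hom_def)
  from lhom_comp[OF this \<phi>(1)] have "(\<lambda>x. \<phi> (f x)) \<in> lhom \<Lambda> E E"
    unfolding lhom_sub_cod[OF lsub_subset[OF sN']] by blast
  hence \<gamma>: "(\<lambda>x\<in>carrier E. \<phi> (f x)) \<in> carrier \<Gamma>" using lmod_hom_restrict[OF lmod_E] by simp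
  have prN': "pr N' \<in> lhom \<Lambda> E ?N'"
    unfolding lhom_sub_cod[OF lsub_subset[OF sN']] using pr_hom[OF N'(1)] pr_in[OF N'(1)] by auto
  have "?\<psi> \<in> lhom \<Lambda> ?N' ?N" using \<psi> lhom_sub_cod[OF rdN, of _ \<Lambda> ?N'] by simp
  from lhom_comp[OF prN' this] have h: "(\<lambda>x\<in>carrier E. ?\<psi> (pr N' x)) \<in> carrier (PP N)"
    using lmod_hom_restrict[OF lmod_E] by simp
  let ?\<gamma> = "\<lambda>x\<in>carrier E. \<phi> (f x)" and ?h = "\<lambda>x\<in>carrier E. ?\<psi> (pr N' x)"
  have \<phi>N': "\<phi> (f x) \<in> N'" if "x \<in> carrier E" for x using lhom_closed[OF \<phi>(1)] frd[OF that] by simp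
  have "f = ?\<gamma> \<odot>\<^bsub>PP N\<^esub> (ee N' \<odot>\<^bsub>PP N\<^esub> ?h)"
  proof (rule lmod_hom_eqI)
    show "f \<in> lmod_hom \<Lambda> E ?N" using fP by simp
    show "?\<gamma> \<odot>\<^bsub>PP N\<^esub> (ee N' \<odot>\<^bsub>PP N\<^esub> ?h) \<in> lmod_hom \<Lambda> E ?N"
      using P.closed_ops[OF \<gamma> P.closed_ops[OF ee_G[OF N'(1)] h]] by simp
    fix x assume x: "x \<in> carrier E"
    have c: "\<phi> (f x) \<in> carrier E" by (rule lsub_mem[OF sN' \<phi>N'[OF x]])
    have "?\<psi> (\<phi> (f x)) = f x" by (rule bij_betw_inv_into_left[OF \<phi>(2) frd[OF x]])
    thus "f x = (?\<gamma> \<odot>\<^bsub>PP N\<^esub> (ee N' \<odot>\<^bsub>PP N\<^esub> ?h)) x"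
      using x c pr_on[OF N'(1) \<phi>N'[OF x]] by (simp add: compose_eq ee_def)
  qed
  moreover have "dimL N' < dimL N" using kdim_iso(1)[OF fR lN' N'(2)] dR by simp
  ultimately show ?thesis using N'(1) \<gamma> h by blast
qed

text \<open>The simple modules of shorter summands are the larger ones. Different summands of the same dimension
  are incomparable.\<close>
definition uleq :: "'x rel" where
  "uleq = {(\<rho>, \<xi>). \<rho> \<in> \<Xi> \<and> \<xi> \<in> \<Xi> \<and> (\<rho> = \<xi> \<or> dimL (sm \<xi>) < dimL (sm \<rho>))}"

text \<open>A map from a summand that is not longer than \<open>N\<close> and different from \<open>N\<close> is not surjective,
  and the maps from shorter summands generate all maps with values in the radical.\<close>
lemma ker_standard_uleq:
  assumes \<xi>: "\<xi> \<in> \<Xi>"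
  shows "ker_standard uleq \<xi> = maps_to_rd (sm \<xi>)"
proof
  let ?N = "sm \<xi>"
  note N = sm(1)[OF \<xi>]
  note lP = lmod_PP[OF N]
  interpret P: lmod \<Gamma> "PP ?N" by (rule lP)
  show "ker_standard uleq \<xi> \<subseteq> maps_to_rd ?N"
  proof (rule wsub_least[OF maps_to_rd_sub[OF N]])
    fix N' f assume "N' \<in> not_below uleq \<xi>" and f: "f \<in> carrier (PP ?N)"
    then obtain \<rho> where \<rho>: "\<rho> \<in> \<Xi>" "(\<rho>, \<xi>) \<notin> uleq" "N' = sm \<rho>" by (auto simp: not_below_def)
    have N': "N' \<in> \<N>" using sm(1)[OF \<rho>(1)] \<rho>(3) by simp
    have ne: "N' \<noteq> ?N" "dimL N' \<le> dimL ?N" using \<rho> \<xi> sm_inj[OF \<rho>(1) \<xi>] by (auto simp: uleq_def)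
    note sN' = summand_props(2)[OF N']
    have fh: "f \<in> lhom \<Lambda> (E\<lparr>carrier := N'\<rparr>) (E\<lparr>carrier := ?N\<rparr>)"
      by (rule lhom_sub_dom[OF _ lsub_subset[OF sN']]) (use f in \<open>simp add: lmod_hom_def\<close>)
    have "ee N' \<odot>\<^bsub>PP ?N\<^esub> f \<in> carrier (PP ?N)" by (rule P.closed_ops[OF ee_G[OF N'] f])
    thus "ee N' \<odot>\<^bsub>PP ?N\<^esub> f \<in> maps_to_rd ?N"
      using non_iso_in_rd[OF N N' ne fh] pr_in[OF N']
      by (simp add: HS_def compose_eq ee_def)
  qed
  show "maps_to_rd ?N \<subseteq> ker_standard uleq \<xi>"
  proof
    fix f assume f: "f \<in> maps_to_rd ?N"
    note sub = wsub_sub[OF lP not_below_sub[of uleq \<xi>]]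
    show "f \<in> ker_standard uleq \<xi>"
    proof (cases "f = \<zero>\<^bsub>PP ?N\<^esub>")
      case True
      thus ?thesis using lsub_zero[OF sub] by (simp only:)
    next
      case False
      obtain N' \<gamma> h where *: "N' \<in> \<N>" "dimL N' < dimL ?N" "\<gamma> \<in> carrier \<Gamma>" "h \<in> carrier (PP ?N)"
        "f = \<gamma> \<odot>\<^bsub>PP ?N\<^esub> (ee N' \<odot>\<^bsub>PP ?N\<^esub> h)" using maps_to_rd_factor[OF N f False] by blast
      obtain \<rho> where \<rho>: "\<rho> \<in> \<Xi>" "sm \<rho> = N'" using sm_surj[OF *(1)] by blast
      have "N' \<in> not_below uleq \<xi>" using \<rho> *(2) by (auto simp: not_below_def uleq_def)
      from lsub_smult[OF sub *(3) wsub_ee[OF lP not_below_sub this *(4)]] show ?thesis by (simp only: *(5))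
    qed
  qed
qed

lemma standard_uleq_epi:
  assumes \<xi>: "\<xi> \<in> \<Xi>"
  shows "\<exists>p. lepi \<Gamma> (PP (sm \<xi>)) (\<Delta> uleq \<xi>) p \<and> {f \<in> carrier (PP (sm \<xi>)). p f = \<zero>\<^bsub>\<Delta> uleq \<xi>\<^esub>} = maps_to_rd (sm \<xi>)"
  using standard_epi[OF \<xi>, of uleq] ker_standard_uleq[OF \<xi>] by simp

lemma tfree_standard:
  assumes \<xi>: "\<xi> \<in> \<Xi>"
  shows "tfree (\<Delta> uleq \<xi>)"
proof -
  note N = sm(1)[OF \<xi>]
  obtain p where p: "lepi \<Gamma> (PP (sm \<xi>)) (\<Delta> uleq \<xi>) p"
    "{f \<in> carrier (PP (sm \<xi>)). p f = \<zero>\<^bsub>\<Delta> uleq \<xi>\<^esub>} = maps_to_rd (sm \<xi>)" using standard_uleq_epi[OF \<xi>] by blast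
  show ?thesis
    using tfree_epi_iff[OF lmod_PP[OF N] fdG_lmod[OF fdm_standard[OF \<xi>]] p(1) p(2)[symmetric]]
      HS_tclosed[OF fdm_lmod[OF fdm_summand[OF N]] rd_sub[OF N]] by blast
qed

text \<open>An element of \<open>PP (sm \<xi>)\<close> outside the kernel of the projection to the standard module is a map onto
  \<open>sm \<xi>\<close>, since its image is not contained in the radical.\<close>
lemma standard_tclosed:
  assumes \<xi>: "\<xi> \<in> \<Xi>" and G: "lsubmodule G \<Gamma> (\<Delta> uleq \<xi>)" and c: "tclosed (\<Delta> uleq \<xi>) G"
  shows "G = {\<zero>\<^bsub>\<Delta> uleq \<xi>\<^esub>} \<or> G = carrier (\<Delta> uleq \<xi>)"
proof -
  let ?N = "sm \<xi>" and ?X = "E\<lparr>carrier := sm \<xi>\<rparr>"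
  note N = sm(1)[OF \<xi>]
  note lP = lmod_PP[OF N] note lD = fdG_lmod[OF fdm_standard[OF \<xi>, of uleq]]
  note lX = fdm_lmod[OF fdm_summand[OF N]]
  interpret P: lmod \<Gamma> "PP ?N" by (rule lP)
  interpret D: lmod \<Gamma> "\<Delta> uleq \<xi>" by (rule lD)
  interpret E: lmod \<Lambda> E by (rule lmod_E)
  obtain p where p: "lepi \<Gamma> (PP ?N) (\<Delta> uleq \<xi>) p" "{f \<in> carrier (PP ?N). p f = \<zero>\<^bsub>\<Delta> uleq \<xi>\<^esub>} = maps_to_rd ?N"
    using standard_uleq_epi[OF \<xi>] by blast
  note ph = lepiD(1)[OF p(1)]
  let ?G = "{f \<in> carrier (PP ?N). p f \<in> G}"
  have G': "lsubmodule ?G \<Gamma> (PP ?N)" by (rule lsub_vimage[OF lP lD ph G])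
  have c': "tclosed (PP ?N) ?G" by (rule tclosed_vimage[OF lP ph c])
  show ?thesis
  proof (cases "?G \<subseteq> maps_to_rd ?N")
    case True
    have "y = \<zero>\<^bsub>\<Delta> uleq \<xi>\<^esub>" if y: "y \<in> G" for y
    proof -
      obtain f where f: "f \<in> carrier (PP ?N)" "y = p f" using lepi_ex[OF p(1) lsub_mem[OF G y]] by blast
      hence "f \<in> maps_to_rd ?N" using True y by blast
      thus ?thesis using p(2) f(2) by blast
    qed
    thus ?thesis using lsub_zero[OF G] by blast
  next
    case False
    then obtain f where f: "f \<in> carrier (PP ?N)" "p f \<in> G" "f \<notin> maps_to_rd ?N" by blast
    have fh: "f \<in> lhom \<Lambda> E ?X" using f(1) by (simp add: lmod_hom_def)
    have "lsubmodule (f ` carrier E) \<Lambda> ?X" by (rule lsub_image[OF lmod_E lX fh E.lsub_carrier])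
    moreover have "\<not> f ` carrier E \<subseteq> rd ?N" using f(1,3) by (auto simp: HS_def)
    ultimately have s: "f ` carrier E = carrier ?X" using rd_largest[OF N] by auto
    have c'': "tclosed ((PP ?N)\<lparr>carrier := carrier (PP ?N)\<rparr>) ?G" using c' by (simp only: carrier_update_self)
    have "?G = carrier (PP ?N)"
      by (rule tclosed_surj[OF lX P.lsub_carrier G' _ c'' _ s]) (use f in auto)
    hence "p ` carrier (PP ?N) \<subseteq> G" by auto
    thus ?thesis using lepiD(2)[OF p(1)] lsub_subset[OF G] by auto
  qed
qed

text \<open>The kernel of an endomorphism is closed, so it is zero or everything.\<close>
lemma schurian_standard:
  assumes \<xi>: "\<xi> \<in> \<Xi>"
  shows "schurian \<Gamma> (\<Delta> uleq \<xi>)"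
proof -
  let ?D = "\<Delta> uleq \<xi>"
  note N = sm(1)[OF \<xi>]
  note fD = fdm_standard[OF \<xi>, of uleq] note lD = fdG_lmod[OF fD]
  interpret D: lmod \<Gamma> ?D by (rule lD)
  obtain p where p: "lepi \<Gamma> (PP (sm \<xi>)) ?D p" "{f \<in> carrier (PP (sm \<xi>)). p f = \<zero>\<^bsub>?D\<^esub>} = maps_to_rd (sm \<xi>)"
    using standard_uleq_epi[OF \<xi>] by blast
  have "ee (sm \<xi>) \<notin> maps_to_rd (sm \<xi>)"
  proof
    assume e: "ee (sm \<xi>) \<in> maps_to_rd (sm \<xi>)"
    have "x \<in> rd (sm \<xi>)" if x: "x \<in> sm \<xi>" for x
    proof -
      have "x \<in> carrier E" by (rule lsub_mem[OF summand_props(2)[OF N] x])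
      thus ?thesis using e pr_on[OF N x] by (auto simp: HS_def ee_def)
    qed
    thus False using rd_psub[OF N] by blast
  qed
  hence "p (ee (sm \<xi>)) \<noteq> \<zero>\<^bsub>?D\<^esub>" using p(2) ee_PP[OF N] by blast
  hence nz: "carrier ?D \<noteq> {\<zero>\<^bsub>?D\<^esub>}" using lhom_closed[OF lepiD(1)[OF p(1)] ee_PP[OF N]] by blast
  show ?thesis
    unfolding schurian_def
  proof (rule D.division_ring_EndI[OF nz])
    fix \<phi> assume \<phi>: "\<phi> \<in> lhom \<Gamma> ?D ?D" and "\<exists>x \<in> carrier ?D. \<phi> x \<noteq> \<zero>\<^bsub>?D\<^esub>"
    let ?K = "{x \<in> carrier ?D. \<phi> x \<in> {\<zero>\<^bsub>?D\<^esub>}}"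
    have "?K = {\<zero>\<^bsub>?D\<^esub>} \<or> ?K = carrier ?D"
      by (rule standard_tclosed[OF \<xi> lsub_vimage[OF lD lD \<phi> D.lsub_zero_module]
            tclosed_vimage[OF lD \<phi> tfree_standard[OF \<xi>]]])
    hence "?K = {\<zero>\<^bsub>?D\<^esub>}" using \<open>\<exists>x \<in> carrier ?D. \<phi> x \<noteq> \<zero>\<^bsub>?D\<^esub>\<close> by blast
    hence inj: "inj_on \<phi> (carrier ?D)" unfolding lhom_inj_iff[OF lD lD \<phi>] by blast
    show "bij_betw \<phi> (carrier ?D) (carrier ?D)"
      using inj fda.kdim_inj_surj[OF fda_G lD fD \<phi> inj] by (simp add: bij_betw_def)
  qed
qed

lemma partial_order_uleq: "partial_order_on \<Xi> uleq"
  unfolding partial_order_on_def preorder_on_def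
  by (auto simp: uleq_def refl_on_def trans_def antisym_def)

text \<open>Let \<open>X\<close> have top \<open>S \<xi>\<close> and socle \<open>S \<xi>'\<close>, with \<open>\<xi>\<close> and \<open>\<xi>'\<close> incomparable. Then \<open>X\<close> is a quotient of
  \<open>PP (sm \<xi>)\<close>, and a generator of the socle comes from a map \<open>sm \<xi>' \<rightarrow> sm \<xi>\<close>. The two summands are
  different but of the same dimension, so the map goes to the radical of \<open>sm \<xi>\<close> and factors through a
  shorter summand. The simple module of the latter is a composition factor of \<open>X\<close> above \<open>\<xi>\<close>.\<close>
lemma adapted_uleq: "adapted_order K \<Gamma> \<Xi> S uleq"
  unfolding adapted_order_def
proof (intro ballI impI)
  fix X \<xi> \<xi>' assume "X \<in> fmod K \<Gamma>" and \<xi>: "\<xi> \<in> \<Xi>" and \<xi>': "\<xi>' \<in> \<Xi>"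
    and *: "lmod_iso \<Gamma> (top_module \<Gamma> X) (S \<xi>) \<and> lmod_iso \<Gamma> (socle \<Gamma> X) (S \<xi>') \<and>
        (\<xi>, \<xi>') \<notin> uleq \<and> (\<xi>', \<xi>) \<notin> uleq"
  hence fX: "fdG X" by (simp add: fmod_def)
  note lX = fdG_lmod[OF fX]
  interpret X: lmod \<Gamma> X by (rule lX)
  let ?N = "sm \<xi>" and ?N' = "sm \<xi>'"
  note N = sm(1)[OF \<xi>] note N' = sm(1)[OF \<xi>']
  have ne: "?N' \<noteq> ?N" and dim: "dimL ?N' \<le> dimL ?N" using * \<xi> \<xi>' sm_inj[OF \<xi> \<xi>'] by (auto simp: uleq_def)
  let ?M = "{U. lsubmodule U \<Gamma> X \<and> U \<noteq> carrier X \<and> (\<forall>V. lsubmodule V \<Gamma> X \<and> U \<subseteq> V \<longrightarrow> V = U \<or> V = carrier X)}"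
  let ?r = "radical \<Gamma> X"
  have Mx: "U \<in> ?M \<longleftrightarrow> max_sub \<Gamma> X U" for U by (simp add: max_sub_def)
  have r: "lsubmodule ?r \<Gamma> X"
  proof -
    have "?r = \<Inter> (insert (carrier X) ?M)" by (simp add: radical_def)
    also have "lsubmodule \<dots> \<Gamma> X" by (rule X.lsub_Inter) (use X.lsub_carrier in auto)
    finally show ?thesis .
  qed
  have rmax: "?r \<subseteq> V" if "max_sub \<Gamma> X V" for V using that Mx[of V] by (auto simp: radical_def)
  have lT: "lmod \<Gamma> (top_module \<Gamma> X)" unfolding top_module_def by (rule X.lmod_quot[OF r])
  have eT: "lepi \<Gamma> X (top_module \<Gamma> X) (quot_map X ?r)" unfolding top_module_def by (rule X.quot_map_epi[OF r])
  have kT: "quot_map X ?r x = \<zero>\<^bsub>top_module \<Gamma> X\<^esub> \<longleftrightarrow> x \<in> ?r" if "x \<in> carrier X" for x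
    unfolding top_module_def by (rule X.quot_map_zero_iff[OF r that])
  have iT: "lmod_iso \<Gamma> (top_module \<Gamma> X) (S \<xi>)" using * by blast
  have "simple_module \<Gamma> (top_module \<Gamma> X)"
    by (rule simple_iso[OF S_props(3)[OF \<xi>] lT lmod_iso_sym[OF lT S_props(3)[OF \<xi>] iT] S_props(2)[OF \<xi>]])
  hence "max_sub \<Gamma> X {x \<in> carrier X. quot_map X ?r x = \<zero>\<^bsub>top_module \<Gamma> X\<^esub>}"
    using simple_max_sub[OF lX lT eT] by blast
  moreover have "{x \<in> carrier X. quot_map X ?r x = \<zero>\<^bsub>top_module \<Gamma> X\<^esub>} = ?r" using kT lsub_subset[OF r] by blast
  ultimately have rm: "max_sub \<Gamma> X ?r" by simp
  have "wt ?N (top_module \<Gamma> X)" by (rule wt_iso[OF lT S_props(3)[OF \<xi>] iT sm[OF \<xi>]])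
  then obtain x0 where x0: "x0 \<in> carrier X" "quot_map X ?r (ee ?N \<odot>\<^bsub>X\<^esub> x0) \<noteq> \<zero>\<^bsub>top_module \<Gamma> X\<^esub>"
    using wt_epi[OF lX lT eT N] by blast
  have exr: "ee ?N \<odot>\<^bsub>X\<^esub> x0 \<notin> ?r" using x0 kT X.closed_ops[OF ee_G[OF N] x0(1)] by blast
  let ?a = "\<lambda>f. f \<odot>\<^bsub>X\<^esub> x0"
  interpret P: lmod \<Gamma> "PP ?N" by (rule lmod_PP[OF N])
  have ah: "?a \<in> lhom \<Gamma> (PP ?N) X" by (rule act_hom[OF lX N x0(1)])
  have im: "lsubmodule (?a ` carrier (PP ?N)) \<Gamma> X" by (rule lsub_image[OF P.lmod_axioms lX ah P.lsub_carrier])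
  have surj: "?a ` carrier (PP ?N) = carrier X"
  proof (rule ccontr)
    assume "?a ` carrier (PP ?N) \<noteq> carrier X"
    then obtain V where V: "max_sub \<Gamma> X V" "?a ` carrier (PP ?N) \<subseteq> V"
      using fda.max_sub_exists[OF fda_G fX im] by blast
    have "V = ?r" using max_subD(4)[OF rm max_subD(1)[OF V(1)] rmax[OF V(1)]] max_subD(2)[OF V(1)] by blast
    thus False using V(2) exr ee_PP[OF N] by blast
  qed
  have "wt ?N' (socle \<Gamma> X)"
  proof -
    let ?s = "\<Inter> {V. lsubmodule V \<Gamma> X \<and> (\<forall>U. lsubmodule U \<Gamma> X \<and> simple_module \<Gamma> (X\<lparr>carrier := U\<rparr>) \<longrightarrow> U \<subseteq> V)}"
    have "lsubmodule ?s \<Gamma> X"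
      by (rule X.lsub_Inter) (use X.lsub_carrier lsub_subset[of _ \<Gamma> X] in blast)+
    hence "lmod \<Gamma> (socle \<Gamma> X)" unfolding socle_def by (rule X.lmod_sub)
    thus ?thesis by (rule wt_iso[OF _ S_props(3)[OF \<xi>'] _ sm[OF \<xi>']]) (use * in blast)
  qed
  then obtain y where y: "y \<in> carrier (socle \<Gamma> X)" "ee ?N' \<odot>\<^bsub>X\<^esub> y \<noteq> \<zero>\<^bsub>X\<^esub>" by (auto simp: wt_def socle_def)
  have "carrier (socle \<Gamma> X) \<subseteq> carrier X"
    using X.lsub_carrier lsub_subset[of _ \<Gamma> X] by (auto simp: socle_def)
  then obtain f where f: "f \<in> carrier (PP ?N)" "y = f \<odot>\<^bsub>X\<^esub> x0" using y(1) surj by blast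
  let ?g = "ee ?N' \<odot>\<^bsub>PP ?N\<^esub> f"
  have gP: "?g \<in> carrier (PP ?N)" by (rule P.closed_ops[OF ee_G[OF N'] f(1)])
  have gx: "?g \<odot>\<^bsub>X\<^esub> x0 \<noteq> \<zero>\<^bsub>X\<^esub>" using lhom_smult[OF ah ee_G[OF N'] f(1)] y(2) f(2) by simp
  have fh: "f \<in> lhom \<Lambda> (E\<lparr>carrier := ?N'\<rparr>) (E\<lparr>carrier := ?N\<rparr>)"
    by (rule lhom_sub_dom[OF _ lsub_subset[OF summand_props(2)[OF N']]]) (use f(1) in \<open>simp add: lmod_hom_def\<close>)
  have gR: "?g \<in> maps_to_rd ?N"
    using gP non_iso_in_rd[OF N N' ne dim fh] pr_in[OF N'] by (simp add: HS_def compose_eq ee_def)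
  have "?g \<noteq> \<zero>\<^bsub>PP ?N\<^esub>" using gx lhom_zero[OF P.lmod_axioms lX ah] by metis
  then obtain M \<gamma> h where M: "M \<in> \<N>" "dimL M < dimL ?N" "\<gamma> \<in> carrier \<Gamma>" "h \<in> carrier (PP ?N)"
    "?g = \<gamma> \<odot>\<^bsub>PP ?N\<^esub> (ee M \<odot>\<^bsub>PP ?N\<^esub> h)" using maps_to_rd_factor[OF N gR] by blast
  obtain \<rho> where \<rho>: "\<rho> \<in> \<Xi>" "sm \<rho> = M" using sm_surj[OF M(1)] by blast
  have eh: "ee M \<odot>\<^bsub>PP ?N\<^esub> h \<in> carrier (PP ?N)" by (rule P.closed_ops[OF ee_G[OF M(1)] M(4)])
  have "?g \<odot>\<^bsub>X\<^esub> x0 = \<gamma> \<odot>\<^bsub>X\<^esub> (ee M \<odot>\<^bsub>X\<^esub> (h \<odot>\<^bsub>X\<^esub> x0))"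
    unfolding M(5) using lhom_smult[OF ah M(3) eh] lhom_smult[OF ah ee_G[OF M(1)] M(4)] by simp
  hence "ee M \<odot>\<^bsub>X\<^esub> (h \<odot>\<^bsub>X\<^esub> x0) \<noteq> \<zero>\<^bsub>X\<^esub>" using gx X.smult_zero[OF M(3)] by auto
  hence "wt M X" using lhom_closed[OF ah M(4)] by (auto simp: wt_def)
  hence "composition_factor \<Gamma> X (S \<rho>)" using composition_factor_wt[OF fX \<rho>(1)] \<rho>(2) by simp
  moreover have "(\<xi>, \<rho>) \<in> uleq" "\<rho> \<noteq> \<xi>" using \<rho> \<xi> M(2) by (auto simp: uleq_def)
  ultimately show "\<exists>\<rho> \<in> \<Xi>. (\<xi>, \<rho>) \<in> uleq \<and> \<rho> \<noteq> \<xi> \<and> composition_factor \<Gamma> X (S \<rho>)" using \<rho>(1) by blast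
qed

end

section \<open>Uniserial algebras: standard filtrations\<close>

text \<open>
  A primitive idempotent \<open>l\<close> that does not move \<open>m\<close> into \<open>V\<close>: among the idempotents with this
  property choose one for which the left ideal \<open>\<Lambda> l = {a. a l = a}\<close> has least dimension.
\<close>
lemma (in fda) primitive_idempotent:
  assumes X: "lmod A X" and V: "lsubmodule V A X" and m: "m \<in> carrier X" "m \<notin> V"
  shows "\<exists>L l. lsubmodule L A (regular_module A) \<and> indecomposable A ((regular_module A)\<lparr>carrier := L\<rparr>) \<and>
    l \<in> L \<and> (\<forall>a \<in> L. a \<otimes>\<^bsub>A\<^esub> l = a) \<and> l \<odot>\<^bsub>X\<^esub> m \<notin> V"
proof -
  let ?R = "regular_module A"
  interpret X: lmod A X by (rule X)
  interpret R: lmod A ?R by (rule lmod_regular)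
  define L where "L l = {a \<in> carrier A. a \<otimes>\<^bsub>A\<^esub> l = a}" for l
  have L: "lsubmodule (L l) A ?R" if "l \<in> carrier A" for l
    by (rule R.lsubmoduleI) (use that in \<open>auto simp: L_def algr.l_distr algr.m_assoc\<close>)
  let ?P = "\<lambda>l. l \<in> carrier A \<and> l \<otimes>\<^bsub>A\<^esub> l = l \<and> l \<odot>\<^bsub>X\<^esub> m \<notin> V"
  let ?d = "\<lambda>l. kdim K A (?R\<lparr>carrier := L l\<rparr>)"
  have P1: "?P \<one>\<^bsub>A\<^esub>" using m by (simp add: X.smult_one)
  define l where "l = arg_min ?d ?P"
  have l: "?P l" unfolding l_def by (rule arg_min_natI[of ?P, OF P1])
  have least: "?d l \<le> ?d l'" if "?P l'" for l' unfolding l_def by (rule arg_min_nat_le) (rule that)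
  have lL: "l \<in> L l" using l by (simp add: L_def)
  interpret Ll: lmod A "?R\<lparr>carrier := L l\<rparr>" by (rule R.lmod_sub[OF L]) (use l in blast)
  have "indecomposable A (?R\<lparr>carrier := L l\<rparr>)"
    unfolding indecomposable_def
  proof (intro conjI allI impI)
    show "carrier (?R\<lparr>carrier := L l\<rparr>) \<noteq> {\<zero>\<^bsub>?R\<lparr>carrier := L l\<rparr>\<^esub>}"
    proof
      assume "carrier (?R\<lparr>carrier := L l\<rparr>) = {\<zero>\<^bsub>?R\<lparr>carrier := L l\<rparr>\<^esub>}"
      hence "l = \<zero>\<^bsub>A\<^esub>" using lL by simp
      thus False using l X.zero_smult[OF m(1)] lsub_zero[OF V] by simp
    qed
    fix U W assume *: "lsubmodule U A (?R\<lparr>carrier := L l\<rparr>) \<and> lsubmodule W A (?R\<lparr>carrier := L l\<rparr>) \<and>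
      U \<inter> W = {\<zero>\<^bsub>?R\<lparr>carrier := L l\<rparr>\<^esub>} \<and> U <+>\<^bsub>?R\<lparr>carrier := L l\<rparr>\<^esub> W = carrier (?R\<lparr>carrier := L l\<rparr>)"
    have lA: "l \<in> carrier A" using l by blast
    have U: "lsubmodule U A ?R" "U \<subseteq> L l" and W: "lsubmodule W A ?R" "W \<subseteq> L l"
      and UW: "U \<inter> W = {\<zero>\<^bsub>A\<^esub>}" using * R.lsub_sub_iff[OF L[OF lA]] by auto
    have "l \<in> U <+>\<^bsub>?R\<lparr>carrier := L l\<rparr>\<^esub> W" using * lL by simp
    then obtain u w where uw: "u \<in> U" "w \<in> W" "l = u \<oplus>\<^bsub>A\<^esub> w" unfolding Ll.set_add_iff by auto
    have uA: "u \<in> carrier A" and wA: "w \<in> carrier A" using lsub_mem[OF U(1) uw(1)] lsub_mem[OF W(1) uw(2)] by auto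
    \<comment> \<open>The components of \<open>l\<close> are orthogonal idempotents that generate the two summands.\<close>
    have comp: "a \<otimes>\<^bsub>A\<^esub> u = a \<and> a \<otimes>\<^bsub>A\<^esub> w = \<zero>\<^bsub>A\<^esub>"
      if U: "lsubmodule U A ?R" "U \<subseteq> L l" and W: "lsubmodule W A ?R"
        and UW: "U \<inter> W = {\<zero>\<^bsub>A\<^esub>}" and u: "u \<in> U" and w: "w \<in> W" and luw: "l = u \<oplus>\<^bsub>A\<^esub> w" and a: "a \<in> U" for a U W u w
    proof -
      have c: "a \<in> carrier A" "u \<in> carrier A" "w \<in> carrier A"
        using lsub_mem[OF U(1) a] lsub_mem[OF U(1) u] lsub_mem[OF W w] by auto
      have auU: "a \<otimes>\<^bsub>A\<^esub> u \<in> U" and awW: "a \<otimes>\<^bsub>A\<^esub> w \<in> W"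
        using lsub_smult[OF U(1) c(1) u] lsub_smult[OF W c(1) w] by auto
      have "a \<otimes>\<^bsub>A\<^esub> l = a" using U(2) a by (auto simp: L_def)
      hence eq: "a = a \<otimes>\<^bsub>A\<^esub> u \<oplus>\<^bsub>A\<^esub> a \<otimes>\<^bsub>A\<^esub> w" using luw c by (simp add: algr.r_distr)
      have awU: "a \<otimes>\<^bsub>A\<^esub> w \<in> U"
      proof -
        have "a \<ominus>\<^bsub>?R\<^esub> (a \<otimes>\<^bsub>A\<^esub> u) \<in> U" by (rule R.lsub_diff[OF U(1) a auU])
        moreover have "a \<ominus>\<^bsub>?R\<^esub> (a \<otimes>\<^bsub>A\<^esub> u) = a \<otimes>\<^bsub>A\<^esub> w"
        proof -
          have "(a \<ominus>\<^bsub>?R\<^esub> (a \<otimes>\<^bsub>A\<^esub> u)) \<oplus>\<^bsub>?R\<^esub> (a \<otimes>\<^bsub>A\<^esub> u) = a"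
            by (rule R.diff_add_cancel) (use c in simp_all)
          moreover have "(a \<otimes>\<^bsub>A\<^esub> w) \<oplus>\<^bsub>?R\<^esub> (a \<otimes>\<^bsub>A\<^esub> u) = a"
            using eq R.a_comm[of "a \<otimes>\<^bsub>A\<^esub> w" "a \<otimes>\<^bsub>A\<^esub> u"] c by simp
          ultimately show ?thesis
            using R.M.add.right_cancel[of "a \<otimes>\<^bsub>A\<^esub> u" "a \<ominus>\<^bsub>?R\<^esub> (a \<otimes>\<^bsub>A\<^esub> u)" "a \<otimes>\<^bsub>A\<^esub> w"] c
              R.minus_closed[of a "a \<otimes>\<^bsub>A\<^esub> u"] by simp
        qed
        ultimately show ?thesis by simp
      qed
      hence "a \<otimes>\<^bsub>A\<^esub> w = \<zero>\<^bsub>A\<^esub>" using awW UW by blast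
      thus ?thesis using eq c by simp
    qed
    have luw': "l = w \<oplus>\<^bsub>A\<^esub> u" using uw(3) R.a_comm[of u w] uA wA by simp
    have WU: "W \<inter> U = {\<zero>\<^bsub>A\<^esub>}" using UW by blast
    note cU = comp[OF U W(1) UW uw] note cW = comp[OF W U(1) WU uw(2,1) luw']
    have LU: "L u = U"
    proof
      show "U \<subseteq> L u" using cU lsub_mem[OF U(1)] by (auto simp: L_def)
      show "L u \<subseteq> U"
      proof
        fix a assume "a \<in> L u"
        hence a: "a \<in> carrier A" "a \<otimes>\<^bsub>A\<^esub> u = a" by (auto simp: L_def)
        show "a \<in> U" using lsub_smult[OF U(1) a(1) uw(1)] a(2) by simp
      qed
    qed
    have LW: "L w = W"
    proof
      show "W \<subseteq> L w" using cW lsub_mem[OF W(1)] by (auto simp: L_def)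
      show "L w \<subseteq> W"
      proof
        fix a assume "a \<in> L w"
        hence a: "a \<in> carrier A" "a \<otimes>\<^bsub>A\<^esub> w = a" by (auto simp: L_def)
        show "a \<in> W" using lsub_smult[OF W(1) a(1) uw(2)] a(2) by simp
      qed
    qed
    show "U = {\<zero>\<^bsub>?R\<lparr>carrier := L l\<rparr>\<^esub>} \<or> W = {\<zero>\<^bsub>?R\<lparr>carrier := L l\<rparr>\<^esub>}"
    proof (rule ccontr)
      assume "\<not> ?thesis"
      hence U0: "U \<noteq> {\<zero>\<^bsub>A\<^esub>}" and W0: "W \<noteq> {\<zero>\<^bsub>A\<^esub>}" by auto
      have "U \<subset> L l" using U(2) W(2) UW W0 by blast
      hence "?d u < ?d l" using kdim_psub[OF fdm_regular U(1) L[OF lA]] LU by simp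
      hence um: "u \<odot>\<^bsub>X\<^esub> m \<in> V" using least[of u] uA cU[OF uw(1)] by fastforce
      have "W \<subset> L l" using U(2) W(2) UW U0 by blast
      hence "?d w < ?d l" using kdim_psub[OF fdm_regular W(1) L[OF lA]] LW by simp
      hence wm: "w \<odot>\<^bsub>X\<^esub> m \<in> V" using least[of w] wA cW[OF uw(2)] by fastforce
      have "l \<odot>\<^bsub>X\<^esub> m \<in> V"
        unfolding uw(3) X.smult_l_distr[OF uA wA m(1)] by (rule lsub_add[OF V um wm])
      thus False using l by blast
    qed
  qed
  moreover have "\<forall>a \<in> L l. a \<otimes>\<^bsub>A\<^esub> l = a" by (simp add: L_def)
  ultimately show ?thesis using L l lL by blast
qed

lemma cong_mod_max_sub:
  assumes X: "lmod A X" and V: "max_sub A X V" and U: "lsubmodule U A X" "\<not> U \<subseteq> V" and x: "x \<in> carrier X"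
  shows "\<exists>u \<in> U. x \<ominus>\<^bsub>X\<^esub> u \<in> V"
proof -
  interpret X: lmod A X by (rule X)
  note sV = max_subD(1)[OF V]
  have "V <+>\<^bsub>X\<^esub> U = carrier X"
    using max_subD(4)[OF V X.lsub_sum[OF sV U(1)]] X.lsub_sum_supset[OF sV U(1)] U(2) by blast
  then obtain v u where vu: "v \<in> V" "u \<in> U" "x = v \<oplus>\<^bsub>X\<^esub> u" using x X.set_add_iff[of x V U] by blast
  have c: "v \<in> carrier X" "u \<in> carrier X" using lsub_mem[OF sV vu(1)] lsub_mem[OF U(1) vu(2)] by auto
  have "x \<ominus>\<^bsub>X\<^esub> u = v" using vu(3) c by (simp add: a_minus_def X.a_assoc X.r_neg)
  thus ?thesis using vu by blast
qed

context auslander_uniserial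
begin

text \<open>
  Let \<open>M\<close> be a submodule of least dimension that is not contained in the maximal submodule \<open>V\<close>.
  A map from a summand of \<open>E\<close> to \<open>X\<close> with image not in \<open>V\<close> agrees modulo \<open>V\<close> with a map to \<open>M\<close>:
  both modules are quotients of the same indecomposable projective module, whose submodules form
  a chain, and by minimality the kernels are contained in each other in the right order.
\<close>
lemma lift_to_minimal:
  assumes X: "fdL X" and V: "max_sub \<Lambda> X V"
    and M: "lsubmodule M \<Lambda> X" "\<not> M \<subseteq> V"
    and least: "\<And>U. lsubmodule U \<Lambda> X \<Longrightarrow> \<not> U \<subseteq> V \<Longrightarrow> kdim K \<Lambda> (X\<lparr>carrier := M\<rparr>) \<le> kdim K \<Lambda> (X\<lparr>carrier := U\<rparr>)"
    and N: "N \<in> \<N>" and k: "k \<in> lhom \<Lambda> (E\<lparr>carrier := N\<rparr>) X" and kV: "\<exists>x \<in> N. k x \<notin> V"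
  shows "\<exists>h \<in> lhom \<Lambda> (E\<lparr>carrier := N\<rparr>) (X\<lparr>carrier := M\<rparr>). \<forall>x \<in> N. k x \<ominus>\<^bsub>X\<^esub> h x \<in> V"
proof -
  let ?N = "E\<lparr>carrier := N\<rparr>" and ?M = "X\<lparr>carrier := M\<rparr>" and ?R = "regular_module \<Lambda>"
  note lX = fdm_lmod[OF X] note fN = fdm_summand[OF N] note lN = fdm_lmod[OF fN]
  have fM: "fdL ?M" by (rule fdm_sub[OF X M(1)])
  note lM = fdm_lmod[OF fM]
  interpret X: lmod \<Lambda> X by (rule lX)
  interpret N: lmod \<Lambda> ?N by (rule lN)
  interpret M: lmod \<Lambda> ?M by (rule lM)
  interpret R: lmod \<Lambda> ?R by (rule lmod_regular)
  note sV = max_subD(1)[OF V]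
  have proper: "U \<subseteq> V" if U: "lsubmodule U \<Lambda> X" "U \<subset> M" for U
    using least[OF U(1)] kdim_psub[OF X U(1) M(1) U(2)] by fastforce
  have imN: "lsubmodule (k ` N) \<Lambda> X" using lsub_image[OF lN lX k N.lsub_carrier] by simp
  have imV: "\<not> k ` N \<subseteq> V" using kV by blast
  obtain m where m: "m \<in> M" "m \<notin> V" using M(2) by blast
  have mc: "m \<in> carrier X" by (rule lsub_mem[OF M(1) m(1)])
  obtain n where n: "n \<in> N" "m \<ominus>\<^bsub>X\<^esub> k n \<in> V" using cong_mod_max_sub[OF lX V imN imV mc] by blast
  have knc: "k n \<in> carrier X" using lhom_closed[OF k] n by simp
  obtain L l where L: "lsubmodule L \<Lambda> ?R" "indecomposable \<Lambda> (?R\<lparr>carrier := L\<rparr>)" "l \<in> L"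
    "\<And>a. a \<in> L \<Longrightarrow> a \<otimes>\<^bsub>\<Lambda>\<^esub> l = a" and lm: "l \<odot>\<^bsub>X\<^esub> m \<notin> V"
    using primitive_idempotent[OF lX sV mc m(2)] by blast
  let ?L = "?R\<lparr>carrier := L\<rparr>"
  have Lc: "a \<in> carrier \<Lambda>" if "a \<in> L" for a using lsub_mem[OF L(1) that] by simp
  have fL: "fdL ?L" by (rule fdm_sub[OF fdm_regular L(1)])
  note lL = fdm_lmod[OF fL]
  interpret L: lmod \<Lambda> ?L by (rule lL)
  let ?\<alpha> = "\<lambda>a. a \<odot>\<^bsub>X\<^esub> m" and ?\<beta> = "\<lambda>a. a \<odot>\<^bsub>E\<^esub> n"
  have \<alpha>: "?\<alpha> \<in> lhom \<Lambda> ?L ?M"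
    by (rule lhomI) (use Lc lsub_smult[OF M(1) _ m(1)] mc in \<open>simp_all add: X.smult_l_distr X.smult_assoc1\<close>)
  have \<beta>: "?\<beta> \<in> lhom \<Lambda> ?L ?N"
    by (rule lhomI) (use Lc N.smult_closed[of _ n] N.smult_l_distr[of _ _ n] N.smult_assoc1[of _ _ n] n in simp_all)
  have cong: "?\<alpha> a \<ominus>\<^bsub>X\<^esub> k (?\<beta> a) \<in> V" if a: "a \<in> L" for a
  proof -
    have "k (?\<beta> a) = a \<odot>\<^bsub>X\<^esub> k n" using lhom_smult[OF k Lc[OF a]] n by simp
    moreover have "a \<odot>\<^bsub>X\<^esub> (m \<ominus>\<^bsub>X\<^esub> k n) = a \<odot>\<^bsub>X\<^esub> m \<ominus>\<^bsub>X\<^esub> a \<odot>\<^bsub>X\<^esub> k n"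
    proof -
      have h: "(\<lambda>b. b \<odot>\<^bsub>X\<^esub> (m \<ominus>\<^bsub>X\<^esub> k n)) a \<oplus>\<^bsub>X\<^esub> a \<odot>\<^bsub>X\<^esub> k n = a \<odot>\<^bsub>X\<^esub> m"
        using X.smult_r_distr[OF Lc[OF a], of "m \<ominus>\<^bsub>X\<^esub> k n" "k n"] mc knc X.diff_add_cancel[OF mc knc] by simp
      have c: "a \<odot>\<^bsub>X\<^esub> (m \<ominus>\<^bsub>X\<^esub> k n) \<in> carrier X" "a \<odot>\<^bsub>X\<^esub> k n \<in> carrier X" using Lc[OF a] mc knc by auto
      thus ?thesis unfolding h[symmetric] by (simp add: a_minus_def X.a_assoc X.r_neg)
    qed
    ultimately show ?thesis using lsub_smult[OF sV Lc[OF a] n(2)] by simp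
  qed
  \<comment> \<open>Both maps are surjective since their images are not contained in \<open>V\<close>: proper submodules of \<open>M\<close> lie
    in \<open>V\<close>, and those of \<open>N\<close> are mapped to \<open>V\<close>, as the submodules of \<open>N\<close> form a chain.\<close>
  have im\<alpha>: "?\<alpha> ` L = M"
  proof (rule ccontr)
    assume ne: "?\<alpha> ` L \<noteq> M"
    have "lsubmodule (?\<alpha> ` L) \<Lambda> ?M" using lsub_image[OF lL lM \<alpha> L.lsub_carrier] by simp
    hence s: "lsubmodule (?\<alpha> ` L) \<Lambda> X" "?\<alpha> ` L \<subseteq> M" using X.lsub_sub_iff[OF M(1)] by auto
    hence "?\<alpha> ` L \<subseteq> V" using proper ne by blast
    thus False using lm L(3) by blast
  qed
  have im\<beta>: "?\<beta> ` L = N"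
  proof -
    have s: "lsubmodule (?\<beta> ` L) \<Lambda> ?N" using lsub_image[OF lL lN \<beta> L.lsub_carrier] by simp
    let ?W = "{x \<in> N. k x \<in> V}"
    have W: "lsubmodule ?W \<Lambda> ?N" using lsub_vimage[OF lN lX k sV] by simp
    have kl: "k (?\<beta> l) \<notin> V"
    proof
      assume "k (?\<beta> l) \<in> V"
      hence "?\<alpha> l \<in> V" using X.lsub_diff_right[OF sV cong[OF L(3)]] Lc[OF L(3)] mc by simp
      thus False using lm by simp
    qed
    have "chain_module \<Lambda> ?N" by (rule chain[OF fN summand_props(3)[OF N]])
    hence "?\<beta> ` L \<subseteq> ?W \<or> ?W \<subseteq> ?\<beta> ` L" using s W by (simp add: chain_module_def)
    hence sub: "?W \<subseteq> ?\<beta> ` L" using kl L(3) by blast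
    have kLs: "lsubmodule (k ` ?\<beta> ` L) \<Lambda> X" by (rule lsub_image[OF lN lX k s])
    have kLV: "\<not> k ` ?\<beta> ` L \<subseteq> V" using kl L(3) by blast
    have "x \<in> ?\<beta> ` L" if x: "x \<in> N" for x
    proof -
      have kx: "k x \<in> carrier X" using lhom_closed[OF k] x by simp
      obtain b where b: "b \<in> ?\<beta> ` L" "k x \<ominus>\<^bsub>X\<^esub> k b \<in> V" using cong_mod_max_sub[OF lX V kLs kLV kx] by blast
      have bN: "b \<in> N" using lsub_mem[OF s b(1)] by simp
      have "x \<ominus>\<^bsub>?N\<^esub> b \<in> ?W"
        using lhom_diff[OF lN lX k, of x b] x bN b(2) N.minus_closed[of x b] by simp
      thus ?thesis using N.lsub_diff_right[OF s, of x b] sub b(1) x by auto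
    qed
    thus ?thesis using lsub_subset[OF s] by auto
  qed
  have e\<alpha>: "lepi \<Lambda> ?L ?M ?\<alpha>" and e\<beta>: "lepi \<Lambda> ?L ?N ?\<beta>" using \<alpha> \<beta> im\<alpha> im\<beta> by (simp_all add: lepi_def)
  let ?Ka = "{a \<in> carrier ?L. ?\<alpha> a = \<zero>\<^bsub>?M\<^esub>}" and ?Kb = "{a \<in> carrier ?L. ?\<beta> a = \<zero>\<^bsub>?N\<^esub>}"
  have "chain_module \<Lambda> ?L" by (rule chain[OF fL L(2)])
  moreover have "lsubmodule ?Ka \<Lambda> ?L" by (rule quot_iso(1)[OF lL lM e\<alpha> refl])
  moreover have "lsubmodule ?Kb \<Lambda> ?L" by (rule quot_iso(1)[OF lL lN e\<beta> refl])
  ultimately have "?Kb \<subseteq> ?Ka \<or> ?Ka \<subseteq> ?Kb" unfolding chain_module_def by blast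
  \<comment> \<open>If the inclusion is the other way round, \<open>N\<close> is a quotient of \<open>M\<close> by a map \<open>u\<close>. As the dimension of
    \<open>M\<close> is least, \<open>u\<close> is bijective, and the kernels agree.\<close>
  hence Kba: "?Kb \<subseteq> ?Ka"
  proof
    assume sub: "?Ka \<subseteq> ?Kb"
    obtain u where u: "u \<in> lhom \<Lambda> ?M ?N" "\<And>a. a \<in> carrier ?L \<Longrightarrow> u (?\<alpha> a) = ?\<beta> a"
      using lepi_factor[OF lL lM lN e\<alpha> \<beta>] sub by blast
    have "u ` M = N"
    proof -
      have "u ` M = u ` ?\<alpha> ` L" using im\<alpha> by simp
      also have "\<dots> = ?\<beta> ` L" unfolding image_image by (rule image_cong) (use u(2) in simp_all)
      finally show ?thesis using im\<beta> by simp
    qed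
    hence eu: "lepi \<Lambda> ?M ?N u" using u(1) by (simp add: lepi_def)
    have ek: "lepi \<Lambda> ?N (X\<lparr>carrier := k ` N\<rparr>) k"
      unfolding lepi_def lhom_sub_cod[OF lsub_subset[OF imN]] using k by auto
    have "kdim K \<Lambda> ?M \<le> kdim K \<Lambda> (X\<lparr>carrier := k ` N\<rparr>)" by (rule least[OF imN imV])
    also have "\<dots> \<le> kdim K \<Lambda> ?N" by (rule kdim_lepi_le[OF fN X.lmod_sub[OF imN] ek])
    finally have inj: "inj_on u (carrier ?M)" by (rule kdim_lepi_inj[OF fM lN eu])
    show "?Kb \<subseteq> ?Ka"
    proof
      fix a assume a: "a \<in> ?Kb"
      hence aL: "a \<in> carrier ?L" and ua: "u (?\<alpha> a) = \<zero>\<^bsub>?N\<^esub>" using u(2)[of a] by auto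
      have "?\<alpha> a = \<zero>\<^bsub>?M\<^esub>" using inj lhom_closed[OF \<alpha> aL] ua unfolding lhom_inj_iff[OF lM lN u(1)] by blast
      thus "a \<in> ?Ka" using aL by blast
    qed
  qed blast
  obtain h where h: "h \<in> lhom \<Lambda> ?N ?M" "\<And>a. a \<in> carrier ?L \<Longrightarrow> h (?\<beta> a) = ?\<alpha> a"
    using lepi_factor[OF lL lN lM e\<beta> \<alpha>] Kba by blast
  have "k x \<ominus>\<^bsub>X\<^esub> h x \<in> V" if x: "x \<in> N" for x
  proof -
    obtain a where a: "a \<in> L" "x = ?\<beta> a" using x im\<beta> by blast
    have kc: "k x \<in> carrier X" using lhom_closed[OF k] x by simp
    have \<alpha>c: "?\<alpha> a \<in> carrier X" using Lc[OF a(1)] mc by simp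
    have "\<ominus>\<^bsub>X\<^esub> (?\<alpha> a \<ominus>\<^bsub>X\<^esub> k x) \<in> V" using X.lsub_minus[OF sV cong[OF a(1)]] a(2) by simp
    moreover have "\<ominus>\<^bsub>X\<^esub> (?\<alpha> a \<ominus>\<^bsub>X\<^esub> k x) = k x \<ominus>\<^bsub>X\<^esub> ?\<alpha> a"
      using kc \<alpha>c by (simp add: a_minus_def X.minus_add X.a_comm)
    ultimately show ?thesis using h(2)[of a] a by simp
  qed
  thus ?thesis by (intro bexI[OF _ h(1)] ballI)
qed

text \<open>A submodule of least dimension among those not contained in \<open>V\<close> has all its proper submodules in \<open>V\<close>.
  So it is indecomposable, isomorphic to some \<open>N\<close>, and meets \<open>V\<close> in its radical. The maps \<open>E \<rightarrow> X\<close> are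
  lifted modulo \<open>V\<close> on each summand of \<open>E\<close> separately, by the preceding lemma.\<close>
lemma maximal_step:
  assumes X: "fdL X" and V: "max_sub \<Lambda> X V"
  shows "\<exists>N \<in> \<N>. \<exists>\<theta> \<in> lhom \<Lambda> (E\<lparr>carrier := N\<rparr>) X. (\<forall>x \<in> N. \<theta> x \<in> V \<longleftrightarrow> x \<in> rd N) \<and>
    (\<forall>h \<in> carrier (H X). \<exists>g \<in> carrier (PP N). \<forall>x \<in> carrier E. h x \<ominus>\<^bsub>X\<^esub> \<theta> (g x) \<in> V)"
proof -
  note lX = fdm_lmod[OF X] note sV = max_subD(1)[OF V]
  interpret X: lmod \<Lambda> X by (rule lX)
  let ?P = "\<lambda>U. lsubmodule U \<Lambda> X \<and> \<not> U \<subseteq> V"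
  let ?d = "\<lambda>U. kdim K \<Lambda> (X\<lparr>carrier := U\<rparr>)"
  have P0: "?P (carrier X)" using X.lsub_carrier max_subD(3)[OF V] by blast
  define M where "M = arg_min ?d ?P"
  have M: "lsubmodule M \<Lambda> X" "\<not> M \<subseteq> V" using arg_min_natI[of ?P, OF P0] unfolding M_def by blast+
  have least: "?d M \<le> ?d U" if "lsubmodule U \<Lambda> X" "\<not> U \<subseteq> V" for U
    unfolding M_def by (rule arg_min_nat_le) (use that in blast)
  let ?M = "X\<lparr>carrier := M\<rparr>"
  have fM: "fdL ?M" by (rule fdm_sub[OF X M(1)])
  note lM = fdm_lmod[OF fM]
  interpret M: lmod \<Lambda> ?M by (rule lM)
  have proper: "U \<subseteq> V" if U: "lsubmodule U \<Lambda> X" "U \<subset> M" for U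
    using least[OF U(1)] kdim_psub[OF X U(1) M(1) U(2)] by fastforce
  have "indecomposable \<Lambda> ?M"
    unfolding indecomposable_def
  proof (intro conjI allI impI)
    show "carrier ?M \<noteq> {\<zero>\<^bsub>?M\<^esub>}" using M(2) lsub_zero[OF sV] by auto
    fix U W assume *: "lsubmodule U \<Lambda> ?M \<and> lsubmodule W \<Lambda> ?M \<and> U \<inter> W = {\<zero>\<^bsub>?M\<^esub>} \<and> U <+>\<^bsub>?M\<^esub> W = carrier ?M"
    hence U: "lsubmodule U \<Lambda> X" "U \<subseteq> M" and W: "lsubmodule W \<Lambda> X" "W \<subseteq> M"
      using X.lsub_sub_iff[OF M(1)] by auto
    show "U = {\<zero>\<^bsub>?M\<^esub>} \<or> W = {\<zero>\<^bsub>?M\<^esub>}"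
    proof (rule ccontr)
      assume n: "\<not> ?thesis"
      have "U \<subset> M" "W \<subset> M" using n * U(2) W(2) by auto
      hence "U \<subseteq> V" "W \<subseteq> V" using proper U(1) W(1) by auto
      moreover have "U <+>\<^bsub>?M\<^esub> W = U <+>\<^bsub>X\<^esub> W"
        unfolding set_eq_iff M.set_add_iff X.set_add_iff by simp
      ultimately have "M \<subseteq> V" using X.lsub_sum_least[OF sV, of U W] * by simp
      thus False using M(2) by blast
    qed
  qed
  then obtain N where N: "N \<in> \<N>" "lmod_iso \<Lambda> ?M (E\<lparr>carrier := N\<rparr>)" using summand_iso[OF fM] by blast
  let ?N = "E\<lparr>carrier := N\<rparr>"
  note fN = fdm_summand[OF N(1)] note lN = fdm_lmod[OF fN]
  interpret N: lmod \<Lambda> ?N by (rule lN)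
  obtain \<theta> where \<theta>: "\<theta> \<in> lhom \<Lambda> ?N ?M" "bij_betw \<theta> N M"
    using lmod_iso_sym[OF lM lN N(2)] unfolding lmod_iso_iff[OF lN] by auto
  let ?\<psi> = "inv_into N \<theta>"
  have \<psi>: "?\<psi> \<in> lhom \<Lambda> ?M ?N" using lhom_inv[OF \<theta>(1) _ lN] \<theta>(2) by simp
  have \<theta>X: "\<theta> \<in> lhom \<Lambda> ?N X" using \<theta>(1) unfolding lhom_sub_cod[OF lsub_subset[OF M(1)]] by blast
  have \<theta>V: "\<theta> x \<in> V \<longleftrightarrow> x \<in> rd N" if x: "x \<in> N" for x
  proof
    let ?W = "{x \<in> N. \<theta> x \<in> V}"
    have W: "lsubmodule ?W \<Lambda> ?N" using lsub_vimage[OF lN lX \<theta>X sV] by simp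
    have "?W \<noteq> N"
    proof
      assume "?W = N"
      hence "\<theta> ` N \<subseteq> V" by blast
      thus False using \<theta>(2) M(2) by (simp add: bij_betw_def)
    qed
    hence "?W \<subseteq> rd N" using rd_largest[OF N(1) W] by blast
    thus "\<theta> x \<in> V \<Longrightarrow> x \<in> rd N" using x by blast
    have s: "lsubmodule (\<theta> ` rd N) \<Lambda> X" by (rule lsub_image[OF lN lX \<theta>X rd_sub[OF N(1)]])
    have "\<theta> ` rd N \<subset> \<theta> ` N"
      using \<theta>(2) rd_psub[OF N(1)] by (auto simp: bij_betw_def psubset_eq inj_on_image_eq_iff)
    hence "\<theta> ` rd N \<subseteq> V" using proper[OF s] \<theta>(2) by (simp add: bij_betw_def)
    thus "x \<in> rd N \<Longrightarrow> \<theta> x \<in> V" by blast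
  qed
  interpret HX: lmod \<Gamma> "H X" by (rule lmod_H[OF lX])
  interpret PN: lmod \<Gamma> "PP N" by (rule lmod_PP[OF N(1)])
  note H\<theta> = H_map[OF lN \<theta>X]
  let ?\<Theta> = "\<lambda>g. \<lambda>x\<in>carrier E. \<theta> (g x)"
  let ?G = "?\<Theta> ` carrier (PP N) <+>\<^bsub>H X\<^esub> HS X V"
  have im: "lsubmodule (?\<Theta> ` carrier (PP N)) \<Gamma> (H X)"
    by (rule lsub_image[OF PN.lmod_axioms HX.lmod_axioms H\<theta> PN.lsub_carrier])
  have G: "lsubmodule ?G \<Gamma> (H X)" by (rule HX.lsub_sum[OF im HS_sub[OF lX sV]])
  have gE: "g x \<in> N" if "g \<in> carrier (PP N)" "x \<in> carrier E" for g x using that PP_carrier[OF N(1)] by blast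
  have \<theta>c: "\<theta> y \<in> carrier X" if "y \<in> N" for y using lhom_closed[OF \<theta>X] that by simp
  have in_G: "h \<in> ?G \<longleftrightarrow> (\<exists>g \<in> carrier (PP N). \<forall>x \<in> carrier E. h x \<ominus>\<^bsub>X\<^esub> \<theta> (g x) \<in> V)"
    if h: "h \<in> carrier (H X)" for h
  proof
    have hl: "h \<in> lmod_hom \<Lambda> E X" using h by simp
    { assume "h \<in> ?G"
      then obtain g v where gv: "g \<in> carrier (PP N)" "v \<in> HS X V" "h = ?\<Theta> g \<oplus>\<^bsub>H X\<^esub> v"
        unfolding HX.set_add_iff by blast
      have "h x \<ominus>\<^bsub>X\<^esub> \<theta> (g x) \<in> V" if x: "x \<in> carrier E" for x
      proof -
        have vV: "v x \<in> V" using gv(2) x by (simp add: HS_def)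
        have vc: "v x \<in> carrier X" by (rule lsub_mem[OF sV vV])
        have "h x = v x \<oplus>\<^bsub>X\<^esub> \<theta> (g x)" using gv(3) x X.a_comm[OF \<theta>c[OF gE[OF gv(1) x]] vc] by simp
        hence "h x \<ominus>\<^bsub>X\<^esub> \<theta> (g x) = v x"
          using vc \<theta>c[OF gE[OF gv(1) x]] by (simp add: a_minus_def X.a_assoc X.r_neg)
        thus ?thesis using vV by simp
      qed
      thus "\<exists>g \<in> carrier (PP N). \<forall>x \<in> carrier E. h x \<ominus>\<^bsub>X\<^esub> \<theta> (g x) \<in> V" using gv(1) by blast }
    { assume "\<exists>g \<in> carrier (PP N). \<forall>x \<in> carrier E. h x \<ominus>\<^bsub>X\<^esub> \<theta> (g x) \<in> V"
      then obtain g where g: "g \<in> carrier (PP N)" "\<And>x. x \<in> carrier E \<Longrightarrow> h x \<ominus>\<^bsub>X\<^esub> \<theta> (g x) \<in> V" by blast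
      have \<Theta>g: "?\<Theta> g \<in> carrier (H X)" by (rule lhom_closed[OF H\<theta> g(1)])
      let ?v = "h \<ominus>\<^bsub>H X\<^esub> ?\<Theta> g"
      have vH: "?v \<in> carrier (H X)" by (rule HX.minus_closed[OF h \<Theta>g])
      have eq: "?v \<oplus>\<^bsub>H X\<^esub> ?\<Theta> g = h" by (rule HX.diff_add_cancel[OF h \<Theta>g])
      have "?v x \<in> V" if x: "x \<in> carrier E" for x
      proof -
        have hx: "h x = ?v x \<oplus>\<^bsub>X\<^esub> \<theta> (g x)" using fun_cong[OF eq, of x] x by simp
        have vc: "?v x \<in> carrier X" using lmod_hom_app(1)[of ?v \<Lambda> E X x] vH x by simp
        have "h x \<ominus>\<^bsub>X\<^esub> \<theta> (g x) = ?v x"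
          unfolding hx using vc \<theta>c[OF gE[OF g(1) x]] by (simp add: a_minus_def X.a_assoc X.r_neg)
        thus ?thesis using g(2)[OF x] by simp
      qed
      hence "?v \<in> HS X V" using vH by (simp add: HS_def)
      moreover have "h = ?\<Theta> g \<oplus>\<^bsub>H X\<^esub> ?v" using eq HX.a_comm[OF \<Theta>g vH] by (simp only:)
      ultimately show "h \<in> ?G" unfolding HX.set_add_iff using g(1) by blast }
  qed
  have "h \<in> ?G" if h: "h \<in> carrier (H X)" for h
  proof (rule ee_generate[OF HX.lmod_axioms G h])
    fix N1 assume N1: "N1 \<in> \<N>"
    have eh: "ee N1 \<odot>\<^bsub>H X\<^esub> h \<in> carrier (H X)" by (rule HX.closed_ops[OF ee_G[OF N1] h])
    have ehx: "(ee N1 \<odot>\<^bsub>H X\<^esub> h) x = h (pr N1 x)" if "x \<in> carrier E" for x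
      using that by (simp add: compose_eq ee_def)
    let ?N1 = "E\<lparr>carrier := N1\<rparr>"
    note sN1 = summand_props(2)[OF N1]
    have k: "h \<in> lhom \<Lambda> ?N1 X"
      by (rule lhom_sub_dom[OF _ lsub_subset[OF sN1]]) (use h in \<open>simp add: lmod_hom_def\<close>)
    have "\<exists>h' \<in> lhom \<Lambda> ?N1 ?M. \<forall>x \<in> N1. h x \<ominus>\<^bsub>X\<^esub> h' x \<in> V"
    proof (cases "\<exists>x \<in> N1. h x \<notin> V")
      case True
      show ?thesis by (rule lift_to_minimal[OF X V M least N1 k True])
    next
      case False
      have "h x \<ominus>\<^bsub>X\<^esub> \<zero>\<^bsub>?M\<^esub> \<in> V" if x: "x \<in> N1" for x
        using X.lsub_diff[OF sV _ lsub_zero[OF sV]] False x by simp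
      thus ?thesis by (intro bexI[OF _ lhom_zero_map[OF lM]] ballI)
    qed
    then obtain h' where h': "h' \<in> lhom \<Lambda> ?N1 ?M" "\<And>x. x \<in> N1 \<Longrightarrow> h x \<ominus>\<^bsub>X\<^esub> h' x \<in> V" by blast
    have prN1: "pr N1 \<in> lhom \<Lambda> E ?N1"
      unfolding lhom_sub_cod[OF lsub_subset[OF sN1]] using pr_hom[OF N1] pr_in[OF N1] by auto
    let ?g = "\<lambda>x\<in>carrier E. ?\<psi> (h' (pr N1 x))"
    have g: "?g \<in> carrier (PP N)"
      using lmod_hom_restrict[OF lmod_E lhom_comp[OF lhom_comp[OF prN1 h'(1)] \<psi>]] by simp
    have "(ee N1 \<odot>\<^bsub>H X\<^esub> h) x \<ominus>\<^bsub>X\<^esub> \<theta> (?g x) \<in> V" if x: "x \<in> carrier E" for x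
    proof -
      have px: "pr N1 x \<in> N1" by (rule pr_in[OF N1 x])
      have "h' (pr N1 x) \<in> M" using lhom_closed[OF h'(1)] px by simp
      hence "\<theta> (?g x) = h' (pr N1 x)" using bij_betw_inv_into_right[OF \<theta>(2)] x by simp
      thus ?thesis using h'(2)[OF px] ehx[OF x] by (simp only:)
    qed
    thus "ee N1 \<odot>\<^bsub>H X\<^esub> h \<in> ?G" using in_G[OF eh] g by blast
  qed
  hence "\<forall>h \<in> carrier (H X). \<exists>g \<in> carrier (PP N). \<forall>x \<in> carrier E. h x \<ominus>\<^bsub>X\<^esub> \<theta> (g x) \<in> V"
    using in_G by blast
  thus ?thesis using N(1) \<theta>X \<theta>V by blast
qed

text \<open>
  A chain of submodules \<open>Y = Y0 \<subset> Y1 \<subset> \<dots> \<subset> X\<close> with simple factors yields a filtration of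
  \<open>H X / H Y\<close>, whose factors \<open>H (Y(i+1)) / H (Yi)\<close> are standard modules by the preceding lemma.
\<close>
lemma filtered_by_standard:
  assumes X: "fdL X" and M: "lmod \<Gamma> M" and \<pi>: "lepi \<Gamma> (H X) M \<pi>"
    and Y: "lsubmodule Y \<Lambda> X" and ker: "{f \<in> carrier (H X). \<pi> f = \<zero>\<^bsub>M\<^esub>} = HS X Y"
  shows "filtered_by \<Gamma> \<Xi> (\<Delta> uleq) M"
proof -
  note lX = fdm_lmod[OF X] note lH = lmod_H[OF lX] note ph = lepiD(1)[OF \<pi>]
  interpret X: lmod \<Lambda> X by (rule lX)
  interpret M: lmod \<Gamma> M by (rule M)
  interpret HX: lmod \<Gamma> "H X" by (rule lH)
  obtain Us where Us: "Us \<noteq> []" "hd Us = Y" "last Us = carrier X" "\<And>W. W \<in> set Us \<Longrightarrow> lsubmodule W \<Lambda> X"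
    "successively (simple_step \<Lambda> X) Us"
    using simple_steps_between[OF X Y X.lsub_carrier lsub_subset[OF Y]] by blast
  have step: "simple_step \<Lambda> X (Us ! i) (Us ! Suc i)" if "Suc i < length Us" for i
    using Us(5) that by (simp add: successively_nth)
  have YU: "Y \<subseteq> Us ! i" if "i < length Us" for i
    using that
  proof (induction i)
    case 0 thus ?case using Us(1,2) by (simp add: hd_conv_nth)
  next
    case (Suc i)
    have "Us ! i \<subset> Us ! Suc i" using step[OF Suc.prems] max_subD(3)[of \<Lambda> "X\<lparr>carrier := Us ! Suc i\<rparr>" "Us ! i"]
      by (simp add: simple_step_def)
    thus ?case using Suc by auto
  qed
  let ?F = "\<lambda>U. \<pi> ` HS X U"
  have F_sub: "lsubmodule (?F U) \<Gamma> M" if "lsubmodule U \<Lambda> X" for U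
    by (rule lsub_image[OF lH M ph HS_sub[OF lX that]])
  have F_mono: "?F U \<subseteq> ?F W" if "U \<subseteq> W" for U W using that by (auto simp: HS_def)
  have F_mem: "\<pi> f \<in> ?F U \<longleftrightarrow> f \<in> HS X U"
    if U: "lsubmodule U \<Lambda> X" "Y \<subseteq> U" and f: "f \<in> carrier (H X)" for U f
  proof
    assume "\<pi> f \<in> ?F U"
    then obtain g where g: "g \<in> HS X U" "\<pi> f = \<pi> g" by blast
    have gc: "g \<in> carrier (H X)" by (rule lsub_mem[OF HS_sub[OF lX U(1)] g(1)])
    have "\<pi> (f \<ominus>\<^bsub>H X\<^esub> g) = \<zero>\<^bsub>M\<^esub>" using lhom_diff[OF lH M ph f gc] g(2) lhom_closed[OF ph gc] by simp
    hence "f \<ominus>\<^bsub>H X\<^esub> g \<in> HS X Y" using ker HX.minus_closed[OF f gc] by blast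
    hence "f \<ominus>\<^bsub>H X\<^esub> g \<in> HS X U" using U(2) by (auto simp: HS_def)
    from HX.lsub_diff_right[OF HS_sub[OF lX U(1)] this g(1) f] show "f \<in> HS X U" .
  qed blast
  have filt: "filtration \<Gamma> M (map ?F Us)"
    unfolding filtration_def
  proof (intro conjI ballI allI impI)
    show "map ?F Us \<noteq> []" using Us(1) by simp
    have "?F Y = {\<zero>\<^bsub>M\<^esub>}"
    proof
      show "?F Y \<subseteq> {\<zero>\<^bsub>M\<^esub>}" using ker by blast
      show "{\<zero>\<^bsub>M\<^esub>} \<subseteq> ?F Y" using lsub_zero[OF F_sub[OF Y]] by blast
    qed
    thus "hd (map ?F Us) = {\<zero>\<^bsub>M\<^esub>}" using Us(1,2) by (simp add: hd_map)
    have "HS X (carrier X) = carrier (H X)" by (auto simp: HS_def lmod_hom_app)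
    thus "last (map ?F Us) = carrier M" using Us(1,3) lepiD(2)[OF \<pi>] by (simp add: last_map)
  next
    fix U assume "U \<in> set (map ?F Us)"
    thus "lsubmodule U \<Gamma> M" using Us(4) F_sub by auto
  next
    fix i assume i: "Suc i < length (map ?F Us)"
    have "Us ! i \<subseteq> Us ! Suc i"
      using step[of i] i max_subD(3)[of \<Lambda> "X\<lparr>carrier := Us ! Suc i\<rparr>" "Us ! i"] by (auto simp: simple_step_def)
    thus "map ?F Us ! i \<subseteq> map ?F Us ! Suc i" using F_mono i by simp
  qed
  have "\<exists>\<xi> \<in> \<Xi>. lmod_iso \<Gamma> (subquotient M (map ?F Us) i) (\<Delta> uleq \<xi>)" if i: "Suc i < length Us" for i
  proof -
    let ?V = "Us ! i" and ?W = "Us ! Suc i"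
    have V: "lsubmodule ?V \<Lambda> X" and W: "lsubmodule ?W \<Lambda> X" and mx: "max_sub \<Lambda> (X\<lparr>carrier := ?W\<rparr>) ?V"
      using step[OF i] by (auto simp: simple_step_def)
    have VW: "?V \<subseteq> ?W" using max_subD(3)[OF mx] by auto
    note FV = F_sub[OF V] note FW = F_sub[OF W]
    interpret FW: lmod \<Gamma> "M\<lparr>carrier := ?F ?W\<rparr>" by (rule M.lmod_sub[OF FW])
    have FVW: "lsubmodule (?F ?V) \<Gamma> (M\<lparr>carrier := ?F ?W\<rparr>)"
      using M.lsub_sub_iff[OF FW] FV F_mono[OF VW] by blast
    let ?Q = "quot_lmod (M\<lparr>carrier := ?F ?W\<rparr>) (?F ?V)"
    let ?q = "quot_map (M\<lparr>carrier := ?F ?W\<rparr>) (?F ?V)"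
    note lQ = FW.lmod_quot[OF FVW] note eq = FW.quot_map_epi[OF FVW]
    have sub_eq: "?Q = subquotient M (map ?F Us) i" using i by (simp add: subquotient_def)
    obtain N \<theta> where N: "N \<in> \<N>" and \<theta>: "\<theta> \<in> lhom \<Lambda> (E\<lparr>carrier := N\<rparr>) (X\<lparr>carrier := ?W\<rparr>)"
      and \<theta>V: "\<And>x. x \<in> N \<Longrightarrow> \<theta> x \<in> ?V \<longleftrightarrow> x \<in> rd N"
      and lift: "\<And>h. h \<in> carrier (H (X\<lparr>carrier := ?W\<rparr>)) \<Longrightarrow>
        \<exists>g \<in> carrier (PP N). \<forall>x \<in> carrier E. h x \<ominus>\<^bsub>X\<lparr>carrier := ?W\<rparr>\<^esub> \<theta> (g x) \<in> ?V"
      using maximal_step[OF fdm_sub[OF X W] mx] by blast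
    obtain \<xi> where \<xi>: "\<xi> \<in> \<Xi>" "sm \<xi> = N" using sm_surj[OF N] by blast
    obtain p where p: "lepi \<Gamma> (PP N) (\<Delta> uleq \<xi>) p" "{f \<in> carrier (PP N). p f = \<zero>\<^bsub>\<Delta> uleq \<xi>\<^esub>} = maps_to_rd N"
      using standard_uleq_epi[OF \<xi>(1)] \<xi>(2) by auto
    note lN = fdm_lmod[OF fdm_summand[OF N]]
    interpret PN: lmod \<Gamma> "PP N" by (rule lmod_PP[OF N])
    let ?\<Theta> = "\<lambda>g. \<lambda>x\<in>carrier E. \<theta> (g x)"
    have HW: "H (X\<lparr>carrier := ?W\<rparr>) = (H X)\<lparr>carrier := HS X ?W\<rparr>" by (rule hom_mod_sub[OF W])
    have \<Theta>: "?\<Theta> \<in> lhom \<Gamma> (PP N) ((H X)\<lparr>carrier := HS X ?W\<rparr>)" using H_map[OF lN \<theta>] unfolding HW .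
    have \<pi>W: "\<pi> \<in> lhom \<Gamma> ((H X)\<lparr>carrier := HS X ?W\<rparr>) (M\<lparr>carrier := ?F ?W\<rparr>)"
      unfolding lhom_sub_cod[OF lsub_subset[OF FW]]
      using lhom_sub_dom[OF ph lsub_subset[OF HS_sub[OF lX W]]] by auto
    let ?t = "\<lambda>g. ?q (\<pi> (?\<Theta> g))"
    have th: "?t \<in> lhom \<Gamma> (PP N) ?Q" by (rule lhom_comp[OF lhom_comp[OF \<Theta> \<pi>W] lepiD(1)[OF eq]])
    have \<Theta>W: "?\<Theta> g \<in> HS X ?W" if "g \<in> carrier (PP N)" for g using lhom_closed[OF \<Theta> that] by simp
    have \<Theta>c: "?\<Theta> g \<in> carrier (H X)" if "g \<in> carrier (PP N)" for g
      by (rule lsub_mem[OF HS_sub[OF lX W] \<Theta>W[OF that]])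
    have kt: "?t g = \<zero>\<^bsub>?Q\<^esub> \<longleftrightarrow> p g = \<zero>\<^bsub>\<Delta> uleq \<xi>\<^esub>" if g: "g \<in> carrier (PP N)" for g
    proof -
      have gN: "g x \<in> N" if "x \<in> carrier E" for x using g that PP_carrier[OF N] by blast
      have "?t g = \<zero>\<^bsub>?Q\<^esub> \<longleftrightarrow> \<pi> (?\<Theta> g) \<in> ?F ?V"
        by (rule FW.quot_map_zero_iff[OF FVW]) (use \<Theta>W[OF g] in simp)
      also have "\<dots> \<longleftrightarrow> ?\<Theta> g \<in> HS X ?V"
        by (rule F_mem[OF V YU \<Theta>c[OF g]]) (use i in simp)
      also have "\<dots> \<longleftrightarrow> g \<in> maps_to_rd N"
        using \<Theta>c[OF g] g \<theta>V[OF gN] by (simp add: HS_def)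
      also have "\<dots> \<longleftrightarrow> p g = \<zero>\<^bsub>\<Delta> uleq \<xi>\<^esub>" using p(2) g by blast
      finally show ?thesis .
    qed
    have "?t ` carrier (PP N) = carrier ?Q"
    proof
      show "?t ` carrier (PP N) \<subseteq> carrier ?Q" using lhom_closed[OF th] by blast
      show "carrier ?Q \<subseteq> ?t ` carrier (PP N)"
      proof
        fix z assume "z \<in> carrier ?Q"
        obtain m where "m \<in> carrier (M\<lparr>carrier := ?F ?W\<rparr>)" "z = ?q m" using lepi_ex[OF eq \<open>z \<in> carrier ?Q\<close>] by blast
        hence m: "m \<in> ?F ?W" "z = ?q m" by simp_all
        then obtain h where h: "h \<in> HS X ?W" "m = \<pi> h" by blast
        have hc: "h \<in> carrier (H X)" by (rule lsub_mem[OF HS_sub[OF lX W] h(1)])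
        have "h \<in> carrier (H (X\<lparr>carrier := ?W\<rparr>))" unfolding HW using h(1) by simp
        then obtain g where g: "g \<in> carrier (PP N)"
          "\<And>x. x \<in> carrier E \<Longrightarrow> h x \<ominus>\<^bsub>X\<lparr>carrier := ?W\<rparr>\<^esub> \<theta> (g x) \<in> ?V" using lift by blast
        let ?v = "h \<ominus>\<^bsub>H X\<^esub> ?\<Theta> g"
        have vc: "?v \<in> carrier (H X)" by (rule HX.minus_closed[OF hc \<Theta>c[OF g(1)]])
        have vh: "?v \<oplus>\<^bsub>H X\<^esub> ?\<Theta> g = h" by (rule HX.diff_add_cancel[OF hc \<Theta>c[OF g(1)]])
        interpret XW: lmod \<Lambda> "X\<lparr>carrier := ?W\<rparr>" by (rule X.lmod_sub[OF W])
        have "?v \<in> HS X ?V"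
          unfolding HS_def
        proof (intro CollectI conjI ballI)
          show "?v \<in> lmod_hom \<Lambda> E X" using vc by simp
          fix x assume x: "x \<in> carrier E"
          have c: "\<theta> (g x) \<in> ?W" "h x \<in> ?W" using \<Theta>W[OF g(1)] h(1) x by (auto simp: HS_def)
          have hx: "h x = ?v x \<oplus>\<^bsub>X\<^esub> \<theta> (g x)" using fun_cong[OF vh, of x] x by simp
          have "?v \<in> HS X ?W" by (rule HX.lsub_diff[OF HS_sub[OF lX W] h(1) \<Theta>W[OF g(1)]])
          hence vW: "?v x \<in> ?W" using x by (simp add: HS_def)
          have "(?v x \<oplus>\<^bsub>X\<lparr>carrier := ?W\<rparr>\<^esub> \<theta> (g x)) \<oplus>\<^bsub>X\<lparr>carrier := ?W\<rparr>\<^esub> \<ominus>\<^bsub>X\<lparr>carrier := ?W\<rparr>\<^esub> \<theta> (g x) = ?v x"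
            using XW.a_assoc[of "?v x" "\<theta> (g x)" "\<ominus>\<^bsub>X\<lparr>carrier := ?W\<rparr>\<^esub> \<theta> (g x)"] XW.r_neg[of "\<theta> (g x)"]
              XW.M.add.inv_closed[of "\<theta> (g x)"] XW.M.r_zero[of "?v x"] vW c(1) by simp
          hence "h x \<ominus>\<^bsub>X\<lparr>carrier := ?W\<rparr>\<^esub> \<theta> (g x) = ?v x" unfolding hx by (simp add: a_minus_def)
          thus "?v x \<in> ?V" using g(2)[OF x] by simp
        qed
        hence "\<pi> ?v \<in> ?F ?V" by blast
        moreover have "\<pi> ?v \<in> ?F ?W" using F_mono[OF VW] calculation by blast
        ultimately have q0: "?q (\<pi> ?v) = \<zero>\<^bsub>?Q\<^esub>" using FW.quot_map_zero_iff[OF FVW] by simp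
        interpret Q: lmod \<Gamma> ?Q by (rule lQ)
        have \<pi>\<Theta>: "\<pi> (?\<Theta> g) \<in> carrier (M\<lparr>carrier := ?F ?W\<rparr>)" using \<Theta>W[OF g(1)] by simp
        have "m = \<pi> ?v \<oplus>\<^bsub>M\<lparr>carrier := ?F ?W\<rparr>\<^esub> \<pi> (?\<Theta> g)"
          using lhom_add[OF ph vc \<Theta>c[OF g(1)]] vh h(2) by simp
        hence "z = ?q (\<pi> ?v) \<oplus>\<^bsub>?Q\<^esub> ?t g"
          using m(2) lhom_add[OF lepiD(1)[OF eq], of "\<pi> ?v" "\<pi> (?\<Theta> g)"] \<open>\<pi> ?v \<in> ?F ?W\<close> \<pi>\<Theta> by simp
        hence "z = ?t g" using q0 lhom_closed[OF th g(1)] by simp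
        thus "z \<in> ?t ` carrier (PP N)" using g(1) by blast
      qed
    qed
    hence et: "lepi \<Gamma> (PP N) ?Q ?t" using th by (simp add: lepi_def)
    have "lmod_iso \<Gamma> ?Q (\<Delta> uleq \<xi>)"
      by (rule lmod_iso_of_epis[OF PN.lmod_axioms lQ fdG_lmod[OF fdm_standard[OF \<xi>(1)]] et p(1)]) (rule kt)
    thus ?thesis unfolding sub_eq using \<xi>(1) by blast
  qed
  thus ?thesis unfolding filtered_by_def using filt by (intro exI[of _ "map ?F Us"]) simp
qed

text \<open>As a left module over itself, \<open>\<Gamma>\<close> is \<open>H E\<close>.\<close>
lemma quasi_hereditary_uleq: "quasi_hereditary_structure K \<Gamma> \<Xi> S P uleq"
proof -
  interpret G: fda K \<Gamma> by (rule fda_G)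
  interpret E: lmod \<Lambda> E by (rule lmod_E)
  have "lepi \<Gamma> (H E) (regular_module \<Gamma>) (\<lambda>f. f)"
    unfolding lepi_def by (auto intro!: lhomI)
  moreover have "{f \<in> carrier (H E). f = \<zero>\<^bsub>regular_module \<Gamma>\<^esub>} = HS E {\<zero>\<^bsub>E\<^esub>}"
    unfolding HS_zero[OF lmod_E] using lmod_hom_zero[OF lmod_E lmod_E] by auto
  ultimately have "filtered_by \<Gamma> \<Xi> (\<Delta> uleq) (regular_module \<Gamma>)"
    by (rule filtered_by_standard[OF fdE G.lmod_regular _ E.lsub_zero_module])
  thus ?thesis
    unfolding quasi_hereditary_structure_def
    using partial_order_uleq adapted_uleq schurian_standard by blast
qed

lemma torsl_eq_filtered: "torsl K \<Gamma> = delta_filtered_modules K \<Gamma> \<Xi> S P uleq"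
proof
  show "torsl K \<Gamma> \<subseteq> delta_filtered_modules K \<Gamma> \<Xi> S P uleq"
  proof
    fix M assume M: "M \<in> torsl K \<Gamma>"
    hence Mf: "M \<in> fmod K \<Gamma>" by (simp add: torsl_def)
    hence fM: "fdG M" by (simp add: fmod_def)
    note lM = fdG_lmod[OF fM]
    have t: "tfree M" by (rule torsl_imp_tfree[OF M])
    obtain X :: "('a, (nat \<Rightarrow> 'k) \<Rightarrow> 'e) module" and \<pi> where X: "fdL X" and \<pi>: "lepi \<Gamma> (H X) M \<pi>"
      using H_cover[OF fM] by blast
    note lX = fdm_lmod[OF X] note lH = lmod_H[OF lX]
    let ?K = "{f \<in> carrier (H X). \<pi> f = \<zero>\<^bsub>M\<^esub>}"
    have "lsubmodule ?K \<Gamma> (H X)" by (rule quot_iso[OF lH lM \<pi> refl])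
    moreover have "tclosed (H X) ?K" using tfree_epi_iff[OF lH lM \<pi> refl] t by blast
    ultimately obtain Y where "lsubmodule Y \<Lambda> X" "?K = HS X Y" using tclosed_HS[OF lX] by blast
    hence "filtered_by \<Gamma> \<Xi> (\<Delta> uleq) M" using filtered_by_standard[OF X lM \<pi>] by blast
    thus "M \<in> delta_filtered_modules K \<Gamma> \<Xi> S P uleq" using Mf by (simp add: delta_filtered_modules_def)
  qed
  show "delta_filtered_modules K \<Gamma> \<Xi> S P uleq \<subseteq> torsl K \<Gamma>"
  proof
    fix M assume "M \<in> delta_filtered_modules K \<Gamma> \<Xi> S P uleq"
    hence M: "M \<in> fmod K \<Gamma>" "filtered_by \<Gamma> \<Xi> (\<Delta> uleq) M" by (auto simp: delta_filtered_modules_def)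
    have "lmod \<Gamma> M" using M(1) by (simp add: fmod_def fdG_lmod)
    from filtered_by_imp_tfree[OF this M(2) tfree_standard] show "M \<in> torsl K \<Gamma>"
      by (rule tfree_imp_torsl[OF M(1)])
  qed
qed

end

section \<open>Algebras for which the torsionless modules are filtered\<close>

lemma carrier_of_update: "carrier (M\<lparr>carrier := U\<rparr>) = U"
  by simp

lemma (in lmod) quot_zero_iso: "lmod_iso A (quot_lmod M {\<zero>\<^bsub>M\<^esub>}) M"
  by (rule quot_iso[OF lmod_axioms lmod_axioms lepi_id]) auto

context auslander
begin

text \<open>The generator \<open>ee N\<close> of \<open>PP N\<close> is fixed by the idempotent \<open>ee N\<close>.\<close>
lemma wt_of_epi:
  assumes N: "N \<in> \<N>" and S: "lmod \<Gamma> S" and p: "lepi \<Gamma> (PP N) S p" and nz: "carrier S \<noteq> {\<zero>\<^bsub>S\<^esub>}"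
  shows "p (ee N) \<noteq> \<zero>\<^bsub>S\<^esub>" and "wt N S"
proof -
  interpret S: lmod \<Gamma> S by (rule S)
  note ph = lepiD(1)[OF p]
  have eN: "ee N \<in> carrier (PP N)" by (rule ee_PP[OF N])
  show 1: "p (ee N) \<noteq> \<zero>\<^bsub>S\<^esub>"
  proof
    assume 0: "p (ee N) = \<zero>\<^bsub>S\<^esub>"
    have "s = \<zero>\<^bsub>S\<^esub>" if s: "s \<in> carrier S" for s
    proof -
      obtain f where f: "f \<in> carrier (PP N)" "s = p f" using lepi_ex[OF p s] by blast
      have fG: "f \<in> carrier \<Gamma>" using f(1) PP_carrier[OF N] by (simp add: auslander_algebra_simps)
      have "s = f \<odot>\<^bsub>S\<^esub> p (ee N)"
        using lhom_smult[OF ph fG eN] f(2) unfolding PP_ee[OF N f(1)] by simp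
      thus ?thesis using 0 S.smult_zero[OF fG] by simp
    qed
    thus False using nz S.zero_closed by blast
  qed
  have "ee N \<odot>\<^bsub>S\<^esub> p (ee N) = p (ee N)"
    using lhom_smult[OF ph ee_G[OF N] eN] unfolding PP_ee[OF N eN] by simp
  thus "wt N S" unfolding wt_def using 1 lhom_closed[OF ph eN] by (intro bexI[of _ "p (ee N)"]) simp_all
qed

text \<open>The simple factor module of \<open>PP N\<close> by its radical has no weight other than \<open>N\<close>.\<close>
lemma ee_in_rad_PP:
  assumes N: "N \<in> \<N>" and N': "N' \<in> \<N>" and ne: "N \<noteq> N'" and f: "f \<in> carrier (PP N)"
  shows "ee N' \<odot>\<^bsub>PP N\<^esub> f \<in> rad_PP N"
proof -
  interpret P: lmod \<Gamma> "PP N" by (rule lmod_PP[OF N])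
  obtain S where S: "S \<in> fmod K \<Gamma>" "simple_module \<Gamma> S" "wt N S" using simple_of_summand[OF N] by blast
  have lS: "lmod \<Gamma> S" using S(1) by (simp add: fmod_def fdG_lmod)
  obtain p where p: "lepi \<Gamma> (PP N) S p" "{f \<in> carrier (PP N). p f = \<zero>\<^bsub>S\<^esub>} = rad_PP N"
    using simple_wt_epi[OF lS S(2) N S(3)] by blast
  have "p (ee N' \<odot>\<^bsub>PP N\<^esub> f) = \<zero>\<^bsub>S\<^esub>"
  proof (rule ccontr)
    assume "p (ee N' \<odot>\<^bsub>PP N\<^esub> f) \<noteq> \<zero>\<^bsub>S\<^esub>"
    hence "wt N' S" using wt_epi[OF P.lmod_axioms lS p(1) N'] f by blast
    thus False using wt_unique[OF lS S(2) N N' S(3)] ne by blast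
  qed
  thus ?thesis using p(2) P.closed_ops[OF ee_G[OF N'] f] by blast
qed

text \<open>A factor module of \<open>PP N\<close> inherits from it that proper submodules lie in a largest one.\<close>
lemma sum_proper_sub:
  assumes N: "N \<in> \<N>" and F: "lmod \<Gamma> F" and q: "lepi \<Gamma> (PP N) F q"
    and U: "lsubmodule U \<Gamma> F" and V: "lsubmodule V \<Gamma> F" and UV: "carrier F \<subseteq> U <+>\<^bsub>F\<^esub> V"
  shows "U = carrier F \<or> V = carrier F"
proof (rule ccontr)
  assume "\<not> ?thesis"
  hence ne: "U \<noteq> carrier F" "V \<noteq> carrier F" by auto
  interpret P: lmod \<Gamma> "PP N" by (rule lmod_PP[OF N])
  interpret F: lmod \<Gamma> F by (rule F)
  note qh = lepiD(1)[OF q]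
  have pre: "{f \<in> carrier (PP N). q f \<in> W} \<subseteq> rad_PP N" if W: "lsubmodule W \<Gamma> F" "W \<noteq> carrier F" for W
  proof (rule rad_PP_largest[OF N lsub_vimage[OF P.lmod_axioms F qh W(1)]])
    show "{f \<in> carrier (PP N). q f \<in> W} \<noteq> carrier (PP N)"
    proof
      assume "{f \<in> carrier (PP N). q f \<in> W} = carrier (PP N)"
      hence "q ` carrier (PP N) \<subseteq> W" by blast
      thus False using lepiD(2)[OF q] lsub_subset[OF W(1)] W(2) by simp
    qed
  qed
  have eN: "ee N \<in> carrier (PP N)" by (rule ee_PP[OF N])
  have "q (ee N) \<in> U <+>\<^bsub>F\<^esub> V" using UV lhom_closed[OF qh eN] by blast
  then obtain u v where uv: "u \<in> U" "v \<in> V" "q (ee N) = u \<oplus>\<^bsub>F\<^esub> v" using F.set_add_iff by blast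
  obtain f where f: "f \<in> carrier (PP N)" "u = q f" using lepi_ex[OF q lsub_mem[OF U uv(1)]] by blast
  have "q (ee N \<ominus>\<^bsub>PP N\<^esub> f) = v"
    using lhom_diff[OF P.lmod_axioms F qh eN f(1)] uv f(2) lsub_mem[OF U uv(1)] lsub_mem[OF V uv(2)]
    by (simp add: F.minus_eq F.a_ac F.r_neg)
  hence "ee N \<ominus>\<^bsub>PP N\<^esub> f \<in> rad_PP N" using pre[OF V ne(2)] uv(2) P.minus_closed[OF eN f(1)] by blast
  moreover have "f \<in> rad_PP N" using pre[OF U ne(1)] f uv(1) by blast
  ultimately have "ee N \<in> rad_PP N" by (rule P.lsub_diff_right[OF rad_PP_sub[OF N] _ _ eN])
  thus False using ee_rad_PP[OF N] by contradiction
qed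

text \<open>
  Since the identity of \<open>X\<close> is a sum of maps through \<open>E\<close>, a map out of \<open>X\<close> lifts along \<open>\<pi>\<close> as soon
  as its composites with maps from \<open>E\<close> do.
\<close>
lemma lift_from_E:
  assumes X: "fdL X" and Y: "lmod \<Lambda> Y" and Z: "lmod \<Lambda> Z"
    and \<tau>: "\<tau> \<in> lhom \<Lambda> X Z" and \<pi>: "\<pi> \<in> lhom \<Lambda> Y Z"
    and lift: "\<And>g. g \<in> lhom \<Lambda> E X \<Longrightarrow> \<exists>g' \<in> lhom \<Lambda> E Y. \<forall>x \<in> carrier E. \<tau> (g x) = \<pi> (g' x)"
  shows "\<exists>\<phi> \<in> lhom \<Lambda> X Y. \<forall>x \<in> carrier X. \<pi> (\<phi> x) = \<tau> x"
proof -
  note lX = fdm_lmod[OF X]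
  interpret Y: lmod \<Lambda> Y by (rule Y)
  have "\<exists>\<phi> \<in> lhom \<Lambda> X Y. \<forall>x \<in> carrier X. \<pi> (\<phi> x) = \<tau> (f x)" if "through_E X f" for f
    using that
  proof induction
    case zero
    show ?case
      by (rule bexI[OF _ lhom_zero_map[OF Y]]) (simp add: lhom_zero[OF Y Z \<pi>] lhom_zero[OF lX Z \<tau>])
  next
    case (comp a b)
    obtain g' where g': "g' \<in> lhom \<Lambda> E Y" "\<And>x. x \<in> carrier E \<Longrightarrow> \<tau> (b x) = \<pi> (g' x)"
      using lift[OF comp(2)] by blast
    show ?case by (rule bexI[OF _ lhom_comp[OF comp(1) g'(1)]]) (use g'(2) lhom_closed[OF comp(1)] in simp)
  next
    case (plus f g)
    obtain \<phi> \<psi> where *: "\<phi> \<in> lhom \<Lambda> X Y" "\<psi> \<in> lhom \<Lambda> X Y"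
      "\<And>x. x \<in> carrier X \<Longrightarrow> \<pi> (\<phi> x) = \<tau> (f x)" "\<And>x. x \<in> carrier X \<Longrightarrow> \<pi> (\<psi> x) = \<tau> (g x)"
      using plus.IH by blast
    note fh = through_E_hom[OF lX plus.hyps(1)] note gh = through_E_hom[OF lX plus.hyps(2)]
    show ?case
    proof (intro bexI[OF _ lhom_plus[OF Y *(1,2)]] ballI)
      fix x assume x: "x \<in> carrier X"
      show "\<pi> (\<phi> x \<oplus>\<^bsub>Y\<^esub> \<psi> x) = \<tau> (f x \<oplus>\<^bsub>X\<^esub> g x)"
        unfolding lhom_add[OF \<pi> lhom_closed[OF *(1) x] lhom_closed[OF *(2) x]]
          lhom_add[OF \<tau> lhom_closed[OF fh x] lhom_closed[OF gh x]] using *(3,4)[OF x] by simp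
    qed
  next
    case (congr f g)
    thus ?case by simp
  qed
  from this[OF through_E_id[OF X]] show ?thesis .
qed

end

text \<open>
  Let \<open>B\<close> and \<open>C\<close> be complements of each other in \<open>R\<close>. A map \<open>\<phi> : M / B \<rightarrow> M / C\<close> over \<open>M / R\<close> makes
  \<open>B\<close> a direct summand of \<open>M\<close>: a complement is the equalizer of \<open>M \<rightarrow> M / C\<close> and
  \<open>M \<rightarrow> M / B \<rightarrow> M / C\<close>.
\<close>
lemma (in lmod) complement_of_map_over:
  assumes ind: "indecomposable A M" and R: "lsubmodule R A M" "R \<noteq> carrier M"
    and C: "lsubmodule C A M" and B: "lsubmodule B A M"
    and CB: "C \<inter> B = {\<zero>\<^bsub>M\<^esub>}" "C <+>\<^bsub>M\<^esub> B = R"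
    and \<phi>: "\<phi> \<in> lhom A (quot_lmod M B) (quot_lmod M C)"
    and \<pi>C: "\<And>m. m \<in> carrier M \<Longrightarrow> \<pi> (quot_map M C m) = quot_map M R m"
    and \<pi>B: "\<And>m. m \<in> carrier M \<Longrightarrow> \<pi> (\<phi> (quot_map M B m)) = quot_map M R m"
  shows "B = {\<zero>\<^bsub>M\<^esub>}"
proof -
  let ?qC = "quot_map M C" and ?qB = "quot_map M B" and ?qR = "quot_map M R"
  let ?QC = "quot_lmod M C" and ?QB = "quot_lmod M B" and ?QR = "quot_lmod M R"
  note eC = quot_map_epi[OF C] note eB = quot_map_epi[OF B] note eR = quot_map_epi[OF R(1)]
  note hC = lepiD(1)[OF eC] note hB = lepiD(1)[OF eB] note hR = lepiD(1)[OF eR]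
  interpret QC: lmod A ?QC by (rule lmod_quot[OF C])
  have h: "(\<lambda>m. \<phi> (?qB m)) \<in> lhom A M ?QC" by (rule lhom_comp[OF hB \<phi>])
  let ?U = "{m \<in> carrier M. ?qC m = \<phi> (?qB m)}"
  have U: "lsubmodule ?U A M"
  proof (rule lsubmoduleI)
    show "?U \<subseteq> carrier M" by blast
    show "\<zero>\<^bsub>M\<^esub> \<in> ?U"
      using lhom_zero[OF lmod_axioms QC.lmod_axioms hC] lhom_zero[OF lmod_axioms QC.lmod_axioms h] by simp
    show "x \<oplus>\<^bsub>M\<^esub> y \<in> ?U" if "x \<in> ?U" "y \<in> ?U" for x y
      using that lhom_add[OF hC, of x y] lhom_add[OF h, of x y] by simp
    show "a \<odot>\<^bsub>M\<^esub> x \<in> ?U" if "a \<in> carrier A" "x \<in> ?U" for a x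
      using that lhom_smult[OF hC, of a x] lhom_smult[OF h, of a x] by simp
  qed
  have "?U \<inter> B = {\<zero>\<^bsub>M\<^esub>}"
  proof
    show "?U \<inter> B \<subseteq> {\<zero>\<^bsub>M\<^esub>}"
    proof
      fix m assume m: "m \<in> ?U \<inter> B"
      hence mc: "m \<in> carrier M" by blast
      have "?qB m = \<zero>\<^bsub>?QB\<^esub>" using quot_map_zero_iff[OF B mc] m by blast
      hence "?qC m = \<zero>\<^bsub>?QC\<^esub>" using m lhom_zero[OF lmod_quot[OF B] QC.lmod_axioms \<phi>] by auto
      hence "m \<in> C" using quot_map_zero_iff[OF C mc] by blast
      thus "m \<in> {\<zero>\<^bsub>M\<^esub>}" using m CB(1) by blast
    qed
    show "{\<zero>\<^bsub>M\<^esub>} \<subseteq> ?U \<inter> B" using lsub_zero[OF U] lsub_zero[OF B] by blast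
  qed
  moreover have "?U <+>\<^bsub>M\<^esub> B = carrier M"
  proof
    show "?U <+>\<^bsub>M\<^esub> B \<subseteq> carrier M" by (rule lsub_subset[OF lsub_sum[OF U B]])
    show "carrier M \<subseteq> ?U <+>\<^bsub>M\<^esub> B"
    proof
      fix m assume m: "m \<in> carrier M"
      obtain m' where m': "m' \<in> carrier M" "\<phi> (?qB m) = ?qC m'"
        using lepi_ex[OF eC lhom_closed[OF h m]] by blast
      have "?qR m' = ?qR m" using \<pi>C[OF m'(1)] \<pi>B[OF m] m'(2) by simp
      hence "?qR (m \<ominus>\<^bsub>M\<^esub> m') = \<zero>\<^bsub>?QR\<^esub>"
        using lhom_diff[OF lmod_axioms lmod_quot[OF R(1)] hR m m'(1)]
          abelian_group.r_neg[of ?QR "?qR m"] lhom_closed[OF hR m] lmod_quot[OF R(1)]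
        by (simp add: a_minus_def lmod_def left_module_def)
      hence "m \<ominus>\<^bsub>M\<^esub> m' \<in> C <+>\<^bsub>M\<^esub> B" using quot_map_zero_iff[OF R(1) M.minus_closed[OF m m'(1)]] CB(2) by simp
      then obtain c b where cb: "c \<in> C" "b \<in> B" "m \<ominus>\<^bsub>M\<^esub> m' = c \<oplus>\<^bsub>M\<^esub> b" using set_add_iff by blast
      have c: "c \<in> carrier M" and b: "b \<in> carrier M" using lsub_mem[OF C cb(1)] lsub_mem[OF B cb(2)] by auto
      have mc: "m \<ominus>\<^bsub>M\<^esub> b \<in> carrier M" by (rule M.minus_closed[OF m b])
      have e: "m \<ominus>\<^bsub>M\<^esub> b = c \<oplus>\<^bsub>M\<^esub> m'"
      proof -
        have "m = (c \<oplus>\<^bsub>M\<^esub> b) \<oplus>\<^bsub>M\<^esub> m'" using diff_add_cancel[OF m m'(1)] cb(3) by simp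
        hence "m = (c \<oplus>\<^bsub>M\<^esub> m') \<oplus>\<^bsub>M\<^esub> b" using c b m'(1) by (simp add: M.a_ac)
        thus ?thesis using c b m'(1) by (simp add: M.minus_eq M.a_assoc M.r_neg)
      qed
      have "?qC (m \<ominus>\<^bsub>M\<^esub> b) = ?qC m'"
        unfolding e lhom_add[OF hC c m'(1)]
        using quot_map_zero_iff[OF C c] cb(1) QC.l_zero[OF lhom_closed[OF hC m'(1)]] by simp
      also have "\<dots> = \<phi> (?qB m)" using m'(2) by simp
      also have "?qB m = ?qB (m \<ominus>\<^bsub>M\<^esub> b)"
      proof -
        interpret QB: lmod A ?QB by (rule lmod_quot[OF B])
        have "?qB b = \<zero>\<^bsub>?QB\<^esub>" using quot_map_zero_iff[OF B b] cb(2) by blast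
        moreover have "?qB m = ?qB ((m \<ominus>\<^bsub>M\<^esub> b) \<oplus>\<^bsub>M\<^esub> b)" using diff_add_cancel[OF m b] by simp
        ultimately show ?thesis using lhom_add[OF hB mc b] QB.r_zero[OF lhom_closed[OF hB mc]] by simp
      qed
      finally have "m \<ominus>\<^bsub>M\<^esub> b \<in> ?U" using mc by blast
      moreover have "m = (m \<ominus>\<^bsub>M\<^esub> b) \<oplus>\<^bsub>M\<^esub> b" using diff_add_cancel[OF m b] by simp
      ultimately show "m \<in> ?U <+>\<^bsub>M\<^esub> B" unfolding set_add_iff using cb(2) by blast
    qed
  qed
  ultimately have "?U = {\<zero>\<^bsub>M\<^esub>} \<or> B = {\<zero>\<^bsub>M\<^esub>}" by (rule indecomposableD[OF ind U B])
  moreover have "?U \<noteq> {\<zero>\<^bsub>M\<^esub>}"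
  proof
    assume "?U = {\<zero>\<^bsub>M\<^esub>}"
    hence "carrier M \<subseteq> B"
      using \<open>?U <+>\<^bsub>M\<^esub> B = carrier M\<close> lsub_sum_least[OF B, of "?U" B] lsub_zero[OF B] by auto
    hence "carrier M \<subseteq> R" using lsub_sum_supset(2)[OF C B] CB(2) by auto
    thus False using lsub_subset[OF R(1)] R(2) by blast
  qed
  ultimately show ?thesis by blast
qed

locale auslander_torsl_filtered = auslander_simples K \<Lambda> E \<N> \<Xi> S P
  for K :: "'k ring" and \<Lambda> :: "('k, 'a) module" and E :: "('a, 'e) module" and \<N> :: "'e set set"
    and \<Xi> :: "'x set" and S P :: "'x \<Rightarrow> ('e \<Rightarrow> 'e, nat \<Rightarrow> 'k) module" +
  fixes leq :: "'x rel"
  assumes leq_refl: "\<xi> \<in> \<Xi> \<Longrightarrow> (\<xi>, \<xi>) \<in> leq"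
    and torsl_filtered: "torsl K \<Gamma> = delta_filtered_modules K \<Gamma> \<Xi> S P leq"
begin

text \<open>A standard module is filtered by standard modules, with one step.\<close>
lemma tfree_standard:
  assumes \<xi>: "\<xi> \<in> \<Xi>"
  shows "tfree (\<Delta> leq \<xi>)"
proof -
  note fD = fdm_standard[OF \<xi>, of leq] note lD = fdG_lmod[OF fD]
  obtain X where X: "X \<in> fmod K \<Gamma>" "lmod_iso \<Gamma> (\<Delta> leq \<xi>) X"
    using fmod_representative[OF fda.fd_alg[OF fda_G] fD] by blast
  have lX: "lmod \<Gamma> X" using X(1) by (simp add: fmod_def fdG_lmod)
  interpret X: lmod \<Gamma> X by (rule lX)
  have "lmod_iso \<Gamma> (quot_lmod X {\<zero>\<^bsub>X\<^esub>}) (\<Delta> leq \<xi>)"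
    by (rule lmod_iso_trans[OF X.lmod_quot[OF X.lsub_zero_module] lX X.quot_zero_iso
          lmod_iso_sym[OF lD lX X(2)]])
  hence "lmod_iso \<Gamma> (subquotient X [{\<zero>\<^bsub>X\<^esub>}, carrier X] 0) (\<Delta> leq \<xi>)" by (simp add: subquotient_def)
  hence "\<forall>i. Suc i < length [{\<zero>\<^bsub>X\<^esub>}, carrier X] \<longrightarrow>
      (\<exists>\<rho> \<in> \<Xi>. lmod_iso \<Gamma> (subquotient X [{\<zero>\<^bsub>X\<^esub>}, carrier X] i) (\<Delta> leq \<rho>))" using \<xi> by auto
  moreover have "filtration \<Gamma> X [{\<zero>\<^bsub>X\<^esub>}, carrier X]"
    using X.lsub_zero_module X.lsub_carrier by (simp add: filtration_def less_Suc_eq)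
  ultimately have "filtered_by \<Gamma> \<Xi> (\<Delta> leq) X" unfolding filtered_by_def by blast
  hence "X \<in> torsl K \<Gamma>" using X(1) unfolding torsl_filtered delta_filtered_modules_def by blast
  hence "tfree X" by (rule torsl_imp_tfree)
  from tfree_iso[OF lD lX X(2) this] show ?thesis .
qed

lemma ker_standard_rad_PP:
  assumes \<xi>: "\<xi> \<in> \<Xi>"
  shows "ker_standard leq \<xi> \<subseteq> rad_PP (sm \<xi>)"
proof (rule wsub_least[OF rad_PP_sub[OF sm(1)[OF \<xi>]]])
  fix N f assume N: "N \<in> not_below leq \<xi>" and f: "f \<in> carrier (PP (sm \<xi>))"
  then obtain \<rho> where \<rho>: "\<rho> \<in> \<Xi>" "(\<rho>, \<xi>) \<notin> leq" "N = sm \<rho>" by (auto simp: not_below_def)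
  have "sm \<xi> \<noteq> N" using sm_inj[OF \<xi> \<rho>(1)] \<rho>(2,3) leq_refl[OF \<xi>] by auto
  thus "ee N \<odot>\<^bsub>PP (sm \<xi>)\<^esub> f \<in> rad_PP (sm \<xi>)"
    using ee_in_rad_PP[OF sm(1)[OF \<xi>] _ _ f] sm(1)[OF \<rho>(1)] \<rho>(3) by blast
qed

lemma standard_nonzero:
  assumes \<xi>: "\<xi> \<in> \<Xi>"
  shows "carrier (\<Delta> leq \<xi>) \<noteq> {\<zero>\<^bsub>\<Delta> leq \<xi>\<^esub>}"
proof -
  note N = sm(1)[OF \<xi>]
  obtain p where p: "lepi \<Gamma> (PP (sm \<xi>)) (\<Delta> leq \<xi>) p" "{f \<in> carrier (PP (sm \<xi>)). p f = \<zero>\<^bsub>\<Delta> leq \<xi>\<^esub>} = ker_standard leq \<xi>"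
    using standard_epi[OF \<xi>] by blast
  have "p (ee (sm \<xi>)) \<noteq> \<zero>\<^bsub>\<Delta> leq \<xi>\<^esub>" using p(2) ee_PP[OF N] ee_rad_PP[OF N] ker_standard_rad_PP[OF \<xi>] by blast
  thus ?thesis using lhom_closed[OF lepiD(1)[OF p(1)] ee_PP[OF N]] by blast
qed

text \<open>The standard module \<open>\<Delta> leq \<xi>\<close> has only one simple factor module, so \<open>N\<close> is determined. The
  kernel of \<open>\<omega>\<close> contains \<open>ker_standard leq \<xi>\<close> as it contains all weight spaces that do not occur in the
  standard module, and they are equal as the factor modules have the same dimension.\<close>
lemma epi_standard_unique:
  assumes N: "N \<in> \<N>" and \<xi>: "\<xi> \<in> \<Xi>" and \<omega>: "lepi \<Gamma> (PP N) (\<Delta> leq \<xi>) \<omega>"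
  shows "sm \<xi> = N" and "{f \<in> carrier (PP N). \<omega> f = \<zero>\<^bsub>\<Delta> leq \<xi>\<^esub>} = ker_standard leq \<xi>"
proof -
  let ?D = "\<Delta> leq \<xi>"
  note N' = sm(1)[OF \<xi>]
  note fD = fdm_standard[OF \<xi>, of leq] note lD = fdG_lmod[OF fD]
  interpret D: lmod \<Gamma> ?D by (rule lD)
  obtain p where p: "lepi \<Gamma> (PP (sm \<xi>)) ?D p" "{f \<in> carrier (PP (sm \<xi>)). p f = \<zero>\<^bsub>?D\<^esub>} = ker_standard leq \<xi>"
    using standard_epi[OF \<xi>] by blast
  obtain V where V: "max_sub \<Gamma> ?D V"
    using fda.max_sub_exists[OF fda_G fD D.lsub_zero_module] standard_nonzero[OF \<xi>] by blast
  note V1 = max_subD(1)[OF V]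
  let ?Q = "quot_lmod ?D V"
  note lQ = D.lmod_quot[OF V1] note eQ = D.quot_map_epi[OF V1]
  have simple: "simple_module \<Gamma> ?Q" using D.simple_quot_iff[OF V1] V by blast
  hence nz: "carrier ?Q \<noteq> {\<zero>\<^bsub>?Q\<^esub>}" by (simp add: simple_module_def)
  show eq: "sm \<xi> = N"
    by (rule wt_unique[OF lQ simple N' N wt_of_epi(2)[OF N' lQ lepi_comp[OF p(1) eQ] nz]
          wt_of_epi(2)[OF N lQ lepi_comp[OF \<omega> eQ] nz]])
  note lP = lmod_PP[OF N]
  interpret P: lmod \<Gamma> "PP N" by (rule lP)
  note \<omega>h = lepiD(1)[OF \<omega>]
  note p' = p[unfolded eq]
  have D0: "ee M \<odot>\<^bsub>?D\<^esub> y = \<zero>\<^bsub>?D\<^esub>" if M: "M \<in> not_below leq \<xi>" and y: "y \<in> carrier ?D" for M y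
  proof -
    have MN: "M \<in> \<N>" using M not_below_sub by blast
    obtain f where f: "f \<in> carrier (PP N)" "y = p f" using lepi_ex[OF p'(1) y] by blast
    have "ee M \<odot>\<^bsub>PP N\<^esub> f \<in> {f \<in> carrier (PP N). p f = \<zero>\<^bsub>?D\<^esub>}"
      unfolding p'(2) by (rule wsub_ee[OF lP not_below_sub M f(1)])
    thus ?thesis using lhom_smult[OF lepiD(1)[OF p'(1)] ee_G[OF MN] f(1)] f(2) by simp
  qed
  have ker: "{f \<in> carrier (PP N). \<omega> f = \<zero>\<^bsub>?D\<^esub>} = {f \<in> carrier (PP N). \<omega> f \<in> {\<zero>\<^bsub>?D\<^esub>}}" by blast
  have sub: "wsub (PP N) (not_below leq \<xi>) \<subseteq> {f \<in> carrier (PP N). \<omega> f = \<zero>\<^bsub>?D\<^esub>}"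
  proof (rule wsub_least)
    show "lsubmodule {f \<in> carrier (PP N). \<omega> f = \<zero>\<^bsub>?D\<^esub>} \<Gamma> (PP N)"
      unfolding ker by (rule lsub_vimage[OF lP lD \<omega>h D.lsub_zero_module])
    fix M f assume M: "M \<in> not_below leq \<xi>" and f: "f \<in> carrier (PP N)"
    have g: "ee M \<in> carrier \<Gamma>" using ee_G M not_below_sub by blast
    show "ee M \<odot>\<^bsub>PP N\<^esub> f \<in> {f \<in> carrier (PP N). \<omega> f = \<zero>\<^bsub>?D\<^esub>}"
      using lhom_smult[OF \<omega>h g f] D0[OF M lhom_closed[OF \<omega>h f]] P.closed_ops[OF g f] by simp
  qed
  have "\<exists>g \<in> lhom \<Gamma> ?D ?D. \<forall>x \<in> carrier (PP N). g (p x) = \<omega> x"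
    by (rule lepi_factor[OF lP lD lD p'(1) \<omega>h]) (use sub p'(2) in blast)
  then obtain g where g: "g \<in> lhom \<Gamma> ?D ?D" "\<And>x. x \<in> carrier (PP N) \<Longrightarrow> g (p x) = \<omega> x" by blast
  have "carrier ?D \<subseteq> g ` carrier ?D"
  proof
    fix y assume "y \<in> carrier ?D"
    then obtain f where f: "f \<in> carrier (PP N)" "y = \<omega> f" using lepi_ex[OF \<omega>] by blast
    have "g (p f) \<in> g ` carrier ?D" by (rule imageI[OF lhom_closed[OF lepiD(1)[OF p'(1)] f(1)]])
    thus "y \<in> g ` carrier ?D" using g(2)[OF f(1)] f(2) by simp
  qed
  hence "lepi \<Gamma> ?D ?D g" using g(1) lhom_closed[OF g(1)] by (auto simp: lepi_def)
  hence "inj_on g (carrier ?D)" by (rule fda.kdim_lepi_inj[OF fda_G fD lD]) simp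
  hence inj: "\<forall>x \<in> carrier ?D. g x = \<zero>\<^bsub>?D\<^esub> \<longrightarrow> x = \<zero>\<^bsub>?D\<^esub>" using lhom_inj_iff[OF lD lD g(1)] by blast
  have "{f \<in> carrier (PP N). \<omega> f = \<zero>\<^bsub>?D\<^esub>} \<subseteq> ker_standard leq \<xi>"
  proof
    fix f assume f: "f \<in> {f \<in> carrier (PP N). \<omega> f = \<zero>\<^bsub>?D\<^esub>}"
    hence fP: "f \<in> carrier (PP N)" and "g (p f) = \<zero>\<^bsub>?D\<^esub>" using g(2) by auto
    hence "p f = \<zero>\<^bsub>?D\<^esub>" using inj lhom_closed[OF lepiD(1)[OF p'(1)] fP] by blast
    thus "f \<in> ker_standard leq \<xi>" unfolding eq p'(2)[symmetric] using fP by blast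
  qed
  thus "{f \<in> carrier (PP N). \<omega> f = \<zero>\<^bsub>?D\<^esub>} = ker_standard leq \<xi>" using sub unfolding eq by blast
qed

text \<open>
  The last factor \<open>\<Delta> leq \<xi>\<close> of a filtration of \<open>F\<close> is torsion-free, so its kernel \<open>G\<close> is closed in
  \<open>F\<close>. As \<open>T\<close> is simple, every nonzero element of \<open>G\<close> is a surjection onto \<open>T\<close>, and by closedness \<open>G\<close>
  would be all of \<open>F\<close>. Hence \<open>G = 0\<close>.
\<close>
lemma simple_hom_sub_standard:
  assumes T: "fdL T" and simple: "simple_module \<Lambda> T"
    and F: "lsubmodule F \<Gamma> (H T)" and nz: "F \<noteq> {\<zero>\<^bsub>H T\<^esub>}"
  shows "\<exists>\<xi> \<in> \<Xi>. lmod_iso \<Gamma> ((H T)\<lparr>carrier := F\<rparr>) (\<Delta> leq \<xi>)"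
proof -
  let ?F = "(H T)\<lparr>carrier := F\<rparr>"
  note lT = fdm_lmod[OF T]
  interpret H: lmod \<Gamma> "H T" by (rule lmod_H[OF lT])
  have fF: "fdG ?F" by (rule fda.fdm_sub[OF fda_G fdm_H[OF T] F])
  note lF = fdG_lmod[OF fF]
  interpret F: lmod \<Gamma> ?F by (rule lF)
  obtain X where X: "X \<in> fmod K \<Gamma>" "lmod_iso \<Gamma> ?F X"
    using fmod_representative[OF fda.fd_alg[OF fda_G] fF] by blast
  have lX: "lmod \<Gamma> X" using X(1) by (simp add: fmod_def fdG_lmod)
  interpret X: lmod \<Gamma> X by (rule lX)
  obtain \<phi> where \<phi>: "\<phi> \<in> lhom \<Gamma> ?F X" "bij_betw \<phi> F (carrier X)"
    using X(2) unfolding lmod_iso_iff[OF lF] by auto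
  have "tfree ?F"
    by (rule tfree_inj[OF lF H.lmod_axioms fda.lhom_incl[OF fda_G lsub_subset[OF F]] _ tfree_H[OF lT]]) simp
  hence "tfree X" by (rule tfree_iso[OF lX lF lmod_iso_sym[OF lF lX X(2)]])
  hence "X \<in> torsl K \<Gamma>" by (rule tfree_imp_torsl[OF X(1)])
  then obtain Us where Us: "filtration \<Gamma> X Us"
    and iso: "\<And>i. Suc i < length Us \<Longrightarrow> \<exists>\<xi> \<in> \<Xi>. lmod_iso \<Gamma> (subquotient X Us i) (\<Delta> leq \<xi>)"
    unfolding torsl_filtered delta_filtered_modules_def filtered_by_def by blast
  have \<phi>0: "\<phi> \<zero>\<^bsub>H T\<^esub> = \<zero>\<^bsub>X\<^esub>" using lhom_zero[OF lF lX \<phi>(1)] by simp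
  have ne: "Us \<noteq> []" and U0: "Us ! 0 = {\<zero>\<^bsub>X\<^esub>}" and Ul: "Us ! (length Us - 1) = carrier X"
    using Us by (auto simp: filtration_def hd_conv_nth last_conv_nth)
  have nzX: "carrier X \<noteq> {\<zero>\<^bsub>X\<^esub>}"
  proof
    assume 0: "carrier X = {\<zero>\<^bsub>X\<^esub>}"
    have "f = \<zero>\<^bsub>H T\<^esub>" if f: "f \<in> F" for f
    proof (rule inj_onD[OF bij_betw_imp_inj_on[OF \<phi>(2)] _ f lsub_zero[OF F]])
      have "\<phi> f \<in> carrier X" using bij_betwE[OF \<phi>(2)] f by blast
      thus "\<phi> f = \<phi> \<zero>\<^bsub>H T\<^esub>" unfolding 0 \<phi>0 by simp
    qed
    thus False using nz lsub_zero[OF F] by blast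
  qed
  \<comment> \<open>Filtrations may repeat members, so the last proper step is where \<open>carrier X\<close> is reached first.\<close>
  define j where "j = (LEAST j. Us ! j = carrier X)"
  have j: "Us ! j = carrier X" unfolding j_def by (rule LeastI[of "\<lambda>j. Us ! j = carrier X", OF Ul])
  have jl: "j \<le> length Us - 1" unfolding j_def by (rule Least_le[of "\<lambda>j. Us ! j = carrier X", OF Ul])
  have "j \<noteq> 0" using j U0 nzX by auto
  then obtain i where i: "j = Suc i" by (cases j) auto
  have il: "Suc i < length Us" using jl ne i by (cases Us) auto
  have Ui: "Us ! i \<noteq> carrier X" using not_less_Least[of i "\<lambda>j. Us ! j = carrier X"] i by (auto simp: j_def)
  have sU: "lsubmodule (Us ! i) \<Gamma> X" using Us il by (auto simp: filtration_def)
  obtain \<xi> where \<xi>: "\<xi> \<in> \<Xi>" "lmod_iso \<Gamma> (quot_lmod X (Us ! i)) (\<Delta> leq \<xi>)"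
    using iso[OF il] j i by (auto simp: subquotient_def)
  note lD = fdG_lmod[OF fdm_standard[OF \<xi>(1), of leq]]
  have "tfree (quot_lmod X (Us ! i))" by (rule tfree_iso[OF X.lmod_quot[OF sU] lD \<xi>(2) tfree_standard[OF \<xi>(1)]])
  moreover have "Us ! i = {x \<in> carrier X. quot_map X (Us ! i) x = \<zero>\<^bsub>quot_lmod X (Us ! i)\<^esub>}"
    using X.quot_map_zero_iff[OF sU] lsub_subset[OF sU] by blast
  ultimately have cU: "tclosed X (Us ! i)"
    using tfree_epi_iff[OF lX X.lmod_quot[OF sU] X.quot_map_epi[OF sU]] by blast
  let ?G = "{f \<in> carrier ?F. \<phi> f \<in> Us ! i}"
  have sG: "lsubmodule ?G \<Gamma> ?F" by (rule lsub_vimage[OF lF lX \<phi>(1) sU])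
  hence sG': "lsubmodule ?G \<Gamma> (H T)" "?G \<subseteq> F" unfolding H.lsub_sub_iff[OF F] by blast+
  have cG: "tclosed ?F ?G" by (rule tclosed_vimage[OF lF \<phi>(1) cU])
  have GF: "?G \<noteq> F"
  proof
    assume G: "?G = F"
    have "carrier X \<subseteq> Us ! i"
    proof
      fix x assume "x \<in> carrier X"
      then obtain f where "f \<in> F" "x = \<phi> f" using \<phi>(2) by (auto simp: bij_betw_def)
      thus "x \<in> Us ! i" using G by blast
    qed
    thus False using Ui lsub_subset[OF sU] by blast
  qed
  have G0: "f = \<zero>\<^bsub>H T\<^esub>" if f: "f \<in> ?G" for f
  proof -
    have fF: "f \<in> F" using f by simp
    have fh: "f \<in> lhom \<Lambda> E T" using lsub_mem[OF F fF] by (simp add: lmod_hom_def)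
    interpret E: lmod \<Lambda> E by (rule lmod_E)
    have "lsubmodule (f ` carrier E) \<Lambda> T" by (rule lsub_image[OF lmod_E lT fh E.lsub_carrier])
    moreover have "f ` carrier E \<noteq> carrier T" using tclosed_surj[OF lT F sG' cG f] GF by blast
    ultimately have "f ` carrier E = {\<zero>\<^bsub>T\<^esub>}" using simple by (auto simp: simple_module_def)
    hence "f \<in> HS T {\<zero>\<^bsub>T\<^esub>}" using lsub_mem[OF F fF] by (auto simp: HS_def)
    thus ?thesis using HS_zero[OF lT] by blast
  qed
  have "x = \<zero>\<^bsub>X\<^esub>" if x: "x \<in> Us ! i" for x
  proof -
    obtain f where f: "f \<in> F" "x = \<phi> f" using \<phi>(2) lsub_mem[OF sU x] by (auto simp: bij_betw_def)
    hence fG: "f \<in> ?G" using x by simp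
    show ?thesis using G0[OF fG] f(2) \<phi>0 by simp
  qed
  hence "Us ! i = {\<zero>\<^bsub>X\<^esub>}" using lsub_zero[OF sU] by blast
  hence "lmod_iso \<Gamma> (quot_lmod X {\<zero>\<^bsub>X\<^esub>}) (\<Delta> leq \<xi>)" using \<xi>(2) by simp
  hence "lmod_iso \<Gamma> X (\<Delta> leq \<xi>)"
    by (rule lmod_iso_trans[OF lX X.lmod_quot[OF X.lsub_zero_module]
          lmod_iso_sym[OF X.lmod_quot[OF X.lsub_zero_module] lX X.quot_zero_iso]])
  from lmod_iso_trans[OF lF lX X(2) this] show ?thesis using \<xi>(1) by blast
qed

text \<open>The image of \<open>PP N\<close> in \<open>H (M / V)\<close> is a standard module by \<open>simple_hom_sub_standard\<close>, and the kernel of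
  an epimorphism from \<open>PP N\<close> onto a standard module is determined by \<open>N\<close>.\<close>
lemma kernel_of_max_sub:
  assumes M: "fdL M" and N: "N \<in> \<N>" and \<theta>: "\<theta> \<in> lhom \<Lambda> (E\<lparr>carrier := N\<rparr>) M"
    and b: "\<theta> ` N = carrier M" and V: "max_sub \<Lambda> M V"
  shows "\<exists>\<xi> \<in> \<Xi>. sm \<xi> = N \<and> HS (E\<lparr>carrier := N\<rparr>) {x \<in> N. \<theta> x \<in> V} = ker_standard leq \<xi>"
proof -
  let ?N = "E\<lparr>carrier := N\<rparr>" and ?T = "quot_lmod M V"
  note lM = fdm_lmod[OF M] note lN = fdm_lmod[OF fdm_summand[OF N]]
  interpret M: lmod \<Lambda> M by (rule lM)
  note V1 = max_subD(1)[OF V]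
  note fT = fdm_quot[OF M V1] note lT = fdm_lmod[OF fT]
  have simple: "simple_module \<Lambda> ?T" using M.simple_quot_iff[OF V1] V by blast
  let ?\<chi> = "\<lambda>x. quot_map M V (\<theta> x)"
  have \<chi>: "?\<chi> \<in> lhom \<Lambda> ?N ?T" by (rule lhom_comp[OF \<theta> lepiD(1)[OF M.quot_map_epi[OF V1]]])
  let ?X = "\<lambda>f. \<lambda>x\<in>carrier E. ?\<chi> (f x)"
  note lP = lmod_PP[OF N] note lH = lmod_H[OF lT]
  interpret P: lmod \<Gamma> "PP N" by (rule lP)
  have Xh: "?X \<in> lhom \<Gamma> (PP N) (H ?T)" by (rule H_map[OF lN \<chi>])
  let ?F = "?X ` carrier (PP N)"
  have F: "lsubmodule ?F \<Gamma> (H ?T)" by (rule lsub_image[OF lP lH Xh P.lsub_carrier])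
  have fN: "f x \<in> N" if "f \<in> carrier (PP N)" "x \<in> carrier E" for f x using that PP_carrier[OF N] by blast
  have \<theta>c: "\<theta> y \<in> carrier M" if "y \<in> N" for y using b that by blast
  have ker: "?X f = \<zero>\<^bsub>H ?T\<^esub> \<longleftrightarrow> (\<forall>x \<in> carrier E. \<theta> (f x) \<in> V)" if f: "f \<in> carrier (PP N)" for f
  proof -
    have "?X f \<in> lmod_hom \<Lambda> E ?T" using lhom_closed[OF Xh f] by simp
    hence "?X f = \<zero>\<^bsub>H ?T\<^esub> \<longleftrightarrow> (\<forall>x \<in> carrier E. ?\<chi> (f x) = \<zero>\<^bsub>?T\<^esub>)"
      unfolding singleton_iff[of _ "\<zero>\<^bsub>H ?T\<^esub>", symmetric] HS_zero[OF lT, symmetric]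
      by (auto simp: HS_def)
    also have "\<dots> \<longleftrightarrow> (\<forall>x \<in> carrier E. \<theta> (f x) \<in> V)"
      using M.quot_map_zero_iff[OF V1 \<theta>c[OF fN[OF f]]] by blast
    finally show ?thesis .
  qed
  have "?X (ee N) \<noteq> \<zero>\<^bsub>H ?T\<^esub>"
  proof
    assume "?X (ee N) = \<zero>\<^bsub>H ?T\<^esub>"
    hence *: "\<theta> (ee N x) \<in> V" if "x \<in> carrier E" for x using ker[OF ee_PP[OF N]] that by blast
    have "carrier M \<subseteq> V"
    proof
      fix m assume "m \<in> carrier M"
      then obtain n where n: "n \<in> N" "m = \<theta> n" using b by blast
      have "n \<in> carrier E" by (rule lsub_mem[OF summand_props(2)[OF N] n(1)])
      from *[OF this] show "m \<in> V" using n(2) pr_on[OF N n(1)] \<open>n \<in> carrier E\<close> by (simp add: ee_def)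
    qed
    thus False using max_subD(3)[OF V] by blast
  qed
  hence "?F \<noteq> {\<zero>\<^bsub>H ?T\<^esub>}" using ee_PP[OF N] by blast
  then obtain \<xi> where \<xi>: "\<xi> \<in> \<Xi>" "lmod_iso \<Gamma> ((H ?T)\<lparr>carrier := ?F\<rparr>) (\<Delta> leq \<xi>)"
    using simple_hom_sub_standard[OF fT simple F] by blast
  interpret HT: lmod \<Gamma> "H ?T" by (rule lH)
  have eF: "lepi \<Gamma> (PP N) ((H ?T)\<lparr>carrier := ?F\<rparr>) ?X"
    unfolding lepi_def lhom_sub_cod[OF lsub_subset[OF F]] using Xh by auto
  obtain \<omega> where \<omega>: "lepi \<Gamma> (PP N) (\<Delta> leq \<xi>) \<omega>"
    "\<And>f. f \<in> carrier (PP N) \<Longrightarrow> \<omega> f = \<zero>\<^bsub>\<Delta> leq \<xi>\<^esub> \<longleftrightarrow> ?X f = \<zero>\<^bsub>H ?T\<^esub>"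
    using lmod_iso_lepi[OF HT.lmod_sub[OF F] fdG_lmod[OF fdm_standard[OF \<xi>(1)]] \<xi>(2) eF] by auto
  have "HS ?N {x \<in> N. \<theta> x \<in> V} = {f \<in> carrier (PP N). \<forall>x \<in> carrier E. \<theta> (f x) \<in> V}"
    using fN by (auto simp: HS_def)
  also have "\<dots> = {f \<in> carrier (PP N). \<omega> f = \<zero>\<^bsub>\<Delta> leq \<xi>\<^esub>}" using \<omega>(2) ker by blast
  finally show ?thesis using epi_standard_unique[OF N \<xi>(1) \<omega>(1)] \<xi>(1) by blast
qed

text \<open>By the preceding lemma, the inverse images of \<open>V\<close> and \<open>V'\<close> under an isomorphism \<open>N \<rightarrow> M\<close> determine the
  same submodule of \<open>PP N\<close>.\<close>
lemma max_sub_unique: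
  assumes M: "fdL M" and ind: "indecomposable \<Lambda> M" and V: "max_sub \<Lambda> M V" and V': "max_sub \<Lambda> M V'"
  shows "V = V'"
proof -
  note lM = fdm_lmod[OF M]
  obtain N where N: "N \<in> \<N>" "lmod_iso \<Lambda> M (E\<lparr>carrier := N\<rparr>)" using summand_iso[OF M ind] by blast
  let ?N = "E\<lparr>carrier := N\<rparr>"
  note lN = fdm_lmod[OF fdm_summand[OF N(1)]]
  obtain \<theta> where \<theta>: "\<theta> \<in> lhom \<Lambda> ?N M" "bij_betw \<theta> N (carrier M)"
    using lmod_iso_sym[OF lM lN N(2)] unfolding lmod_iso_iff[OF lN] by auto
  have im: "\<theta> ` N = carrier M" using \<theta>(2) by (simp add: bij_betw_def)
  let ?W = "\<lambda>V. {x \<in> N. \<theta> x \<in> V}"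
  have W: "lsubmodule (?W V) \<Lambda> ?N" if "max_sub \<Lambda> M V" for V
    using lsub_vimage[OF lN lM \<theta>(1) max_subD(1)[OF that]] by simp
  obtain \<xi> \<xi>' where *: "\<xi> \<in> \<Xi>" "sm \<xi> = N" "HS ?N (?W V) = ker_standard leq \<xi>"
    "\<xi>' \<in> \<Xi>" "sm \<xi>' = N" "HS ?N (?W V') = ker_standard leq \<xi>'"
    using kernel_of_max_sub[OF M N(1) \<theta>(1) im V] kernel_of_max_sub[OF M N(1) \<theta>(1) im V'] by blast
  have "\<xi> = \<xi>'" by (rule sm_inj[OF *(1,4)]) (simp add: *(2,5))
  hence "HS ?N (?W V) = HS ?N (?W V')" using *(3,6) by simp
  hence eq: "?W V = ?W V'" using HS_subset_iff[OF lN W[OF V] W[OF V']] HS_subset_iff[OF lN W[OF V'] W[OF V]] by blast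
  have im_W: "\<theta> ` ?W U = U" if U: "max_sub \<Lambda> M U" for U
  proof
    show "U \<subseteq> \<theta> ` ?W U"
    proof
      fix u assume u: "u \<in> U"
      hence "u \<in> \<theta> ` N" unfolding im by (rule lsub_mem[OF max_subD(1)[OF U]])
      then obtain x where "x \<in> N" "u = \<theta> x" by blast
      thus "u \<in> \<theta> ` ?W U" using u by simp
    qed
  qed auto
  have "V = \<theta> ` ?W V" by (rule im_W[OF V, symmetric])
  also have "\<dots> = \<theta> ` ?W V'" unfolding eq ..
  also have "\<dots> = V'" by (rule im_W[OF V'])
  finally show ?thesis .
qed

text \<open>
  Let \<open>R\<close> be the direct sum of \<open>C\<close> and \<open>D\<close>. The maps \<open>E \<rightarrow> M / R\<close> that lift to \<open>M / C\<close>, and those that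
  lift to \<open>M / D\<close>, are submodules of \<open>Hom(E, M / R)\<close>. Their sum is a standard module, so one of them
  contains the other, and this gives a map between \<open>M / C\<close> and \<open>M / D\<close> over \<open>M / R\<close>.
\<close>
lemma max_sub_indecomposable:
  assumes M: "fdL M" and ind: "indecomposable \<Lambda> M" and R: "max_sub \<Lambda> M R" and nz: "R \<noteq> {\<zero>\<^bsub>M\<^esub>}"
  shows "indecomposable \<Lambda> (M\<lparr>carrier := R\<rparr>)"
proof -
  note lM = fdm_lmod[OF M]
  interpret M: lmod \<Lambda> M by (rule lM)
  note R1 = max_subD(1)[OF R]
  let ?T = "quot_lmod M R" and ?Q = "quot_lmod M"
  note fT = fdm_quot[OF M R1] note lT = fdm_lmod[OF fT]
  have simple: "simple_module \<Lambda> ?T" using M.simple_quot_iff[OF R1] R by blast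
  interpret HT: lmod \<Gamma> "H ?T" by (rule lmod_H[OF lT])
  have one: "D = {\<zero>\<^bsub>M\<^esub>}"
    if C: "lsubmodule C \<Lambda> M" and D: "lsubmodule D \<Lambda> M" and int: "C \<inter> D = {\<zero>\<^bsub>M\<^esub>}" and sum: "C <+>\<^bsub>M\<^esub> D = R"
      and p: "p \<in> lhom \<Lambda> (?Q C) ?T" "\<And>m. m \<in> carrier M \<Longrightarrow> p (quot_map M C m) = quot_map M R m"
      and q: "q \<in> lhom \<Lambda> (?Q D) ?T" "\<And>m. m \<in> carrier M \<Longrightarrow> q (quot_map M D m) = quot_map M R m"
      and sub: "(\<lambda>f. \<lambda>x\<in>carrier E. q (f x)) ` carrier (H (?Q D)) \<subseteq> (\<lambda>f. \<lambda>x\<in>carrier E. p (f x)) ` carrier (H (?Q C))"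
    for C D p q
  proof -
    note fD = fdm_quot[OF M D] note fC = fdm_quot[OF M C]
    note lD = fdm_lmod[OF fD] note lC = fdm_lmod[OF fC]
    have "\<exists>\<phi> \<in> lhom \<Lambda> (?Q D) (?Q C). \<forall>x \<in> carrier (?Q D). p (\<phi> x) = q x"
    proof (rule lift_from_E[OF fD lC lT q(1) p(1)])
      fix g assume g: "g \<in> lhom \<Lambda> E (?Q D)"
      have "(\<lambda>x\<in>carrier E. g x) \<in> carrier (H (?Q D))" using lmod_hom_restrict[OF lmod_E g] by simp
      hence "(\<lambda>x\<in>carrier E. q ((\<lambda>x\<in>carrier E. g x) x)) \<in> (\<lambda>f. \<lambda>x\<in>carrier E. p (f x)) ` carrier (H (?Q C))"
        using sub by blast
      then obtain g' where g': "g' \<in> carrier (H (?Q C))"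
        "(\<lambda>x\<in>carrier E. q ((\<lambda>x\<in>carrier E. g x) x)) = (\<lambda>x\<in>carrier E. p (g' x))" by blast
      have "q (g x) = p (g' x)" if "x \<in> carrier E" for x using fun_cong[OF g'(2), of x] that by simp
      thus "\<exists>g' \<in> lhom \<Lambda> E (?Q C). \<forall>x \<in> carrier E. q (g x) = p (g' x)"
        using g'(1) by (auto simp: lmod_hom_def)
    qed
    then obtain \<phi> where \<phi>: "\<phi> \<in> lhom \<Lambda> (?Q D) (?Q C)" "\<And>x. x \<in> carrier (?Q D) \<Longrightarrow> p (\<phi> x) = q x" by blast
    show ?thesis
    proof (rule M.complement_of_map_over[OF ind R1 max_subD(2)[OF R] C D int sum \<phi>(1) p(2)])
      fix m assume m: "m \<in> carrier M"
      show "p (\<phi> (quot_map M D m)) = quot_map M R m"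
        using \<phi>(2)[OF lhom_closed[OF lepiD(1)[OF M.quot_map_epi[OF D]] m]] q(2)[OF m] by simp
    qed
  qed
  show ?thesis
    unfolding indecomposable_def
  proof (intro conjI allI impI)
    show "carrier (M\<lparr>carrier := R\<rparr>) \<noteq> {\<zero>\<^bsub>M\<lparr>carrier := R\<rparr>\<^esub>}" using nz by simp
    fix C D assume CD: "lsubmodule C \<Lambda> (M\<lparr>carrier := R\<rparr>) \<and> lsubmodule D \<Lambda> (M\<lparr>carrier := R\<rparr>) \<and>
      C \<inter> D = {\<zero>\<^bsub>M\<lparr>carrier := R\<rparr>\<^esub>} \<and> C <+>\<^bsub>M\<lparr>carrier := R\<rparr>\<^esub> D = carrier (M\<lparr>carrier := R\<rparr>)"
    hence C: "lsubmodule C \<Lambda> M" "C \<subseteq> R" and D: "lsubmodule D \<Lambda> M" "D \<subseteq> R"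
      unfolding M.lsub_sub_iff[OF R1] by blast+
    have int: "C \<inter> D = {\<zero>\<^bsub>M\<^esub>}" using CD by simp
    have sum: "C <+>\<^bsub>M\<^esub> D = R" using CD by (simp add: set_add_def set_mult_def)
    have sum': "D <+>\<^bsub>M\<^esub> C = R"
    proof -
      have "D <+>\<^bsub>M\<^esub> C = C <+>\<^bsub>M\<^esub> D"
        using M.a_comm[OF lsub_mem[OF C(1)] lsub_mem[OF D(1)]] unfolding set_eq_iff M.set_add_iff by metis
      thus ?thesis using sum by simp
    qed
    have over: "\<exists>p \<in> lhom \<Lambda> (?Q W) ?T. \<forall>m \<in> carrier M. p (quot_map M W m) = quot_map M R m"
      if W: "lsubmodule W \<Lambda> M" "W \<subseteq> R" for W
      by (rule lepi_factor[OF lM M.lmod_quot[OF W(1)] lT M.quot_map_epi[OF W(1)] lepiD(1)[OF M.quot_map_epi[OF R1]]])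
        (use M.quot_map_zero_iff[OF W(1)] M.quot_map_zero_iff[OF R1] W(2) in blast)
    obtain p where p: "p \<in> lhom \<Lambda> (?Q C) ?T" "\<And>m. m \<in> carrier M \<Longrightarrow> p (quot_map M C m) = quot_map M R m"
      using over[OF C] by blast
    obtain q where q: "q \<in> lhom \<Lambda> (?Q D) ?T" "\<And>m. m \<in> carrier M \<Longrightarrow> q (quot_map M D m) = quot_map M R m"
      using over[OF D] by blast
    let ?I = "(\<lambda>f. \<lambda>x\<in>carrier E. p (f x)) ` carrier (H (?Q C))"
    let ?J = "(\<lambda>f. \<lambda>x\<in>carrier E. q (f x)) ` carrier (H (?Q D))"
    note lC = M.lmod_quot[OF C(1)] note lD = M.lmod_quot[OF D(1)]
    interpret HC: lmod \<Gamma> "H (?Q C)" by (rule lmod_H[OF lC])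
    interpret HD: lmod \<Gamma> "H (?Q D)" by (rule lmod_H[OF lD])
    have I: "lsubmodule ?I \<Gamma> (H ?T)"
      by (rule lsub_image[OF HC.lmod_axioms HT.lmod_axioms H_map[OF lC p(1)] HC.lsub_carrier])
    have J: "lsubmodule ?J \<Gamma> (H ?T)"
      by (rule lsub_image[OF HD.lmod_axioms HT.lmod_axioms H_map[OF lD q(1)] HD.lsub_carrier])
    let ?F = "?I <+>\<^bsub>H ?T\<^esub> ?J"
    have F: "lsubmodule ?F \<Gamma> (H ?T)" by (rule HT.lsub_sum[OF I J])
    note sup = HT.lsub_sum_supset[OF I J]
    have "?I \<subseteq> ?J \<or> ?J \<subseteq> ?I"
    proof (cases "?F = {\<zero>\<^bsub>H ?T\<^esub>}")
      case True
      have "?I \<subseteq> {\<zero>\<^bsub>H ?T\<^esub>}" using sup(1) unfolding True .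
      also have "{\<zero>\<^bsub>H ?T\<^esub>} \<subseteq> ?J" by (rule subsetI) (simp only: singleton_iff lsub_zero[OF J])
      finally show ?thesis ..
    next
      case False
      obtain \<xi> where \<xi>: "\<xi> \<in> \<Xi>" "lmod_iso \<Gamma> ((H ?T)\<lparr>carrier := ?F\<rparr>) (\<Delta> leq \<xi>)"
        using simple_hom_sub_standard[OF fT simple F False] by blast
      note lDelta = fdG_lmod[OF fdm_standard[OF \<xi>(1), of leq]]
      note lF = HT.lmod_sub[OF F]
      obtain r where r: "lepi \<Gamma> (PP (sm \<xi>)) (\<Delta> leq \<xi>) r" using standard_epi[OF \<xi>(1)] by blast
      obtain s where s: "lepi \<Gamma> (PP (sm \<xi>)) ((H ?T)\<lparr>carrier := ?F\<rparr>) s"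
        using lmod_iso_lepi[OF lDelta lF lmod_iso_sym[OF lF lDelta \<xi>(2)] r] by blast
      have "?I = carrier ((H ?T)\<lparr>carrier := ?F\<rparr>) \<or> ?J = carrier ((H ?T)\<lparr>carrier := ?F\<rparr>)"
      proof (rule sum_proper_sub[OF sm(1)[OF \<xi>(1)] lF s])
        show "lsubmodule ?I \<Gamma> ((H ?T)\<lparr>carrier := ?F\<rparr>)" "lsubmodule ?J \<Gamma> ((H ?T)\<lparr>carrier := ?F\<rparr>)"
          unfolding HT.lsub_sub_iff[OF F] using I J sup by simp_all
        show "carrier ((H ?T)\<lparr>carrier := ?F\<rparr>) \<subseteq> ?I <+>\<^bsub>(H ?T)\<lparr>carrier := ?F\<rparr>\<^esub> ?J"
          by (simp add: set_add_def set_mult_def)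
      qed
      hence "?I = ?F \<or> ?J = ?F" unfolding carrier_of_update .
      thus ?thesis using sup by (elim disjE) (simp_all only: simp_thms)
    qed
    thus "C = {\<zero>\<^bsub>M\<lparr>carrier := R\<rparr>\<^esub>} \<or> D = {\<zero>\<^bsub>M\<lparr>carrier := R\<rparr>\<^esub>}"
    proof
      assume IJ: "?I \<subseteq> ?J"
      have "C = {\<zero>\<^bsub>M\<^esub>}" by (rule one[OF D(1) C(1) _ sum' q p IJ]) (use int in blast)
      thus ?thesis by simp
    next
      assume JI: "?J \<subseteq> ?I"
      have "D = {\<zero>\<^bsub>M\<^esub>}" by (rule one[OF C(1) D(1) int sum p q JI])
      thus ?thesis by simp
    qed
  qed
qed

text \<open>All proper submodules lie in the maximal one, which is again indecomposable.\<close>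
lemma indecomposable_chain:
  "fdL M \<Longrightarrow> indecomposable \<Lambda> M \<Longrightarrow> chain_module \<Lambda> M"
proof (induction "kdim K \<Lambda> M" arbitrary: M rule: less_induct)
  case less
  note M = less.prems(1) note ind = less.prems(2)
  interpret M: lmod \<Lambda> M by (rule fdm_lmod[OF M])
  have "{\<zero>\<^bsub>M\<^esub>} \<noteq> carrier M" using ind by (auto simp: indecomposable_def)
  then obtain R where R: "max_sub \<Lambda> M R" using max_sub_exists[OF M M.lsub_zero_module] by blast
  note R1 = max_subD(1)[OF R]
  have UR: "U \<subseteq> R" if U: "lsubmodule U \<Lambda> M" "U \<noteq> carrier M" for U
  proof -
    obtain V where "max_sub \<Lambda> M V" "U \<subseteq> V" using max_sub_exists[OF M U] by blast
    thus ?thesis using max_sub_unique[OF M ind R] by blast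
  qed
  have cR: "chain_module \<Lambda> (M\<lparr>carrier := R\<rparr>)"
  proof (cases "R = {\<zero>\<^bsub>M\<^esub>}")
    case True
    thus ?thesis using M.lsub_sub_iff[OF R1] lsub_zero[of _ \<Lambda> M] unfolding chain_module_def by blast
  next
    case False
    have "kdim K \<Lambda> (M\<lparr>carrier := R\<rparr>) < kdim K \<Lambda> (M\<lparr>carrier := carrier M\<rparr>)"
      by (rule kdim_psub[OF M R1 M.lsub_carrier max_subD(3)[OF R]])
    hence "kdim K \<Lambda> (M\<lparr>carrier := R\<rparr>) < kdim K \<Lambda> M" by simp
    from less.hyps[OF this fdm_sub[OF M R1] max_sub_indecomposable[OF M ind R False]] show ?thesis .
  qed
  show ?case
    unfolding chain_module_def
  proof (intro allI impI, elim conjE)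
    fix U V assume U: "lsubmodule U \<Lambda> M" and V: "lsubmodule V \<Lambda> M"
    show "U \<subseteq> V \<or> V \<subseteq> U"
    proof (cases "U = carrier M \<or> V = carrier M")
      case True
      thus ?thesis using lsub_subset[OF U] lsub_subset[OF V] by blast
    next
      case False
      thus ?thesis using cR U V UR unfolding chain_module_def M.lsub_sub_iff[OF R1] by blast
    qed
  qed
qed

lemma uniserial: "uniserial_algebra K \<Lambda>"
  unfolding uniserial_algebra_def
proof (intro ballI impI)
  fix M assume "M \<in> fmod K \<Lambda>" and ind: "indecomposable \<Lambda> M"
  hence M: "fdL M" by (simp add: fmod_def)
  show "\<exists>!Us. composition_series \<Lambda> M Us"
    unfolding unique_composition_series_iff[OF M] by (rule indecomposable_chain[OF M ind])
qed

end

theorem theorem3: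
  fixes K :: "'k ring"
    and \<Lambda> :: "('k, 'a) module"
    and E :: "('a, 'e) module"
    and \<Gamma> :: "('k, 'e \<Rightarrow> 'e) module"
    and \<Xi> :: "'x set"
    and S P :: "'x \<Rightarrow> ('e \<Rightarrow> 'e, nat \<Rightarrow> 'k) module"
  assumes "fd_algebra K \<Lambda>"
    and "basic_algebra \<Lambda>"
    and "representation_finite K \<Lambda>"
    and "auslander_generator K \<Lambda> E"
    and "\<Gamma> = auslander_algebra \<Lambda> E"
    and "parametrizes_simples K \<Gamma> \<Xi> S"
    and "\<And>\<xi>. \<xi> \<in> \<Xi> \<Longrightarrow> projective_cover K \<Gamma> (P \<xi>) (S \<xi>)"
  shows "(\<exists>leq. quasi_hereditary_structure K \<Gamma> \<Xi> S P leq \<and>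
            torsl K \<Gamma> = delta_filtered_modules K \<Gamma> \<Xi> S P leq)
         \<longleftrightarrow> uniserial_algebra K \<Lambda>"
proof -
  obtain \<N> where \<N>: "fd_left_module K \<Lambda> E" "basic_decomposition \<Lambda> E \<N>"
    "\<And>M. M \<in> fmod K \<Lambda> \<Longrightarrow> indecomposable \<Lambda> M \<Longrightarrow> \<exists>N \<in> \<N>. lmod_iso \<Lambda> M (E\<lparr>carrier := N\<rparr>)"
    using assms(4) unfolding auslander_generator_def by blast
  interpret A: auslander_simples K \<Lambda> E \<N> \<Xi> S P
    by unfold_locales (use assms \<N> in blast)+
  show ?thesis
  proof
    assume "\<exists>leq. quasi_hereditary_structure K \<Gamma> \<Xi> S P leq \<and>
      torsl K \<Gamma> = delta_filtered_modules K \<Gamma> \<Xi> S P leq"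
    then obtain leq where leq: "quasi_hereditary_structure K \<Gamma> \<Xi> S P leq"
      "torsl K \<Gamma> = delta_filtered_modules K \<Gamma> \<Xi> S P leq" by blast
    have "refl_on \<Xi> leq"
      using leq(1) by (simp add: quasi_hereditary_structure_def partial_order_on_def preorder_on_def)
    hence "\<xi> \<in> \<Xi> \<Longrightarrow> (\<xi>, \<xi>) \<in> leq" for \<xi> by (rule refl_onD)
    then interpret B: auslander_torsl_filtered K \<Lambda> E \<N> \<Xi> S P leq
      by unfold_locales (use leq(2) assms(5) in auto)
    show "uniserial_algebra K \<Lambda>" by (rule B.uniserial)
  next
    assume "uniserial_algebra K \<Lambda>"
    then interpret B: auslander_uniserial K \<Lambda> E \<N> \<Xi> S P by unfold_locales
    show "\<exists>leq. quasi_hereditary_structure K \<Gamma> \<Xi> S P leq \<and>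
        torsl K \<Gamma> = delta_filtered_modules K \<Gamma> \<Xi> S P leq"
      using B.quasi_hereditary_uleq B.torsl_eq_filtered unfolding assms(5) by blast
  qed
qed

end
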